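(* Let $\Gamma$ be a normalized zonal Fuchsian group with quotient orbifold $S=\mathbb{H}/\Gamma$, as in the context, and let $\mathcal{A}(z)=z$ for $0<z\le 1$ and $\mathcal{A}(z)=2-z+2\log z$ for $1\le z\le 2$. For almost all $\mathbf v\in T_1S$: (i) For $0<k\le 2$, the average length of an arc of $\gamma=\gamma(\mathbf v)$ between consecutive $k$-excursions is $\pi\,\mathrm{area}(S)\,k^{-1}$ (assuming here that $\Gamma=\mathrm{PSL}_2(\mathbb{Z})$ or $U_\eta\notin\Gamma$), and the average length of an arc of $\gamma$ between consecutive approximating $k$-excursions is $\pi\,\mathrm{area}(S)\,\mathcal{A}(k)^{-1}$ (no restriction on $\Gamma$). That is, if $t_1<t_2<\cdots$ are the depth parameters in $[0,\infty)$ of the $k$-excursions (respectively, approximating $k$-excursions), then $\lim_{n\to\infty}\frac1n\sum_{i=1}^{n}(t_{i+1}-t_i)$ exists and equals $\pi\,\mathrm{area}(S)/k$ (respectively $\pi\,\mathrm{area}(S)/\mathcal{A}(k)$). (ii) For $0<k\le 1$, the average length of a $k$-excursion is $\pi$. That is, $\lim_{n\to\infty}\frac1n\sum_{i=1}^n(\delta_{2i}-\delta_{2i-1})=\pi$, where $\delta_{2i-1},\delta_{2i}$ are the boundary parameters of the $i$-th $k$-excursion.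
   Context: **Setting.** $\mathbb{H}$ is the upper half-plane with its hyperbolic metric. $\Gamma\subset \mathrm{PSL}_2(\mathbb{R})$ is a discrete group such that $S=\mathbb{H}/\Gamma$ is a non-compact hyperbolic 2-orbifold of finite area and the stabilizer of $\infty$ in $\Gamma$, $\mathrm{Stab}(\infty)$, is generated by $z\mapsto z+1$ (a zonal Fuchsian group). $P$ is the cusp of $S$ corresponding to $\infty$. For $m>0$ let $H_m=\{z: \mathrm{Im}(z)>m\}$, and let $C_k$ be the projection of $H_{1/k}$ to $S$. Let $\eta=\eta(\Gamma)$ be the smallest number with $H_\eta\cap g(H_\eta)=\emptyset$ for all $g\in\Gamma\setminus\mathrm{Stab}(\infty)$. Normalization: there is $h\in\Gamma$ with $h(\infty)=0$ and the closures of $H_\eta$ and $h(H_\eta)$ tangent at the single point $\eta i$. Put $U_\eta(z)=-\eta^2/z$. $T_1S=\Gamma\backslash T_1\mathbb{H}$ is the unit tangent bundle; "almost all $\mathbf v$" refers to the measure on $T_1S$ induced by $dA\,d\theta$ on $T_1\mathbb{H}=\mathbb{H}\times S^1$. For $\mathbf v\in T_1S$, $\gamma=\gamma(\mathbf v):\mathbb{R}\to S$ is the unit-speed geodesic with $\dot\gamma(0)=\mathbf v$. A lift $\tilde\gamma$ to $\mathbb{H}$ has forward endpoint $\tilde\gamma_+$ and backward endpoint $\tilde\gamma_-$. **Excursions.** A $k$-excursion of $\gamma$ is a point $e=\gamma(t_e)$ at which $\gamma$ is tangent to a neighborhood $C_d$ with $d<k$, i.e. some lift $\tilde\gamma$ of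 $\gamma$ is tangent to the boundary of $H_{1/d}$ at $\tilde\gamma(t_e)$. The number $t_e$ is the depth parameter of $e$ and $d=d(e)$ its depth (for almost every $\mathbf v$, $d(e)$ is well defined and the lift is unique up to $\mathrm{Stab}(\infty)$). Let $J=[(-1,0)\times(0,\infty)]\cup[(0,1)\times(-\infty,0)]$ and $I=[(-1,0)\times(1,\infty)]\cup[(0,1)\times(-\infty,-1)]$. For $k\le 2$ and a $k$-excursion $e$, let $\tilde\gamma_e$ be the unique lift of $\gamma$ tangent to $\partial H_{1/d(e)}$ at $\tilde\gamma_e(t_e)$ with $((\tilde\gamma_e)_+,(\tilde\gamma_e)_-)\in J$. The $k$-excursion $e$ is an approximating $k$-excursion if $((\tilde\gamma_e)_+,(\tilde\gamma_e)_-)\in I$. For almost all $\mathbf v$ there are infinitely many $k$-excursions and approximating $k$-excursions with nonnegative depth parameters, and these depth parameters tend to infinity. **Boundary parameters.** Let $k\le 1$ (then the lifts of $C_k$ to $\mathbb{H}$, i.e. the $\Gamma$-translates of $H_{1/k}$, are pairwise disjoint). If $t_1<t_2<\cdots$ are the nonnegative depth parameters of the $k$-excursions of $\gamma$, the boundary parameters $\delta_{2i-1}<t_i<\delta_{2i}$ are such that the arc of $\gamma(t)$ for $\delta_{2i-1}\le t\le\delta_{2i}$ is the maximal arc of $\gamma$ in $C_k$ (up to its endpoints, which lie on $\partial C_k$) containing $\gamma(t_i)$. The length of the excursion $\gamma(t_i)$ is $\delta_{2i}-\delta_{2i-1}$. *)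

theory Defs
  imports "HOL-Analysis.Analysis"
begin

subsection \<open>The hyperbolic plane and its unit tangent bundle\<close>

definition upper_half :: "complex set" where
  "upper_half = {z. Im z > 0}"

definition hyp_dist :: "complex \<Rightarrow> complex \<Rightarrow> real" where
  "hyp_dist z w = arcosh (1 + (cmod (z - w))\<^sup>2 / (2 * Im z * Im w))"

definition hyp_area :: "complex measure" where
  "hyp_area = density (restrict_space lborel upper_half) (\<lambda>z. ennreal (1 / (Im z)\<^sup>2))"

definition circle_measure :: "complex measure" where
  "circle_measure =
     distr (restrict_space lborel {0..<2 * pi}) (restrict_space borel (sphere 0 1)) cis"

text \<open>
  A unit tangent vector of the upper half-plane is a pair \<open>(z, u)\<close> of a base point \<open>z\<close> and a
  direction \<open>u\<close> of Euclidean length one; the tangent vector of hyperbolic length one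
  itself is \<open>Im z * u\<close>. In these coordinates the measure below is \<open>dA d\<theta>\<close>.
\<close>

definition T1H_measure :: "(complex \<times> complex) measure" where
  "T1H_measure = hyp_area \<Otimes>\<^sub>M circle_measure"

text \<open>
  Complete unit-speed geodesics of the hyperbolic plane are exactly the isometric embeddings of
  the real line.
\<close>

definition hyp_geodesic :: "(real \<Rightarrow> complex) \<Rightarrow> bool" where
  "hyp_geodesic c \<longleftrightarrow>
     (\<forall>t. c t \<in> upper_half) \<and> (\<forall>s t. hyp_dist (c s) (c t) = \<bar>s - t\<bar>)"

definition velocity :: "(real \<Rightarrow> complex) \<Rightarrow> real \<Rightarrow> complex" where
  "velocity c t = vector_derivative c (at t)"


subsection \<open>Moebius transformations\<close>

definition mat2 :: "real \<Rightarrow> real \<Rightarrow> real \<Rightarrow> real \<Rightarrow> real^2^2" where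
  "mat2 a b c d = vector [vector [a, b], vector [c, d]]"

definition SL2R :: "(real^2^2) set" where
  "SL2R = {A. det A = 1}"

definition moebius :: "real^2^2 \<Rightarrow> complex \<Rightarrow> complex" where
  "moebius A z = (of_real (A$1$1) * z + of_real (A$1$2)) / (of_real (A$2$1) * z + of_real (A$2$2))"

definition moebius_T1 :: "real^2^2 \<Rightarrow> complex \<times> complex \<Rightarrow> complex \<times> complex" where
  "moebius_T1 A = (\<lambda>(z, u). (moebius A z, sgn (deriv (moebius A) z) * u))"

text \<open>
  A subgroup of \<open>PSL(2,R)\<close> is represented by its full preimage in \<open>SL(2,R)\<close>, that is, by a
  subgroup of \<open>SL(2,R)\<close> closed under negation. Since the kernel is finite, one is
  discrete if and only if the other is.
\<close>

definition PSL2R_subgroup :: "(real^2^2) set \<Rightarrow> bool" where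
  "PSL2R_subgroup \<Gamma> \<longleftrightarrow>
     \<Gamma> \<subseteq> SL2R \<and> mat 1 \<in> \<Gamma> \<and> (\<forall>A\<in>\<Gamma>. \<forall>B\<in>\<Gamma>. A ** B \<in> \<Gamma>) \<and>
     (\<forall>A\<in>\<Gamma>. matrix_inv A \<in> \<Gamma>) \<and> (\<forall>A\<in>\<Gamma>. - A \<in> \<Gamma>)"

definition PSL2Z :: "(real^2^2) set" where
  "PSL2Z = {A \<in> SL2R. \<forall>i j. A$i$j \<in> \<int>}"

text \<open>The matrix \<open>A\<close> sends \<open>\<infinity>\<close> to \<open>A$1$1 / A$2$1\<close>, so it fixes \<open>\<infinity>\<close> iff \<open>A$2$1 = 0\<close>.\<close>

definition stab_inf :: "(real^2^2) set \<Rightarrow> (real^2^2) set" where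
  "stab_inf \<Gamma> = {A \<in> \<Gamma>. A$2$1 = 0}"


subsection \<open>The quotient orbifold and its unit tangent bundle\<close>

text \<open>Points of the orbifold and of its unit tangent bundle are orbits.\<close>

definition orbit :: "(real^2^2) set \<Rightarrow> complex \<Rightarrow> complex set" where
  "orbit \<Gamma> z = (\<lambda>A. moebius A z) ` \<Gamma>"

definition orbit_T1 ::
    "(real^2^2) set \<Rightarrow> complex \<times> complex \<Rightarrow> (complex \<times> complex) set" where
  "orbit_T1 \<Gamma> w = (\<lambda>A. moebius_T1 A w) ` \<Gamma>"

definition orbifold_topology :: "(real^2^2) set \<Rightarrow> complex set topology" where
  "orbifold_topology \<Gamma> =
     topology (\<lambda>V. V \<subseteq> orbit \<Gamma> ` upper_half \<and> open {z \<in> upper_half. orbit \<Gamma> z \<in> V})"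

lemma openin_orbifold_topology:
  "openin (orbifold_topology \<Gamma>) V \<longleftrightarrow>
     V \<subseteq> orbit \<Gamma> ` upper_half \<and> open {z \<in> upper_half. orbit \<Gamma> z \<in> V}"
proof -
  let ?Q = "\<lambda>V. V \<subseteq> orbit \<Gamma> ` upper_half \<and> open {z \<in> upper_half. orbit \<Gamma> z \<in> V}"
  have "istopology ?Q"
    unfolding istopology_def
  proof (intro conjI allI impI)
    fix S T assume "?Q S" "?Q T"
    moreover have "{z \<in> upper_half. orbit \<Gamma> z \<in> S \<inter> T} =
        {z \<in> upper_half. orbit \<Gamma> z \<in> S} \<inter> {z \<in> upper_half. orbit \<Gamma> z \<in> T}" by auto
    ultimately show "S \<inter> T \<subseteq> orbit \<Gamma> ` upper_half"
      and "open {z \<in> upper_half. orbit \<Gamma> z \<in> S \<inter> T}" by auto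
  next
    fix K assume "\<forall>V\<in>K. ?Q V"
    moreover have "{z \<in> upper_half. orbit \<Gamma> z \<in> \<Union>K} =
        (\<Union>V\<in>K. {z \<in> upper_half. orbit \<Gamma> z \<in> V})" by auto
    ultimately show "\<Union>K \<subseteq> orbit \<Gamma> ` upper_half"
      and "open {z \<in> upper_half. orbit \<Gamma> z \<in> \<Union>K}" by auto
  qed
  then show ?thesis by (simp add: orbifold_topology_def topology_inverse')
qed

text \<open>
  The measure induced on a quotient with projection \<open>p\<close> by an invariant measure upstairs: it is
  the measure for which \<open>p\<close> is measure preserving on every measurable set that it maps
  injectively.
\<close>

definition induced_emeasure :: "'a measure \<Rightarrow> ('a \<Rightarrow> 'b) \<Rightarrow> 'b set \<Rightarrow> ennreal" where
  "induced_emeasure M p B =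
     (SUP E \<in> {E \<in> sets M. inj_on p E \<and> p ` E \<subseteq> B}. emeasure M E)"

definition induced_measure :: "'a measure \<Rightarrow> ('a \<Rightarrow> 'b) \<Rightarrow> 'b measure" where
  "induced_measure M p =
     measure_of (p ` space M) {B. B \<subseteq> p ` space M \<and> p -` B \<inter> space M \<in> sets M}
       (induced_emeasure M p)"

lemma emeasure_induced_measure:
  assumes B: "B \<subseteq> p ` space M" "p -` B \<inter> space M \<in> sets M"
  shows "emeasure (induced_measure M p) B = induced_emeasure M p B"
proof -
  let ?\<Omega> = "p ` space M"
  let ?\<A> = "{B. B \<subseteq> ?\<Omega> \<and> p -` B \<inter> space M \<in> sets M}"
  let ?\<E> = "\<lambda>B. {E \<in> sets M. inj_on p E \<and> p ` E \<subseteq> B}"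
  let ?\<mu> = "induced_emeasure M p"
  have sa: "sigma_algebra ?\<Omega> ?\<A>"
    unfolding sigma_algebra_iff2
  proof (intro conjI ballI allI impI)
    fix B assume "B \<in> ?\<A>"
    moreover have "p -` (?\<Omega> - B) \<inter> space M = space M - (p -` B \<inter> space M)" by auto
    ultimately show "?\<Omega> - B \<in> ?\<A>" by auto
  next
    fix A :: "nat \<Rightarrow> _" assume A: "range A \<subseteq> ?\<A>"
    have "p -` (\<Union>i. A i) \<inter> space M = (\<Union>i. p -` A i \<inter> space M)" by auto
    also have "\<dots> \<in> sets M" using A by (intro sets.countable_UN) auto
    finally have "p -` (\<Union>i. A i) \<inter> space M \<in> sets M" .
    moreover have "(\<Union>i. A i) \<subseteq> ?\<Omega>" using A by blast
    ultimately show "(\<Union>i. A i) \<in> ?\<A>" by blast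
  qed auto
  have empty_E: "{} \<in> ?\<E> B" for B by auto
  have two: "?\<mu> B + ?\<mu> C \<le> ?\<mu> (B \<union> C)" if disj: "B \<inter> C = {}" for B C
  proof -
    have le0: "emeasure M E + emeasure M F \<le> ?\<mu> (B \<union> C)" if E: "E \<in> ?\<E> B" and F: "F \<in> ?\<E> C" for E F
    proof -
      have "E \<inter> F = {}" using E F disj by auto
      then have "emeasure M E + emeasure M F = emeasure M (E \<union> F)"
        using E F by (intro plus_emeasure) auto
      also have "\<dots> \<le> ?\<mu> (B \<union> C)"
        unfolding induced_emeasure_def
      proof (rule SUP_upper)
        have "inj_on p (E \<union> F)"
          using E F disj by (subst inj_on_Un) blast
        then show "E \<union> F \<in> ?\<E> (B \<union> C)" using E F by auto
      qed
      finally show ?thesis .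
    qed
    have le1: "emeasure M E + ?\<mu> C \<le> ?\<mu> (B \<union> C)" if "E \<in> ?\<E> B" for E
    proof -
      have "emeasure M E + ?\<mu> C = ?\<mu> C + emeasure M E" by (rule add.commute)
      also have "\<dots> = (SUP F\<in>?\<E> C. emeasure M F + emeasure M E)"
        unfolding induced_emeasure_def[of M p C] using empty_E
        by (intro ennreal_SUP_add_left[symmetric]) blast
      also have "\<dots> = (SUP F\<in>?\<E> C. emeasure M E + emeasure M F)"
        by (simp add: add.commute)
      also have "\<dots> \<le> ?\<mu> (B \<union> C)"
        by (intro SUP_least) (rule le0[OF that])
      finally show ?thesis .
    qed
    have "?\<mu> B + ?\<mu> C = (SUP E\<in>?\<E> B. emeasure M E + ?\<mu> C)"
      unfolding induced_emeasure_def[of M p B] using empty_E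
      by (intro ennreal_SUP_add_left[symmetric]) blast
    also have "\<dots> \<le> ?\<mu> (B \<union> C)" by (intro SUP_least le1)
    finally show ?thesis .
  qed
  have mono: "?\<mu> B \<le> ?\<mu> C" if "B \<subseteq> C" for B C
    unfolding induced_emeasure_def by (rule SUP_subset_mono) (use that in auto)
  have "countably_additive ?\<A> ?\<mu>"
    unfolding countably_additive_def
  proof (intro allI impI)
    fix A :: "nat \<Rightarrow> _"
    assume A: "range A \<subseteq> ?\<A>" and disj: "disjoint_family A"
    have fin: "(\<Sum>i<n. ?\<mu> (A i)) \<le> ?\<mu> (\<Union>i<n. A i)" for n
    proof (induction n)
      case (Suc n)
      have "(\<Sum>i<Suc n. ?\<mu> (A i)) \<le> ?\<mu> (\<Union>i<n. A i) + ?\<mu> (A n)"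
        using Suc by (simp add: add_right_mono)
      also have "\<dots> \<le> ?\<mu> ((\<Union>i<n. A i) \<union> A n)"
      proof (rule two)
        have "A i \<inter> A n = {}" if "i < n" for i
          using disj that by (intro disjoint_family_onD[of A UNIV]) auto
        then show "(\<Union>i<n. A i) \<inter> A n = {}" by blast
      qed
      also have "(\<Union>i<n. A i) \<union> A n = (\<Union>i<Suc n. A i)"
        by (auto simp: lessThan_Suc)
      finally show ?case .
    qed simp
    show "(\<Sum>i. ?\<mu> (A i)) = ?\<mu> (\<Union>i. A i)"
    proof (rule antisym)
      show "(\<Sum>i. ?\<mu> (A i)) \<le> ?\<mu> (\<Union>i. A i)"
        unfolding suminf_eq_SUP
        by (rule SUP_least, rule order_trans[OF fin], rule mono) auto
      have "emeasure M E \<le> (\<Sum>i. ?\<mu> (A i))" if E: "E \<in> ?\<E> (\<Union>i. A i)" for E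
      proof -
        let ?F = "\<lambda>i. E \<inter> (p -` A i \<inter> space M)"
        have F: "?F i \<in> sets M" for i
        proof (rule sets.Int)
          show "E \<in> sets M" using E by blast
          show "p -` A i \<inter> space M \<in> sets M" using A by blast
        qed
        have "E \<subseteq> space M" using E sets.sets_into_space by auto
        then have "E = (\<Union>i. ?F i)" using E by blast
        then have "emeasure M E = emeasure M (\<Union>i. ?F i)" by simp
        also have "\<dots> = (\<Sum>i. emeasure M (?F i))"
        proof (rule suminf_emeasure[symmetric])
          show "range ?F \<subseteq> sets M" using F by blast
          show "disjoint_family ?F" using disj unfolding disjoint_family_on_def by blast
        qed
        also have "\<dots> \<le> (\<Sum>i. ?\<mu> (A i))"
        proof (intro suminf_le summableI)
          fix i
          have "inj_on p (?F i)" using E by (auto intro: inj_on_subset)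
          then show "emeasure M (?F i) \<le> ?\<mu> (A i)"
            unfolding induced_emeasure_def using F by (intro SUP_upper) blast
        qed
        finally show ?thesis .
      qed
      then show "?\<mu> (\<Union>i. A i) \<le> (\<Sum>i. ?\<mu> (A i))"
        unfolding induced_emeasure_def[of M p "\<Union>i. A i"] by (blast intro!: SUP_least)
    qed
  qed
  moreover have "?\<mu> {} = 0"
    unfolding induced_emeasure_def by (rule antisym) (auto intro!: SUP_least)
  ultimately have "measure_space ?\<Omega> ?\<A> ?\<mu>"
    unfolding measure_space_def positive_def using sa by auto
  then show ?thesis
    unfolding induced_measure_def
    using B sa by (intro emeasure_measure_of_sigma)
      (auto simp: measure_space_def)
qed

definition orbifold_area :: "(real^2^2) set \<Rightarrow> complex set measure" where
  "orbifold_area \<Gamma> = induced_measure hyp_area (orbit \<Gamma>)"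

definition T1S_measure :: "(real^2^2) set \<Rightarrow> (complex \<times> complex) set measure" where
  "T1S_measure \<Gamma> = induced_measure T1H_measure (orbit_T1 \<Gamma>)"

definition total_area :: "(real^2^2) set \<Rightarrow> real" where
  "total_area \<Gamma> = measure (orbifold_area \<Gamma>) (space (orbifold_area \<Gamma>))"


subsection \<open>Normalized zonal Fuchsian groups\<close>

definition horoball :: "real \<Rightarrow> complex set" where
  "horoball m = {z. Im z > m}"

definition zonal_fuchsian :: "(real^2^2) set \<Rightarrow> bool" where
  "zonal_fuchsian \<Gamma> \<longleftrightarrow>
     PSL2R_subgroup \<Gamma> \<and> discrete \<Gamma> \<and>
     \<not> compact_space (orbifold_topology \<Gamma>) \<and>
     emeasure (orbifold_area \<Gamma>) (space (orbifold_area \<Gamma>)) < \<infinity> \<and>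
     stab_inf \<Gamma> = (\<Union>n::int. {mat2 1 (of_int n) 0 1, - mat2 1 (of_int n) 0 1})"

definition eta :: "(real^2^2) set \<Rightarrow> real" where
  "eta \<Gamma> = (LEAST m. m > 0 \<and>
     (\<forall>A \<in> \<Gamma> - stab_inf \<Gamma>. horoball m \<inter> moebius A ` horoball m = {}))"

text \<open>As \<open>det A = 1\<close>, the condition \<open>A$1$1 = 0\<close> says that \<open>A\<close> sends \<open>\<infinity>\<close> to \<open>0\<close>.\<close>

definition normalized :: "(real^2^2) set \<Rightarrow> bool" where
  "normalized \<Gamma> \<longleftrightarrow> (\<exists>A\<in>\<Gamma>. A$1$1 = 0 \<and>
     closure (horoball (eta \<Gamma>)) \<inter> closure (moebius A ` horoball (eta \<Gamma>)) =
       {of_real (eta \<Gamma>) * \<i>})"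

text \<open>The transformation \<open>z \<mapsto> - \<eta>\<^sup>2 / z\<close>.\<close>

definition U_eta :: "real \<Rightarrow> real^2^2" where
  "U_eta \<eta> = mat2 0 (- \<eta>) (1 / \<eta>) 0"


subsection \<open>Geodesics of the orbifold and their excursions\<close>

text \<open>
  A point \<open>v\<close> of the unit tangent bundle of the orbifold is an orbit of tangent vectors, and
  the lifts of the geodesic with initial vector \<open>v\<close> are the geodesics whose initial vectors
  belong to that orbit. The lifts are permuted transitively by the group, so the set of their
  positions at time \<open>t\<close> is a single orbit, namely the point at time \<open>t\<close> of the geodesic downstairs.
\<close>

definition lifts :: "(complex \<times> complex) set \<Rightarrow> (real \<Rightarrow> complex) set" where
  "lifts v = {c. hyp_geodesic c \<and> (c 0, sgn (velocity c 0)) \<in> v}"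

definition geod :: "(complex \<times> complex) set \<Rightarrow> real \<Rightarrow> complex set" where
  "geod v t = {c t | c. c \<in> lifts v}"

definition tangent_at :: "(real \<Rightarrow> complex) \<Rightarrow> real \<Rightarrow> real \<Rightarrow> bool" where
  "tangent_at c d t \<longleftrightarrow> Im (c t) = 1 / d \<and> Im (velocity c t) = 0"

definition depth_params :: "real \<Rightarrow> (complex \<times> complex) set \<Rightarrow> real set" where
  "depth_params k v = {t. \<exists>c\<in>lifts v. \<exists>d. 0 < d \<and> d < k \<and> tangent_at c d t}"

text \<open>The pair (forward endpoint, backward endpoint) of \<open>c\<close> is finite and belongs to \<open>X\<close>.\<close>

definition endpoints_in :: "(real \<Rightarrow> complex) \<Rightarrow> (real \<times> real) set \<Rightarrow> bool" where
  "endpoints_in c X \<longleftrightarrow> (\<exists>x y. (c \<longlongrightarrow> of_real x) at_top \<and> (c \<longlongrightarrow> of_real y) at_bot \<and> (x, y) \<in> X)"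

definition J_region :: "(real \<times> real) set" where
  "J_region = ({-1<..<0} \<times> {0<..}) \<union> ({0<..<1} \<times> {..<0})"

definition I_region :: "(real \<times> real) set" where
  "I_region = ({-1<..<0} \<times> {1<..}) \<union> ({0<..<1} \<times> {..<-1})"

text \<open>
  For \<open>k \<le> 2\<close> every excursion has a lift with endpoint pair in \<open>J_region\<close>, which is unique outside
  a null set of geodesics. The excursion is approximating if the pair of that lift lies in
  \<open>I_region\<close>.
\<close>

definition approx_depth_params :: "real \<Rightarrow> (complex \<times> complex) set \<Rightarrow> real set" where
  "approx_depth_params k v = {t. \<exists>c\<in>lifts v. \<exists>d. 0 < d \<and> d < k \<and> tangent_at c d t \<and>
     endpoints_in c J_region \<and> endpoints_in c I_region}"

definition cusp_nbhd :: "(real^2^2) set \<Rightarrow> real \<Rightarrow> complex set set" where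
  "cusp_nbhd \<Gamma> k = orbit \<Gamma> ` horoball (1 / k)"

text \<open>
  The arc of the geodesic over \<open>[a, b]\<close> is the maximal arc through time \<open>t\<close> in the cusp
  neighbourhood, up to its endpoints. Maximality holds because the neighbourhood is open, hence
  disjoint from its frontier.
\<close>

definition boundary_params ::
    "(real^2^2) set \<Rightarrow> real \<Rightarrow> (complex \<times> complex) set \<Rightarrow> real \<Rightarrow> real \<Rightarrow> real \<Rightarrow> bool" where
  "boundary_params \<Gamma> k v t a b \<longleftrightarrow>
     a < t \<and> t < b \<and> (\<forall>s\<in>{a<..<b}. geod v s \<in> cusp_nbhd \<Gamma> k) \<and>
     geod v a \<in> orbifold_topology \<Gamma> frontier_of cusp_nbhd \<Gamma> k \<and>
     geod v b \<in> orbifold_topology \<Gamma> frontier_of cusp_nbhd \<Gamma> k"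

definition increasing_enumeration :: "(nat \<Rightarrow> real) \<Rightarrow> real set \<Rightarrow> bool" where
  "increasing_enumeration t D \<longleftrightarrow> strict_mono_on {1..} t \<and> t ` {1..} = D"

definition calA :: "real \<Rightarrow> real" where
  "calA z = (if z \<le> 1 then z else 2 - z + 2 * ln z)"

end

theory Submission
  imports Defs
begin

text \<open>
  Why the theorem is true. A unit tangent vector whose geodesic does not run straight up to
  \<open>\<infinity>\<close> is determined by its forward endpoint \<open>x\<close> and by the image \<open>a + i e^s\<close> of its base point
  under \<open>z \<mapsto> -1/(z - x)\<close>, a map that sends \<open>x\<close> to \<open>\<infinity>\<close> and the geodesic to a vertical line.
  In the coordinates \<open>(x, a, s)\<close> everything becomes explicit. The measure \<open>dA d\<theta>\<close> is twice Lebesgue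
  measure (\<open>nn_integral_T1H\<close>), the geodesic flow is \<open>s \<mapsto> s + t\<close>, and the group acts by maps
  that preserve Lebesgue measure and commute with the flow (\<open>nn_integral_act\<close>, \<open>act_flow\<close>).
  The backward endpoint is \<open>x - 1/a\<close>, and the geodesic reaches its greatest height \<open>1/(2|a|)\<close>
  at time \<open>ln |a| - s\<close>. Hence the \<open>k\<close>-excursions of a vector are the points \<open>(x, a, s)\<close> of its
  orbit with \<open>2|a| < k\<close>, up to integer translations of \<open>x\<close>; the lift with endpoints in \<open>J_region\<close>
  is the one with \<open>(x, a)\<close> in \<open>excursion_region k\<close>, and both the condition of being approximating
  and the length of the excursion are expressed by \<open>(x, a)\<close> alone.

  For a weight \<open>h(x, a)\<close> consider the sum of \<open>h\<close> over the excursions with depth parameter in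
  \<open>[0, T)\<close>. Unfolding the integral over a fundamental domain \<open>F\<close> into an integral over the whole
  space shows that the mean of this sum over \<open>F\<close> is \<open>T (\<integral>h) / |F|\<close>, where
  \<open>|F| = \<pi> area(S)\<close> (\<open>exists_domain\<close>). The geodesic flow is ergodic, so for almost every vector the
  sum itself grows like that (\<open>count_average\<close>, \<open>excursion_average\<close>). It remains to compute
  three plane integrals: the region of the \<open>k\<close>-excursions has area \<open>k\<close>, that of the approximating
  ones has area \<open>calA k\<close>, and the length of the excursion integrates to \<open>\<pi> k\<close>. The number of
  excursions up to time \<open>T\<close> is therefore asymptotic to \<open>k T / |F|\<close> or \<open>calA k T / |F|\<close>, so the mean gap
  is \<open>|F| / k\<close> or \<open>|F| / calA k\<close>, and the mean length is \<open>\<pi> k / k = \<pi>\<close>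
  (\<open>increasing_enumeration_limit\<close>).

  Ergodicity is Hopf's argument in the form of Mautner. A set that is invariant under the group and the
  flow is almost invariant under the translations of \<open>a\<close> along stable horocycles, because the flow
  contracts them, while small translations hardly move a set of finite measure. So, up to null sets,
  membership depends on the forward endpoint only. Reversing the direction of time, it also depends on
  the backward endpoint only, and such a set is null or conull. Since the sets on which a Birkhoff sum
  is unbounded are of this kind, the maximal ergodic lemma yields the ergodic theorem directly
  (\<open>birkhoff_zero_one\<close>).

  Three points remain. For almost every vector different excursions have different depth parameters, so
  that counting excursions and counting times is the same (\<open>excursion_fiber\<close>). By Shimizu's lemma no
  group element lifts a point of height at least \<open>1\<close> higher unless it fixes \<open>\<infinity>\<close>, so for \<open>k \<le> 1\<close> an
  excursion is bounded by the two instants at which its lift has height \<open>1/k\<close>. Finally, the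
  exceptional null set must not depend on \<open>k\<close>; it comes from the rational values of \<open>k\<close>, and the others
  follow by monotonicity and continuity in \<open>k\<close> (\<open>monotone_family_limit\<close>).
\<close>

section \<open>Substitution in integrals over the real line\<close>

lemma nn_integral_translate:
  fixes f :: "real \<Rightarrow> ennreal"
  assumes [measurable]: "f \<in> borel_measurable borel"
  shows "(\<integral>\<^sup>+x. f (x + t) \<partial>lborel) = (\<integral>\<^sup>+x. f x \<partial>lborel)"
  using nn_integral_real_affine[OF assms, of 1 t] by (simp add: add.commute)

lemma nn_integral_scale:
  fixes f :: "real \<Rightarrow> ennreal"
  assumes [measurable]: "f \<in> borel_measurable borel" and "c \<noteq> 0"
  shows "ennreal \<bar>c\<bar> * (\<integral>\<^sup>+x. f (c * x + t) \<partial>lborel) = (\<integral>\<^sup>+x. f x \<partial>lborel)"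
  using nn_integral_real_affine[OF assms, of t] by (simp add: add.commute)

lemma nn_integral_split_sign:
  fixes h :: "real \<Rightarrow> ennreal"
  assumes [measurable]: "h \<in> borel_measurable borel"
  shows "(\<integral>\<^sup>+y. h y \<partial>lborel) =
    (\<integral>\<^sup>+y. h y * indicator {..<0} y \<partial>lborel) + (\<integral>\<^sup>+y. h y * indicator {0<..} y \<partial>lborel)"
proof -
  have "(\<integral>\<^sup>+y. h y \<partial>lborel) = (\<integral>\<^sup>+y. h y * indicator {..<0} y + h y * indicator {0<..} y \<partial>lborel)"
    by (intro nn_integral_cong_AE, use AE_lborel_singleton[of "0::real"] in eventually_elim)
       (auto split: split_indicator)
  then show ?thesis by (simp add: nn_integral_add)
qed

text \<open>
  Monotone substitution on an interval \<open>I\<close> that need not be compact. On the compact pieces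
  \<open>{a n..b n}\<close> this is the library rule; monotone convergence carries it over to \<open>I\<close> for indicators,
  and comparing the two sides as measures extends it to all nonnegative \<open>f\<close>, integrable or not.
\<close>

lemma nn_integral_substitution_open:
  fixes f :: "real \<Rightarrow> ennreal" and g g' :: "real \<Rightarrow> real" and a b :: "nat \<Rightarrow> real"
  assumes f[measurable]: "f \<in> borel_measurable borel"
    and g[measurable]: "g \<in> borel_measurable borel" and g'[measurable]: "g' \<in> borel_measurable borel"
    and der: "\<And>x. x \<in> I \<Longrightarrow> (g has_real_derivative g' x) (at x)"
    and cont: "continuous_on I g'" and nn: "\<And>x. x \<in> I \<Longrightarrow> 0 \<le> g' x"
    and ab: "\<And>n. a n \<le> b n" and inc: "decseq a" "incseq b"
    and I: "(\<Union>n. {a n..b n}) = I" and K: "(\<Union>n. {g (a n)..g (b n)}) = K"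
  shows "(\<integral>\<^sup>+x. f x * indicator K x \<partial>lborel) =
         (\<integral>\<^sup>+x. ennreal (g' x) * f (g x) * indicator I x \<partial>lborel)"
proof -
  have I_meas[measurable]: "I \<in> sets borel" and K_meas[measurable]: "K \<in> sets borel"
    unfolding I[symmetric] K[symmetric] by auto
  have sub: "{a n..b n} \<subseteq> I" for n using I by blast
  have mono: "g x \<le> g y" if "x \<le> y" "x \<in> {a n..b n}" "y \<in> {a n..b n}" for x y n
  proof (rule deriv_nonneg_imp_mono[of x y g g'])
    fix z assume "z \<in> {x..y}"
    then have "z \<in> I" using that sub[of n] by auto
    then show "(g has_real_derivative g' z) (at z)" "0 \<le> g' z" using der nn by auto
  qed (use that in auto)
  have incI: "incseq (\<lambda>n. {a n..b n})"
    using inc by (auto simp: incseq_def decseq_def intro: order_trans)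
  have incK: "incseq (\<lambda>n. {g (a n)..g (b n)})"
  proof (rule incseq_SucI)
    fix n
    have *: "a (Suc n) \<le> a n" "b n \<le> b (Suc n)" "a n \<le> b n"
      using inc ab by (auto simp: decseq_Suc_iff incseq_Suc_iff)
    have "g (a (Suc n)) \<le> g (a n)" by (rule mono[of _ _ "Suc n"]) (use * in auto)
    moreover have "g (b n) \<le> g (b (Suc n))" by (rule mono[of _ _ "Suc n"]) (use * in auto)
    ultimately show "{g (a n)..g (b n)} \<subseteq> {g (a (Suc n))..g (b (Suc n))}" by auto
  qed
  have SUPind: "(SUP n. (indicator (A n) x :: ennreal)) = indicator (\<Union>n. A n) x" for A :: "nat \<Rightarrow> real set" and x
    by (auto simp: indicator_def intro!: antisym SUP_least intro: SUP_upper2)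
  let ?M1 = "density lborel (indicator K)"
  let ?M2 = "distr (density lborel (\<lambda>x. ennreal (g' x) * indicator I x)) borel g"
  have "?M1 = ?M2"
  proof (rule measure_eqI)
    fix B assume "B \<in> sets ?M1"
    then have [measurable]: "B \<in> sets borel" by simp
    have step: "(\<integral>\<^sup>+x. indicator B x * indicator {g (a n)..g (b n)} x \<partial>lborel) =
       (\<integral>\<^sup>+x. ennreal (g' x) * indicator B (g x) * indicator {a n..b n} x \<partial>lborel)" for n
    proof -
      have "(\<lambda>x. indicator {g (a n)..g (b n)} x * indicator B x :: real) \<in> borel_measurable borel"
        by measurable
      then have mB: "set_borel_measurable borel {g (a n)..g (b n)} (indicator B :: real \<Rightarrow> real)"
        by (simp add: set_borel_measurable_def)
      have "(\<integral>\<^sup>+x. ennreal (indicator B x * indicator {g (a n)..g (b n)} x) \<partial>lborel) =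
          (\<integral>\<^sup>+x. ennreal (indicator B (g x) * g' x * indicator {a n..b n} x) \<partial>lborel)"
        using nn_integral_substitution[where f = "indicator B" and g = g and a = "a n" and b = "b n" and g' = g', OF mB] der sub[of n] nn ab[of n] continuous_on_subset[OF cont sub[of n]]
        by (simp add: subset_iff)
      also have "(\<integral>\<^sup>+x. ennreal (indicator B (g x) * g' x * indicator {a n..b n} x) \<partial>lborel) =
         (\<integral>\<^sup>+x. ennreal (g' x) * indicator B (g x) * indicator {a n..b n} x \<partial>lborel)"
        by (intro nn_integral_cong) (auto split: split_indicator)
      finally show ?thesis by (simp add: ennreal_indicator ennreal_mult')
    qed
    have "emeasure ?M1 B = (\<integral>\<^sup>+x. (SUP n. indicator B x * indicator {g (a n)..g (b n)} x) \<partial>lborel)"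
      by (simp add: emeasure_density SUP_mult_left_ennreal[symmetric] SUPind K mult.commute)
    also have "\<dots> = (SUP n. \<integral>\<^sup>+x. indicator B x * indicator {g (a n)..g (b n)} x \<partial>lborel)"
    proof (intro nn_integral_monotone_convergence_SUP incseq_SucI le_funI)
      show "indicator B x * indicator {g (a n)..g (b n)} x
          \<le> (indicator B x * indicator {g (a (Suc n))..g (b (Suc n))} x :: ennreal)" for n x
        using incseq_SucD[OF incK, of n] by (auto split: split_indicator)
    qed measurable
    also have "\<dots> = (SUP n. \<integral>\<^sup>+x. ennreal (g' x) * indicator B (g x) * indicator {a n..b n} x \<partial>lborel)"
      by (simp add: step)
    also have "\<dots> = (\<integral>\<^sup>+x. (SUP n. ennreal (g' x) * indicator B (g x) * indicator {a n..b n} x) \<partial>lborel)"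
    proof (intro nn_integral_monotone_convergence_SUP[symmetric] incseq_SucI le_funI)
      show "ennreal (g' x) * indicator B (g x) * indicator {a n..b n} x
          \<le> ennreal (g' x) * indicator B (g x) * indicator {a (Suc n)..b (Suc n)} x" for n x
        using incseq_SucD[OF incI, of n] by (auto split: split_indicator)
    qed measurable
    also have "\<dots> = (\<integral>\<^sup>+x. ennreal (g' x) * indicator B (g x) * indicator I x \<partial>lborel)"
      by (simp add: SUP_mult_left_ennreal[symmetric] SUPind I)
    also have "\<dots> = emeasure ?M2 B"
    proof -
      have [measurable]: "g -` B \<in> sets borel"
        using measurable_sets_borel[OF g \<open>B \<in> sets borel\<close>] .
      show ?thesis
        by (simp add: emeasure_distr emeasure_density mult_ac)
           (intro nn_integral_cong, auto split: split_indicator)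
    qed
    finally show "emeasure ?M1 B = emeasure ?M2 B" .
  qed simp
  then have "nn_integral ?M1 f = nn_integral ?M2 f" by simp
  then show ?thesis
    by (simp add: nn_integral_density nn_integral_distr mult_ac)
qed

lemma nn_integral_exp:
  fixes f :: "real \<Rightarrow> ennreal"
  assumes [measurable]: "f \<in> borel_measurable borel"
  shows "(\<integral>\<^sup>+y. f y * indicator {0<..} y \<partial>lborel) = (\<integral>\<^sup>+s. ennreal (exp s) * f (exp s) \<partial>lborel)"
proof -
  have "(\<integral>\<^sup>+x. f x * indicator {0<..} x \<partial>lborel) =
         (\<integral>\<^sup>+x. ennreal (exp x) * f (exp x) * indicator UNIV x \<partial>lborel)"
  proof (rule nn_integral_substitution_open[where a = "\<lambda>n. - real n" and b = "\<lambda>n. real n"])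
    show "(\<Union>n. {- real n..real n}) = UNIV"
    proof -
      have "x \<in> (\<Union>n. {- real n..real n})" for x
        using real_arch_simple[of "\<bar>x\<bar>"] by (auto simp: abs_le_iff minus_le_iff)
      then show ?thesis by blast
    qed
    show "(\<Union>n. {exp (- real n)..exp (real n)}) = {0<..}"
    proof -
      have "x \<in> (\<Union>n. {exp (- real n)..exp (real n)})" if "0 < x" for x
      proof -
        obtain n where n: "\<bar>ln x\<bar> \<le> real n" using real_arch_simple by blast
        have "exp (- real n) \<le> exp (ln x)" "exp (ln x) \<le> exp (real n)"
          using n by (auto simp: abs_le_iff)
        then show ?thesis using that by auto
      qed
      moreover have "x > 0" if "exp a \<le> x" for a x :: real using that exp_gt_zero[of a] by linarith
      ultimately show ?thesis by auto
    qed
  qed (auto simp: decseq_def incseq_def intro!: derivative_eq_intros continuous_intros)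
  then show ?thesis by simp
qed

lemma nn_integral_arctan:
  fixes f :: "real \<Rightarrow> ennreal"
  assumes [measurable]: "f \<in> borel_measurable borel"
  shows "(\<integral>\<^sup>+y. f y * indicator {- (pi / 2)<..<pi / 2} y \<partial>lborel) =
     (\<integral>\<^sup>+x. ennreal (1 / (1 + x\<^sup>2)) * f (arctan x) \<partial>lborel)"
proof -
  have "(\<integral>\<^sup>+x. f x * indicator {- (pi / 2)<..<pi / 2} x \<partial>lborel) =
         (\<integral>\<^sup>+x. ennreal (1 / (1 + x\<^sup>2)) * f (arctan x) * indicator UNIV x \<partial>lborel)"
  proof (rule nn_integral_substitution_open[where a = "\<lambda>n. - real n" and b = "\<lambda>n. real n"])
    show "(\<Union>n. {- real n..real n}) = UNIV"
    proof -
      have "x \<in> (\<Union>n. {- real n..real n})" for x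
        using real_arch_simple[of "\<bar>x\<bar>"] by (auto simp: abs_le_iff minus_le_iff)
      then show ?thesis by blast
    qed
    show "(\<Union>n. {arctan (- real n)..arctan (real n)}) = {- (pi / 2)<..<pi / 2}"
    proof -
      have "x \<in> (\<Union>n. {arctan (- real n)..arctan (real n)})" if "- (pi / 2) < x" "x < pi / 2" for x
      proof -
        obtain n where n: "\<bar>tan x\<bar> \<le> real n" using real_arch_simple by blast
        have "arctan (- real n) \<le> arctan (tan x)" "arctan (tan x) \<le> arctan (real n)"
          using n unfolding arctan_le_iff by linarith+
        then show ?thesis using that by (auto simp: arctan_tan)
      qed
      moreover have "- (pi/2) < x" if "arctan a \<le> x" for a x :: real using that arctan_lbound[of a] by linarith
      moreover have "x < pi/2" if "x \<le> arctan a" for a x :: real using that arctan_ubound[of a] by linarith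
      ultimately show ?thesis by (auto simp del: arctan_minus)
    qed
    show "(arctan has_real_derivative 1 / (1 + x\<^sup>2)) (at x)" for x
      using DERIV_arctan[of x] by (simp add: inverse_eq_divide)
    show "continuous_on UNIV (\<lambda>x::real. 1 / (1 + x\<^sup>2))"
      by (intro continuous_intros) (smt (verit) zero_le_power2)
  qed (auto simp: decseq_def incseq_def add_pos_nonneg less_imp_le)
  then show ?thesis by simp
qed

lemma nn_integral_neg_inverse_half:
  fixes f :: "real \<Rightarrow> ennreal"
  assumes [measurable]: "f \<in> borel_measurable borel"
  shows "(\<integral>\<^sup>+y. f y * indicator {..<0} y \<partial>lborel) =
     (\<integral>\<^sup>+x. ennreal (1 / x\<^sup>2) * f (- 1 / x) * indicator {0<..} x \<partial>lborel)" (is ?A)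
    and "(\<integral>\<^sup>+y. f y * indicator {0<..} y \<partial>lborel) =
     (\<integral>\<^sup>+x. ennreal (1 / x\<^sup>2) * f (- 1 / x) * indicator {..<0} x \<partial>lborel)" (is ?B)
proof -
  have pos: "(\<Union>n. {1 / real (Suc n)..real (Suc n)}) = {0<..}"
  proof -
    have "x \<in> (\<Union>n. {1 / real (Suc n)..real (Suc n)})" if "0 < x" for x
    proof -
      obtain n where n: "max x (1/x) \<le> real n" using real_arch_simple by blast
      then have "1 / x \<le> real (Suc n)" "x \<le> real (Suc n)" by auto
      then have "1 / real (Suc n) \<le> x" "x \<le> real (Suc n)" using that by (auto simp: field_simps)
      then show ?thesis by auto
    qed
    moreover have "x > 0" if "1 / real (Suc n) \<le> x" for n x
      using that by (meson less_le_trans divide_pos_pos zero_less_one of_nat_0_less_iff zero_less_Suc)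
    ultimately show ?thesis by auto
  qed
  have neg: "(\<Union>n. {- real (Suc n)..- (1 / real (Suc n))}) = {..<0}"
  proof -
    have "(\<Union>n. {- real (Suc n)..- (1 / real (Suc n))}) = uminus ` (\<Union>n. {1 / real (Suc n)..real (Suc n)})"
      by (simp add: image_UN)
    then show ?thesis unfolding pos by (simp add: image_uminus_greaterThan)
  qed
  have d: "((\<lambda>x. - 1 / x) has_real_derivative 1 / x\<^sup>2) (at x)" if "x \<noteq> 0" for x :: real
    using that by (auto intro!: derivative_eq_intros simp: power2_eq_square)
  have dec: "decseq (\<lambda>n. 1 / real (Suc n))" "incseq (\<lambda>n. - (1 / real (Suc n)))"
    by (auto simp: decseq_def incseq_def intro!: divide_left_mono)
  have le1: "1 / real (Suc n) \<le> real (Suc n)" for n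
    by (simp add: field_simps)
  have cont: "continuous_on S (\<lambda>x. 1 / x\<^sup>2)" if "0 \<notin> S" for S :: "real set"
    by (intro continuous_intros) (use that in auto)
  show ?A
  proof (rule nn_integral_substitution_open[where g = "\<lambda>x. - 1 / x" and a = "\<lambda>n. 1 / real (Suc n)" and b = "\<lambda>n. real (Suc n)"])
    show "(\<Union>n. {- 1 / (1 / real (Suc n))..- 1 / real (Suc n)}) = {..<0}" using neg by simp
  qed (use d dec le1 pos cont in \<open>auto simp: incseq_def\<close>)
  show ?B
  proof (rule nn_integral_substitution_open[where g = "\<lambda>x. - 1 / x" and a = "\<lambda>n. - real (Suc n)" and b = "\<lambda>n. - (1 / real (Suc n))"])
    show "(\<Union>n. {- 1 / - real (Suc n)..- 1 / - (1 / real (Suc n))}) = {0<..}"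
      unfolding pos[symmetric] by (simp del: of_nat_Suc)
    show "- real (Suc n) \<le> - (1 / real (Suc n))" for n using le1[of n] by simp
  qed (use d dec neg cont in \<open>auto simp: decseq_def\<close>)
qed

text \<open>
  The two halves of the line are exchanged by \<open>x \<mapsto> -1/x\<close>. This is the only nonlinear substitution
  needed for Moebius transformations, since translations and scalings generate the rest.
\<close>

lemma nn_integral_neg_inverse:
  fixes f :: "real \<Rightarrow> ennreal"
  assumes [measurable]: "f \<in> borel_measurable borel"
  shows "(\<integral>\<^sup>+x. ennreal (1 / x\<^sup>2) * f (- 1 / x) \<partial>lborel) = (\<integral>\<^sup>+y. f y \<partial>lborel)"
proof -
  have "(\<integral>\<^sup>+x. ennreal (1 / x\<^sup>2) * f (- 1 / x) \<partial>lborel) =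
    (\<integral>\<^sup>+x. ennreal (1 / x\<^sup>2) * f (- 1 / x) * indicator {..<0} x \<partial>lborel) +
    (\<integral>\<^sup>+x. ennreal (1 / x\<^sup>2) * f (- 1 / x) * indicator {0<..} x \<partial>lborel)"
    by (rule nn_integral_split_sign) measurable
  also have "\<dots> = (\<integral>\<^sup>+y. f y * indicator {0<..} y \<partial>lborel) + (\<integral>\<^sup>+y. f y * indicator {..<0} y \<partial>lborel)"
    by (simp only: nn_integral_neg_inverse_half[OF assms])
  also have "\<dots> = (\<integral>\<^sup>+y. f y \<partial>lborel)"
    by (subst nn_integral_split_sign[OF assms]) (rule add.commute)
  finally show ?thesis .
qed

section \<open>A pointwise ergodic theorem under a zero-one condition\<close>

text \<open>
  Garsia's proof. With \<open>M\<close> the maximum of the first partial sums, including the empty one,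
  \<open>M \<le> f + M \<circ> T\<close> wherever \<open>M > 0\<close>; integrate \<open>M - M \<circ> T\<close>, whose integral vanishes.
\<close>

lemma maximal_ergodic_finite:
  fixes f :: "'a \<Rightarrow> real" and T :: "'a \<Rightarrow> 'a"
  assumes T[measurable]: "T \<in> M \<rightarrow>\<^sub>M M" and pres: "distr M M T = M" and f: "integrable M f"
  defines "S \<equiv> \<lambda>n x. \<Sum>i<n. f ((T ^^ i) x)"
  defines "Mx \<equiv> \<lambda>N x. Max ((\<lambda>n. S n x) ` {..N})"
  shows "0 \<le> (\<integral>x. f x * indicator {x. 0 < Mx N x} x \<partial>M)"
proof -
  have [measurable]: "f \<in> borel_measurable M" using f by auto
  have [measurable]: "(\<lambda>x. f ((T ^^ i) x)) \<in> borel_measurable M" for i by measurable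
  have int_shift: "integrable M (\<lambda>x. h (T x)) \<and> (\<integral>x. h (T x) \<partial>M) = (\<integral>x. h x \<partial>M)"
    if h: "integrable M h" for h :: "'a \<Rightarrow> real"
  proof -
    have [measurable]: "h \<in> borel_measurable M" using h by auto
    have "integrable (distr M M T) h" using h by (simp add: pres)
    then have "integrable M (\<lambda>x. h (T x))" by (subst (asm) integrable_distr_eq) auto
    moreover have "(\<integral>x. h x \<partial>distr M M T) = (\<integral>x. h (T x) \<partial>M)" by (rule integral_distr) auto
    ultimately show ?thesis by (simp add: pres)
  qed
  have int_i: "integrable M (\<lambda>x. f ((T ^^ i) x))" for i
  proof (induction i)
    case (Suc i) then show ?case using int_shift[of "\<lambda>x. f ((T ^^ i) x)"] by (simp add: funpow_swap1)
  qed (use f in simp)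
  have int_S: "integrable M (S n)" for n unfolding S_def using int_i by auto
  have S_Suc: "S (Suc n) x = f x + S n (T x)" for n x
    unfolding S_def by (subst sum.lessThan_Suc_shift) (simp add: funpow_swap1)
  have Mx_Suc: "Mx (Suc N) x = max (S (Suc N) x) (Mx N x)" for N x
    unfolding Mx_def atMost_Suc by (simp add: Max_insert)
  have int_M: "integrable M (Mx N)" for N
  proof (induction N)
    case 0
    have "Mx 0 = S 0" by (auto simp: Mx_def fun_eq_iff)
    then show ?case using int_S by simp
  next
    case (Suc N)
    have "Mx (Suc N) = (\<lambda>x. max (S (Suc N) x) (Mx N x))" by (rule ext) (rule Mx_Suc)
    then show ?case using Suc int_S by (auto intro!: integrable_max)
  qed
  have M_nn: "0 \<le> Mx N x" for N x
    unfolding Mx_def by (rule Max_ge_iff[THEN iffD2]) (auto simp: S_def intro!: bexI[of _ 0])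
  have S_le: "S n x \<le> Mx N x" if "n \<le> N" for n x
    unfolding Mx_def by (rule Max_ge) (use that in auto)
  have key: "Mx N x - Mx N (T x) \<le> f x * indicator {x. 0 < Mx N x} x" for x
  proof (cases "0 < Mx N x")
    case True
    have "Mx N x \<in> (\<lambda>n. S n x) ` {..N}" unfolding Mx_def by (rule Max_in) auto
    then obtain n where n: "n \<le> N" "Mx N x = S n x" by auto
    then obtain m where m: "n = Suc m" using True by (cases n) (auto simp: S_def)
    have "S n x \<le> f x + Mx N (T x)" unfolding m S_Suc using n m by (simp add: S_le)
    then show ?thesis using True n by simp
  next
    case False
    then have "Mx N x = 0" using M_nn[of N x] by simp
    then show ?thesis using M_nn[of N "T x"] by simp
  qed
  have [measurable]: "Mx N \<in> borel_measurable M" using int_M by auto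
  have "0 = (\<integral>x. Mx N x - Mx N (T x) \<partial>M)" using int_shift[OF int_M[of N]] int_M[of N] by simp
  also have "\<dots> \<le> (\<integral>x. f x * indicator {x. 0 < Mx N x} x \<partial>M)"
  proof (rule integral_mono)
    show "integrable M (\<lambda>x. f x * indicator {x. 0 < Mx N x} x)"
    proof -
      have "integrable M (\<lambda>x. f x * indicator {x\<in>space M. 0 < Mx N x} x)"
        using integrable_real_mult_indicator[OF _ f, of "{x\<in>space M. 0 < Mx N x}"] by auto
      moreover have "integrable M (\<lambda>x. f x * indicator {x\<in>space M. 0 < Mx N x} x) \<longleftrightarrow>
          integrable M (\<lambda>x. f x * indicator {x. 0 < Mx N x} x)"
        by (rule Bochner_Integration.integrable_cong) (auto split: split_indicator)
      ultimately show ?thesis by simp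
    qed
  qed (use key int_shift[OF int_M[of N]] int_M[of N] in auto)
  finally show ?thesis .
qed

text \<open>
  The set on which some partial sum is positive exhausts the space in the limit \<open>N \<rightarrow> \<infinity>\<close>.
\<close>

lemma maximal_ergodic:
  fixes f :: "'a \<Rightarrow> real" and T :: "'a \<Rightarrow> 'a"
  assumes T[measurable]: "T \<in> M \<rightarrow>\<^sub>M M" and pres: "distr M M T = M" and f: "integrable M f"
    and pos: "AE x in M. \<exists>n. 0 < (\<Sum>i<n. f ((T ^^ i) x))"
  shows "0 \<le> (\<integral>x. f x \<partial>M)"
proof -
  define S where "S = (\<lambda>n x. \<Sum>i<n. f ((T ^^ i) x))"
  define Mx where "Mx = (\<lambda>N x. Max ((\<lambda>n. S n x) ` {..N}))"
  have [measurable]: "f \<in> borel_measurable M" using f by auto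
  have [measurable]: "S n \<in> borel_measurable M" for n unfolding S_def by measurable
  have Mx_pos: "0 < Mx N x \<longleftrightarrow> (\<exists>n\<le>N. 0 < S n x)" for N x
    unfolding Mx_def by (subst Max_gr_iff) auto
  have fin: "0 \<le> (\<integral>x. f x * indicator {x. 0 < Mx N x} x \<partial>M)" for N
    using maximal_ergodic_finite[OF T pres f, of N] unfolding Mx_def S_def .
  have "(\<lambda>N. \<integral>x. f x * indicator {x. 0 < Mx N x} x \<partial>M) \<longlonglongrightarrow> (\<integral>x. f x \<partial>M)"
  proof (rule integral_dominated_convergence[where w = "\<lambda>x. \<bar>f x\<bar>"])
    show "(\<lambda>x. f x * indicator {x. 0 < Mx N x} x) \<in> borel_measurable M" for N
      unfolding Mx_pos by measurable
    show "AE x in M. (\<lambda>N. f x * indicator {x. 0 < Mx N x} x) \<longlonglongrightarrow> f x"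
      using pos
    proof eventually_elim
      case (elim x)
      then obtain n where n: "0 < S n x" unfolding S_def by auto
      have "\<forall>\<^sub>F N in sequentially. f x * indicator {x. 0 < Mx N x} x = f x"
        using eventually_ge_at_top[of n] by eventually_elim (use n in \<open>auto simp: Mx_pos indicator_def\<close>)
      then show ?case by (rule tendsto_eventually)
    qed
  qed (use f in \<open>auto split: split_indicator\<close>)
  then show ?thesis by (rule LIMSEQ_le_const) (use fin in auto)
qed

text \<open>
  Birkhoff's theorem, with ergodicity assumed only for the sets where the partial sums of \<open>f - c\<close>
  or of \<open>c - f\<close> are unbounded above. If \<open>c\<close> exceeds the mean, the first set cannot be conull, for then
  \<open>f - c\<close> would have nonnegative mean by the maximal ergodic lemma; so it is null and the averages
  have upper limit at most \<open>c\<close>. The lower limit is treated in the same way. Unboundedness, unlike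
  positivity of some partial sum, does not depend on the starting point within an orbit.
\<close>

theorem birkhoff_zero_one:
  fixes f :: "'a \<Rightarrow> real" and T :: "'a \<Rightarrow> 'a"
  assumes M: "finite_measure M" and T[measurable]: "T \<in> M \<rightarrow>\<^sub>M M" and pres: "distr M M T = M"
    and f: "integrable M f" and pos: "0 < measure M (space M)"
    and up: "\<And>c. (AE x in M. \<forall>C. \<exists>n. C < (\<Sum>i<n. f ((T ^^ i) x)) - c * real n) \<or>
                  (AE x in M. \<not> (\<forall>C. \<exists>n. C < (\<Sum>i<n. f ((T ^^ i) x)) - c * real n))"
    and dn: "\<And>c. (AE x in M. \<forall>C. \<exists>n. C < c * real n - (\<Sum>i<n. f ((T ^^ i) x))) \<or>
                  (AE x in M. \<not> (\<forall>C. \<exists>n. C < c * real n - (\<Sum>i<n. f ((T ^^ i) x))))"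
  shows "AE x in M. (\<lambda>n. (\<Sum>i<n. f ((T ^^ i) x)) / real n) \<longlonglongrightarrow> (\<integral>x. f x \<partial>M) / measure M (space M)"
proof -
  interpret finite_measure M by (rule M)
  define m where "m = (\<integral>x. f x \<partial>M) / measure M (space M)"
  define S where "S = (\<lambda>x n. \<Sum>i<n. f ((T ^^ i) x))"
  have m: "(\<integral>x. f x \<partial>M) = m * measure M (space M)" using pos by (simp add: m_def)
  have upper: "AE x in M. \<exists>C. \<forall>n. S x n - c * real n \<le> C" if "m < c" for c
  proof -
    have "\<not> (AE x in M. \<forall>C. \<exists>n. C < S x n - c * real n)"
    proof
      assume "AE x in M. \<forall>C. \<exists>n. C < S x n - c * real n"
      then have "AE x in M. \<exists>n. 0 < (\<Sum>i<n. f ((T ^^ i) x) - c)"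
      proof eventually_elim
        case (elim x)
        then obtain n where "0 < S x n - c * real n" by blast
        then show ?case by (intro exI[of _ n]) (simp add: S_def sum_subtractf mult.commute)
      qed
      from maximal_ergodic[OF T pres _ this] f
      have "0 \<le> (\<integral>x. f x - c \<partial>M)" by auto
      also have "\<dots> = (m - c) * measure M (space M)" using f by (simp add: m algebra_simps)
      finally show False using pos that by (simp add: zero_le_mult_iff)
    qed
    then have "AE x in M. \<not> (\<forall>C. \<exists>n. C < S x n - c * real n)" using up[of c] by (simp add: S_def)
    then show ?thesis by eventually_elim (auto simp: not_less)
  qed
  have lower: "AE x in M. \<exists>C. \<forall>n. c * real n - S x n \<le> C" if "c < m" for c
  proof -
    have "\<not> (AE x in M. \<forall>C. \<exists>n. C < c * real n - S x n)"
    proof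
      assume "AE x in M. \<forall>C. \<exists>n. C < c * real n - S x n"
      then have "AE x in M. \<exists>n. 0 < (\<Sum>i<n. c - f ((T ^^ i) x))"
      proof eventually_elim
        case (elim x)
        then obtain n where "0 < c * real n - S x n" by blast
        then show ?case by (intro exI[of _ n]) (simp add: S_def sum_subtractf mult.commute)
      qed
      from maximal_ergodic[OF T pres _ this] f
      have "0 \<le> (\<integral>x. c - f x \<partial>M)" by auto
      also have "\<dots> = (c - m) * measure M (space M)" using f by (simp add: m algebra_simps)
      finally show False using pos that by (simp add: zero_le_mult_iff)
    qed
    then have "AE x in M. \<not> (\<forall>C. \<exists>n. C < c * real n - S x n)" using dn[of c] by (simp add: S_def)
    then show ?thesis by eventually_elim (auto simp: not_less)
  qed
  have "AE x in M. \<forall>j. (\<exists>C. \<forall>n. S x n - (m + 1 / real (Suc j)) * real n \<le> C) \<and>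
     (\<exists>C. \<forall>n. (m - 1 / real (Suc j)) * real n - S x n \<le> C)"
    unfolding AE_all_countable AE_conj_iff using upper lower by auto
  then have "AE x in M. (\<lambda>n. S x n / real n) \<longlonglongrightarrow> m"
  proof eventually_elim
    case (elim x)
    show ?case
    proof (rule LIMSEQ_I)
      fix r :: real assume "0 < r"
      then obtain j where j: "1 / real (Suc j) < r / 2" using nat_approx_posE[of "r/2"] by auto
      obtain C where C: "\<And>n. S x n - (m + 1 / real (Suc j)) * real n \<le> C" using elim by blast
      obtain C' where C': "\<And>n. (m - 1 / real (Suc j)) * real n - S x n \<le> C'" using elim by blast
      obtain N where N: "2 * (\<bar>C\<bar> + \<bar>C'\<bar>) / r < real N" using reals_Archimedean2 by blast
      show "\<exists>no. \<forall>n\<ge>no. norm (S x n / real n - m) < r"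
      proof (intro exI allI impI)
        fix n assume n: "Suc N \<le> n"
        then have n0: "0 < real n" by simp
        have "2 * (\<bar>C\<bar> + \<bar>C'\<bar>) / r < real n" using N n by simp
        then have Cn: "\<bar>C\<bar> + \<bar>C'\<bar> < r / 2 * real n" using \<open>0 < r\<close> by (simp add: field_simps)
        have jn: "1 / real (Suc j) * real n < r / 2 * real n" using j n0 by (rule mult_strict_right_mono)
        have "S x n - m * real n < r * real n" using C[of n] Cn jn unfolding distrib_right by linarith
        moreover have "m * real n - S x n < r * real n" using C'[of n] Cn jn unfolding left_diff_distrib by linarith
        ultimately show "norm (S x n / real n - m) < r"
          using n0 by (simp add: abs_less_iff field_simps)
      qed
    qed
  qed
  then show ?thesis by (simp add: S_def m_def)
qed

section \<open>Discrete subgroups of SL(2,R)\<close>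

lemma mat2_simps [simp]:
  "mat2 a b c d $ 1 $ 1 = a" "mat2 a b c d $ 1 $ 2 = b"
  "mat2 a b c d $ 2 $ 1 = c" "mat2 a b c d $ 2 $ 2 = d"
  by (simp_all add: mat2_def)

lemma mat2_eq_iff:
  fixes A B :: "real^2^2"
  shows "A = B \<longleftrightarrow> A$1$1 = B$1$1 \<and> A$1$2 = B$1$2 \<and> A$2$1 = B$2$1 \<and> A$2$2 = B$2$2"
  by (auto simp: vec_eq_iff forall_2)

lemma matrix_mult_2:
  fixes A B :: "real^2^2"
  shows "(A ** B)$1$1 = A$1$1 * B$1$1 + A$1$2 * B$2$1"
    "(A ** B)$1$2 = A$1$1 * B$1$2 + A$1$2 * B$2$2"
    "(A ** B)$2$1 = A$2$1 * B$1$1 + A$2$2 * B$2$1"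
    "(A ** B)$2$2 = A$2$1 * B$1$2 + A$2$2 * B$2$2"
  by (simp_all add: matrix_matrix_mult_def sum_2)

lemma SL2R_iff: "A \<in> SL2R \<longleftrightarrow> A$1$1 * A$2$2 - A$1$2 * A$2$1 = 1"
  by (simp add: SL2R_def det_2)

text \<open>
  The adjugate is the inverse on \<open>SL2R\<close>, and has polynomial entries.
\<close>

definition adj2 :: "real^2^2 \<Rightarrow> real^2^2" where
  "adj2 A = mat2 (A$2$2) (- A$1$2) (- A$2$1) (A$1$1)"

lemma adj2_simps [simp]:
  "adj2 A $ 1 $ 1 = A$2$2" "adj2 A $ 1 $ 2 = - A$1$2"
  "adj2 A $ 2 $ 1 = - A$2$1" "adj2 A $ 2 $ 2 = A$1$1"
  by (simp_all add: adj2_def)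

lemma adj2_adj2 [simp]: "adj2 (adj2 A) = A"
  by (simp add: mat2_eq_iff)

lemma adj2_mult: assumes "A \<in> SL2R" shows "adj2 A ** A = mat 1" "A ** adj2 A = mat 1"
  using assms by (auto simp: mat2_eq_iff matrix_mult_2 SL2R_iff mat_def algebra_simps)

lemma matrix_inv_SL2R: assumes "A \<in> SL2R" shows "matrix_inv A = adj2 A"
proof -
  have "A ** matrix_inv A = mat 1 \<and> matrix_inv A ** A = mat 1"
    unfolding matrix_inv_def by (rule someI[of _ "adj2 A"]) (simp add: adj2_mult[OF assms])
  then have "adj2 A = adj2 A ** (A ** matrix_inv A)" by (simp add: matrix_mul_rid)
  also have "\<dots> = matrix_inv A" by (simp add: matrix_mul_assoc adj2_mult[OF assms] matrix_mul_lid)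
  finally show ?thesis by simp
qed

lemma tendsto_mat_iff:
  fixes f :: "'b \<Rightarrow> real^2^2"
  shows "(f \<longlongrightarrow> L) F \<longleftrightarrow> ((\<lambda>n. f n$1$1) \<longlongrightarrow> L$1$1) F \<and> ((\<lambda>n. f n$1$2) \<longlongrightarrow> L$1$2) F \<and>
    ((\<lambda>n. f n$2$1) \<longlongrightarrow> L$2$1) F \<and> ((\<lambda>n. f n$2$2) \<longlongrightarrow> L$2$2) F" (is "?L \<longleftrightarrow> ?R")
proof
  assume ?L then show ?R by (intro conjI tendsto_intros) auto
next
  assume R: ?R
  show ?L
  proof (rule vec_tendstoI, rule vec_tendstoI)
    fix i j :: 2
    show "((\<lambda>x. f x $ i $ j) \<longlongrightarrow> L $ i $ j) F"
      using exhaust_2[of i] exhaust_2[of j] R by auto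
  qed
qed

locale sl2_group =
  fixes \<Gamma> :: "(real^2^2) set"
  assumes PSL: "PSL2R_subgroup \<Gamma>" and discr: "discrete \<Gamma>"
begin

lemma in_SL2R: "A \<in> \<Gamma> \<Longrightarrow> A \<in> SL2R" using PSL by (auto simp: PSL2R_subgroup_def)
lemma det1: "A \<in> \<Gamma> \<Longrightarrow> A$1$1 * A$2$2 - A$1$2 * A$2$1 = 1" using in_SL2R SL2R_iff by blast
lemma one_in [simp]: "mat 1 \<in> \<Gamma>" using PSL by (auto simp: PSL2R_subgroup_def)
lemma mult_in [simp]: "A \<in> \<Gamma> \<Longrightarrow> B \<in> \<Gamma> \<Longrightarrow> A ** B \<in> \<Gamma>" using PSL by (auto simp: PSL2R_subgroup_def)
lemma uminus_in [simp]: "A \<in> \<Gamma> \<Longrightarrow> - A \<in> \<Gamma>" using PSL by (auto simp: PSL2R_subgroup_def)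
lemma adj_in [simp]: "A \<in> \<Gamma> \<Longrightarrow> adj2 A \<in> \<Gamma>"
  using PSL matrix_inv_SL2R[of A] in_SL2R[of A] by (auto simp: PSL2R_subgroup_def)

lemma neg_neq: "B \<in> \<Gamma> \<Longrightarrow> B \<noteq> - B"
proof
  assume "B \<in> \<Gamma>" "B = - B"
  then have "B$i$j = 0" for i j by (metis vector_uminus_component equal_neg_zero)
  then show False using det1[OF \<open>B \<in> \<Gamma>\<close>] by simp
qed

lemma isolated_identity:
  obtains e where "0 < e" "\<And>A. A \<in> \<Gamma> \<Longrightarrow> dist A (mat 1) < e \<Longrightarrow> A = mat 1"
proof -
  have "mat 1 isolated_in \<Gamma>" using discr by (simp add: discrete_def)
  then obtain T where T: "open T" "T \<inter> \<Gamma> = {mat 1}" unfolding isolated_in_def by blast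
  then obtain e where "0 < e" "ball (mat 1) e \<subseteq> T" using open_contains_ball by blast
  show ?thesis
  proof (rule that[OF \<open>0 < e\<close>])
    fix A assume "A \<in> \<Gamma>" "dist A (mat 1) < e"
    then have "A \<in> T \<inter> \<Gamma>" using \<open>ball (mat 1) e \<subseteq> T\<close> by (auto simp: dist_commute)
    then show "A = mat 1" using T by simp
  qed
qed

lemma convergent_eventually_identity:
  assumes B: "\<And>n. B n \<in> \<Gamma>" and lim: "B \<longlonglongrightarrow> mat 1"
  shows "\<forall>\<^sub>F n in sequentially. B n = mat 1"
proof -
  obtain e where e: "0 < e" "\<And>A. A \<in> \<Gamma> \<Longrightarrow> dist A (mat 1) < e \<Longrightarrow> A = mat 1" by (rule isolated_identity) blast
  from tendstoD[OF lim e(1)] show ?thesis by eventually_elim (use e B in auto)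
qed

text \<open>
  Discreteness is used in this form: the quotients of consecutive terms tend to the identity,
  which is isolated.
\<close>

lemma convergent_eventually_const:
  assumes A: "\<And>n. A n \<in> \<Gamma>" and lim: "A \<longlonglongrightarrow> L"
  shows "\<forall>\<^sub>F n in sequentially. A (Suc n) = A n"
proof -
  have comp: "(\<lambda>n. A n $ i $ j) \<longlonglongrightarrow> L $ i $ j" for i j by (intro tendsto_intros lim)
  have compS: "(\<lambda>n. A (Suc n) $ i $ j) \<longlonglongrightarrow> L $ i $ j" for i j by (rule LIMSEQ_Suc[OF comp])
  have detL: "L$1$1 * L$2$2 - L$1$2 * L$2$1 = 1"
  proof (rule LIMSEQ_unique)
    show "(\<lambda>n. A n$1$1 * A n$2$2 - A n$1$2 * A n$2$1) \<longlonglongrightarrow> L$1$1 * L$2$2 - L$1$2 * L$2$1"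
      by (intro tendsto_intros comp)
    show "(\<lambda>n. A n$1$1 * A n$2$2 - A n$1$2 * A n$2$1) \<longlonglongrightarrow> 1" using det1[OF A] by simp
  qed
  have "(\<lambda>n. A (Suc n) ** adj2 (A n)) \<longlonglongrightarrow> mat 1"
    unfolding tendsto_mat_iff matrix_mult_2 adj2_simps
  proof (intro conjI)
    show "(\<lambda>n. A (Suc n)$1$1 * A n$2$2 + A (Suc n)$1$2 * - A n$2$1) \<longlonglongrightarrow> (mat 1::real^2^2)$1$1"
      by (rule tendsto_eq_intros comp compS refl)+ (simp add: mat_def detL)
    show "(\<lambda>n. A (Suc n)$1$1 * - A n$1$2 + A (Suc n)$1$2 * A n$1$1) \<longlonglongrightarrow> (mat 1::real^2^2)$1$2"
      by (rule tendsto_eq_intros comp compS refl)+ (simp add: mat_def)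
    show "(\<lambda>n. A (Suc n)$2$1 * A n$2$2 + A (Suc n)$2$2 * - A n$2$1) \<longlonglongrightarrow> (mat 1::real^2^2)$2$1"
      by (rule tendsto_eq_intros comp compS refl)+ (simp add: mat_def)
    show "(\<lambda>n. A (Suc n)$2$1 * - A n$1$2 + A (Suc n)$2$2 * A n$1$1) \<longlonglongrightarrow> (mat 1::real^2^2)$2$2"
      by (rule tendsto_eq_intros comp compS refl)+ (use detL in \<open>simp add: mat_def algebra_simps\<close>)
  qed
  then have "\<forall>\<^sub>F n in sequentially. A (Suc n) ** adj2 (A n) = mat 1"
    by (rule convergent_eventually_identity[rotated]) (use A in auto)
  then show ?thesis
  proof eventually_elim
    case (elim n)
    have "A (Suc n) = A (Suc n) ** (adj2 (A n) ** A n)" using adj2_mult[OF in_SL2R[OF A]] by (simp add: matrix_mul_rid)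
    also have "\<dots> = A n" using elim by (simp add: matrix_mul_assoc matrix_mul_lid)
    finally show ?case .
  qed
qed

lemma finite_of_bounded: assumes K: "K \<subseteq> \<Gamma>" "bounded K" shows "finite K"
proof (rule ccontr)
  assume "infinite K"
  then obtain f :: "nat \<Rightarrow> real^2^2" where f: "inj f" "range f \<subseteq> K" using infinite_countable_subset by blast
  then have "bounded (range f)" using K bounded_subset by blast
  then obtain l r where r: "strict_mono r" "(f \<circ> r) \<longlonglongrightarrow> l" using bounded_imp_convergent_subsequence by blast
  have "\<forall>\<^sub>F n in sequentially. (f \<circ> r) (Suc n) = (f \<circ> r) n"
    by (rule convergent_eventually_const[OF _ r(2)]) (use f K in auto)
  then obtain n where "f (r (Suc n)) = f (r n)" by (auto simp: eventually_sequentially)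
  then have "r (Suc n) = r n" using f(1) by (simp add: inj_eq)
  moreover have "r n < r (Suc n)" using r(1) by (simp add: strict_mono_Suc_iff)
  ultimately show False by simp
qed

lemma countable_group: "countable \<Gamma>"
proof -
  have "\<Gamma> \<subseteq> (\<Union>n. \<Gamma> \<inter> cball 0 (real n))"
    using real_arch_simple by fastforce
  moreover have "countable (\<Union>n. \<Gamma> \<inter> cball 0 (real n))"
    by (intro countable_UN countableI_type countable_finite finite_of_bounded) auto
  ultimately show ?thesis by (rule countable_subset)
qed

text \<open>
  Shimizu's lemma. With \<open>T\<close> the translation by 1, iterate \<open>B \<mapsto> B T B^(-1)\<close> from \<open>A\<close>. The lower left
  entry is squared, up to sign, at every step. Were it less than 1 in absolute value, the iterates
  would converge to \<open>T\<close> without ever becoming constant.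
\<close>

lemma shimizu:
  assumes T: "mat2 1 1 0 1 \<in> \<Gamma>" and A: "A \<in> \<Gamma>" and c: "A$2$1 \<noteq> 0"
  shows "1 \<le> \<bar>A$2$1\<bar>"
proof (rule ccontr)
  assume "\<not> ?thesis"
  then have c1: "\<bar>A$2$1\<bar> < 1" by simp
  define B where "B = rec_nat A (\<lambda>_ M. M ** mat2 1 1 0 1 ** adj2 M)"
  have B0: "B 0 = A" and BS: "B (Suc n) = B n ** mat2 1 1 0 1 ** adj2 (B n)" for n by (simp_all add: B_def)
  have BG: "B n \<in> \<Gamma>" for n by (induction n) (auto simp: B0 BS A T)
  have e21: "B (Suc n)$2$1 = - (B n$2$1)\<^sup>2" for n
    by (simp add: BS matrix_mult_2 power2_eq_square algebra_simps)
  have e11: "B (Suc n)$1$1 = 1 - B n$1$1 * B n$2$1" for n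
    using det1[OF BG[of n]] by (simp add: BS matrix_mult_2 algebra_simps)
  have e12: "B (Suc n)$1$2 = (B n$1$1)\<^sup>2" for n
    by (simp add: BS matrix_mult_2 power2_eq_square algebra_simps)
  have e22: "B (Suc n)$2$2 = 1 + B n$1$1 * B n$2$1" for n
    using det1[OF BG[of n]] by (simp add: BS matrix_mult_2 algebra_simps)
  define q where "q = \<bar>A$2$1\<bar>"
  have q: "0 \<le> q" "q < 1" using c1 by (auto simp: q_def)
  have bq: "\<bar>B n$2$1\<bar> \<le> q ^ Suc n" for n
  proof (induction n)
    case (Suc n)
    have "\<bar>B (Suc n)$2$1\<bar> = \<bar>B n$2$1\<bar> * \<bar>B n$2$1\<bar>" by (simp add: e21 power2_eq_square)
    also have "\<dots> \<le> q ^ Suc n * q ^ Suc n" using Suc by (intro mult_mono) auto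
    also have "\<dots> \<le> q ^ Suc n * q" using q power_decreasing[of 1 "Suc n" q] by (intro mult_left_mono) auto
    finally show ?case by (simp add: mult_ac)
  qed (simp add: B0 q_def)
  have nz: "B n$2$1 \<noteq> 0" for n by (induction n) (auto simp: B0 c e21)
  have q0: "(\<lambda>n. q ^ Suc n) \<longlonglongrightarrow> 0" using q by (intro LIMSEQ_Suc LIMSEQ_realpow_zero) auto
  have l21: "(\<lambda>n. B n$2$1) \<longlonglongrightarrow> 0"
    by (rule Lim_null_comparison[OF _ q0]) (use bq in auto)
  \<comment> \<open>The bound \<open>D\<close> satisfies \<open>1 + D q \<le> D\<close>, which makes it invariant under \<open>e11\<close>.\<close>
  define D where "D = max \<bar>A$1$1\<bar> (1 / (1 - q))"
  have D: "\<bar>B n$1$1\<bar> \<le> D" for n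
  proof (induction n)
    case (Suc n)
    have Dq: "1 + D * q \<le> D"
    proof -
      have "1 / (1 - q) \<le> D" by (simp add: D_def)
      then show ?thesis using q by (simp add: divide_le_eq algebra_simps)
    qed
    have "\<bar>B n$2$1\<bar> \<le> q" using bq[of n] power_decreasing[of 1 "Suc n" q] q by auto
    then have "\<bar>B n$1$1 * B n$2$1\<bar> \<le> D * q" using Suc by (simp add: abs_mult mult_mono)
    then show ?case using Dq unfolding e11 by linarith
  qed (simp add: B0 D_def)
  have prod0: "(\<lambda>n. B n$1$1 * B n$2$1) \<longlonglongrightarrow> 0"
  proof (rule Lim_null_comparison)
    show "\<forall>\<^sub>F n in sequentially. norm (B n$1$1 * B n$2$1) \<le> D * q ^ Suc n"
      using D bq by (intro always_eventually allI) (simp add: abs_mult mult_mono')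
    show "(\<lambda>n. D * q ^ Suc n) \<longlonglongrightarrow> 0" using tendsto_mult_left[OF q0, of D] by simp
  qed
  have l11: "(\<lambda>n. B n$1$1) \<longlonglongrightarrow> 1"
    by (rule LIMSEQ_imp_Suc) (use tendsto_diff[OF tendsto_const prod0, of 1] in \<open>simp add: e11\<close>)
  have l22: "(\<lambda>n. B n$2$2) \<longlonglongrightarrow> 1"
    by (rule LIMSEQ_imp_Suc) (use tendsto_add[OF tendsto_const prod0, of 1] in \<open>simp add: e22\<close>)
  have l12: "(\<lambda>n. B n$1$2) \<longlonglongrightarrow> 1"
    by (rule LIMSEQ_imp_Suc) (use tendsto_power[OF l11, of 2] in \<open>simp add: e12\<close>)
  have "B \<longlonglongrightarrow> mat2 1 1 0 1"
    unfolding tendsto_mat_iff using l11 l12 l21 l22 by simp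
  from convergent_eventually_const[OF BG this]
  obtain n where n: "B (Suc n) = B n" by (auto simp: eventually_sequentially)
  have "\<bar>B n$2$1\<bar> < 1" using bq[of n] power_decreasing[of 1 "Suc n" q] q by auto
  moreover have "B n$2$1 * (1 + B n$2$1) = 0" using e21[of n] n by (simp add: power2_eq_square distrib_left)
  ultimately show False using nz[of n] by (auto simp: add_eq_0_iff2)
qed

end

section \<open>Horospherical coordinates\<close>

text \<open>
  A triple \<open>(x, a, s)\<close> stands for the tangent vector with forward endpoint \<open>x\<close> whose base point is
  sent to \<open>W = a + i e^s\<close> by \<open>z \<mapsto> -1/(z - x)\<close>. The translation into vectors is made later; this
  part studies the maps that the coordinates induce.
\<close>

type_synonym horo_coords = "real \<times> real \<times> real"

lemma nn_integral_lborel3: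
  fixes f :: "horo_coords \<Rightarrow> ennreal"
  assumes [measurable]: "f \<in> borel_measurable borel"
  shows "(\<integral>\<^sup>+w. f w \<partial>lborel) = (\<integral>\<^sup>+x. \<integral>\<^sup>+a. \<integral>\<^sup>+s. f (x, a, s) \<partial>lborel \<partial>lborel \<partial>lborel)"
proof -
  have "(\<integral>\<^sup>+w. f w \<partial>lborel) = (\<integral>\<^sup>+w. f w \<partial>(lborel \<Otimes>\<^sub>M lborel))" by (simp add: lborel_prod)
  also have "\<dots> = (\<integral>\<^sup>+x. \<integral>\<^sup>+p. f (x, p) \<partial>lborel \<partial>lborel)"
    by (rule lborel.nn_integral_fst[symmetric]) (simp add: lborel_prod)
  also have "\<dots> = (\<integral>\<^sup>+x. \<integral>\<^sup>+p. f (x, p) \<partial>(lborel \<Otimes>\<^sub>M lborel) \<partial>lborel)" by (simp add: lborel_prod)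
  also have "\<dots> = (\<integral>\<^sup>+x. \<integral>\<^sup>+a. \<integral>\<^sup>+s. f (x, a, s) \<partial>lborel \<partial>lborel \<partial>lborel)"
  proof (intro nn_integral_cong)
    fix x
    have [measurable]: "(\<lambda>p. f (x, p)) \<in> borel_measurable borel" by measurable
    show "(\<integral>\<^sup>+p. f (x, p) \<partial>(lborel \<Otimes>\<^sub>M lborel)) = (\<integral>\<^sup>+a. \<integral>\<^sup>+s. f (x, a, s) \<partial>lborel \<partial>lborel)"
      by (subst lborel.nn_integral_fst[symmetric]) (simp_all add: lborel_prod)
  qed
  finally show ?thesis .
qed

lemma nn_integral_swap:
  fixes f :: "real \<Rightarrow> real \<Rightarrow> ennreal"
  assumes "(\<lambda>p. f (fst p) (snd p)) \<in> borel_measurable (borel \<Otimes>\<^sub>M borel)"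
  shows "(\<integral>\<^sup>+x. \<integral>\<^sup>+y. f x y \<partial>lborel \<partial>lborel) = (\<integral>\<^sup>+y. \<integral>\<^sup>+x. f x y \<partial>lborel \<partial>lborel)"
proof (rule lborel_pair.Fubini'[symmetric])
  have "(\<lambda>p. f (fst p) (snd p)) \<in> borel_measurable (lborel \<Otimes>\<^sub>M lborel)"
    using assms by (simp add: lborel_prod borel_prod)
  then show "case_prod f \<in> borel_measurable (lborel \<Otimes>\<^sub>M lborel)" by (simp add: case_prod_beta')
qed

text \<open>
  The denominator of the Moebius transformation at the real point \<open>x\<close>.
\<close>

definition cocycle :: "real^2^2 \<Rightarrow> real \<Rightarrow> real" where
  "cocycle A x = A$2$1 * x + A$2$2"

text \<open>
  The forward endpoint is moved by the Moebius transformation, and with \<open>j = cocycle A x\<close> the point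
  \<open>W\<close> becomes \<open>j\<^sup>2 W - c j\<close>, where \<open>c\<close> is the lower left entry of \<open>A\<close>.
\<close>

definition act :: "real^2^2 \<Rightarrow> horo_coords \<Rightarrow> horo_coords" where
  "act A = (\<lambda>(x, a, s). ((A$1$1 * x + A$1$2) / cocycle A x,
     (cocycle A x)\<^sup>2 * a - A$2$1 * cocycle A x, s + 2 * ln \<bar>cocycle A x\<bar>))"

definition flow :: "real \<Rightarrow> horo_coords \<Rightarrow> horo_coords" where
  "flow t = (\<lambda>(x, a, s). (x, a, s + t))"

text \<open>
  Translation by hyperbolic length \<open>\<bar>u\<bar>\<close> along the stable horocycle, the line \<open>Im W = e^s\<close>.
\<close>

definition horo :: "real \<Rightarrow> horo_coords \<Rightarrow> horo_coords" where
  "horo u = (\<lambda>(x, a, s). (x, a + u * exp s, s))"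

text \<open>
  Reversal of the vector at its base point: the endpoints \<open>x\<close> and \<open>x - 1/a\<close> are exchanged, and the
  time to the highest point of the geodesic, \<open>ln \<bar>a\<bar> - s\<close>, changes sign.
\<close>

definition flip :: "horo_coords \<Rightarrow> horo_coords" where
  "flip = (\<lambda>(x, a, s). (x - 1 / a, - a, 2 * ln \<bar>a\<bar> - s))"

lemma cocycle_measurable [measurable]: "cocycle A \<in> borel_measurable borel"
  unfolding cocycle_def by measurable

lemma act_measurable [measurable]: "act A \<in> borel \<rightarrow>\<^sub>M borel"
  unfolding act_def case_prod_beta' borel_prod[symmetric] by measurable

lemma flow_measurable [measurable]: "flow t \<in> borel \<rightarrow>\<^sub>M borel"
  unfolding flow_def case_prod_beta' borel_prod[symmetric] by measurable

lemma horo_measurable [measurable]: "horo t \<in> borel \<rightarrow>\<^sub>M borel"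
  unfolding horo_def case_prod_beta' borel_prod[symmetric] by measurable

lemma flip_measurable [measurable]: "flip \<in> borel \<rightarrow>\<^sub>M borel"
  unfolding flip_def case_prod_beta' borel_prod[symmetric] by measurable

text \<open>
  The cocycle identity makes \<open>act\<close> an action away from the points that are sent to \<open>\<infinity>\<close>.
\<close>

lemma cocycle_mult:
  assumes "cocycle B x \<noteq> 0"
  shows "cocycle (A ** B) x = cocycle A ((B$1$1 * x + B$1$2) / cocycle B x) * cocycle B x"
  using assms by (simp add: cocycle_def matrix_mult_2 field_simps)

lemma act_mult:
  assumes B: "B \<in> SL2R" and b: "cocycle B x \<noteq> 0" and ab: "cocycle (A ** B) x \<noteq> 0"
  shows "act A (act B (x, a, s)) = act (A ** B) (x, a, s)"
proof -
  define kb where "kb = cocycle B x"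
  define y where "y = (B$1$1 * x + B$1$2) / kb"
  define ka where "ka = cocycle A y"
  have c: "cocycle (A ** B) x = ka * kb" using cocycle_mult[OF b, of A] by (simp add: ka_def y_def kb_def)
  have nz: "kb \<noteq> 0" "ka \<noteq> 0" using b ab c by (auto simp: kb_def)
  have d: "B$1$1 * B$2$2 - B$1$2 * B$2$1 = 1" using B by (simp add: SL2R_iff)
  have y: "kb * y = B$1$1 * x + B$1$2" using nz by (simp add: y_def)
  have kb: "kb = B$2$1 * x + B$2$2" by (simp add: kb_def cocycle_def)
  have ka: "ka = A$2$1 * y + A$2$2" by (simp add: ka_def cocycle_def)
  have e1: "(A$1$1 * y + A$1$2) * kb = (A ** B)$1$1 * x + (A ** B)$1$2"
  proof -
    have "(A$1$1 * y + A$1$2) * kb = A$1$1 * (kb * y) + A$1$2 * kb" by (simp add: algebra_simps)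
    also have "\<dots> = A$1$1 * (B$1$1 * x + B$1$2) + A$1$2 * (B$2$1 * x + B$2$2)"
      unfolding y by (simp only: kb)
    finally show ?thesis by (simp add: matrix_mult_2 algebra_simps)
  qed
  have f: "B$1$1 * kb = B$2$1 * (kb * y) + 1"
    unfolding y using d by (subst kb) algebra
  have e2: "(A ** B)$2$1 * kb = ka * B$2$1 * kb + A$2$1"
    unfolding ka matrix_mult_2 using f by algebra
  have "ka\<^sup>2 * (kb\<^sup>2 * a - B$2$1 * kb) - A$2$1 * ka = (ka * kb)\<^sup>2 * a - ka * (ka * B$2$1 * kb + A$2$1)"
    by (simp add: power2_eq_square algebra_simps)
  also have "\<dots> = (ka * kb)\<^sup>2 * a - (A ** B)$2$1 * (ka * kb)" by (simp add: e2[symmetric])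
  finally have e3: "ka\<^sup>2 * (kb\<^sup>2 * a - B$2$1 * kb) - A$2$1 * ka = (ka * kb)\<^sup>2 * a - (A ** B)$2$1 * (ka * kb)" .
  have e4: "(A$1$1 * y + A$1$2) / ka = ((A ** B)$1$1 * x + (A ** B)$1$2) / (ka * kb)"
    using e1 nz by (simp add: field_simps)
  show ?thesis
    unfolding act_def prod.case Let_def c
    unfolding kb_def[symmetric] y_def[symmetric] ka_def[symmetric]
    using nz e3 e4 by (simp add: abs_mult ln_mult)
qed

lemma act_one [simp]: "act (mat 1) w = w"
  by (cases w) (simp add: act_def cocycle_def mat_def)

lemma act_uminus [simp]: "act (- A) w = act A w"
proof -
  have "cocycle (- A) x = - cocycle A x" for x by (simp add: cocycle_def)
  moreover have "(- p - q) / (- k) = (p + q) / k" for p q k :: real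
    using minus_divide_divide[of "p + q" k] by simp
  ultimately show ?thesis by (cases w) (simp add: act_def)
qed

lemma act_flow: "act A (flow t w) = flow t (act A w)"
  by (cases w) (simp add: act_def flow_def)

lemma act_horo:
  assumes "cocycle A (fst w) \<noteq> 0"
  shows "act A (horo u w) = horo u (act A w)"
proof (cases w)
  case (fields x a s)
  have "exp (s + 2 * ln \<bar>cocycle A x\<bar>) = exp s * (cocycle A x)\<^sup>2"
    using assms fields by (simp add: exp_add exp_double power2_eq_square[symmetric])
  then show ?thesis by (simp add: act_def horo_def fields algebra_simps)
qed

lemma act_flip:
  assumes d: "A \<in> SL2R" and k: "cocycle A x \<noteq> 0" and a: "a \<noteq> 0" and k': "cocycle A (x - 1 / a) \<noteq> 0"
  shows "flip (act A (x, a, s)) = act A (flip (x, a, s))" "fst (snd (act A (x, a, s))) \<noteq> 0"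
proof -
  define kk l where "kk = cocycle A x" and "l = cocycle A (x - 1 / a)"
  define a' where "a' = kk\<^sup>2 * a - A$2$1 * kk"
  have det: "A$1$1 * A$2$2 - A$1$2 * A$2$1 = 1" using d by (simp add: SL2R_iff)
  have kl: "kk * a - A$2$1 = l * a" using a by (simp add: kk_def l_def cocycle_def field_simps)
  have "a' = kk * (kk * a - A$2$1)" by (simp add: a'_def power2_eq_square algebra_simps)
  then have a'2: "a' = kk * (l * a)" by (simp only: kl)
  have nz: "kk \<noteq> 0" "l \<noteq> 0" using k k' by (auto simp: kk_def l_def)
  then show "fst (snd (act A (x, a, s))) \<noteq> 0" using a'2 a
    by (simp add: act_def a'_def kk_def[symmetric])
  have kx: "kk = A$2$1 * x + A$2$2" and lx: "l * a = (A$2$1 * x + A$2$2) * a - A$2$1"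
    using kl by (simp_all add: kk_def cocycle_def)
  have num: "(A$1$1 * x + A$1$2) * (l * a) - 1 = kk * ((A$1$1 * x + A$1$2) * a - A$1$1)"
    unfolding lx kx using det by algebra
  have e1: "(A$1$1 * x + A$1$2) / kk - 1 / a' = (A$1$1 * (x - 1 / a) + A$1$2) / l"
  proof -
    have "(A$1$1 * x + A$1$2) / kk - 1 / a' = ((A$1$1 * x + A$1$2) * (l * a) - 1) / (kk * (l * a))"
      unfolding a'2 using nz a by (simp add: diff_divide_distrib)
    also have "\<dots> = ((A$1$1 * x + A$1$2) * a - A$1$1) / (l * a)" unfolding num using nz by simp
    also have "\<dots> = (A$1$1 * (x - 1 / a) + A$1$2) / l" using nz a by (simp add: field_simps)
    finally show ?thesis .
  qed
  have e2: "- a' = l\<^sup>2 * (- a) - A$2$1 * l"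
  proof -
    show ?thesis unfolding a'2 using kl by algebra
  qed
  have e3: "2 * ln \<bar>a'\<bar> - (s + 2 * ln \<bar>kk\<bar>) = 2 * ln \<bar>a\<bar> - s + 2 * ln \<bar>l\<bar>"
    unfolding a'2 using nz a by (simp add: abs_mult ln_mult)
  show "flip (act A (x, a, s)) = act A (flip (x, a, s))"
    using e1 e2 e3 unfolding act_def flip_def prod.case a'_def kk_def l_def by auto
qed

lemma flow_flow [simp]: "flow t (flow u w) = flow (t + u) w" by (cases w) (simp add: flow_def add_ac)
lemma flow_0 [simp]: "flow 0 w = w" by (cases w) (simp add: flow_def)
lemma fst_flow [simp]: "fst (flow t w) = fst w" "fst (snd (flow t w)) = fst (snd w)" "snd (snd (flow t w)) = snd (snd w) + t"
  by (cases w, simp add: flow_def)+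

text \<open>
  The flow contracts horocycles: after time \<open>t\<close>, the displacement \<open>u * exp t\<close> has shrunk to \<open>u\<close>.
\<close>

lemma horo_flow: "horo u (flow t w) = flow t (horo (u * exp t) w)"
  by (cases w) (simp add: horo_def flow_def exp_add)

lemma flip_flow: "flip (flow t w) = flow (- t) (flip w)"
  by (cases w) (simp add: flip_def flow_def)

lemma nn_integral_flow:
  fixes f :: "horo_coords \<Rightarrow> ennreal"
  assumes [measurable]: "f \<in> borel_measurable borel"
  shows "(\<integral>\<^sup>+w. f (flow t w) \<partial>lborel) = (\<integral>\<^sup>+w. f w \<partial>lborel)"
proof -
  have "(\<integral>\<^sup>+w. f (flow t w) \<partial>lborel) = (\<integral>\<^sup>+x. \<integral>\<^sup>+a. \<integral>\<^sup>+s. f (flow t (x, a, s)) \<partial>lborel \<partial>lborel \<partial>lborel)"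
    by (rule nn_integral_lborel3) measurable
  also have "\<dots> = (\<integral>\<^sup>+x. \<integral>\<^sup>+a. \<integral>\<^sup>+s. f (x, a, s) \<partial>lborel \<partial>lborel \<partial>lborel)"
  proof -
    have "(\<lambda>s. f (x, a, s)) \<in> borel_measurable borel" for x a by measurable
    then show ?thesis by (simp add: flow_def nn_integral_translate[of "\<lambda>s. f (_, _, s)"])
  qed
  also have "\<dots> = (\<integral>\<^sup>+w. f w \<partial>lborel)" by (rule nn_integral_lborel3[symmetric]) measurable
  finally show ?thesis .
qed

lemma nn_integral_horo:
  fixes f :: "horo_coords \<Rightarrow> ennreal"
  assumes [measurable]: "f \<in> borel_measurable borel"
  shows "(\<integral>\<^sup>+w. f (horo t w) \<partial>lborel) = (\<integral>\<^sup>+w. f w \<partial>lborel)"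
proof -
  have sw: "(\<integral>\<^sup>+w. g w \<partial>lborel) = (\<integral>\<^sup>+x. \<integral>\<^sup>+s. \<integral>\<^sup>+a. g (x, a, s) \<partial>lborel \<partial>lborel \<partial>lborel)"
    if [measurable]: "g \<in> borel_measurable borel" for g :: "horo_coords \<Rightarrow> ennreal"
    unfolding nn_integral_lborel3[OF that]
    by (rule nn_integral_cong, rule nn_integral_swap) measurable
  have "(\<integral>\<^sup>+w. f (horo t w) \<partial>lborel) = (\<integral>\<^sup>+x. \<integral>\<^sup>+s. \<integral>\<^sup>+a. f (horo t (x, a, s)) \<partial>lborel \<partial>lborel \<partial>lborel)"
    by (rule sw) measurable
  also have "\<dots> = (\<integral>\<^sup>+x. \<integral>\<^sup>+s. \<integral>\<^sup>+a. f (x, a, s) \<partial>lborel \<partial>lborel \<partial>lborel)"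
  proof -
    have "(\<lambda>a. f (x, a, s)) \<in> borel_measurable borel" for x s by measurable
    then show ?thesis by (simp add: horo_def nn_integral_translate[of "\<lambda>a. f (_, a, _)"])
  qed
  also have "\<dots> = (\<integral>\<^sup>+w. f w \<partial>lborel)" by (rule sw[symmetric]) measurable
  finally show ?thesis .
qed

text \<open>
  If \<open>A\<close> moves \<open>\<infinity>\<close>, it is an affine map followed by \<open>t \<mapsto> -1/t\<close> and another affine map.
\<close>

lemma nn_integral_moebius:
  fixes f :: "real \<Rightarrow> ennreal"
  assumes [measurable]: "f \<in> borel_measurable borel" and A: "A \<in> SL2R"
  shows "(\<integral>\<^sup>+x. ennreal (1 / (cocycle A x)\<^sup>2) * f ((A$1$1 * x + A$1$2) / cocycle A x) \<partial>lborel) = (\<integral>\<^sup>+x. f x \<partial>lborel)"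
proof (cases "A$2$1 = 0")
  case True
  have d: "A$1$1 * A$2$2 = 1" using A True by (simp add: SL2R_iff)
  then have nz: "A$1$1 \<noteq> 0" "A$2$2 \<noteq> 0" by auto
  have A22: "A$2$2 = 1 / A$1$1" using d nz by (simp add: field_simps)
  have e: "1 / (A$2$2)\<^sup>2 = \<bar>(A$1$1)\<^sup>2\<bar>" by (simp add: A22 power_divide)
  have e': "(A$1$1 * x + A$1$2) / A$2$2 = (A$1$1)\<^sup>2 * x + A$1$2 / A$2$2" for x
    unfolding A22 using nz by (simp add: power2_eq_square algebra_simps)
  have "(\<integral>\<^sup>+x. ennreal (1 / (cocycle A x)\<^sup>2) * f ((A$1$1 * x + A$1$2) / cocycle A x) \<partial>lborel) =
    (\<integral>\<^sup>+x. ennreal \<bar>(A$1$1)\<^sup>2\<bar> * f ((A$1$1)\<^sup>2 * x + A$1$2 / A$2$2) \<partial>lborel)"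
    by (simp only: cocycle_def True mult_zero_left add_0_left e e')
  also have "\<dots> = (\<integral>\<^sup>+x. f x \<partial>lborel)"
    using nn_integral_scale[OF assms(1), of "(A$1$1)\<^sup>2" "A$1$2 / A$2$2"] nz
    by (subst nn_integral_cmult) simp_all
  finally show ?thesis .
next
  case False
  define c where "c = A$2$1"
  have c: "c \<noteq> 0" using False by (simp add: c_def)
  define h where "h = (\<lambda>r. ennreal (1 / c\<^sup>2) * f (r / c\<^sup>2 + A$1$1 / c))"
  have [measurable]: "h \<in> borel_measurable borel" unfolding h_def by measurable
  have k: "cocycle A x = c * (x + A$2$2 / c)" for x using c by (simp add: cocycle_def c_def field_simps)
  have d: "A$1$1 * A$2$2 - A$1$2 * c = 1" using A by (simp add: SL2R_iff c_def)
  have pt: "ennreal (1 / (cocycle A x)\<^sup>2) * f ((A$1$1 * x + A$1$2) / cocycle A x) =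
     ennreal (1 / (x + A$2$2 / c)\<^sup>2) * h (- 1 / (x + A$2$2 / c))" if "x \<noteq> - A$2$2 / c" for x
  proof -
    define t where "t = x + A$2$2 / c"
    have t: "t \<noteq> 0" using that by (simp add: t_def add_eq_0_iff2)
    have x: "x = t - A$2$2 / c" by (simp add: t_def)
    have n: "A$1$1 * x + A$1$2 = A$1$1 * t - 1 / c"
      unfolding x using c d by (simp add: field_simps)
    have "(A$1$1 * x + A$1$2) / (c * t) = - 1 / t / c\<^sup>2 + A$1$1 / c"
      unfolding n using c t by (simp add: field_simps power2_eq_square)
    moreover have "ennreal (1 / (c * t)\<^sup>2) = ennreal (1 / t\<^sup>2) * ennreal (1 / c\<^sup>2)"
      by (simp add: power_mult_distrib flip: ennreal_mult')
    ultimately show ?thesis unfolding k t_def[symmetric] h_def by (simp add: mult_ac)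
  qed
  have "(\<integral>\<^sup>+x. ennreal (1 / (cocycle A x)\<^sup>2) * f ((A$1$1 * x + A$1$2) / cocycle A x) \<partial>lborel) =
    (\<integral>\<^sup>+x. ennreal (1 / (x + A$2$2 / c)\<^sup>2) * h (- 1 / (x + A$2$2 / c)) \<partial>lborel)"
    by (intro nn_integral_cong_AE, use AE_lborel_singleton[of "- A$2$2 / c"] in eventually_elim) (rule pt)
  also have "\<dots> = (\<integral>\<^sup>+x. ennreal (1 / x\<^sup>2) * h (- 1 / x) \<partial>lborel)"
    using nn_integral_translate[of "\<lambda>x. ennreal (1 / x\<^sup>2) * h (- 1 / x)" "A$2$2 / c"] by simp
  also have "\<dots> = (\<integral>\<^sup>+x. h x \<partial>lborel)" by (rule nn_integral_neg_inverse) measurable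
  also have "\<dots> = ennreal \<bar>1 / c\<^sup>2\<bar> * (\<integral>\<^sup>+x. f ((1 / c\<^sup>2) * x + A$1$1 / c) \<partial>lborel)"
    unfolding h_def by (subst nn_integral_cmult) auto
  also have "\<dots> = (\<integral>\<^sup>+x. f x \<partial>lborel)" by (rule nn_integral_scale) (use c in auto)
  finally show ?thesis .
qed

lemma AE_cocycle_nonzero:
  assumes "A \<in> SL2R"
  shows "AE x in lborel. cocycle A x \<noteq> 0"
proof (cases "A$2$1 = 0")
  case True then show ?thesis using assms by (auto simp: cocycle_def SL2R_iff)
next
  case False
  show ?thesis using AE_lborel_singleton[of "- A$2$2 / A$2$1"]
    by eventually_elim (use False in \<open>auto simp: cocycle_def field_simps add_eq_0_iff2\<close>)
qed

text \<open>
  The derivative \<open>1/j\<^sup>2\<close> in the endpoint direction cancels the factor \<open>j\<^sup>2\<close> in the direction of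
  \<open>a\<close>, and \<open>s\<close> is translated.
\<close>

lemma nn_integral_act:
  fixes f :: "horo_coords \<Rightarrow> ennreal"
  assumes [measurable]: "f \<in> borel_measurable borel" and A: "A \<in> SL2R"
  shows "(\<integral>\<^sup>+w. f (act A w) \<partial>lborel) = (\<integral>\<^sup>+w. f w \<partial>lborel)"
proof -
  define F where "F x = (\<integral>\<^sup>+a. \<integral>\<^sup>+s. f (x, a, s) \<partial>lborel \<partial>lborel)" for x
  have [measurable]: "F \<in> borel_measurable borel" unfolding F_def by measurable
  have inner: "(\<integral>\<^sup>+a. \<integral>\<^sup>+s. f (act A (x, a, s)) \<partial>lborel \<partial>lborel) =
      ennreal (1 / (cocycle A x)\<^sup>2) * F ((A$1$1 * x + A$1$2) / cocycle A x)" if k: "cocycle A x \<noteq> 0" for x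
  proof -
    define k where "k = (cocycle A x)\<^sup>2"
    define y where "y = (A$1$1 * x + A$1$2) / cocycle A x"
    have k0: "0 < k" using k by (simp add: k_def)
    have "(\<integral>\<^sup>+a. \<integral>\<^sup>+s. f (act A (x, a, s)) \<partial>lborel \<partial>lborel) =
      (\<integral>\<^sup>+a. \<integral>\<^sup>+s. f (y, k * a + - A$2$1 * cocycle A x, s) \<partial>lborel \<partial>lborel)"
      unfolding act_def prod.case by (subst nn_integral_translate) (simp_all add: y_def k_def)
    also have "\<dots> = ennreal (1 / k) * (ennreal \<bar>k\<bar> * (\<integral>\<^sup>+a. \<integral>\<^sup>+s. f (y, k * a + - A$2$1 * cocycle A x, s) \<partial>lborel \<partial>lborel))"
      using k0 by (simp add: mult.assoc[symmetric] flip: ennreal_mult')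
    also have "\<dots> = ennreal (1 / k) * F y"
      unfolding F_def using k0 by (subst nn_integral_scale[where f = "\<lambda>a. \<integral>\<^sup>+s. f (y, a, s) \<partial>lborel"]) auto
    finally show ?thesis by (simp add: k_def y_def)
  qed
  have "(\<integral>\<^sup>+w. f (act A w) \<partial>lborel) = (\<integral>\<^sup>+x. \<integral>\<^sup>+a. \<integral>\<^sup>+s. f (act A (x, a, s)) \<partial>lborel \<partial>lborel \<partial>lborel)"
    by (rule nn_integral_lborel3) measurable
  also have "\<dots> = (\<integral>\<^sup>+x. ennreal (1 / (cocycle A x)\<^sup>2) * F ((A$1$1 * x + A$1$2) / cocycle A x) \<partial>lborel)"
    by (intro nn_integral_cong_AE, use AE_cocycle_nonzero[OF A] in eventually_elim) (rule inner)
  also have "\<dots> = (\<integral>\<^sup>+x. F x \<partial>lborel)" by (rule nn_integral_moebius) (use A in auto)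
  also have "\<dots> = (\<integral>\<^sup>+w. f w \<partial>lborel)" unfolding F_def by (rule nn_integral_lborel3[symmetric]) measurable
  finally show ?thesis .
qed

lemma AE_preserved:
  fixes T :: "'a::euclidean_space \<Rightarrow> 'a"
  assumes T[measurable]: "T \<in> borel \<rightarrow>\<^sub>M borel"
    and pres: "\<And>f::'a \<Rightarrow> ennreal. f \<in> borel_measurable borel \<Longrightarrow> (\<integral>\<^sup>+w. f (T w) \<partial>lborel) = (\<integral>\<^sup>+w. f w \<partial>lborel)"
    and P: "AE w in lborel. P w"
  shows "AE w in lborel. P (T w)"
proof -
  from P obtain N where N: "{w \<in> space lborel. \<not> P w} \<subseteq> N" "emeasure lborel N = 0" "N \<in> sets lborel"
    by (rule AE_E)
  then have [measurable]: "N \<in> sets borel" by simp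
  have "(\<integral>\<^sup>+w. indicator N (T w) \<partial>lborel) = 0" using pres[of "indicator N"] N by simp
  then have "AE w in lborel. indicator N (T w) = (0::ennreal)" by (subst (asm) nn_integral_0_iff_AE) auto
  then show ?thesis by eventually_elim (use N in \<open>auto split: split_indicator_asm\<close>)
qed

lemmas AE_act = AE_preserved[OF act_measurable nn_integral_act, rotated]

section \<open>Hyperbolic area and the circle of directions\<close>

lemma Complex_measurable [measurable (raw)]:
  assumes "f \<in> borel_measurable M" "g \<in> borel_measurable M"
  shows "(\<lambda>x. Complex (f x) (g x)) \<in> borel_measurable M"
proof -
  have "continuous_on UNIV (\<lambda>p::real \<times> real. Complex (fst p) (snd p))"
    by (intro continuous_intros)
  from measurable_compose[OF borel_measurable_Pair[OF assms] borel_measurable_continuous_onI[OF this]]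
  show ?thesis by simp
qed

lemma lborel_complex: "lborel = distr (lborel :: (real \<times> real) measure) borel (\<lambda>p. Complex (fst p) (snd p))"
proof (rule lborel_eqI)
  have m[measurable]: "(\<lambda>p. Complex (fst p) (snd p)) \<in> borel_measurable (borel :: (real \<times> real) measure)"
    unfolding borel_prod[symmetric] by measurable
  fix l u :: complex assume le: "\<And>b. b \<in> Basis \<Longrightarrow> l \<bullet> b \<le> u \<bullet> b"
  have le': "Re l \<le> Re u" "Im l \<le> Im u" using le[of 1] le[of \<i>] by (auto simp: Basis_complex_def inner_complex_def)
  have pre: "(\<lambda>p. Complex (fst p) (snd p)) -` box l u = {Re l<..<Re u} \<times> {Im l<..<Im u}"
    by (auto simp: box_def Basis_complex_def inner_complex_def)
  have "emeasure (distr (lborel :: (real \<times> real) measure) borel (\<lambda>p. Complex (fst p) (snd p))) (box l u) =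
      emeasure (lborel \<Otimes>\<^sub>M lborel) ({Re l<..<Re u} \<times> {Im l<..<Im u})"
    by (subst emeasure_distr) (use m in \<open>auto simp: pre lborel_prod\<close>)
  also have "\<dots> = ennreal (Re u - Re l) * ennreal (Im u - Im l)"
    by (subst lborel.emeasure_pair_measure_Times) (use le' in auto)
  also have "\<dots> = (\<Prod>b\<in>Basis. (u - l) \<bullet> b)"
    using le' by (simp add: Basis_complex_def inner_complex_def ennreal_mult')
  finally show "emeasure (distr (lborel :: (real \<times> real) measure) borel (\<lambda>p. Complex (fst p) (snd p))) (box l u) = (\<Prod>b\<in>Basis. (u - l) \<bullet> b)" .
qed simp

lemma nn_integral_complex:
  fixes f :: "complex \<Rightarrow> ennreal"
  assumes [measurable]: "f \<in> borel_measurable borel"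
  shows "(\<integral>\<^sup>+z. f z \<partial>lborel) = (\<integral>\<^sup>+x. \<integral>\<^sup>+y. f (Complex x y) \<partial>lborel \<partial>lborel)"
proof -
  have [measurable]: "(\<lambda>p. Complex (fst p) (snd p)) \<in> borel_measurable (borel :: (real \<times> real) measure)"
    unfolding borel_prod[symmetric] by measurable
  have "(\<integral>\<^sup>+z. f z \<partial>lborel) = (\<integral>\<^sup>+p. f (Complex (fst p) (snd p)) \<partial>lborel)"
    by (subst lborel_complex, subst nn_integral_distr) auto
  also have "\<dots> = (\<integral>\<^sup>+p. f (Complex (fst p) (snd p)) \<partial>(lborel \<Otimes>\<^sub>M lborel))" by (simp add: lborel_prod)
  also have "\<dots> = (\<integral>\<^sup>+x. \<integral>\<^sup>+y. f (Complex x y) \<partial>lborel \<partial>lborel)"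
    by (subst lborel.nn_integral_fst[symmetric]) (simp_all add: lborel_prod)
  finally show ?thesis .
qed

lemma upper_half_borel [measurable]: "upper_half \<in> sets borel"
proof -
  have "upper_half = {z \<in> space borel. 0 < Im z}" by (auto simp: upper_half_def)
  also have "\<dots> \<in> sets borel" by measurable
  finally show ?thesis .
qed

lemma space_hyp_area [simp]: "space hyp_area = upper_half"
  by (simp add: hyp_area_def space_restrict_space)
lemma sets_hyp_area: "sets hyp_area = sets (restrict_space borel upper_half)"
  by (simp add: hyp_area_def sets_restrict_space)
lemma space_circle [simp]: "space circle_measure = sphere 0 1"
  by (simp add: circle_measure_def space_restrict_space)
lemma sets_circle: "sets circle_measure = sets (restrict_space borel (sphere 0 1))"
  by (simp add: circle_measure_def)

lemma sphere_borel: "sphere (0::complex) 1 \<in> sets borel" by (intro borel_closed closed_sphere)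

lemma measurable_hyp: "f \<in> borel_measurable borel \<Longrightarrow> f \<in> borel_measurable hyp_area"
  by (subst measurable_cong_sets[OF sets_hyp_area refl]) (rule measurable_restrict_space1)
lemma measurable_circ: "f \<in> borel_measurable borel \<Longrightarrow> f \<in> borel_measurable circle_measure"
  by (subst measurable_cong_sets[OF sets_circle refl]) (rule measurable_restrict_space1)

lemma nn_integral_hyp_area_lborel:
  fixes f :: "complex \<Rightarrow> ennreal"
  assumes [measurable]: "f \<in> borel_measurable borel"
  shows "(\<integral>\<^sup>+z. f z \<partial>hyp_area) = (\<integral>\<^sup>+z. ennreal (1 / (Im z)\<^sup>2) * f z * indicator upper_half z \<partial>lborel)"
proof -
  have "(\<integral>\<^sup>+z. f z \<partial>hyp_area) = (\<integral>\<^sup>+z. ennreal (1 / (Im z)\<^sup>2) * f z \<partial>restrict_space lborel upper_half)"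
    unfolding hyp_area_def
    by (rule nn_integral_density) (auto intro!: measurable_restrict_space1)
  also have "\<dots> = (\<integral>\<^sup>+z. ennreal (1 / (Im z)\<^sup>2) * f z * indicator upper_half z \<partial>lborel)"
    by (subst nn_integral_restrict_space) auto
  finally show ?thesis .
qed

lemma nn_integral_hyp_area:
  fixes f :: "complex \<Rightarrow> ennreal"
  assumes [measurable]: "f \<in> borel_measurable borel"
  shows "(\<integral>\<^sup>+z. f z \<partial>hyp_area) =
    (\<integral>\<^sup>+x. \<integral>\<^sup>+y. ennreal (1 / y\<^sup>2) * f (Complex x y) * indicator {0<..} y \<partial>lborel \<partial>lborel)"
proof -
  have "(\<integral>\<^sup>+z. f z \<partial>hyp_area) = (\<integral>\<^sup>+z. ennreal (1 / (Im z)\<^sup>2) * f z * indicator upper_half z \<partial>lborel)"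
    by (rule nn_integral_hyp_area_lborel[OF assms])
  also have "\<dots> = (\<integral>\<^sup>+x. \<integral>\<^sup>+y. ennreal (1 / y\<^sup>2) * f (Complex x y) * indicator {0<..} y \<partial>lborel \<partial>lborel)"
    by (subst nn_integral_complex) (auto simp: upper_half_def indicator_def intro!: nn_integral_cong)
  finally show ?thesis .
qed

text \<open>
  The direction at a vector with \<open>a = q e^s\<close>, a parametrization of the circle without the point
  \<open>\<i>\<close>, which is the upward direction.
\<close>

definition cayley_angle :: "real \<Rightarrow> complex" where
  "cayley_angle q = \<i> / (sgn (Complex q 1))\<^sup>2"

lemma cayley_angle_cis: "cayley_angle q = cis (2 * arctan q - pi / 2)"
proof -
  define \<psi> where "\<psi> = arctan q"
  have c: "Complex q 1 = of_real (sqrt (1 + q\<^sup>2)) * (\<i> * cis (- \<psi>))"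
  proof -
    have s: "sqrt (1 + q\<^sup>2) > 0" by (simp add: add_pos_nonneg)
    show ?thesis
      using s by (auto simp: complex_eq_iff \<psi>_def cos_arctan sin_arctan)
  qed
  have "sgn (Complex q 1) = \<i> * cis (- \<psi>)"
  proof -
    have s: "sqrt (1 + q\<^sup>2) > 0" by (simp add: add_pos_nonneg)
    then show ?thesis unfolding c by (simp add: sgn_mult sgn_of_real) (simp add: sgn_div_norm)
  qed
  then have "cayley_angle q = \<i> / (- (cis (- \<psi>))\<^sup>2)"
    by (simp add: cayley_angle_def power_mult_distrib)
  also have "\<dots> = - \<i> * cis (2 * \<psi>)"
  proof -
    have "(cis (- \<psi>))\<^sup>2 = cis (- (2 * \<psi>))" by (simp add: power2_eq_square cis_mult)
    then show ?thesis by (simp add: field_simps cis_mult)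
  qed
  also have "\<dots> = cis (2 * \<psi> - pi / 2)"
    by (simp add: complex_eq_iff cos_diff sin_diff)
  finally show ?thesis by (simp add: \<psi>_def)
qed

lemma cis_measurable [measurable]: "cis \<in> borel_measurable borel"
  unfolding cis_conv_exp by measurable

text \<open>
  The angle runs over the interval from \<open>-3\<pi>/2\<close> to \<open>\<pi>/2\<close>, which differs from \<open>[0, 2\<pi>)\<close> by
  moving one part by a full turn, and equals \<open>2 arctan q - \<pi>/2\<close>.
\<close>

lemma nn_integral_circle:
  fixes f :: "complex \<Rightarrow> ennreal"
  assumes [measurable]: "f \<in> borel_measurable borel"
  shows "(\<integral>\<^sup>+u. f u \<partial>circle_measure) = (\<integral>\<^sup>+q. ennreal (2 / (1 + q\<^sup>2)) * f (cayley_angle q) \<partial>lborel)"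
proof -
  have "(\<integral>\<^sup>+u. f u \<partial>circle_measure) = (\<integral>\<^sup>+t. f (cis t) \<partial>restrict_space lborel {0..<2 * pi})"
    unfolding circle_measure_def
  proof (rule nn_integral_distr)
    show "cis \<in> restrict_space lborel {0..<2 * pi} \<rightarrow>\<^sub>M restrict_space borel (sphere 0 1)"
      by (intro measurable_restrict_space2 measurable_restrict_space1) auto
  qed (auto intro: measurable_restrict_space1)
  also have "\<dots> = (\<integral>\<^sup>+t. f (cis t) * indicator {0..<2 * pi} t \<partial>lborel)"
    by (subst nn_integral_restrict_space) auto
  also have "\<dots> = (\<integral>\<^sup>+t. f (cis t) * indicator {0..<pi/2} t + f (cis t) * indicator {pi/2..<2 * pi} t \<partial>lborel)"
    by (intro nn_integral_cong) (auto split: split_indicator)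
  also have "\<dots> = (\<integral>\<^sup>+t. f (cis t) * indicator {0..<pi/2} t \<partial>lborel) + (\<integral>\<^sup>+t. f (cis t) * indicator {pi/2..<2 * pi} t \<partial>lborel)"
    by (intro nn_integral_add) auto
  also have "(\<integral>\<^sup>+t. f (cis t) * indicator {pi/2..<2 * pi} t \<partial>lborel) =
      (\<integral>\<^sup>+t. f (cis (t + 2 * pi)) * indicator {pi/2..<2 * pi} (t + 2 * pi) \<partial>lborel)"
    by (rule nn_integral_translate[symmetric]) measurable
  also have "\<dots> = (\<integral>\<^sup>+t. f (cis t) * indicator {-3*pi/2..<0} t \<partial>lborel)"
  proof (intro nn_integral_cong)
    fix t
    have "cis (t + 2 * pi) = cis t" by (simp add: complex_eq_iff)
    then show "f (cis (t + 2 * pi)) * indicator {pi/2..<2 * pi} (t + 2 * pi) = f (cis t) * indicator {-3*pi/2..<0} t"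
      by (auto split: split_indicator)
  qed
  also have "(\<integral>\<^sup>+t. f (cis t) * indicator {0..<pi/2} t \<partial>lborel) + (\<integral>\<^sup>+t. f (cis t) * indicator {-3*pi/2..<0} t \<partial>lborel) =
    (\<integral>\<^sup>+t. f (cis t) * indicator {0..<pi/2} t + f (cis t) * indicator {-3*pi/2..<0} t \<partial>lborel)"
    by (intro nn_integral_add[symmetric]) auto
  also have "\<dots> = (\<integral>\<^sup>+t. f (cis t) * indicator {-3*pi/2<..<pi/2} t \<partial>lborel)"
    by (intro nn_integral_cong_AE, use AE_lborel_singleton[of "-3*pi/2"] in eventually_elim)
      (auto split: split_indicator)
  also have "\<dots> = \<bar>2::real\<bar> * (\<integral>\<^sup>+t. f (cis (- (pi/2) + 2 * t)) * indicator {-3*pi/2<..<pi/2} (- (pi/2) + 2 * t) \<partial>lborel)"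
    by (rule nn_integral_real_affine) auto
  also have "(\<integral>\<^sup>+t. f (cis (- (pi/2) + 2 * t)) * indicator {-3*pi/2<..<pi/2} (- (pi/2) + 2 * t) \<partial>lborel) =
     (\<integral>\<^sup>+t. f (cis (2 * t - pi/2)) * indicator {-(pi/2)<..<pi/2} t \<partial>lborel)"
    by (intro nn_integral_cong) (auto split: split_indicator simp: algebra_simps)
  also have "\<dots> = (\<integral>\<^sup>+q. ennreal (1 / (1 + q\<^sup>2)) * f (cis (2 * arctan q - pi/2)) \<partial>lborel)"
    by (rule nn_integral_arctan) measurable
  also have "\<bar>2::real\<bar> * \<dots> = (\<integral>\<^sup>+q. ennreal 2 * (ennreal (1 / (1 + q\<^sup>2)) * f (cis (2 * arctan q - pi/2))) \<partial>lborel)"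
    by (subst nn_integral_cmult) auto
  also have "\<dots> = (\<integral>\<^sup>+q. ennreal (2 / (1 + q\<^sup>2)) * f (cayley_angle q) \<partial>lborel)"
  proof (intro nn_integral_cong)
    fix q :: real
    have "ennreal 2 * ennreal (1 / (1 + q\<^sup>2)) = ennreal (2 / (1 + q\<^sup>2))"
      by (subst ennreal_mult'[symmetric]) auto
    then show "ennreal 2 * (ennreal (1 / (1 + q\<^sup>2)) * f (cis (2 * arctan q - pi/2))) = ennreal (2 / (1 + q\<^sup>2)) * f (cayley_angle q)"
      by (simp add: cayley_angle_cis mult.assoc[symmetric])
  qed
  finally show ?thesis .
qed

lemma emeasure_circle: "emeasure circle_measure (space circle_measure) = ennreal (2 * pi)"
proof -
  have "emeasure circle_measure (space circle_measure) = (\<integral>\<^sup>+u. 1 \<partial>circle_measure)" by simp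
  also have "\<dots> = (\<integral>\<^sup>+q. ennreal 2 * (ennreal (1 / (1 + q\<^sup>2)) * 1) \<partial>lborel)"
  proof -
    have "ennreal 2 * (ennreal (1 / (1 + q\<^sup>2)) * 1) = ennreal (2 / (1 + q\<^sup>2))" for q :: real
      unfolding mult_1_right by (subst ennreal_mult'[symmetric]) auto
    then show ?thesis by (subst nn_integral_circle) auto
  qed
  also have "\<dots> = ennreal 2 * (\<integral>\<^sup>+q. ennreal (1 / (1 + q\<^sup>2)) * (\<lambda>_. 1) (arctan q) \<partial>lborel)"
    by (subst nn_integral_cmult) auto
  also have "\<dots> = ennreal 2 * (\<integral>\<^sup>+y. 1 * indicator {- (pi / 2)<..<pi / 2} y \<partial>lborel)"
    by (subst nn_integral_arctan[symmetric]) auto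
  also have "\<dots> = ennreal (2 * pi)"
    by (simp add: ennreal_mult')
  finally show ?thesis .
qed

lemma finite_circle: "finite_measure circle_measure"
  by (rule finite_measureI) (simp add: emeasure_circle del: space_circle)

section \<open>The measure on the unit tangent bundle in horospherical coordinates\<close>

text \<open>
  The base point and the direction of the vector with coordinates \<open>(x, a, s)\<close>: the point
  \<open>x - 1/W\<close>, and the image of the upward direction at \<open>W\<close> under \<open>W \<mapsto> x - 1/W\<close>.
\<close>

definition pt :: "horo_coords \<Rightarrow> complex" where
  "pt = (\<lambda>(x, a, s). of_real x - 1 / Complex a (exp s))"

definition dir :: "horo_coords \<Rightarrow> complex" where
  "dir = (\<lambda>(x, a, s). \<i> / (sgn (Complex a (exp s)))\<^sup>2)"

definition Psi :: "horo_coords \<Rightarrow> complex \<times> complex" where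
  "Psi w = (pt w, dir w)"

lemma pt_measurable [measurable]: "pt \<in> borel_measurable borel"
  unfolding pt_def case_prod_beta' borel_prod[symmetric] by measurable

lemma dir_measurable [measurable]: "dir \<in> borel_measurable borel"
  unfolding dir_def case_prod_beta' borel_prod[symmetric] by measurable

lemma Psi_measurable [measurable]: "Psi \<in> borel_measurable borel"
  unfolding Psi_def by measurable

lemma pt_Complex:
  "pt (x, a, s) = Complex (x - a / (a\<^sup>2 + (exp s)\<^sup>2)) (exp s / (a\<^sup>2 + (exp s)\<^sup>2))"
  by (simp add: pt_def complex_eq_iff Re_divide Im_divide)

lemma Im_pt: "Im (pt (x, a, s)) = exp s / (a\<^sup>2 + (exp s)\<^sup>2)" by (simp add: pt_Complex)

lemma Im_pt_pos: "0 < Im (pt w)"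
  by (cases w) (auto simp: Im_pt intro!: divide_pos_pos add_nonneg_pos)

lemma pt_upper [simp]: "pt w \<in> upper_half" using Im_pt_pos by (simp add: upper_half_def)

lemma Complex_exp_nz [simp]: "Complex a (exp s) \<noteq> 0" by (simp add: complex_eq_iff)

lemma norm_dir [simp]: "cmod (dir w) = 1"
  by (cases w) (simp add: dir_def norm_divide norm_power norm_sgn)

text \<open>
  In terms of \<open>q = a e^(-s)\<close> the direction depends on \<open>q\<close> alone.
\<close>

lemma Psi_scale:
  "Psi (x, q * exp s, s) = (Complex (x - q * (exp (- s) / (1 + q\<^sup>2))) (exp (- s) / (1 + q\<^sup>2)), cayley_angle q)"
proof -
  have c: "Complex (q * exp s) (exp s) = of_real (exp s) * Complex q 1" by (simp add: complex_eq_iff)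
  have 1: "dir (x, q * exp s, s) = cayley_angle q"
    by (simp add: dir_def cayley_angle_def c sgn_mult sgn_of_real)
  have e: "exp s * exp (- s) = 1" by (simp flip: exp_add)
  have nz: "(q * exp s)\<^sup>2 + (exp s)\<^sup>2 = (exp s)\<^sup>2 * (1 + q\<^sup>2)" by (simp add: power_mult_distrib algebra_simps)
  have p: "1 + q\<^sup>2 \<noteq> 0" by (smt (verit) zero_le_power2)
  have 2: "exp s / ((exp s)\<^sup>2 * (1 + q\<^sup>2)) = exp (- s) / (1 + q\<^sup>2)"
    by (simp add: exp_minus power2_eq_square divide_inverse mult_ac)
  have 3: "q * exp s / ((exp s)\<^sup>2 * (1 + q\<^sup>2)) = q * (exp (- s) / (1 + q\<^sup>2))"
    using 2 by (metis times_divide_eq_right)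
  show ?thesis unfolding Psi_def pt_Complex nz 1 2 3 ..
qed

lemma measurable_T1H:
  "f \<in> borel_measurable borel \<Longrightarrow> f \<in> borel_measurable T1H_measure"
proof -
  have 1: "fst \<in> borel_measurable T1H_measure" unfolding T1H_measure_def
    by (rule measurable_compose[OF measurable_fst measurable_hyp[of "\<lambda>x. x"]]) simp
  have 2: "snd \<in> borel_measurable T1H_measure" unfolding T1H_measure_def
    by (rule measurable_compose[OF measurable_snd measurable_circ[of "\<lambda>x. x"]]) simp
  assume "f \<in> borel_measurable borel"
  from measurable_compose[OF borel_measurable_Pair[OF 1 2] this] show ?thesis by simp
qed

lemma nn_integral_rotate3:
  fixes K :: "real \<Rightarrow> real \<Rightarrow> real \<Rightarrow> ennreal"
  assumes m: "(\<lambda>p. K (fst p) (fst (snd p)) (snd (snd p))) \<in> borel_measurable (borel \<Otimes>\<^sub>M borel \<Otimes>\<^sub>M borel)"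
  shows "(\<integral>\<^sup>+x. \<integral>\<^sup>+y. \<integral>\<^sup>+q. K x y q \<partial>lborel \<partial>lborel \<partial>lborel) = (\<integral>\<^sup>+y. \<integral>\<^sup>+q. \<integral>\<^sup>+x. K x y q \<partial>lborel \<partial>lborel \<partial>lborel)"
proof -
  have K[measurable (raw)]: "(\<lambda>z. K (f z) (g z) (h z)) \<in> borel_measurable M"
    if "f \<in> borel_measurable M" "g \<in> borel_measurable M" "h \<in> borel_measurable M" for f g h and M :: "'c measure"
    using measurable_compose[OF measurable_Pair[OF that(1) measurable_Pair[OF that(2,3)]] m] by simp
  have "(\<integral>\<^sup>+x. \<integral>\<^sup>+y. \<integral>\<^sup>+q. K x y q \<partial>lborel \<partial>lborel \<partial>lborel) = (\<integral>\<^sup>+y. \<integral>\<^sup>+x. \<integral>\<^sup>+q. K x y q \<partial>lborel \<partial>lborel \<partial>lborel)"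
  proof (rule nn_integral_swap, rule lborel.borel_measurable_nn_integral)
    have "(\<lambda>x. K (fst (fst x)) (snd (fst x)) (snd x)) \<in> borel_measurable ((borel \<Otimes>\<^sub>M borel) \<Otimes>\<^sub>M lborel)"
      by (rule K) measurable
    then show "case_prod (\<lambda>p. K (fst p) (snd p)) \<in> borel_measurable ((borel \<Otimes>\<^sub>M borel) \<Otimes>\<^sub>M lborel)"
      by (simp add: case_prod_beta')
  qed
  also have "\<dots> = (\<integral>\<^sup>+y. \<integral>\<^sup>+q. \<integral>\<^sup>+x. K x y q \<partial>lborel \<partial>lborel \<partial>lborel)"
    by (rule nn_integral_cong, rule nn_integral_swap, rule K) measurable
  finally show ?thesis .
qed

text \<open>
  With \<open>q = a e^(-s)\<close>, the direction is \<open>cayley_angle q\<close>, the height \<open>y\<close> of the base point is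
  \<open>e^(-s)/(1 + q\<^sup>2)\<close>, and its real part is \<open>x - q y\<close>. So \<open>dA d\<theta>\<close> is
  \<open>1/y\<^sup>2 (2/(1 + q\<^sup>2)) dx dy dq\<close>, which becomes \<open>2 e^s dx ds dq = 2 dx da ds\<close>.
\<close>

theorem nn_integral_T1H:
  fixes g :: "complex \<times> complex \<Rightarrow> ennreal"
  assumes g: "g \<in> borel_measurable borel"
  shows "(\<integral>\<^sup>+p. g p \<partial>T1H_measure) = 2 * (\<integral>\<^sup>+w. g (Psi w) \<partial>lborel)"
proof -
  interpret circ: finite_measure circle_measure by (rule finite_circle)
  have gP[measurable (raw)]: "(\<lambda>z. g (f z, h z)) \<in> borel_measurable M"
    if "f \<in> borel_measurable M" "h \<in> borel_measurable M" for f h and M :: "'c measure"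
    using measurable_compose[OF borel_measurable_Pair[OF that] g] by simp
  have cay[measurable]: "cayley_angle \<in> borel_measurable borel"
    unfolding cayley_angle_def by measurable
  have sq[measurable]: "(\<lambda>q::real. q\<^sup>2) \<in> borel_measurable borel" by measurable
  \<comment> \<open>\<open>K\<close> is the integrand in the real part, the height and \<open>q\<close>; \<open>K'\<close> has the forward endpoint in place of the real part.\<close>
  define K where "K x y q = ennreal (1 / y\<^sup>2) * (ennreal (2 / (1 + q\<^sup>2)) * g (Complex x y, cayley_angle q)) * indicator {0<..} y" for x y q
  define K' where "K' x y q = K (x + - (q * y)) y q" for x y q
  define H where "H x a s = 2 * g (Psi (x, a, s))" for x a s
  have mK: "(\<lambda>p. K (fst p) (fst (snd p)) (snd (snd p))) \<in> borel_measurable (borel \<Otimes>\<^sub>M borel \<Otimes>\<^sub>M borel)"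
    unfolding K_def by measurable
  have mK': "(\<lambda>p. K' (fst p) (fst (snd p)) (snd (snd p))) \<in> borel_measurable (borel \<Otimes>\<^sub>M borel \<Otimes>\<^sub>M borel)"
    unfolding K'_def K_def by measurable
  have mH0: "(\<lambda>p. H (fst p) (fst (snd p)) (snd (snd p))) \<in> borel_measurable (borel \<Otimes>\<^sub>M borel \<Otimes>\<^sub>M borel)"
  proof -
    have "(\<lambda>p. 2 * g (Psi p)) \<in> borel_measurable borel" using g by measurable
    then show ?thesis unfolding H_def by (simp add: borel_prod)
  qed
  have Km[measurable (raw)]: "(\<lambda>z. K (f z) (f2 z) (f3 z)) \<in> borel_measurable M"
    if "f \<in> borel_measurable M" "f2 \<in> borel_measurable M" "f3 \<in> borel_measurable M" for f f2 f3 and M :: "'c measure"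
    using measurable_compose[OF measurable_Pair[OF that(1) measurable_Pair[OF that(2,3)]] mK] by simp
  have K'm[measurable (raw)]: "(\<lambda>z. K' (f z) (f2 z) (f3 z)) \<in> borel_measurable M"
    if "f \<in> borel_measurable M" "f2 \<in> borel_measurable M" "f3 \<in> borel_measurable M" for f f2 f3 and M :: "'c measure"
    using measurable_compose[OF measurable_Pair[OF that(1) measurable_Pair[OF that(2,3)]] mK'] by simp
  have Hm[measurable (raw)]: "(\<lambda>z. H (f z) (f2 z) (f3 z)) \<in> borel_measurable M"
    if "f \<in> borel_measurable M" "f2 \<in> borel_measurable M" "f3 \<in> borel_measurable M" for f f2 f3 and M :: "'c measure"
    using measurable_compose[OF measurable_Pair[OF that(1) measurable_Pair[OF that(2,3)]] mH0] by simp
  have inner: "(\<integral>\<^sup>+y. K' x y q \<partial>lborel) = (\<integral>\<^sup>+s. ennreal (exp s) * H x (exp s * q + 0) s \<partial>lborel)" for x q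
  proof -
    \<comment> \<open>Substitute \<open>y = exp (- L - s)\<close> for fixed \<open>q\<close>.\<close>
    define L where "L = ln (1 + q\<^sup>2)"
    have p: "0 < 1 + q\<^sup>2" by (simp add: add_pos_nonneg)
    have eL: "exp L = 1 + q\<^sup>2" using p by (simp add: L_def)
    have "(\<integral>\<^sup>+y. K' x y q \<partial>lborel) = (\<integral>\<^sup>+y. K' x y q * indicator {0<..} y \<partial>lborel)"
      by (intro nn_integral_cong) (auto simp: K'_def K_def split: split_indicator)
    also have "\<dots> = (\<integral>\<^sup>+t. ennreal (exp t) * K' x (exp t) q \<partial>lborel)"
      by (rule nn_integral_exp) measurable
    also have "\<dots> = \<bar>-1::real\<bar> * (\<integral>\<^sup>+s. ennreal (exp (- L + -1 * s)) * K' x (exp (- L + -1 * s)) q \<partial>lborel)"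
    proof (rule nn_integral_real_affine)
      show "(\<lambda>t. ennreal (exp t) * K' x (exp t) q) \<in> borel_measurable borel" by measurable
    qed simp
    also have "\<dots> = (\<integral>\<^sup>+s. ennreal (exp (- L + -1 * s)) * K' x (exp (- L + -1 * s)) q \<partial>lborel)" by simp
    also have "\<dots> = (\<integral>\<^sup>+s. ennreal (exp s) * H x (exp s * q + 0) s \<partial>lborel)"
    proof (intro nn_integral_cong)
      fix s :: real
      define y where "y = exp (- L + -1 * s)"
      have y: "y = exp (- s) / (1 + q\<^sup>2)" unfolding y_def eL[symmetric] by (simp add: exp_diff[symmetric])
      have y0: "0 < y" by (simp add: y_def)
      have "y * (1 / y\<^sup>2 * (2 / (1 + q\<^sup>2))) = exp s * 2"
      proof -
        have "y * (1 / y\<^sup>2 * (2 / (1 + q\<^sup>2))) = 2 / (y * (1 + q\<^sup>2))"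
          using y0 by (simp add: power2_eq_square)
        also have "y * (1 + q\<^sup>2) = exp (- s)" using y p by simp
        finally show ?thesis by (simp add: exp_minus divide_inverse)
      qed
      then have co: "ennreal y * (ennreal (1 / y\<^sup>2) * ennreal (2 / (1 + q\<^sup>2))) = ennreal (exp s) * 2"
        using y0 p by (simp flip: ennreal_mult' ennreal_numeral)
      have co': "ennreal y * (ennreal (1 / y\<^sup>2) * (ennreal (2 / (1 + q\<^sup>2)) * G)) = ennreal (exp s) * (2 * G)" for G
        using arg_cong[OF co, of "\<lambda>c. c * G"] by (simp only: mult.assoc)
      have "Psi (x, exp s * q + 0, s) = (Complex (x + - (q * y)) y, cayley_angle q)"
        using Psi_scale[of x q s] by (simp add: y mult.commute)
      then show "ennreal (exp (- L + -1 * s)) * K' x (exp (- L + -1 * s)) q = ennreal (exp s) * H x (exp s * q + 0) s"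
        unfolding y_def[symmetric] using y0 co' by (simp add: H_def K'_def K_def)
    qed
    finally show ?thesis .
  qed
  have "(\<integral>\<^sup>+p. g p \<partial>T1H_measure) = (\<integral>\<^sup>+z. \<integral>\<^sup>+u. g (z, u) \<partial>circle_measure \<partial>hyp_area)"
    unfolding T1H_measure_def
    by (rule circ.nn_integral_fst[symmetric]) (use measurable_T1H[OF g] in \<open>simp add: T1H_measure_def\<close>)
  also have "\<dots> = (\<integral>\<^sup>+z. \<integral>\<^sup>+q. ennreal (2 / (1 + q\<^sup>2)) * g (z, cayley_angle q) \<partial>lborel \<partial>hyp_area)"
    by (rule nn_integral_cong, rule nn_integral_circle) measurable
  also have "\<dots> = (\<integral>\<^sup>+x. \<integral>\<^sup>+y. ennreal (1 / y\<^sup>2) * (\<integral>\<^sup>+q. ennreal (2 / (1 + q\<^sup>2)) * g (Complex x y, cayley_angle q) \<partial>lborel) * indicator {0<..} y \<partial>lborel \<partial>lborel)"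
    by (rule nn_integral_hyp_area) measurable
  also have "\<dots> = (\<integral>\<^sup>+x. \<integral>\<^sup>+y. \<integral>\<^sup>+q. K x y q \<partial>lborel \<partial>lborel \<partial>lborel)"
    unfolding K_def
    by (intro nn_integral_cong) (simp add: nn_integral_cmult nn_integral_multc)
  also have "\<dots> = (\<integral>\<^sup>+y. \<integral>\<^sup>+q. \<integral>\<^sup>+x. K x y q \<partial>lborel \<partial>lborel \<partial>lborel)"
    by (rule nn_integral_rotate3[OF mK])
  also have "\<dots> = (\<integral>\<^sup>+y. \<integral>\<^sup>+q. \<integral>\<^sup>+x. K' x y q \<partial>lborel \<partial>lborel \<partial>lborel)"
    unfolding K'_def by (rule nn_integral_cong, rule nn_integral_cong, rule nn_integral_translate[symmetric]) measurable
  also have "\<dots> = (\<integral>\<^sup>+x. \<integral>\<^sup>+y. \<integral>\<^sup>+q. K' x y q \<partial>lborel \<partial>lborel \<partial>lborel)"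
    by (rule nn_integral_rotate3[OF mK', symmetric])
  also have "\<dots> = (\<integral>\<^sup>+x. \<integral>\<^sup>+q. \<integral>\<^sup>+y. K' x y q \<partial>lborel \<partial>lborel \<partial>lborel)"
    by (rule nn_integral_cong, rule nn_integral_swap) measurable
  also have "\<dots> = (\<integral>\<^sup>+x. \<integral>\<^sup>+q. \<integral>\<^sup>+s. ennreal (exp s) * H x (exp s * q + 0) s \<partial>lborel \<partial>lborel \<partial>lborel)"
    by (simp only: inner)
  also have "\<dots> = (\<integral>\<^sup>+x. \<integral>\<^sup>+s. \<integral>\<^sup>+q. ennreal (exp s) * H x (exp s * q + 0) s \<partial>lborel \<partial>lborel \<partial>lborel)"
    by (rule nn_integral_cong, rule nn_integral_swap) measurable
  also have "\<dots> = (\<integral>\<^sup>+x. \<integral>\<^sup>+s. \<integral>\<^sup>+a. H x a s \<partial>lborel \<partial>lborel \<partial>lborel)"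
  proof (rule nn_integral_cong, rule nn_integral_cong)
    fix x s :: real
    have m: "(\<lambda>a. H x a s) \<in> borel_measurable borel" by measurable
    have "(\<integral>\<^sup>+q. ennreal (exp s) * H x (exp s * q + 0) s \<partial>lborel) = ennreal \<bar>exp s\<bar> * (\<integral>\<^sup>+q. H x (exp s * q + 0) s \<partial>lborel)"
    proof -
      have "(\<lambda>q. H x (exp s * q + 0) s) \<in> borel_measurable lborel" by measurable
      from nn_integral_cmult[OF this, of "ennreal (exp s)"] show ?thesis by simp
    qed
    also have "\<dots> = (\<integral>\<^sup>+a. H x a s \<partial>lborel)" by (rule nn_integral_scale[OF m]) simp
    finally show "(\<integral>\<^sup>+q. ennreal (exp s) * H x (exp s * q + 0) s \<partial>lborel) = (\<integral>\<^sup>+a. H x a s \<partial>lborel)" .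
  qed
  also have "\<dots> = (\<integral>\<^sup>+x. \<integral>\<^sup>+a. \<integral>\<^sup>+s. H x a s \<partial>lborel \<partial>lborel \<partial>lborel)"
    by (rule nn_integral_cong, rule nn_integral_swap) measurable
  also have "\<dots> = (\<integral>\<^sup>+w. 2 * g (Psi w) \<partial>lborel)"
    unfolding H_def by (rule nn_integral_lborel3[symmetric]) (use g in measurable)
  also have "\<dots> = 2 * (\<integral>\<^sup>+w. g (Psi w) \<partial>lborel)"
    by (rule nn_integral_cmult) (use g in measurable)
  finally show ?thesis .
qed

text \<open>
  Integrating a function of the base point over the fibre gives \<open>2\<pi>\<close> on one side and the factor 2
  on the other.
\<close>

corollary nn_integral_hyp_area_pt:
  fixes f :: "complex \<Rightarrow> ennreal"
  assumes f: "f \<in> borel_measurable borel"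
  shows "ennreal pi * (\<integral>\<^sup>+z. f z \<partial>hyp_area) = (\<integral>\<^sup>+w. f (pt w) \<partial>lborel)"
proof -
  interpret circ: finite_measure circle_measure by (rule finite_circle)
  have m: "(\<lambda>p. f (fst p)) \<in> borel_measurable (borel :: (complex \<times> complex) measure)"
    unfolding borel_prod[symmetric] using f by measurable
  have "2 * (\<integral>\<^sup>+w. f (pt w) \<partial>lborel) = (\<integral>\<^sup>+p. f (fst p) \<partial>T1H_measure)"
    using nn_integral_T1H[OF m] by (simp add: Psi_def)
  also have "\<dots> = (\<integral>\<^sup>+z. \<integral>\<^sup>+u. f (fst (z, u)) \<partial>circle_measure \<partial>hyp_area)"
    unfolding T1H_measure_def
    by (rule circ.nn_integral_fst[symmetric]) (use measurable_T1H[OF m] in \<open>simp add: T1H_measure_def\<close>)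
  also have "\<dots> = (\<integral>\<^sup>+z. f z * ennreal (2 * pi) \<partial>hyp_area)"
    by (simp add: emeasure_circle del: space_circle)
  also have "\<dots> = ennreal (2 * pi) * (\<integral>\<^sup>+z. f z \<partial>hyp_area)"
    by (subst nn_integral_multc[OF measurable_hyp[OF f]]) (simp add: mult.commute)
  also have "\<dots> = 2 * (ennreal pi * (\<integral>\<^sup>+z. f z \<partial>hyp_area))"
    by (simp add: ennreal_mult' mult.assoc)
  finally show ?thesis by (simp add: ennreal_mult_cancel_left)
qed

lemma T1H_sets_borel: assumes "N \<in> sets T1H_measure" shows "N \<in> sets borel"
proof -
  have r: "A \<in> sets (restrict_space borel S) \<Longrightarrow> S \<in> sets borel \<Longrightarrow> A \<in> sets borel" for A S :: "complex set"
    by (auto simp: sets_restrict_space)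
  have "N \<in> sigma_sets (upper_half \<times> sphere 0 1) {a \<times> b | a b. a \<in> sets hyp_area \<and> b \<in> sets circle_measure}"
    using assms unfolding T1H_measure_def sets_pair_measure by simp
  then show ?thesis
  proof (induction rule: sigma_sets.induct)
    case (Basic X)
    then obtain a b where ab: "X = a \<times> b" "a \<in> sets hyp_area" "b \<in> sets circle_measure" by blast
    then have "a \<in> sets borel" "b \<in> sets borel"
      using r upper_half_borel sphere_borel unfolding sets_hyp_area sets_circle by blast+
    then show ?case unfolding ab(1) borel_prod[symmetric] by simp
  next
    case (Compl a)
    have "upper_half \<times> sphere 0 1 \<in> sets (borel :: (complex \<times> complex) measure)"
      unfolding borel_prod[symmetric] using upper_half_borel sphere_borel by simp
    then show ?case using Compl by auto
  qed auto
qed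

lemma T1H_sets: assumes "N \<in> sets borel" shows "N \<inter> (upper_half \<times> sphere 0 1) \<in> sets T1H_measure"
proof -
  have "(\<lambda>x. x) \<in> T1H_measure \<rightarrow>\<^sub>M borel" by (rule measurable_T1H) simp
  from measurable_sets[OF this assms] show ?thesis
    by (simp add: T1H_measure_def space_pair_measure)
qed

lemma space_T1H [simp]: "space T1H_measure = upper_half \<times> sphere 0 1"
  by (simp add: T1H_measure_def space_pair_measure)

text \<open>
  The inverse of \<open>Psi\<close> off the upward directions: \<open>q\<close> is recovered from the direction \<open>u\<close> by the
  Cayley transform inverse to \<open>cayley_angle\<close>, which takes real values on the circle, and \<open>b\<close> is \<open>e^s\<close>.
\<close>

definition Psi_inv :: "complex \<times> complex \<Rightarrow> horo_coords" where
  "Psi_inv = (\<lambda>(z, u). let q = Re (\<i> * (1 - \<i> * u) / (1 + \<i> * u)); b = 1 / (Im z * (1 + q\<^sup>2))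
     in (Re z + q * Im z, q * b, ln b))"

lemma Psi_inv_measurable [measurable]: "Psi_inv \<in> borel \<rightarrow>\<^sub>M borel"
  unfolding Psi_inv_def case_prod_beta' Let_def borel_prod[symmetric] by measurable

lemma cayley_angle_alt: "cayley_angle q = \<i> * (Complex q (-1) / Complex q 1)"
proof -
  define c where "c = Complex q 1"
  have nz: "c \<noteq> 0" by (simp add: c_def complex_eq_iff)
  have cc: "Complex q (-1) = cnj c" by (simp add: c_def complex_eq_iff)
  have m: "c * cnj c = (of_real (cmod c))\<^sup>2" using complex_norm_square[of c] by simp
  have "1 / (sgn c)\<^sup>2 = cnj c / c"
  proof -
    have "(sgn c)\<^sup>2 = c\<^sup>2 / (of_real (cmod c))\<^sup>2" by (simp add: sgn_eq power_divide)
    then have "1 / (sgn c)\<^sup>2 = (of_real (cmod c))\<^sup>2 / c\<^sup>2" by simp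
    also have "\<dots> = cnj c / c" unfolding m[symmetric] using nz by (simp add: power2_eq_square)
    finally show ?thesis .
  qed
  then show ?thesis unfolding cayley_angle_def cc c_def[symmetric] by (metis mult.commute mult_1 times_divide_eq_left)
qed

lemma Psi_Psi_inv:
  assumes z: "z \<in> upper_half" and u: "cmod u = 1" and ui: "u \<noteq> \<i>"
  shows "Psi (Psi_inv (z, u)) = (z, u)"
proof -
  define c where "c = \<i> * (1 - \<i> * u) / (1 + \<i> * u)"
  define q where "q = Re c"
  define b where "b = 1 / (Im z * (1 + q\<^sup>2))"
  have n: "1 + \<i> * u \<noteq> 0"
  proof
    assume "1 + \<i> * u = 0"
    then have "\<i> * (1 + \<i> * u) = 0" by simp
    then show False using ui by (simp add: algebra_simps)
  qed
  have uu: "u * cnj u = 1" using u by (simp add: complex_norm_square[symmetric])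
  have u0: "u \<noteq> 0" using u by auto
  have "cnj c = c"
  proof -
    have n': "1 - \<i> * cnj u \<noteq> 0" using n by (metis complex_cnj_add complex_cnj_cnj complex_cnj_i complex_cnj_mult complex_cnj_one complex_cnj_zero diff_conv_add_uminus mult_minus_left)
    have "cnj c = - \<i> * (1 + \<i> * cnj u) / (1 - \<i> * cnj u)" by (simp add: c_def)
    also have "\<dots> = c" unfolding c_def frac_eq_eq[OF n' n]
      using uu i_squared by algebra
    finally show ?thesis .
  qed
  then have cq: "c = of_real q" by (simp add: q_def complex_eq_iff)
  have z0: "0 < Im z" using z by (simp add: upper_half_def)
  have p: "0 < 1 + q\<^sup>2" by (simp add: add_pos_nonneg)
  have b0: "0 < b" using z0 p by (simp add: b_def)
  have inv: "Psi_inv (z, u) = (Re z + q * Im z, q * exp (ln b), ln b)"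
    unfolding Psi_inv_def prod.case c_def[symmetric] q_def[symmetric] Let_def b_def[symmetric] using b0 by simp
  have im: "exp (- ln b) / (1 + q\<^sup>2) = Im z"
    using b0 p z0 by (simp add: exp_minus b_def field_simps)
  have "cayley_angle q = u"
  proof -
    have e: "c * (1 + \<i> * u) = \<i> * (1 - \<i> * u)" using n by (simp add: c_def)
    have 1: "Complex q (-1) = c - \<i>" "Complex q 1 = c + \<i>" unfolding cq by (simp_all add: complex_eq_iff)
    have nz: "c + \<i> \<noteq> 0" unfolding 1(2)[symmetric] by (simp add: complex_eq_iff)
    have "\<i> * (c - \<i>) = u * (c + \<i>)"
    proof -
      have "c + c * (\<i> * u) = \<i> + u" using e by (simp add: algebra_simps)
      then have "\<i> * (c + c * (\<i> * u)) = \<i> * (\<i> + u)" by simp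
      then show ?thesis by (simp add: algebra_simps)
    qed
    then show ?thesis unfolding cayley_angle_alt 1 using nz by (simp add: field_simps)
  qed
  then show ?thesis unfolding inv Psi_scale im by (simp add: complex_eq_iff)
qed

lemma inj_Psi: "inj Psi"
proof (rule injI)
  fix w w' :: horo_coords assume eq: "Psi w = Psi w'"
  obtain x a s x' a' s' where w: "w = (x, a, s)" "w' = (x', a', s')" by (metis surj_pair)
  define q q' where "q = a / exp s" and "q' = a' / exp s'"
  have a: "a = q * exp s" "a' = q' * exp s'" by (simp_all add: q_def q'_def)
  have E: "cayley_angle q = cayley_angle q'" "exp (- s) / (1 + q\<^sup>2) = exp (- s') / (1 + q'\<^sup>2)"
     "x - q * (exp (- s) / (1 + q\<^sup>2)) = x' - q' * (exp (- s') / (1 + q'\<^sup>2))"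
    using eq unfolding w a Psi_scale prod.inject complex.inject by blast+
  have nz: "Complex q 1 \<noteq> 0" "Complex q' 1 \<noteq> 0" by (simp_all add: complex_eq_iff)
  have "Complex q (-1) / Complex q 1 = Complex q' (-1) / Complex q' 1"
    using E(1) unfolding cayley_angle_alt mult_cancel_left by simp
  then have "Complex q (-1) * Complex q' 1 = Complex q' (-1) * Complex q 1" using nz by (simp add: frac_eq_eq)
  then have q: "q = q'" by (simp add: complex_eq_iff)
  have p: "1 + q\<^sup>2 \<noteq> 0" by (smt (verit) zero_le_power2)
  then have s: "s = s'" using E(2) q by (simp add: exp_minus)
  have "x = x'" using E(3) unfolding q s by simp
  moreover have "a = a'" unfolding a q s ..
  ultimately show "w = w'" using s unfolding w by simp
qed

lemma dir_neq: "dir w \<noteq> \<i>"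
proof -
  obtain x a s where w: "w = (x, a, s)" by (metis surj_pair)
  have "dir w = cayley_angle (a / exp s)" unfolding w using Psi_scale[of x "a / exp s" s] by (simp add: Psi_def)
  also have "\<dots> \<noteq> \<i>"
  proof
    assume "cayley_angle (a / exp s) = \<i>"
    then have "\<i> * (Complex (a / exp s) (-1) / Complex (a / exp s) 1) = \<i> * 1"
      unfolding cayley_angle_alt by (simp only: mult_1_right)
    then have "Complex (a / exp s) (-1) / Complex (a / exp s) 1 = 1"
      by (simp only: mult_cancel_left) simp
    then have "Complex (a / exp s) (-1) = Complex (a / exp s) 1" by (metis divide_eq_1_iff)
    then show False by simp
  qed
  finally show ?thesis .
qed

text \<open>
  The vectors missed by \<open>Psi\<close> are those pointing straight up, a null set.
\<close>

lemma AE_T1H: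
  assumes "AE w in lborel. Q (Psi w)"
  shows "AE p in T1H_measure. Q p"
proof -
  from assms obtain N where N: "{w \<in> space lborel. \<not> Q (Psi w)} \<subseteq> N" "emeasure lborel N = 0" "N \<in> sets lborel"
    by (rule AE_E)
  define B where "B = {p. snd p = \<i>} \<union> Psi_inv -` N"
  have Bb: "B \<in> sets borel"
  proof -
    have "{p :: complex \<times> complex. snd p = \<i>} \<in> sets borel"
      by (intro borel_closed closed_Collect_eq continuous_intros)
    moreover have "Psi_inv -` N \<in> sets borel"
      using measurable_sets[OF Psi_inv_measurable, of N] N(3) by simp
    ultimately show ?thesis by (simp add: B_def)
  qed
  have inv: "Psi_inv (Psi w) = w" for w
  proof -
    have "Psi (Psi_inv (Psi w)) = Psi w" using Psi_Psi_inv[of "pt w" "dir w"] dir_neq[of w] by (simp add: Psi_def)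
    then show ?thesis using inj_Psi by (simp add: inj_eq)
  qed
  have "emeasure T1H_measure (B \<inter> (upper_half \<times> sphere 0 1)) = (\<integral>\<^sup>+p. indicator (B \<inter> (upper_half \<times> sphere 0 1)) p \<partial>T1H_measure)"
    using T1H_sets[OF Bb] by simp
  also have "\<dots> = 2 * (\<integral>\<^sup>+w. indicator (B \<inter> (upper_half \<times> sphere 0 1)) (Psi w) \<partial>lborel)"
    by (rule nn_integral_T1H) (use T1H_sets_borel[OF T1H_sets[OF Bb]] in auto)
  also have "(\<integral>\<^sup>+w. indicator (B \<inter> (upper_half \<times> sphere 0 1)) (Psi w) \<partial>lborel) = (\<integral>\<^sup>+w. indicator N w \<partial>lborel)"
  proof (intro nn_integral_cong)
    fix w
    have "Psi w \<in> upper_half \<times> sphere 0 1" "snd (Psi w) \<noteq> \<i>" using dir_neq[of w] by (simp_all add: Psi_def)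
    then show "indicator (B \<inter> (upper_half \<times> sphere 0 1)) (Psi w) = (indicator N w :: ennreal)"
      by (simp add: indicator_def B_def inv)
  qed
  also have "\<dots> = 0" using N by simp
  finally have "B \<inter> (upper_half \<times> sphere 0 1) \<in> null_sets T1H_measure" using T1H_sets[OF Bb] by auto
  then show ?thesis
  proof (rule AE_I')
    show "{p \<in> space T1H_measure. \<not> Q p} \<subseteq> B \<inter> (upper_half \<times> sphere 0 1)"
    proof
      fix p assume p: "p \<in> {p \<in> space T1H_measure. \<not> Q p}"
      then have sp: "p \<in> upper_half \<times> sphere 0 1" by simp
      show "p \<in> B \<inter> (upper_half \<times> sphere 0 1)"
      proof (cases "snd p = \<i>")
        case False
        then have "Psi (Psi_inv p) = p" using sp Psi_Psi_inv[of "fst p" "snd p"] by auto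
        then have "Psi_inv p \<in> N" using p N(1) by auto
        then show ?thesis using sp by (simp add: B_def)
      qed (use sp in \<open>simp add: B_def\<close>)
    qed
  qed
qed

section \<open>Fundamental domains and unfolding\<close>

lemma AE_cocycle_fst_nonzero: assumes "A \<in> SL2R" shows "AE w in (lborel :: horo_coords measure). cocycle A (fst w) \<noteq> 0"
proof -
  define N where "N = {x. cocycle A x = 0}"
  have N: "N \<in> sets borel" unfolding N_def by (intro borel_closed closed_Collect_eq) (auto simp: cocycle_def intro!: continuous_intros)
  have [measurable]: "(\<lambda>w::horo_coords. indicator N (fst w) :: ennreal) \<in> borel_measurable borel"
    unfolding borel_prod[symmetric] using N by measurable
  have "(\<integral>\<^sup>+w. indicator N (fst (w::horo_coords)) \<partial>lborel) = (\<integral>\<^sup>+x. \<integral>\<^sup>+a. \<integral>\<^sup>+s. indicator N x \<partial>(lborel::real measure) \<partial>(lborel::real measure) \<partial>(lborel::real measure))"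
    by (subst nn_integral_lborel3) auto
  also have "\<dots> = (\<integral>\<^sup>+x. 0 \<partial>(lborel :: real measure))"
    by (intro nn_integral_cong_AE, use AE_cocycle_nonzero[OF assms] in eventually_elim) (auto simp: N_def)
  finally have "(\<integral>\<^sup>+w. indicator N (fst (w::horo_coords)) \<partial>lborel) = 0" by simp
  then have "AE w in lborel. indicator N (fst (w::horo_coords)) = (0::ennreal)" by (subst (asm) nn_integral_0_iff_AE) auto
  then show ?thesis by eventually_elim (auto simp: N_def indicator_def split: if_splits)
qed

text \<open>
  No group element sends the forward endpoint to \<open>\<infinity>\<close>. On this set \<open>act\<close> is an action.
\<close>

definition generic :: "(real^2^2) set \<Rightarrow> horo_coords set" where
  "generic \<Gamma> = {w. \<forall>A\<in>\<Gamma>. cocycle A (fst w) \<noteq> 0}"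

context sl2_group
begin

lemma AE_generic: "AE w in lborel. w \<in> generic \<Gamma>"
  unfolding generic_def mem_Collect_eq
  by (subst AE_ball_countable[OF countable_group]) (use AE_cocycle_fst_nonzero in_SL2R in blast)

lemma generic_borel [measurable]: "generic \<Gamma> \<in> sets borel"
proof -
  have "generic \<Gamma> = (\<Inter>A\<in>\<Gamma>. {w. cocycle A (fst w) \<noteq> 0})" by (auto simp: generic_def)
  also have "\<dots> \<in> sets borel"
  proof (rule sets.countable_INT''[OF _ countable_group])
    fix A
    have "open {w::horo_coords. cocycle A (fst w) \<noteq> 0}"
      unfolding cocycle_def by (intro open_Collect_neq continuous_intros)
    then show "{w::horo_coords. cocycle A (fst w) \<noteq> 0} \<in> sets borel" by simp
  qed simp
  finally show ?thesis .
qed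

lemma generic_act: assumes w: "w \<in> generic \<Gamma>" and A: "A \<in> \<Gamma>" shows "act A w \<in> generic \<Gamma>"
  unfolding generic_def
proof (intro CollectI ballI)
  fix B assume B: "B \<in> \<Gamma>"
  obtain x a s where w': "w = (x, a, s)" by (metis surj_pair)
  have "cocycle A x \<noteq> 0" "cocycle (B ** A) x \<noteq> 0" using w A B w' by (auto simp: generic_def)
  then show "cocycle B (fst (act A w)) \<noteq> 0" by (simp add: w' act_def cocycle_mult)
qed

lemma generic_flow [simp]: "flow t w \<in> generic \<Gamma> \<longleftrightarrow> w \<in> generic \<Gamma>" by (simp add: generic_def)
lemma fst_horo [simp]: "fst (horo t w) = fst w" by (cases w) (simp add: horo_def)
lemma generic_horo [simp]: "horo t w \<in> generic \<Gamma> \<longleftrightarrow> w \<in> generic \<Gamma>" by (simp add: generic_def)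

lemma act_act: assumes w: "w \<in> generic \<Gamma>" and A: "A \<in> \<Gamma>" and B: "B \<in> \<Gamma>"
  shows "act A (act B w) = act (A ** B) w"
proof -
  obtain x a s where w': "w = (x, a, s)" by (metis surj_pair)
  show ?thesis unfolding w' by (rule act_mult) (use w A B w' in_SL2R in \<open>auto simp: generic_def\<close>)
qed

lemma act_adj: assumes w: "w \<in> generic \<Gamma>" and A: "A \<in> \<Gamma>"
  shows "act (adj2 A) (act A w) = w" "act A (act (adj2 A) w) = w"
  by (simp_all add: act_act[OF w adj_in[OF A] A] act_act[OF w A adj_in[OF A]] adj2_mult[OF in_SL2R[OF A]])

text \<open>
  The sum of \<open>h\<close> over the orbit. Since \<open>A\<close> and \<open>- A\<close> act alike, every orbit point is counted twice
  (or more, at fixed points); this explains the factors 2 below.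
\<close>

definition orbit_sum :: "(horo_coords \<Rightarrow> ennreal) \<Rightarrow> horo_coords \<Rightarrow> ennreal" where
  "orbit_sum h w = (\<integral>\<^sup>+A. h (act A w) \<partial>count_space \<Gamma>)"

lemma orbit_sum_measurable [measurable]:
  assumes [measurable]: "h \<in> borel_measurable borel" shows "orbit_sum h \<in> borel_measurable borel"
proof -
  interpret G: sigma_finite_measure "count_space \<Gamma>" by (rule sigma_finite_measure_count_space_countable[OF countable_group])
  have m: "(\<lambda>p. h (act (snd p) (fst p))) \<in> borel_measurable (borel \<Otimes>\<^sub>M count_space \<Gamma>)"
    by (rule measurable_compose_countable'[where f = "\<lambda>A p. h (act A (fst p))" and g = snd and I = \<Gamma>, OF _ _ countable_group]) auto
  have "(\<lambda>w. \<integral>\<^sup>+A. h (act A w) \<partial>count_space \<Gamma>) \<in> borel_measurable borel"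
    by (rule G.borel_measurable_nn_integral) (use m in \<open>simp add: case_prod_beta'\<close>)
  then show ?thesis by (simp add: orbit_sum_def[abs_def])
qed

lemma bij_mult_right: assumes B: "B \<in> \<Gamma>" shows "bij_betw (\<lambda>A. A ** B) \<Gamma> \<Gamma>"
proof (rule bij_betw_byWitness[where f' = "\<lambda>A. A ** adj2 B"])
  show "\<forall>a\<in>\<Gamma>. a ** B ** adj2 B = a" "\<forall>a\<in>\<Gamma>. a ** adj2 B ** B = a"
    using adj2_mult[OF in_SL2R[OF B]] by (simp_all add: matrix_mul_assoc[symmetric] matrix_mul_rid)
qed (use B in auto)

lemma bij_adj2: "bij_betw adj2 \<Gamma> \<Gamma>"
  by (rule bij_betw_byWitness[where f' = adj2]) auto

lemma orbit_sum_act: assumes w: "w \<in> generic \<Gamma>" and B: "B \<in> \<Gamma>" shows "orbit_sum h (act B w) = orbit_sum h w"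
proof -
  have "orbit_sum h (act B w) = (\<integral>\<^sup>+A. h (act (A ** B) w) \<partial>count_space \<Gamma>)"
    unfolding orbit_sum_def by (intro nn_integral_cong) (simp add: act_act[OF w _ B])
  also have "\<dots> = orbit_sum h w"
    unfolding orbit_sum_def by (rule nn_integral_bij_count_space[OF bij_mult_right[OF B]])
  finally show ?thesis .
qed

lemma orbit_sum_flow: "orbit_sum h (flow t w) = orbit_sum (\<lambda>w. h (flow t w)) w"
  by (simp add: orbit_sum_def act_flow)

text \<open>
  Substitute \<open>w \<mapsto> A^(-1) w\<close> in the term of each \<open>A\<close>, and then replace \<open>A^(-1)\<close> by \<open>A\<close> in the sum.
\<close>

lemma unfold_swap:
  assumes [measurable]: "g \<in> borel_measurable borel" "h \<in> borel_measurable borel"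
  shows "(\<integral>\<^sup>+w. g w * orbit_sum h w \<partial>lborel) = (\<integral>\<^sup>+w. h w * orbit_sum g w \<partial>lborel)"
proof -
  have "(\<integral>\<^sup>+w. g w * orbit_sum h w \<partial>lborel) = (\<integral>\<^sup>+w. \<integral>\<^sup>+A. g w * h (act A w) \<partial>count_space \<Gamma> \<partial>lborel)"
    unfolding orbit_sum_def by (intro nn_integral_cong nn_integral_cmult[symmetric]) auto
  also have "\<dots> = (\<integral>\<^sup>+A. \<integral>\<^sup>+w. g w * h (act A w) \<partial>lborel \<partial>count_space \<Gamma>)"
    by (rule nn_integral_count_space_nn_integral[OF countable_group]) measurable
  also have "\<dots> = (\<integral>\<^sup>+A. \<integral>\<^sup>+w. g (act (adj2 A) w) * h w \<partial>lborel \<partial>count_space \<Gamma>)"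
  proof (rule nn_integral_cong)
    fix A assume "A \<in> space (count_space \<Gamma>)"
    then have A: "A \<in> \<Gamma>" by simp
    have "(\<integral>\<^sup>+w. g w * h (act A w) \<partial>lborel) = (\<integral>\<^sup>+w. g (act (adj2 A) w) * h (act A (act (adj2 A) w)) \<partial>lborel)"
      by (rule nn_integral_act[symmetric]) (use A in_SL2R in \<open>auto\<close>)
    also have "\<dots> = (\<integral>\<^sup>+w. g (act (adj2 A) w) * h w \<partial>lborel)"
      by (intro nn_integral_cong_AE, use AE_generic in eventually_elim) (simp add: act_adj A)
    finally show "(\<integral>\<^sup>+w. g w * h (act A w) \<partial>lborel) = (\<integral>\<^sup>+w. g (act (adj2 A) w) * h w \<partial>lborel)" .
  qed
  also have "\<dots> = (\<integral>\<^sup>+A. \<integral>\<^sup>+w. g (act A w) * h w \<partial>lborel \<partial>count_space \<Gamma>)"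
    by (rule nn_integral_bij_count_space[OF bij_adj2])
  also have "\<dots> = (\<integral>\<^sup>+w. \<integral>\<^sup>+A. h w * g (act A w) \<partial>count_space \<Gamma> \<partial>lborel)"
    by (subst nn_integral_count_space_nn_integral[OF countable_group]) (auto simp: mult.commute)
  also have "\<dots> = (\<integral>\<^sup>+w. h w * orbit_sum g w \<partial>lborel)"
    unfolding orbit_sum_def by (intro nn_integral_cong nn_integral_cmult) auto
  finally show ?thesis .
qed

end

text \<open>
  A fundamental domain up to null sets. The value 2 of the sum says that an orbit meets \<open>F\<close> in one
  point, with two group elements of opposite sign leading there.
\<close>

locale sl2_domain = sl2_group +
  fixes F :: "horo_coords set"
  assumes F_borel [measurable]: "F \<in> sets borel"
    and F_once: "AE w in lborel. orbit_sum (indicator F) w = 2"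
    and F_finite: "emeasure lborel F < \<infinity>" and F_pos: "emeasure lborel F > 0"
begin

lemma unfolding_formula:
  assumes [measurable]: "h \<in> borel_measurable borel"
  shows "(\<integral>\<^sup>+w. indicator F w * orbit_sum h w \<partial>lborel) = 2 * (\<integral>\<^sup>+w. h w \<partial>lborel)"
proof -
  have "(\<integral>\<^sup>+w. indicator F w * orbit_sum h w \<partial>lborel) = (\<integral>\<^sup>+w. h w * orbit_sum (indicator F) w \<partial>lborel)"
    by (rule unfold_swap) auto
  also have "\<dots> = (\<integral>\<^sup>+w. 2 * h w \<partial>lborel)"
    by (intro nn_integral_cong_AE, use F_once in eventually_elim) (simp add: mult.commute)
  finally show ?thesis by (simp add: nn_integral_cmult)
qed

text \<open>
  Only at generic points, where \<open>act\<close> is an action, is invariance meaningful.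
\<close>

definition invariant :: "horo_coords set \<Rightarrow> bool" where
  "invariant B \<longleftrightarrow> (\<forall>w\<in>generic \<Gamma>. \<forall>A\<in>\<Gamma>. act A w \<in> B \<longleftrightarrow> w \<in> B)"

definition Inv :: "horo_coords set set" where "Inv = {B \<in> sets borel. invariant B}"

lemma Inv_sigma: "sigma_algebra UNIV Inv"
  unfolding sigma_algebra_iff2 Inv_def invariant_def by auto

text \<open>
  The quotient is represented by Lebesgue measure on \<open>F\<close>, restricted to the invariant Borel sets. On
  these it does not depend on the choice of \<open>F\<close>, so the flow acts on it although it does not
  preserve \<open>F\<close>.
\<close>

definition quot :: "horo_coords measure" where
  "quot = distr (density lborel (indicator F)) (sigma UNIV Inv) (\<lambda>w. w)"

lemma space_quot [simp]: "space quot = UNIV" by (simp add: quot_def space_measure_of_conv)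
lemma sets_quot: "sets quot = Inv"
  using sigma_algebra.sigma_sets_eq[OF Inv_sigma] by (simp add: quot_def)

lemma measurable_id_quot: "(\<lambda>w. w) \<in> density lborel (indicator F) \<rightarrow>\<^sub>M sigma UNIV Inv"
  by (rule measurable_measure_of) (auto simp: Inv_def)

lemma emeasure_quot:
  assumes B: "B \<in> Inv" shows "emeasure quot B = emeasure lborel (B \<inter> F)"
proof -
  have [measurable]: "B \<in> sets borel" using B by (simp add: Inv_def)
  have "B \<in> sets (sigma UNIV Inv)" using B by simp
  then have "emeasure quot B = emeasure (density lborel (indicator F)) ((\<lambda>w. w) -` B \<inter> space (density lborel (indicator F)))"
    unfolding quot_def by (rule emeasure_distr[OF measurable_id_quot])
  also have "\<dots> = (\<integral>\<^sup>+w. indicator F w * indicator B w \<partial>lborel)"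
    by (simp add: emeasure_density)
  also have "\<dots> = (\<integral>\<^sup>+w. indicator (B \<inter> F) w \<partial>lborel)"
    by (intro nn_integral_cong) (auto split: split_indicator)
  finally show ?thesis by simp
qed

lemma quot_measurable_iff:
  fixes f :: "horo_coords \<Rightarrow> 'b::{second_countable_topology,t1_space}"
  assumes f: "f \<in> borel_measurable borel" and inv: "\<And>w A. w \<in> generic \<Gamma> \<Longrightarrow> A \<in> \<Gamma> \<Longrightarrow> f (act A w) = f w"
  shows "f \<in> borel_measurable quot"
proof (rule measurableI)
  fix B :: "'b set" assume "B \<in> sets borel"
  then have "f -` B \<in> sets borel" using measurable_sets[OF f, of B] by simp
  then show "f -` B \<inter> space quot \<in> sets quot" using inv by (simp add: sets_quot Inv_def invariant_def)
qed simp

lemma nn_integral_quot: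
  assumes "f \<in> borel_measurable quot" "f \<in> borel_measurable borel"
  shows "(\<integral>\<^sup>+w. f w \<partial>quot) = (\<integral>\<^sup>+w. indicator F w * f w \<partial>lborel)"
proof -
  have "f \<in> borel_measurable (sigma UNIV Inv)" using assms(1) by (simp add: quot_def)
  then have "(\<integral>\<^sup>+w. f w \<partial>quot) = (\<integral>\<^sup>+w. f w \<partial>density lborel (indicator F))"
    unfolding quot_def by (subst nn_integral_distr[OF measurable_id_quot]) auto
  also have "\<dots> = (\<integral>\<^sup>+w. indicator F w * f w \<partial>lborel)"
    by (rule nn_integral_density) (use assms(2) in auto)
  finally show ?thesis .
qed

lemma orbit_sum_invariant:
  assumes "invariant B" "w \<in> generic \<Gamma>"
  shows "orbit_sum (\<lambda>w. indicator B w * h w) w = indicator B w * orbit_sum h w"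
proof -
  have "orbit_sum (\<lambda>w. indicator B w * h w) w = (\<integral>\<^sup>+A. indicator B w * h (act A w) \<partial>count_space \<Gamma>)"
    unfolding orbit_sum_def using assms by (intro nn_integral_cong) (auto simp: invariant_def split: split_indicator)
  then show ?thesis by (simp add: orbit_sum_def nn_integral_cmult)
qed

text \<open>
  The preimage of \<open>F\<close> under \<open>T'\<close> is another fundamental domain, and unfolding shows that two
  fundamental domains give an invariant set the same measure.
\<close>

lemma emeasure_invariant_shift:
  assumes B: "B \<in> sets borel" "invariant B"
    and T[measurable]: "T \<in> borel \<rightarrow>\<^sub>M borel" and T'[measurable]: "T' \<in> borel \<rightarrow>\<^sub>M borel"
    and TT': "\<And>w. T (T' w) = w" "\<And>w. T' (T w) = w"
    and pres: "\<And>f::horo_coords \<Rightarrow> ennreal. f \<in> borel_measurable borel \<Longrightarrow> (\<integral>\<^sup>+w. f (T w) \<partial>lborel) = (\<integral>\<^sup>+w. f w \<partial>lborel)"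
    and pres': "\<And>f::horo_coords \<Rightarrow> ennreal. f \<in> borel_measurable borel \<Longrightarrow> (\<integral>\<^sup>+w. f (T' w) \<partial>lborel) = (\<integral>\<^sup>+w. f w \<partial>lborel)"
    and com: "\<And>w A. w \<in> generic \<Gamma> \<Longrightarrow> A \<in> \<Gamma> \<Longrightarrow> act A (T' w) = T' (act A w)"
    and gen: "\<And>w. T' w \<in> generic \<Gamma> \<longleftrightarrow> w \<in> generic \<Gamma>"
  shows "emeasure lborel (T -` B \<inter> F) = emeasure lborel (B \<inter> F)"
proof -
  note [measurable] = B(1)
  define F' where "F' = T' -` F"
  have [measurable]: "F' \<in> sets borel" using measurable_sets[OF T' F_borel] by (simp add: F'_def)
  have AEp: "AE w in lborel. orbit_sum (indicator F) (T' w) = 2"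
    by (rule AE_preserved[OF T' _ F_once]) (rule pres')
  have F'2: "AE w in lborel. orbit_sum (indicator F') w = 2"
    using AEp AE_generic
  proof eventually_elim
    case (elim w)
    have "orbit_sum (indicator F') w = orbit_sum (indicator F) (T' w)"
      unfolding orbit_sum_def by (intro nn_integral_cong) (auto simp: F'_def com elim split: split_indicator)
    then show ?case using elim by simp
  qed
  have "2 * emeasure lborel (B \<inter> F) = (\<integral>\<^sup>+w. 2 * (indicator B w * indicator F w) \<partial>lborel)"
    by (subst nn_integral_cmult) (auto simp: indicator_inter_arith[symmetric])
  also have "\<dots> = (\<integral>\<^sup>+w. (indicator B w * indicator F w) * orbit_sum (indicator F') w \<partial>lborel)"
    by (intro nn_integral_cong_AE, use F'2 in eventually_elim) (simp add: mult.commute)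
  also have "\<dots> = (\<integral>\<^sup>+w. indicator F' w * orbit_sum (\<lambda>w. indicator B w * indicator F w) w \<partial>lborel)"
    by (rule unfold_swap) auto
  also have "\<dots> = (\<integral>\<^sup>+w. indicator F' w * (indicator B w * 2) \<partial>lborel)"
    by (intro nn_integral_cong_AE, use F_once AE_generic in eventually_elim) (simp add: orbit_sum_invariant[OF B(2)])
  also have "\<dots> = (\<integral>\<^sup>+w. indicator F' (T w) * (indicator B (T w) * 2) \<partial>lborel)"
    by (rule pres[symmetric]) measurable
  also have "\<dots> = (\<integral>\<^sup>+w. 2 * indicator (T -` B \<inter> F) w \<partial>lborel)"
    by (intro nn_integral_cong) (auto simp: F'_def TT' split: split_indicator)
  also have "\<dots> = 2 * emeasure lborel (T -` B \<inter> F)"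
    using measurable_sets[OF T B(1)] by (subst nn_integral_cmult) auto
  finally show ?thesis by (simp add: ennreal_mult_cancel_left)
qed

lemma emeasure_invariant_flow:
  assumes "B \<in> sets borel" "invariant B"
  shows "emeasure lborel (flow t -` B \<inter> F) = emeasure lborel (B \<inter> F)"
proof (rule emeasure_invariant_shift[OF assms, where T' = "flow (- t)"])
  show "(\<integral>\<^sup>+w. f (flow t w) \<partial>lborel) = (\<integral>\<^sup>+w. f w \<partial>lborel)"
    "(\<integral>\<^sup>+w. f (flow (- t) w) \<partial>lborel) = (\<integral>\<^sup>+w. f w \<partial>lborel)"
    if "f \<in> borel_measurable borel" for f :: "horo_coords \<Rightarrow> ennreal" by (rule nn_integral_flow[OF that])+
  show "act A (flow (- t) w) = flow (- t) (act A w)" for w A by (rule act_flow)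
qed simp_all

lemma flow_quot [measurable]: "flow t \<in> quot \<rightarrow>\<^sub>M quot"
proof (rule measurableI)
  fix B assume "B \<in> sets quot"
  then have B: "B \<in> sets borel" "invariant B" by (auto simp: sets_quot Inv_def)
  have "flow t -` B \<in> sets borel" using measurable_sets[OF flow_measurable B(1), of t] by simp
  then show "flow t -` B \<inter> space quot \<in> sets quot"
    using B(2) by (simp add: sets_quot Inv_def invariant_def flip: act_flow)
qed simp

lemma flow_preserves: "distr quot quot (flow t) = quot"
proof (rule measure_eqI)
  fix B assume "B \<in> sets (distr quot quot (flow t))"
  then have B: "B \<in> Inv" by (simp add: sets_quot)
  have "flow t -` B \<in> Inv" using measurable_sets[OF flow_quot, of B t] B by (simp add: sets_quot)
  then show "emeasure (distr quot quot (flow t)) B = emeasure quot B"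
    using B emeasure_invariant_flow[of B t]
    by (subst emeasure_distr) (auto simp: sets_quot emeasure_quot Inv_def)
qed simp

lemma finite_quot: "finite_measure quot"
  by (rule finite_measureI) (use F_finite in \<open>auto simp: emeasure_quot Inv_def invariant_def\<close>)

lemma measure_quot: "measure quot (space quot) = measure lborel F"
  by (simp add: measure_def emeasure_quot Inv_def invariant_def)

lemma null_of_quot:
  assumes B: "B \<in> sets borel" "invariant B" and z: "emeasure lborel (B \<inter> F) = 0"
  shows "AE w in lborel. w \<notin> B"
proof -
  note [measurable] = B(1)
  have mB: "(indicator B :: horo_coords \<Rightarrow> ennreal) \<in> borel_measurable borel" using B(1) by simp
  have "2 * emeasure lborel B = (\<integral>\<^sup>+w. indicator F w * orbit_sum (indicator B) w \<partial>lborel)"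
    using unfolding_formula[OF mB] B(1) by simp
  also have "\<dots> = (\<integral>\<^sup>+w. 0 \<partial>(lborel :: horo_coords measure))"
  proof (intro nn_integral_cong_AE)
    have "AE w in lborel. w \<notin> B \<inter> F" using z by (intro AE_not_in) (auto simp: null_sets_def)
    then show "AE w in lborel. indicator F w * orbit_sum (indicator B) w = 0"
      using AE_generic
    proof eventually_elim
      case (elim w)
      have "orbit_sum (indicator B) w = 0" if "w \<notin> B"
        using orbit_sum_invariant[OF B(2) elim(2), of "\<lambda>_. 1"] that by simp
      then show ?case using elim(1) by (auto split: split_indicator)
    qed
  qed
  finally have "B \<in> null_sets lborel" by (auto simp: null_sets_def)
  then show ?thesis by (rule AE_not_in)
qed

end

section \<open>Ergodicity of the geodesic flow\<close>

lemma AE_lborel_const [simp]: "(AE x in (lborel :: real measure). P) \<longleftrightarrow> P"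
  by (simp add: eventually_const_iff ae_filter_eq_bot_iff)

lemma AE_lborel3:
  assumes [measurable]: "N \<in> sets (borel :: horo_coords measure)"
  shows "(AE w in lborel. w \<notin> N) \<longleftrightarrow> (AE x in lborel. AE a in lborel. AE s in lborel. (x, a, s) \<notin> N)"
proof -
  have "(AE w in lborel. w \<notin> N) \<longleftrightarrow> (\<integral>\<^sup>+w. indicator N w \<partial>lborel) = 0"
    by (subst nn_integral_0_iff_AE) (auto simp: indicator_eq_0_iff)
  also have "(\<integral>\<^sup>+w. indicator N w \<partial>lborel) = (\<integral>\<^sup>+x. \<integral>\<^sup>+a. \<integral>\<^sup>+s. indicator N (x, a, s) \<partial>lborel \<partial>lborel \<partial>lborel)"
    by (rule nn_integral_lborel3) measurable
  also have "\<dots> = 0 \<longleftrightarrow> (AE x in lborel. AE a in lborel. AE s in lborel. (x, a, s) \<notin> N)"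
    by (simp add: nn_integral_0_iff_AE indicator_eq_0_iff)
  finally show ?thesis .
qed

lemma AE_neg_inverse:
  assumes "AE t in lborel. Q t" shows "AE t in lborel. Q (- 1 / t :: real)"
proof -
  from assms obtain N where N: "{w \<in> space lborel. \<not> Q w} \<subseteq> N" "emeasure lborel N = 0" "N \<in> sets lborel"
    by (rule AE_E)
  then have [measurable]: "N \<in> sets borel" by simp
  have "(\<integral>\<^sup>+x. ennreal (1 / x\<^sup>2) * indicator N (- 1 / x) \<partial>lborel) = 0"
    using nn_integral_neg_inverse[of "indicator N"] N by simp
  then have "AE x in lborel. ennreal (1 / x\<^sup>2) * indicator N (- 1 / x) = 0"
    by (subst (asm) nn_integral_0_iff_AE) auto
  then show ?thesis using AE_lborel_singleton[of "0::real"]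
    by eventually_elim (use N in \<open>auto split: split_indicator_asm simp: ennreal_eq_0_iff\<close>)
qed

lemma AE_translate:
  assumes "AE t in lborel. Q t" shows "AE t in lborel. Q (t + c :: real)"
  by (rule AE_preserved[OF _ _ assms]) (auto intro!: nn_integral_translate)

lemma AE_recip_diff:
  assumes "AE t in lborel. Q t" shows "AE y in lborel. Q (1 / (x - y) :: real)"
proof -
  have "AE y in lborel. Q (- 1 / (y + - x))"
    by (rule AE_translate[OF AE_neg_inverse[OF assms]])
  moreover have "- 1 / (y + - x) = 1 / (x - y)" for y
    by (metis add_uminus_conv_diff minus_diff_eq minus_divide_divide minus_minus)
  ultimately show ?thesis by simp
qed

text \<open>
  Let \<open>P\<close> consist of the \<open>x\<close> whose vertical slice is conull. Up to a null set, \<open>b\<close> is the product of \<open>P\<close>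
  with the line, so almost every horizontal slice is \<open>P\<close> up to a null set, and \<open>P\<close> is null or conull.
\<close>

lemma null_or_conull_of_slices:
  fixes b :: "(real \<times> real) set"
  assumes b: "b \<in> sets borel"
    and h: "AE x in lborel. (AE y in lborel. (x, y) \<in> b) \<or> (AE y in lborel. (x, y) \<notin> b)"
    and v: "AE y in lborel. (AE x in lborel. (x, y) \<in> b) \<or> (AE x in lborel. (x, y) \<notin> b)"
  shows "(AE x in lborel. AE y in lborel. (x, y) \<in> b) \<or> (AE x in lborel. AE y in lborel. (x, y) \<notin> b)"
proof -
  have bp: "b \<in> sets (borel \<Otimes>\<^sub>M borel)" unfolding borel_prod by (rule b)
  define P where "P = {x. (\<integral>\<^sup>+y. indicator (- b) (x, y) \<partial>lborel) = 0}"
  note [measurable] = bp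
  have [measurable]: "(\<lambda>p. indicator (- b) p :: ennreal) \<in> borel_measurable (borel \<Otimes>\<^sub>M borel)"
    unfolding borel_prod using b by (intro borel_measurable_indicator) auto
  have Pm: "P \<in> sets borel"
  proof -
    have "P = {x \<in> space borel. (\<integral>\<^sup>+y. indicator (- b) (x, y) \<partial>lborel) = 0}" by (simp add: P_def)
    also have "\<dots> \<in> sets borel" by measurable
    finally show ?thesis .
  qed
  have slice: "{y. (x, y) \<in> b} \<in> sets borel" for x
    using measurable_sets[OF measurable_Pair1'[of x borel borel] bp] by (simp add: vimage_def)
  have P_iff: "x \<in> P \<longleftrightarrow> (AE y in lborel. (x, y) \<in> b)" for x
  proof -
    have "(\<lambda>y. indicator (- b) (x, y) :: ennreal) \<in> borel_measurable borel" by measurable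
    then show ?thesis unfolding P_def mem_Collect_eq
      by (subst nn_integral_0_iff_AE) (auto simp: indicator_eq_0_iff)
  qed
  have "AE x in lborel. AE y in lborel. (x, y) \<in> b \<longleftrightarrow> x \<in> P"
    using h
  proof eventually_elim
    case (elim x)
    then show ?case
    proof
      assume "AE y in lborel. (x, y) \<in> b"
      then show ?thesis using P_iff[of x] by auto
    next
      assume n: "AE y in lborel. (x, y) \<notin> b"
      have "\<not> (AE y in lborel. (x, y) \<in> b)"
      proof
        assume "AE y in lborel. (x, y) \<in> b"
        then have "AE y in (lborel :: real measure). False" using n by eventually_elim auto
        then show False by (simp add: AE_lborel_const)
      qed
      then show ?thesis using n P_iff[of x] by auto
    qed
  qed
  moreover have "{p \<in> space (lborel \<Otimes>\<^sub>M lborel). (fst p, snd p) \<in> b \<longleftrightarrow> fst p \<in> P} \<in> sets (lborel \<Otimes>\<^sub>M lborel)"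
  proof -
    have "{p \<in> space (lborel \<Otimes>\<^sub>M lborel). (fst p, snd p) \<in> b \<longleftrightarrow> fst p \<in> P} =
      (b \<inter> (P \<times> UNIV)) \<union> (- b \<inter> ((- P) \<times> UNIV))" by (auto simp: space_pair_measure)
    also have "\<dots> \<in> sets (borel :: (real \<times> real) measure)"
    proof -
      have "Q \<times> UNIV \<in> sets (borel :: (real \<times> real) measure)" if "Q \<in> sets borel" for Q :: "real set"
        unfolding borel_prod[symmetric] using that by (intro pair_measureI) auto
      then show ?thesis using b Pm by (intro sets.Un sets.Int) auto
    qed
    finally show ?thesis unfolding lborel_prod by simp
  qed
  ultimately have "AE y in lborel. AE x in lborel. (x, y) \<in> b \<longleftrightarrow> x \<in> P"
    by (subst (asm) lborel_pair.AE_commute) auto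
  then have "AE y in (lborel :: real measure). (AE x in lborel. x \<in> P) \<or> (AE x in lborel. x \<notin> P)"
    using v
  proof eventually_elim
    case (elim y)
    from elim(2) show ?case
    proof
      assume "AE x in lborel. (x, y) \<in> b"
      then have "AE x in lborel. x \<in> P" using elim(1) by eventually_elim simp
      then show ?thesis ..
    next
      assume "AE x in lborel. (x, y) \<notin> b"
      then have "AE x in lborel. x \<notin> P" using elim(1) by eventually_elim simp
      then show ?thesis ..
    qed
  qed
  then have "(AE x in lborel. x \<in> P) \<or> (AE x in lborel. x \<notin> P)"
  proof -
    assume "AE y in (lborel::real measure). (AE x in lborel. x \<in> P) \<or> (AE x in lborel. x \<notin> P)"
    then show ?thesis by (rule contrapos_pp) (simp add: AE_lborel_const)
  qed
  then show ?thesis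
  proof
    assume "AE x in lborel. x \<in> P"
    then show ?thesis using P_iff by simp
  next
    assume "AE x in lborel. x \<notin> P"
    then have "AE x in lborel. AE y in lborel. (x, y) \<notin> b"
      using h by eventually_elim (use P_iff in auto)
    then show ?thesis ..
  qed
qed

context sl2_domain
begin

definition flow_inv :: "horo_coords set \<Rightarrow> bool" where
  "flow_inv B \<longleftrightarrow> (\<forall>w t. flow t w \<in> B \<longleftrightarrow> w \<in> B)"

lemma flow_invD: "flow_inv B \<Longrightarrow> flow t w \<in> B \<longleftrightarrow> w \<in> B"
  unfolding flow_inv_def by blast

text \<open>
  Mautner's phenomenon. Let \<open>D u\<close> be the set of points of \<open>B\<close> that leave \<open>B\<close> under \<open>horo u\<close>. The
  preimage of \<open>D u\<close> under \<open>flow t\<close> is \<open>D (u e^t)\<close>, and the flow preserves the measure of the quotient, so \<open>D u\<close> has the same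
  measure as \<open>D v\<close> for arbitrarily small \<open>v\<close>. The latter is small: enclose \<open>B\<close> in an open set \<open>U\<close> with
  little excess; every point of \<open>B\<close> stays in \<open>U\<close> under small translations.
\<close>

lemma AE_horocycle_invariant:
  assumes B: "B \<in> sets borel" "invariant B" "flow_inv B"
  shows "AE w in lborel. \<not> (w \<in> B \<and> horo u w \<notin> B)"
proof -
  note [measurable] = B(1)
  define D where "D v = B - horo v -` B" for v
  have pre[measurable]: "horo v -` X \<in> sets borel" if "X \<in> sets borel" for X v
    using measurable_sets[OF horo_measurable that, of v] by simp
  have Dm[measurable]: "D v \<in> sets borel" for v unfolding D_def by measurable
  have Dinv: "invariant (D v)" for v
    unfolding invariant_def
  proof (intro ballI)
    fix w A assume w: "w \<in> generic \<Gamma>" and A: "A \<in> \<Gamma>"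
    have "cocycle A (fst w) \<noteq> 0" using w A by (auto simp: generic_def)
    then have "horo v (act A w) = act A (horo v w)" by (simp add: act_horo)
    then show "(act A w \<in> D v) = (w \<in> D v)"
      using B(2) w A by (simp add: D_def invariant_def)
  qed
  have shift: "flow t -` D v = D (v * exp t)" for v t
  proof (rule set_eqI)
    fix w
    have "flow t w' \<in> B \<longleftrightarrow> w' \<in> B" for w' by (rule flow_invD[OF B(3)])
    then show "w \<in> flow t -` D v \<longleftrightarrow> w \<in> D (v * exp t)" by (simp add: D_def horo_flow)
  qed
  have same: "emeasure lborel (D u \<inter> F) = emeasure lborel (D (u * exp t) \<inter> F)" for t
    using emeasure_invariant_flow[OF Dm Dinv, of t u] by (simp add: shift)
  have "emeasure lborel (D u \<inter> F) \<le> 0"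
  proof (rule ennreal_le_epsilon)
    fix e :: real assume e: "0 < e"
    obtain U where U: "open U" "B \<subseteq> U" "emeasure lborel (U - B) < ennreal e"
      using outer_regular_lborel[OF B(1) e] by blast
    have [measurable]: "U \<in> sets borel" using U(1) by simp
    define v where "v n = u * exp (- real n)" for n
    define E where "E n = (B \<inter> F) - horo (v n) -` U" for n
    have [measurable]: "E n \<in> sets borel" for n unfolding E_def by measurable
    have bound: "emeasure lborel (D u \<inter> F) \<le> emeasure lborel (E n) + ennreal e" for n
    proof -
      have "emeasure lborel (D u \<inter> F) = emeasure lborel (D (v n) \<inter> F)"
        using same[of "- real n"] by (simp add: v_def)
      also have "\<dots> \<le> emeasure lborel (E n \<union> horo (v n) -` (U - B))"
        by (rule emeasure_mono) (auto simp: D_def E_def)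
      also have "\<dots> \<le> emeasure lborel (E n) + emeasure lborel (horo (v n) -` (U - B))"
        by (rule emeasure_subadditive) auto
      also have "emeasure lborel (horo (v n) -` (U - B)) = (\<integral>\<^sup>+w. indicator (horo (v n) -` (U - B)) w \<partial>lborel)"
        by (rule nn_integral_indicator[symmetric]) auto
      also have "\<dots> = (\<integral>\<^sup>+w. indicator (U - B) (horo (v n) w) \<partial>lborel)"
        by (intro nn_integral_cong) (auto split: split_indicator)
      also have "\<dots> = emeasure lborel (U - B)" by (subst nn_integral_horo) auto
      also have "\<dots> \<le> ennreal e" using U(3) by simp
      finally show ?thesis by (simp add: add_left_mono)
    qed
    have "(\<lambda>n. \<integral>\<^sup>+w. indicator (E n) w \<partial>lborel) \<longlonglongrightarrow> (\<integral>\<^sup>+w. (0::ennreal) \<partial>(lborel::horo_coords measure))"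
    proof (rule nn_integral_dominated_convergence[where w = "indicator F"])
      show "(\<integral>\<^sup>+w. indicator F w \<partial>lborel) < \<infinity>" using F_finite by simp
      show "AE w in lborel. (\<lambda>n. indicator (E n) w :: ennreal) \<longlonglongrightarrow> 0"
      proof (intro AE_I2)
        fix w :: horo_coords
        show "(\<lambda>n. indicator (E n) w :: ennreal) \<longlonglongrightarrow> 0"
        proof (cases "w \<in> B \<inter> F")
          case True
          obtain x a s where w: "w = (x, a, s)" by (metis surj_pair)
          have "(\<lambda>n. exp (- real n)) \<longlonglongrightarrow> 0"
            by (rule filterlim_compose[OF exp_at_bot]) (simp add: filterlim_uminus_at_bot filterlim_real_sequentially)
          then have "(\<lambda>n. horo (v n) w) \<longlonglongrightarrow> (x, a + u * 0 * exp s, s)"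
            unfolding w horo_def prod.case v_def by (intro tendsto_intros)
          then have "(\<lambda>n. horo (v n) w) \<longlonglongrightarrow> w" by (simp add: w)
          moreover have "w \<in> U" using True U(2) by auto
          ultimately have "\<forall>\<^sub>F n in sequentially. horo (v n) w \<in> U" using U(1) topological_tendstoD by blast
          then have "\<forall>\<^sub>F n in sequentially. indicator (E n) w = (0::ennreal)"
            by eventually_elim (simp add: E_def)
          then show ?thesis by (rule tendsto_eventually)
        next
          case False
          then have "indicator (E n) w = (0::ennreal)" for n by (auto simp: E_def)
          then show ?thesis by simp
        qed
      qed
    qed (auto simp: E_def split: split_indicator)
    then have "(\<lambda>n. emeasure lborel (E n) + ennreal e) \<longlonglongrightarrow> 0 + ennreal e"
      by (intro tendsto_add tendsto_const) simp
    then have "emeasure lborel (D u \<inter> F) \<le> 0 + ennreal e"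
      by (rule LIMSEQ_le_const) (use bound in auto)
    then show "emeasure lborel (D u \<inter> F) \<le> 0 + ennreal e" .
  qed
  then have "AE w in lborel. w \<notin> D u" by (intro null_of_quot Dm Dinv) simp
  then show ?thesis by (simp add: D_def)
qed

text \<open>
  The points with forward endpoint \<open>x\<close> are connected by the flow and the horocycle translations, so
  \<open>B\<close> contains almost all or almost none of them. By flow invariance it suffices to look at \<open>s = 0\<close>,
  and horocycle translation by 1 or -1 at level \<open>s\<close> moves \<open>a\<close> by \<open>e^s\<close> or \<open>-e^s\<close>; letting \<open>s\<close> vary, every pair
  of values of \<open>a\<close> is compared.
\<close>

lemma AE_forward_endpoint_slices:
  assumes B: "B \<in> sets borel" "invariant B" "flow_inv B"
  shows "AE x in lborel. (AE a in lborel. (x, a, 0) \<in> B) \<or> (AE a in lborel. (x, a, 0) \<notin> B)"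
proof -
  note [measurable] = B(1)
  have fl: "(x, a, s) \<in> B \<longleftrightarrow> (x, a, 0) \<in> B" for x a s
    using flow_invD[OF B(3), of s "(x, a, 0)"] by (simp add: flow_def)
  define i :: "real \<Rightarrow> real \<Rightarrow> ennreal" where "i x a = indicator B (x, a, 0)" for x a
  define j :: "real \<Rightarrow> real \<Rightarrow> ennreal" where "j x a = indicator (- B) (x, a, 0)" for x a
  have im[measurable (raw)]: "(\<lambda>z. i (f z) (g z)) \<in> borel_measurable M"
    if "f \<in> borel_measurable M" "g \<in> borel_measurable M" for f g and M :: "'c measure"
    unfolding i_def using that by measurable
  have jm[measurable (raw)]: "(\<lambda>z. j (f z) (g z)) \<in> borel_measurable M"
    if "f \<in> borel_measurable M" "g \<in> borel_measurable M" for f g and M :: "'c measure"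
    unfolding j_def using that by measurable
  \<comment> \<open>No horocycle translation leads from \<open>B\<close> to its complement.\<close>
  have conv: "AE x in lborel. AE a in lborel. AE s in lborel. i x a * j x (a + u * exp s) = 0" for u
  proof -
    define N where "N = B - horo u -` B"
    have "horo u -` B \<in> sets borel" using measurable_sets[OF horo_measurable B(1), of u] by simp
    then have Nm: "N \<in> sets borel" unfolding N_def by measurable
    have "AE w in lborel. w \<notin> N" using AE_horocycle_invariant[OF B, of u] by (simp add: N_def)
    then have "AE x in lborel. AE a in lborel. AE s in lborel. (x, a, s) \<notin> N" using AE_lborel3[OF Nm] by simp
    then show ?thesis
    proof (rule eventually_mono)
      fix x assume "AE a in lborel. AE s in lborel. (x, a, s) \<notin> N"
      then show "AE a in lborel. AE s in lborel. i x a * j x (a + u * exp s) = 0"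
      proof (rule eventually_mono)
        fix a assume "AE s in lborel. (x, a, s) \<notin> N"
        then show "AE s in lborel. i x a * j x (a + u * exp s) = 0"
        proof (rule eventually_mono)
          fix s assume "(x, a, s) \<notin> N"
          then show "i x a * j x (a + u * exp s) = 0" using fl[of x a s] fl[of x "a + u * exp s" s]
            by (auto simp: N_def horo_def i_def j_def split: split_indicator)
        qed
      qed
    qed
  qed
  \<comment> \<open>The values \<open>a + e^s\<close> and \<open>a - e^s\<close> together fill the line, with density \<open>e^s\<close>.\<close>
  have split: "(\<integral>\<^sup>+a'. j x a' \<partial>lborel) =
     (\<integral>\<^sup>+s. ennreal (exp s) * j x (a + exp s) \<partial>lborel) + (\<integral>\<^sup>+s. ennreal (exp s) * j x (a - exp s) \<partial>lborel)" for x a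
  proof -
    have "(\<integral>\<^sup>+a'. j x a' \<partial>lborel) = (\<integral>\<^sup>+r. j x (r + a) \<partial>lborel)"
      by (rule nn_integral_translate[symmetric]) measurable
    also have "\<dots> = (\<integral>\<^sup>+r. j x (r + a) * indicator {..<0} r \<partial>lborel) + (\<integral>\<^sup>+r. j x (r + a) * indicator {0<..} r \<partial>lborel)"
      by (rule nn_integral_split_sign) measurable
    also have "(\<integral>\<^sup>+r. j x (r + a) * indicator {..<0} r \<partial>lborel) = (\<integral>\<^sup>+r. j x (- r + a) * indicator {..<0} (- r) \<partial>lborel)"
      using nn_integral_scale[of "\<lambda>r. j x (r + a) * indicator {..<0} r" "-1" 0] by simp
    also have "\<dots> = (\<integral>\<^sup>+r. j x (- r + a) * indicator {0<..} r \<partial>lborel)"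
      by (intro nn_integral_cong) (auto split: split_indicator)
    also have "\<dots> = (\<integral>\<^sup>+s. ennreal (exp s) * j x (- exp s + a) \<partial>lborel)"
      by (rule nn_integral_exp) measurable
    also have "(\<integral>\<^sup>+r. j x (r + a) * indicator {0<..} r \<partial>lborel) = (\<integral>\<^sup>+s. ennreal (exp s) * j x (exp s + a) \<partial>lborel)"
      by (rule nn_integral_exp) measurable
    finally show ?thesis by (simp add: add.commute)
  qed
  have "AE x in lborel. (\<integral>\<^sup>+a. i x a \<partial>lborel) * (\<integral>\<^sup>+a'. j x a' \<partial>lborel) = 0"
    using conv[of 1] conv[of "-1"]
  proof eventually_elim
    case (elim x)
    have "(\<integral>\<^sup>+a. i x a \<partial>lborel) * (\<integral>\<^sup>+a'. j x a' \<partial>lborel) = (\<integral>\<^sup>+a. i x a * (\<integral>\<^sup>+a'. j x a' \<partial>lborel) \<partial>lborel)"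
      by (rule nn_integral_multc[symmetric]) measurable
    also have "\<dots> = (\<integral>\<^sup>+a. 0 \<partial>(lborel::real measure))"
    proof (rule nn_integral_cong_AE)
      show "AE a in lborel. i x a * (\<integral>\<^sup>+a'. j x a' \<partial>lborel) = 0"
        using elim
      proof eventually_elim
        case (elim a)
        have "i x a * (\<integral>\<^sup>+a'. j x a' \<partial>lborel) =
          (\<integral>\<^sup>+s. i x a * (ennreal (exp s) * j x (a + exp s)) \<partial>lborel) + (\<integral>\<^sup>+s. i x a * (ennreal (exp s) * j x (a - exp s)) \<partial>lborel)"
          unfolding split[of x a] distrib_left
          by (intro arg_cong2[of _ _ _ _ "(+)"] nn_integral_cmult[symmetric]) measurable
        also have "(\<integral>\<^sup>+s. i x a * (ennreal (exp s) * j x (a + exp s)) \<partial>lborel) = (\<integral>\<^sup>+s. 0 \<partial>(lborel::real measure))"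
          by (rule nn_integral_cong_AE, use elim(1) in eventually_elim) auto
        also have "(\<integral>\<^sup>+s. i x a * (ennreal (exp s) * j x (a - exp s)) \<partial>lborel) = (\<integral>\<^sup>+s. 0 \<partial>(lborel::real measure))"
          by (rule nn_integral_cong_AE, use elim(2) in eventually_elim) auto
        finally show ?case by simp
      qed
    qed
    finally show ?case by simp
  qed
  then show ?thesis
  proof eventually_elim
    case (elim x)
    then consider "(\<integral>\<^sup>+a. i x a \<partial>lborel) = 0" | "(\<integral>\<^sup>+a. j x a \<partial>lborel) = 0" by auto
    then show ?case
    proof cases
      case 1
      have "(\<lambda>a. i x a) \<in> borel_measurable lborel" by measurable
      then have "AE a in lborel. i x a = 0" using 1 by (simp add: nn_integral_0_iff_AE)
      then have "AE a in lborel. (x, a, 0) \<notin> B" by eventually_elim (auto simp: i_def split: split_indicator_asm)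
      then show ?thesis ..
    next
      case 2
      have "(\<lambda>a. j x a) \<in> borel_measurable lborel" by measurable
      then have "AE a in lborel. j x a = 0" using 2 by (simp add: nn_integral_0_iff_AE)
      then have "AE a in lborel. (x, a, 0) \<in> B" by eventually_elim (auto simp: j_def split: split_indicator_asm)
      then show ?thesis ..
    qed
  qed
qed

text \<open>
  Identify a flow-invariant set with a set \<open>b\<close> of pairs of endpoints. Its slices with fixed forward
  endpoint are null or conull by \<open>AE_forward_endpoint_slices\<close>. The same lemma for the image \<open>B'\<close> of \<open>B\<close> under reversal
  gives this for the slices with fixed backward endpoint.
\<close>

theorem ergodicity:
  assumes B: "B \<in> sets borel" "invariant B" "flow_inv B"
  shows "(AE w in lborel. w \<in> B) \<or> (AE w in lborel. w \<notin> B)"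
proof -
  note [measurable] = B(1)
  have fl: "(x, a, s) \<in> B \<longleftrightarrow> (x, a, 0) \<in> B" for x a s
    using flow_invD[OF B(3), of s "(x, a, 0)"] by (simp add: flow_def)
  have AE_s: "(AE s in lborel. (x, a, s) \<in> B) \<longleftrightarrow> (x, a, 0) \<in> B"
    and AE_s': "(AE s in lborel. (x, a, s) \<notin> B) \<longleftrightarrow> (x, a, 0) \<notin> B" for x a
    by (subst fl, rule AE_lborel_const)+
  \<comment> \<open>The backward endpoint must be generic as well for \<open>flip\<close> to commute with the group.\<close>
  define B' where "B' = {w. fst (snd w) \<noteq> 0} \<inter> flip -` (generic \<Gamma> \<inter> B)"
  have B'm: "B' \<in> sets borel"
  proof -
    have "{w::horo_coords. fst (snd w) \<noteq> 0} \<in> sets borel"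
      by (intro borel_open open_Collect_neq continuous_intros)
    moreover have "flip -` (generic \<Gamma> \<inter> B) \<in> sets borel"
      using measurable_sets[OF flip_measurable, of "generic \<Gamma> \<inter> B"] by simp
    ultimately show ?thesis by (simp add: B'_def)
  qed
  have fwd: "act A w \<in> B'" if w: "w \<in> generic \<Gamma>" and A: "A \<in> \<Gamma>" and b: "w \<in> B'" for w A
  proof -
    obtain x a s where w': "w = (x, a, s)" by (metis surj_pair)
    have a: "a \<noteq> 0" and g: "flip w \<in> generic \<Gamma>" "flip w \<in> B" using b by (auto simp: B'_def w')
    have k: "cocycle A x \<noteq> 0" "cocycle A (x - 1 / a) \<noteq> 0"
      using w g(1) A by (auto simp: generic_def w' flip_def)
    have e: "flip (act A w) = act A (flip w)" "fst (snd (act A w)) \<noteq> 0"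
      unfolding w' using act_flip[OF in_SL2R[OF A] k(1) a k(2), of s] by auto
    show ?thesis using e g A generic_act[OF g(1) A] B(2) by (auto simp: B'_def invariant_def)
  qed
  have B'inv: "invariant B'"
    unfolding invariant_def
  proof (intro ballI iffI)
    fix w A assume w: "w \<in> generic \<Gamma>" and A: "A \<in> \<Gamma>"
    show "act A w \<in> B'" if "w \<in> B'" by (rule fwd[OF w A that])
    show "w \<in> B'" if "act A w \<in> B'"
      using fwd[OF generic_act[OF w A] adj_in[OF A] that] act_adj[OF w A] by simp
  qed
  have B'fl: "flow_inv B'"
    unfolding flow_inv_def
  proof (intro allI)
    fix w t
    have "flow t' w' \<in> B \<longleftrightarrow> w' \<in> B" for t' w' by (rule flow_invD[OF B(3)])
    then show "flow t w \<in> B' \<longleftrightarrow> w \<in> B'" by (simp add: B'_def flip_flow)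
  qed
  define b where "b = {p. (fst p, 1 / (fst p - snd p), 0::real) \<in> B}"
  have bm: "b \<in> sets borel"
  proof -
    have "(\<lambda>p::real \<times> real. (fst p, 1 / (fst p - snd p), 0::real)) \<in> borel_measurable (borel \<Otimes>\<^sub>M borel)" by measurable
    from measurable_sets[OF this B(1)] have "b \<in> sets (borel \<Otimes>\<^sub>M borel)"
      by (simp add: b_def vimage_def space_pair_measure)
    then show ?thesis unfolding borel_prod .
  qed
  have b_iff: "(x, y) \<in> b \<longleftrightarrow> (x, 1 / (x - y), 0) \<in> B" for x y by (simp add: b_def)
  have h: "AE x in lborel. (AE y in lborel. (x, y) \<in> b) \<or> (AE y in lborel. (x, y) \<notin> b)"
    using AE_forward_endpoint_slices[OF B] unfolding b_iff by eventually_elim (use AE_recip_diff in blast)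
  have gen1: "AE x in lborel. \<forall>A\<in>\<Gamma>. cocycle A x \<noteq> 0"
  proof -
    have "AE w in lborel. w \<notin> - generic \<Gamma>" using AE_generic by simp
    then have "AE x in lborel. AE a in (lborel::real measure). AE s in (lborel::real measure). (x, a, s) \<notin> - generic \<Gamma>"
      by (subst (asm) AE_lborel3) auto
    then show ?thesis by eventually_elim (auto simp: generic_def AE_lborel_const)
  qed
  have v: "AE y in lborel. (AE x in lborel. (x, y) \<in> b) \<or> (AE x in lborel. (x, y) \<notin> b)"
    using AE_forward_endpoint_slices[OF B'm B'inv B'fl]
  proof eventually_elim
    case (elim y)
    have mem: "(y, 1 / (y - x), 0) \<in> B' \<longleftrightarrow> (x, y) \<in> b"
      if xy: "x \<noteq> y" and g: "\<forall>A\<in>\<Gamma>. cocycle A x \<noteq> 0" for x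
    proof -
      have "1 / (y - x) \<noteq> 0" "y - 1 / (1 / (y - x)) = x" "- (1 / (y - x)) = 1 / (x - y)"
        using xy by (auto simp: minus_divide_right)
      then show ?thesis using g fl by (simp add: B'_def flip_def generic_def b_iff)
    qed
    from elim show ?case
    proof
      assume "AE a in lborel. (y, a, 0) \<in> B'"
      then have "AE x in lborel. (y, 1 / (y - x), 0) \<in> B'" by (rule AE_recip_diff)
      then have "AE x in lborel. (x, y) \<in> b" using gen1 AE_lborel_singleton[of y]
        by eventually_elim (use mem in blast)
      then show ?thesis ..
    next
      assume "AE a in lborel. (y, a, 0) \<notin> B'"
      then have "AE x in lborel. (y, 1 / (y - x), 0) \<notin> B'" by (rule AE_recip_diff)
      then have "AE x in lborel. (x, y) \<notin> b" using gen1 AE_lborel_singleton[of y]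
        by eventually_elim (use mem in blast)
      then show ?thesis ..
    qed
  qed
  have to_a: "AE a in lborel. Q a" if Q: "AE y in lborel. Q (1 / (x - y))"
    for Q :: "real \<Rightarrow> bool" and x
  proof -
    have "AE t in lborel. Q (1 / (x - (t + x)))" by (rule AE_translate[OF Q])
    then have "AE t in lborel. Q (1 / (x - (- 1 / t + x)))" by (rule AE_neg_inverse)
    then show ?thesis using AE_lborel_singleton[of "0::real"] by eventually_elim simp
  qed
  from null_or_conull_of_slices[OF bm h v] show ?thesis
  proof
    assume "AE x in lborel. AE y in lborel. (x, y) \<in> b"
    then have "AE x in lborel. AE a in lborel. (x, a, 0) \<in> B"
      unfolding b_iff by eventually_elim (rule to_a)
    then have "AE x in lborel. AE a in lborel. AE s in lborel. (x, a, s) \<notin> - B"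
      by (simp only: AE_s Compl_iff not_not)
    then have "AE w in lborel. w \<notin> - B" by (subst AE_lborel3) auto
    then show ?thesis by simp
  next
    assume "AE x in lborel. AE y in lborel. (x, y) \<notin> b"
    then have "AE x in lborel. AE a in lborel. (x, a, 0) \<notin> B"
      unfolding b_iff by eventually_elim (rule to_a)
    then have "AE x in lborel. AE a in lborel. AE s in lborel. (x, a, s) \<notin> B"
      by (simp only: AE_s')
    then have "AE w in lborel. w \<notin> B" by (subst AE_lborel3) auto
    then show ?thesis by simp
  qed
qed

end

section \<open>Counting orbit points along the flow\<close>

text \<open>
  The time at which the geodesic is highest.
\<close>

definition apex_time :: "horo_coords \<Rightarrow> real" where
  "apex_time w = ln \<bar>fst (snd w)\<bar> - snd (snd w)"

lemma apex_time_measurable [measurable]: "apex_time \<in> borel_measurable borel"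
  unfolding apex_time_def borel_prod[symmetric] by measurable

lemma apex_time_flow [simp]: "apex_time (flow t w) = apex_time w - t"
  by (simp add: apex_time_def)

definition height_fun :: "(real \<times> real \<Rightarrow> ennreal) \<Rightarrow> real set \<Rightarrow> horo_coords \<Rightarrow> ennreal" where
  "height_fun h I w = h (fst w, fst (snd w)) * indicator I (apex_time w)"

lemma height_fun_measurable [measurable]:
  assumes [measurable]: "h \<in> borel_measurable borel" "I \<in> sets borel"
  shows "height_fun h I \<in> borel_measurable borel"
proof -
  have "(\<lambda>w::horo_coords. (fst w, fst (snd w))) \<in> borel_measurable borel" unfolding borel_prod[symmetric] by measurable
  from measurable_compose[OF this assms(1)] have [measurable]: "(\<lambda>w::horo_coords. h (fst w, fst (snd w))) \<in> borel_measurable borel" .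
  show ?thesis unfolding height_fun_def[abs_def] by measurable
qed

context sl2_domain
begin

text \<open>
  The sum of \<open>h\<close> over the orbit points whose geodesic is highest at a time in \<open>I\<close>.
\<close>

definition orbit_count :: "(real \<times> real \<Rightarrow> ennreal) \<Rightarrow> horo_coords \<Rightarrow> real set \<Rightarrow> ennreal" where
  "orbit_count h w I = orbit_sum (height_fun h I) w"

lemma orbit_count_act: "w \<in> generic \<Gamma> \<Longrightarrow> A \<in> \<Gamma> \<Longrightarrow> orbit_count h (act A w) I = orbit_count h w I"
  by (simp add: orbit_count_def orbit_sum_act)

lemma orbit_count_flow: "orbit_count h (flow t w) {a..<b} = orbit_count h w {a + t..<b + t}"
proof -
  have "height_fun h {a..<b} (flow t v) = height_fun h {a + t..<b + t} v" for v
    by (auto simp: height_fun_def split: split_indicator)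
  then show ?thesis by (simp add: orbit_count_def orbit_sum_flow)
qed

lemma orbit_count_mono: "I \<subseteq> K \<Longrightarrow> orbit_count h w I \<le> orbit_count h w K"
  unfolding orbit_count_def orbit_sum_def height_fun_def
  by (intro nn_integral_mono mult_left_mono) (auto split: split_indicator)

lemma orbit_count_Un: "orbit_count h w (I \<union> K) \<le> orbit_count h w I + orbit_count h w K"
proof -
  have "orbit_count h w (I \<union> K) \<le> (\<integral>\<^sup>+A. height_fun h I (act A w) + height_fun h K (act A w) \<partial>count_space \<Gamma>)"
    unfolding orbit_count_def orbit_sum_def by (intro nn_integral_mono) (auto simp: height_fun_def split: split_indicator)
  also have "\<dots> = orbit_count h w I + orbit_count h w K" unfolding orbit_count_def orbit_sum_def by (rule nn_integral_add) auto
  finally show ?thesis .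
qed

lemma orbit_count_split: "a \<le> b \<Longrightarrow> b \<le> c \<Longrightarrow> orbit_count h w {a..<c} = orbit_count h w {a..<b} + orbit_count h w {b..<c}"
proof -
  assume ab: "a \<le> b" "b \<le> c"
  have "orbit_count h w {a..<c} = (\<integral>\<^sup>+A. height_fun h {a..<b} (act A w) + height_fun h {b..<c} (act A w) \<partial>count_space \<Gamma>)"
    unfolding orbit_count_def orbit_sum_def using ab by (intro nn_integral_cong) (auto simp: height_fun_def split: split_indicator)
  also have "\<dots> = orbit_count h w {a..<b} + orbit_count h w {b..<c}" unfolding orbit_count_def orbit_sum_def by (rule nn_integral_add) auto
  finally show ?thesis .
qed

lemma orbit_count_measurable [measurable]:
  assumes [measurable]: "h \<in> borel_measurable borel" "I \<in> sets borel"
  shows "(\<lambda>w. orbit_count h w I) \<in> borel_measurable borel"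
  unfolding orbit_count_def by measurable

text \<open>
  After unfolding, the integral over \<open>s\<close> is the length of the interval of those \<open>s\<close> for which the
  apex time lies in \<open>[a, b)\<close>.
\<close>

lemma orbit_count_integral:
  assumes h[measurable]: "h \<in> borel_measurable borel" and ab: "a \<le> b"
  shows "(\<integral>\<^sup>+w. indicator F w * orbit_count h w {a..<b} \<partial>lborel) = 2 * (ennreal (b - a) * (\<integral>\<^sup>+p. h p \<partial>lborel))"
proof -
  have hp: "h \<in> borel_measurable (borel \<Otimes>\<^sub>M borel)" unfolding borel_prod by (rule h)
  have "(\<integral>\<^sup>+w. indicator F w * orbit_count h w {a..<b} \<partial>lborel) = 2 * (\<integral>\<^sup>+w. height_fun h {a..<b} w \<partial>lborel)"
    unfolding orbit_count_def by (rule unfolding_formula) measurable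
  also have "(\<integral>\<^sup>+w. height_fun h {a..<b} w \<partial>lborel) =
    (\<integral>\<^sup>+x. \<integral>\<^sup>+y. \<integral>\<^sup>+s. height_fun h {a..<b} (x, y, s) \<partial>lborel \<partial>lborel \<partial>lborel)"
    by (rule nn_integral_lborel3) measurable
  also have "\<dots> = (\<integral>\<^sup>+x. \<integral>\<^sup>+y. ennreal (b - a) * h (x, y) \<partial>lborel \<partial>lborel)"
  proof (rule nn_integral_cong, rule nn_integral_cong)
    fix x y :: real
    define L where "L = ln \<bar>y\<bar>"
    have "(\<integral>\<^sup>+s. height_fun h {a..<b} (x, y, s) \<partial>lborel) = (\<integral>\<^sup>+s. h (x, y) * indicator {L - b<..L - a} s \<partial>lborel)"
      by (intro nn_integral_cong) (auto simp: height_fun_def apex_time_def L_def split: split_indicator)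
    also have "\<dots> = h (x, y) * emeasure lborel {L - b<..L - a}" by (rule nn_integral_cmult_indicator) simp
    also have "\<dots> = ennreal (b - a) * h (x, y)" using ab by (simp add: mult.commute)
    finally show "(\<integral>\<^sup>+s. height_fun h {a..<b} (x, y, s) \<partial>lborel) = ennreal (b - a) * h (x, y)" .
  qed
  also have "\<dots> = (\<integral>\<^sup>+p. ennreal (b - a) * h p \<partial>(lborel \<Otimes>\<^sub>M lborel))"
    using hp by (intro lborel.nn_integral_fst) (simp add: lborel_prod borel_prod)
  also have "\<dots> = ennreal (b - a) * (\<integral>\<^sup>+p. h p \<partial>lborel)"
    unfolding lborel_prod by (rule nn_integral_cmult) simp
  finally show ?thesis .
qed

lemma AE_of_quot:
  assumes "AE w in quot. P w" shows "AE w in lborel. P w"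
proof -
  from assms obtain N where N: "{w \<in> space quot. \<not> P w} \<subseteq> N" "emeasure quot N = 0" "N \<in> sets quot"
    by (rule AE_E)
  then have "AE w in lborel. w \<notin> N" by (intro null_of_quot) (auto simp: sets_quot Inv_def emeasure_quot)
  then show ?thesis by eventually_elim (use N(1) in auto)
qed

lemma AE_quotI:
  assumes "AE w in lborel. w \<in> B" "B \<in> Inv" shows "AE w in quot. w \<in> B"
proof -
  have B: "- B \<in> Inv" using assms(2) by (auto simp: Inv_def invariant_def)
  have "AE w in lborel. w \<notin> - B \<inter> F" using assms(1) by eventually_elim simp
  then have "emeasure lborel (- B \<inter> F) = 0"
    using B by (subst (asm) AE_iff_measurable[where N = "- B \<inter> F"]) (auto simp: Inv_def)
  then have "- B \<in> null_sets quot" using B by (auto simp: null_sets_def sets_quot emeasure_quot)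
  then have "AE w in quot. w \<notin> - B" by (rule AE_not_in)
  then show ?thesis by simp
qed

text \<open>
  The count over \<open>[0, n)\<close> is the Birkhoff sum of the count \<open>f\<close> over \<open>[0, 1)\<close> along the flow at integer
  times. Moving the starting point changes counts by a bounded amount, so that the sets where
  the sums of \<open>f - c\<close> or \<open>c - f\<close> are unbounded are invariant under the whole flow and \<open>ergodicity\<close>
  applies to them.
\<close>

theorem count_average:
  fixes \<mu> :: real
  assumes h[measurable]: "h \<in> borel_measurable borel"
    and \<mu>: "(\<integral>\<^sup>+p. h p \<partial>lborel) = ennreal \<mu>" "0 \<le> \<mu>"
  shows "AE w in lborel. (\<forall>n::nat. orbit_count h w {- real n..<real n} < \<infinity>) \<and>
    (\<lambda>n. enn2real (orbit_count h w {0..<real n}) / real n) \<longlonglongrightarrow> 2 * \<mu> / measure lborel F"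
proof -
  \<comment> \<open>Infinite counts must be excluded before passing to real numbers; they occur on a null set.\<close>
  define W where "W = {w. \<forall>n::nat. orbit_count h w {- real n..<real n} < \<infinity>}"
  define R where "R w a b = enn2real (orbit_count h w {a..<b})" for w a b
  have fin: "orbit_count h w {a..<b} < \<infinity>" if "w \<in> W" for w a b
  proof -
    obtain n where n: "max \<bar>a\<bar> \<bar>b\<bar> \<le> real n" using real_arch_simple by blast
    have "orbit_count h w {a..<b} \<le> orbit_count h w {- real n..<real n}" by (rule orbit_count_mono) (use n in auto)
    also have "\<dots> < \<infinity>" using that by (auto simp: W_def)
    finally show ?thesis .
  qed
  have R_nn: "0 \<le> R w a b" for w a b by (simp add: R_def)
  have R_cover: "R w a b \<le> R w a1 b1 + R w a2 b2" if w: "w \<in> W" and s: "{a..<b} \<subseteq> {a1..<b1} \<union> {a2..<b2}" for w a b a1 b1 a2 b2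
  proof -
    have "orbit_count h w {a..<b} \<le> orbit_count h w {a1..<b1} + orbit_count h w {a2..<b2}"
      using orbit_count_mono[OF s] orbit_count_Un order_trans by blast
    then have "R w a b \<le> enn2real (orbit_count h w {a1..<b1} + orbit_count h w {a2..<b2})"
      unfolding R_def using fin[OF w] by (intro enn2real_mono) (auto simp: less_top)
    also have "\<dots> = R w a1 b1 + R w a2 b2" unfolding R_def using fin[OF w] by (intro enn2real_plus) auto
    finally show ?thesis .
  qed
  have R_add: "R w a b + R w b c = R w a c" if "w \<in> W" "a \<le> b" "b \<le> c" for w a b c
    unfolding R_def using fin[OF that(1)] orbit_count_split[OF that(2,3)] by (simp add: enn2real_plus)
  have R_flow: "R (flow t w) a b = R w (a + t) (b + t)" for w a b t by (simp add: R_def orbit_count_flow)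
  have R_act: "R (act A w) a b = R w a b" if "w \<in> generic \<Gamma>" "A \<in> \<Gamma>" for A w a b
    using orbit_count_act[OF that] by (simp add: R_def)
  have [measurable]: "(\<lambda>w. R w a b) \<in> borel_measurable borel" for a b unfolding R_def by measurable
  have W_borel: "W \<in> sets borel"
  proof -
    have "W = {w \<in> space borel. \<forall>n::nat. orbit_count h w {- real n..<real n} < \<infinity>}" by (simp add: W_def)
    also have "\<dots> \<in> sets borel" by measurable
    finally show ?thesis .
  qed
  have W_Inv: "W \<in> Inv" using W_borel orbit_count_act by (simp add: Inv_def invariant_def W_def)
  have W_fwd: "flow t w \<in> W" if "w \<in> W" for w t
    unfolding W_def using fin[OF that] by (simp add: orbit_count_flow)
  have W_flow: "flow t w \<in> W \<longleftrightarrow> w \<in> W" for w t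
    using W_fwd[of w t] W_fwd[of "flow t w" "- t"] by auto
  have AE_W_quot: "AE w in quot. w \<in> W"
  proof -
    have "AE w in quot. orbit_count h w {- real n..<real n} \<noteq> \<infinity>" for n :: nat
    proof (rule nn_integral_noteq_infinite)
      show m: "(\<lambda>w. orbit_count h w {- real n..<real n}) \<in> borel_measurable quot"
        by (rule quot_measurable_iff) (auto simp: orbit_count_act)
      have "(\<integral>\<^sup>+w. orbit_count h w {- real n..<real n} \<partial>quot) = 2 * (ennreal (2 * real n) * ennreal \<mu>)"
        using orbit_count_integral[OF h, of "- real n" "real n"] by (subst nn_integral_quot[OF m]) (auto simp: \<mu>)
      then show "(\<integral>\<^sup>+w. orbit_count h w {- real n..<real n} \<partial>quot) \<noteq> \<infinity>"
        by (simp add: ennreal_mult_eq_top_iff)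
    qed
    then have "AE w in quot. \<forall>n::nat. orbit_count h w {- real n..<real n} \<noteq> \<infinity>" by (subst AE_all_countable) auto
    then show ?thesis by eventually_elim (simp add: W_def less_top)
  qed
  define f where "f w = R w 0 1" for w
  have f_m[measurable]: "f \<in> borel_measurable borel" unfolding f_def[abs_def] by measurable
  have f_q: "f \<in> borel_measurable quot"
    by (rule quot_measurable_iff[OF f_m]) (simp add: f_def R_act)
  have pow: "(flow 1 ^^ i) w = flow (real i) w" for i w
    by (induction i) (simp_all add: add.commute)
  have S: "(\<Sum>i<n. f ((flow 1 ^^ i) w)) = R w 0 (real n)" if w: "w \<in> W" for n w
  proof (induction n)
    case 0 have "R w 0 0 = 0" by (simp add: R_def orbit_count_def orbit_sum_def height_fun_def) then show ?case by simp
  next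
    case (Suc n)
    then show ?case using R_add[OF w, of 0 "real n" "real (Suc n)"] by (simp add: pow f_def R_flow add.commute)
  qed
  have int_f: "(\<integral>\<^sup>+w. ennreal (f w) \<partial>quot) = ennreal (2 * \<mu>)"
  proof -
    have m: "(\<lambda>w. orbit_count h w {0..<1}) \<in> borel_measurable quot"
      by (rule quot_measurable_iff) (auto simp: orbit_count_act)
    have "(\<integral>\<^sup>+w. ennreal (f w) \<partial>quot) = (\<integral>\<^sup>+w. orbit_count h w {0..<1} \<partial>quot)"
      by (rule nn_integral_cong_AE, use AE_W_quot in eventually_elim) (use fin in \<open>simp add: f_def R_def less_top\<close>)
    also have "\<dots> = 2 * (ennreal 1 * ennreal \<mu>)"
      using orbit_count_integral[OF h, of 0 1] by (subst nn_integral_quot[OF m]) (auto simp: \<mu>)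
    also have "\<dots> = ennreal (2 * \<mu>)" using \<mu>(2) by (simp add: ennreal_mult')
    finally show ?thesis .
  qed
  have f_nn: "0 \<le> f w" for w by (simp add: f_def R_nn)
  have f_int: "integrable quot f"
    by (rule integrableI_nonneg[OF f_q]) (auto simp: f_nn int_f)
  have f_val: "(\<integral>w. f w \<partial>quot) = 2 * \<mu>"
    using \<mu>(2) by (subst integral_eq_nn_integral[OF f_q]) (auto simp: f_nn int_f)
  have dichotomy: "(AE w in quot. P w) \<or> (AE w in quot. \<not> P w)"
    if B: "W \<inter> {w. P w} \<in> sets borel"
      and inv: "\<And>w A. w \<in> W \<Longrightarrow> w \<in> generic \<Gamma> \<Longrightarrow> A \<in> \<Gamma> \<Longrightarrow> P (act A w) = P w"
      and fl: "\<And>w t. w \<in> W \<Longrightarrow> P w \<Longrightarrow> P (flow t w)" for P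
  proof -
    have I: "invariant (W \<inter> {w. P w})"
      using W_Inv inv by (auto simp: Inv_def invariant_def)
    have FI: "flow t w \<in> W \<inter> {w. P w} \<longleftrightarrow> w \<in> W \<inter> {w. P w}" for t w
      using fl[of w t] fl[of "flow t w" "- t"] W_flow by auto
    have "flow_inv (W \<inter> {w. P w})" unfolding flow_inv_def using FI by blast
    from ergodicity[OF B I this] show ?thesis
    proof
      assume "AE w in lborel. w \<in> W \<inter> {w. P w}"
      then have "AE w in quot. w \<in> W \<inter> {w. P w}" using B I by (intro AE_quotI) (auto simp: Inv_def)
      then show ?thesis by auto
    next
      assume "AE w in lborel. w \<notin> W \<inter> {w. P w}"
      then have *: "AE w in lborel. w \<in> - (W \<inter> {w. P w})" by eventually_elim blast
      have "invariant (- (W \<inter> {w. P w}))" using I unfolding invariant_def by blast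
      then have "- (W \<inter> {w. P w}) \<in> Inv" using borel_comp[OF B] by (simp add: Inv_def)
      from AE_quotI[OF * this] have "AE w in quot. w \<in> - (W \<inter> {w. P w})" .
      then have "AE w in quot. \<not> P w" using AE_W_quot by eventually_elim auto
      then show ?thesis ..
    qed
  qed
  have nat_C: "(\<forall>C. \<exists>n. C < g n) \<longleftrightarrow> (\<forall>C::nat. \<exists>n. real C < g n)" for g :: "nat \<Rightarrow> real"
    by (metis less_le_trans not_le real_arch_simple order.trans)
  have up: "(AE w in quot. \<forall>C. \<exists>n. C < (\<Sum>i<n. f ((flow 1 ^^ i) w)) - c * real n) \<or>
      (AE w in quot. \<not> (\<forall>C. \<exists>n. C < (\<Sum>i<n. f ((flow 1 ^^ i) w)) - c * real n))" for c
  proof -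
    define P where "P w \<longleftrightarrow> (\<forall>C. \<exists>n. C < R w 0 (real n) - c * real n)" for w
    have "(AE w in quot. P w) \<or> (AE w in quot. \<not> P w)"
    proof (rule dichotomy)
      have "W \<inter> {w. P w} = {w \<in> space borel. w \<in> W \<and> (\<forall>C::nat. \<exists>n. real C < R w 0 (real n) - c * real n)}"
        using nat_C by (auto simp: P_def)
      also have "\<dots> \<in> sets borel" using W_borel by measurable
      finally show "W \<inter> {w. P w} \<in> sets borel" .
      show "P (act A w) = P w" if "w \<in> generic \<Gamma>" "A \<in> \<Gamma>" for w A
        using R_act[OF that] by (simp add: P_def)
      show "P (flow t w)" if w: "w \<in> W" and P: "P w" for w t
        unfolding P_def
      proof
        fix C
        obtain m where m: "\<bar>t\<bar> \<le> real m" using real_arch_simple by blast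
        obtain n where n: "C + c * real m + R w (- real m) (real m) < R w 0 (real n) - c * real n"
          using P unfolding P_def by blast
        have "R w 0 (real n) \<le> R w (- real m) (real m) + R w t (t + real (n + m))"
          by (rule R_cover[OF w]) (use m in auto)
        then have "C < R (flow t w) 0 (real (n + m)) - c * real (n + m)"
          using n by (simp add: R_flow algebra_simps)
        then show "\<exists>n. C < R (flow t w) 0 (real n) - c * real n" by blast
      qed
    qed
    then show ?thesis
    proof
      assume "AE w in quot. P w"
      then have "AE w in quot. \<forall>C. \<exists>n. C < (\<Sum>i<n. f ((flow 1 ^^ i) w)) - c * real n"
        using AE_W_quot by eventually_elim (simp add: P_def S)
      then show ?thesis ..
    next
      assume "AE w in quot. \<not> P w"
      then have "AE w in quot. \<not> (\<forall>C. \<exists>n. C < (\<Sum>i<n. f ((flow 1 ^^ i) w)) - c * real n)"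
        using AE_W_quot by eventually_elim (simp add: P_def S)
      then show ?thesis ..
    qed
  qed
  have dn: "(AE w in quot. \<forall>C. \<exists>n. C < c * real n - (\<Sum>i<n. f ((flow 1 ^^ i) w))) \<or>
      (AE w in quot. \<not> (\<forall>C. \<exists>n. C < c * real n - (\<Sum>i<n. f ((flow 1 ^^ i) w))))" for c
  proof -
    define P where "P w \<longleftrightarrow> (\<forall>C. \<exists>n. C < c * real n - R w 0 (real n))" for w
    have "(AE w in quot. P w) \<or> (AE w in quot. \<not> P w)"
    proof (rule dichotomy)
      have "W \<inter> {w. P w} = {w \<in> space borel. w \<in> W \<and> (\<forall>C::nat. \<exists>n. real C < c * real n - R w 0 (real n))}"
        using nat_C by (auto simp: P_def)
      also have "\<dots> \<in> sets borel" using W_borel by measurable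
      finally show "W \<inter> {w. P w} \<in> sets borel" .
      show "P (act A w) = P w" if "w \<in> generic \<Gamma>" "A \<in> \<Gamma>" for w A
        using R_act[OF that] by (simp add: P_def)
      show "P (flow t w)" if w: "w \<in> W" and P: "P w" for w t
        unfolding P_def
      proof
        fix C
        obtain m where m: "\<bar>t\<bar> \<le> real m" using real_arch_simple by blast
        obtain n where n: "max (\<bar>c\<bar> * real m) (C + c * real m + R w (- real m) (real m)) < c * real n - R w 0 (real n)"
          using P unfolding P_def by blast
        \<comment> \<open>For small \<open>n\<close> the sum cannot be as far below \<open>c n\<close> as \<open>n\<close> was chosen to make it.\<close>
        have nm: "m \<le> n"
        proof (rule ccontr)
          assume "\<not> m \<le> n"
          then have "\<bar>c\<bar> * real n \<le> \<bar>c\<bar> * real m" by (intro mult_left_mono) auto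
          moreover have "c * real n \<le> \<bar>c\<bar> * real n" by (intro mult_right_mono) auto
          ultimately show False using n R_nn[of w 0 "real n"] by auto
        qed
        have "R w t (t + real (n - m)) \<le> R w (- real m) (real m) + R w 0 (real n)"
          by (rule R_cover[OF w]) (use m nm in auto)
        then have "C < c * real (n - m) - R (flow t w) 0 (real (n - m))"
          using n nm by (simp add: R_flow algebra_simps of_nat_diff)
        then show "\<exists>n. C < c * real n - R (flow t w) 0 (real n)" by blast
      qed
    qed
    then show ?thesis
    proof
      assume "AE w in quot. P w"
      then have "AE w in quot. \<forall>C. \<exists>n. C < c * real n - (\<Sum>i<n. f ((flow 1 ^^ i) w))"
        using AE_W_quot by eventually_elim (simp add: P_def S)
      then show ?thesis ..
    next
      assume "AE w in quot. \<not> P w"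
      then have "AE w in quot. \<not> (\<forall>C. \<exists>n. C < c * real n - (\<Sum>i<n. f ((flow 1 ^^ i) w)))"
        using AE_W_quot by eventually_elim (simp add: P_def S)
      then show ?thesis ..
    qed
  qed
  have pos: "0 < measure quot (space quot)"
    unfolding measure_quot using F_pos F_finite by (simp add: measure_def enn2real_positive_iff less_top)
  have "AE w in quot. (\<lambda>n. (\<Sum>i<n. f ((flow 1 ^^ i) w)) / real n) \<longlonglongrightarrow> (\<integral>w. f w \<partial>quot) / measure quot (space quot)"
    by (rule birkhoff_zero_one[OF finite_quot flow_quot flow_preserves f_int pos up dn])
  then have "AE w in quot. w \<in> W \<and> (\<lambda>n. R w 0 (real n) / real n) \<longlonglongrightarrow> 2 * \<mu> / measure lborel F"
    using AE_W_quot by eventually_elim (simp add: S f_val measure_quot[simplified])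
  then have "AE w in lborel. w \<in> W \<and> (\<lambda>n. R w 0 (real n) / real n) \<longlonglongrightarrow> 2 * \<mu> / measure lborel F"
    by (rule AE_of_quot)
  then show ?thesis by (simp add: W_def R_def)
qed

end

section \<open>Existence of a fundamental domain\<close>

lemma mat2_mult_neg:
  fixes X Y :: "real^2^2"
  shows "X ** (- mat 1) = - X" "(- mat 1) ** X = - X" "(- X) ** Y = - (X ** Y)"
  by (simp_all add: mat2_eq_iff matrix_mult_2 mat_def)

lemma moebius_denom_nz:
  assumes "A \<in> SL2R" "z \<in> upper_half"
  shows "of_real (A$2$1) * z + of_real (A$2$2) \<noteq> (0::complex)"
proof
  assume 0: "of_real (A$2$1) * z + of_real (A$2$2) = (0::complex)"
  then have "Im (of_real (A$2$1) * z + of_real (A$2$2)) = 0" by simp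
  then have c: "A$2$1 = 0" using assms(2) by (simp add: upper_half_def)
  then have "A$2$2 = 0" using 0 by simp
  then show False using c assms(1) by (simp add: SL2R_iff)
qed

lemma Im_moebius:
  assumes A: "A \<in> SL2R" and z: "z \<in> upper_half"
  shows "Im (moebius A z) = Im z / (cmod (of_real (A$2$1) * z + of_real (A$2$2)))\<^sup>2"
proof -
  define w where "w = of_real (A$2$1) * z + of_real (A$2$2)"
  have "Im ((of_real (A$1$1) * z + of_real (A$1$2)) * cnj w) = Im z * (A$1$1 * A$2$2 - A$1$2 * A$2$1)"
    by (simp add: w_def algebra_simps)
  also have "\<dots> = Im z" using A by (simp add: SL2R_iff)
  finally have n: "Im ((of_real (A$1$1) * z + of_real (A$1$2)) * cnj w) = Im z" .
  have "moebius A z = ((of_real (A$1$1) * z + of_real (A$1$2)) * cnj w) / of_real ((cmod w)\<^sup>2)"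
    unfolding moebius_def w_def[symmetric] complex_norm_square
    using moebius_denom_nz[OF A z, folded w_def] by simp
  then show ?thesis using n by (simp only: Im_divide_of_real w_def)
qed

lemma moebius_upper: "A \<in> SL2R \<Longrightarrow> z \<in> upper_half \<Longrightarrow> moebius A z \<in> upper_half"
  using Im_moebius[of A z] moebius_denom_nz[of A z] by (simp add: upper_half_def)

lemma moebius_mult:
  assumes A: "A \<in> SL2R" and B: "B \<in> SL2R" and z: "z \<in> upper_half"
  shows "moebius (A ** B) z = moebius A (moebius B z)"
proof -
  define n d where "n = of_real (B$1$1) * z + of_real (B$1$2)" and "d = of_real (B$2$1) * z + of_real (B$2$2)"
  have d: "d \<noteq> 0" using moebius_denom_nz[OF B z] by (simp add: d_def)
  have "moebius A (moebius B z) = moebius A (n / d)" by (simp add: moebius_def n_def d_def)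
  also have "\<dots> = (of_real (A$1$1) * n + of_real (A$1$2) * d) / (of_real (A$2$1) * n + of_real (A$2$2) * d)"
  proof -
    have "of_real (A$1$1) * (n / d) + of_real (A$1$2) = (of_real (A$1$1) * n + of_real (A$1$2) * d) / d"
      "of_real (A$2$1) * (n / d) + of_real (A$2$2) = (of_real (A$2$1) * n + of_real (A$2$2) * d) / d"
      using d by (simp_all add: field_simps)
    then show ?thesis unfolding moebius_def using d by simp
  qed
  also have "\<dots> = moebius (A ** B) z"
    unfolding moebius_def n_def d_def matrix_mult_2 by (simp add: algebra_simps)
  finally show ?thesis ..
qed

lemma moebius_one [simp]: "moebius (mat 1) z = z" by (simp add: moebius_def mat_def)

lemma moebius_uminus [simp]: "moebius (- A) z = moebius A z"
proof -
  have "(- p - q) / (- r - s) = (p + q) / (r + s)" for p q r s :: complex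
    using minus_divide_divide[of "p + q" "r + s"] by simp
  then show ?thesis by (simp add: moebius_def)
qed

lemma deriv_moebius:
  assumes A: "A \<in> SL2R" and z: "z \<in> upper_half"
  shows "deriv (moebius A) z = 1 / (of_real (A$2$1) * z + of_real (A$2$2))\<^sup>2"
proof -
  define D where "D = of_real (A$2$1) * z + complex_of_real (A$2$2)"
  have D0: "D \<noteq> 0" using moebius_denom_nz[OF A z] by (simp add: D_def)
  have det: "complex_of_real (A$1$1) * of_real (A$2$2) - of_real (A$1$2) * of_real (A$2$1) = 1"
    using A unfolding SL2R_iff by (metis of_real_1 of_real_diff of_real_mult)
  have "((\<lambda>z. (of_real (A$1$1) * z + of_real (A$1$2)) / (of_real (A$2$1) * z + of_real (A$2$2)))
     has_field_derivative (of_real (A$1$1) * D - (of_real (A$1$1) * z + of_real (A$1$2)) * of_real (A$2$1)) / (D * D)) (at z)"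
    using D0 by (auto intro!: derivative_eq_intros simp: D_def)
  moreover have "of_real (A$1$1) * D - (of_real (A$1$1) * z + of_real (A$1$2)) * of_real (A$2$1) = 1"
    unfolding D_def using det by algebra
  ultimately have "(moebius A has_field_derivative 1 / D\<^sup>2) (at z)"
    by (simp add: moebius_def[abs_def] power2_eq_square)
  then show ?thesis unfolding D_def by (rule DERIV_imp_deriv)
qed

lemma moebius_measurable [measurable]: "moebius A \<in> borel_measurable borel"
  unfolding moebius_def[abs_def] by measurable

text \<open>
  \<open>act\<close> is the Moebius action read in coordinates. The second statement expresses the denominator at
  the base point, which determines how the direction turns.
\<close>

lemma moebius_pt:
  assumes A: "A \<in> SL2R" and k: "cocycle A (fst w) \<noteq> 0"
  shows "moebius A (pt w) = pt (act A w)"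
    and "of_real (A$2$1) * pt w + of_real (A$2$2) =
      Complex (fst (snd (act A w))) (exp (snd (snd (act A w)))) /
        (of_real (cocycle A (fst w)) * Complex (fst (snd w)) (exp (snd (snd w))))"
proof -
  obtain x a s where w: "w = (x, a, s)" by (metis surj_pair)
  define kk where "kk = complex_of_real (cocycle A x)"
  define W where "W = Complex a (exp s)"
  define c al be de where "c = complex_of_real (A$2$1)" and "al = complex_of_real (A$1$1)"
    and "be = complex_of_real (A$1$2)" and "de = complex_of_real (A$2$2)"
  define X where "X = complex_of_real x"
  have kk: "kk = c * X + de" by (simp add: kk_def cocycle_def c_def de_def X_def)
  have kk0: "kk \<noteq> 0" using k by (simp add: kk_def w)
  have W0: "W \<noteq> 0" by (simp add: W_def)
  have det: "al * de - be * c = 1"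
  proof -
    have "A$1$1 * A$2$2 - A$1$2 * A$2$1 = 1" using A by (simp add: SL2R_iff)
    then show ?thesis unfolding al_def de_def be_def c_def by (metis of_real_1 of_real_diff of_real_mult)
  qed
  have es: "exp (s + 2 * ln \<bar>cocycle A x\<bar>) = exp s * (cocycle A x)\<^sup>2"
    using k by (simp add: w exp_add exp_double power2_eq_square[symmetric])
  have W': "Complex (fst (snd (act A w))) (exp (snd (snd (act A w)))) = kk * (kk * W - c)"
    by (simp add: w act_def es complex_eq_iff kk_def W_def c_def power2_eq_square algebra_simps)
  have W'0: "kk * W - c \<noteq> 0"
  proof -
    have "kk * (kk * W - c) \<noteq> 0" unfolding W'[symmetric] by simp
    then show ?thesis by simp
  qed
  have p: "pt w = X - 1 / W" by (simp add: pt_def w X_def W_def)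
  have den: "c * pt w + de = (kk * W - c) / W" unfolding p kk using W0 by (simp add: field_simps)
  have num: "al * pt w + be = ((al * X + be) * W - al) / W" unfolding p using W0 by (simp add: field_simps)
  show 2: "of_real (A$2$1) * pt w + of_real (A$2$2) =
      Complex (fst (snd (act A w))) (exp (snd (snd (act A w)))) /
        (of_real (cocycle A (fst w)) * Complex (fst (snd w)) (exp (snd (snd w))))"
    unfolding W' using den kk0 by (simp add: w kk_def[symmetric] W_def[symmetric] c_def[symmetric] de_def[symmetric])
  have "pt (act A w) = (al * X + be) / kk - 1 / (kk * (kk * W - c))"
    using W' by (simp add: pt_def w act_def kk_def al_def be_def X_def)
  also have "\<dots> = ((al * X + be) * (kk * W - c) - 1) / (kk * (kk * W - c))"
    using kk0 W'0 by (simp add: field_simps)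
  also have "(al * X + be) * (kk * W - c) - 1 = kk * ((al * X + be) * W - al)"
    unfolding kk using det by algebra
  also have "\<dots> / (kk * (kk * W - c)) = ((al * X + be) * W - al) / (kk * W - c)" using kk0 by simp
  also have "\<dots> = moebius A (pt w)"
    unfolding moebius_def c_def[symmetric] al_def[symmetric] be_def[symmetric] de_def[symmetric] den num using W0 by simp
  finally show "moebius A (pt w) = pt (act A w)" ..
qed

context sl2_group
begin

text \<open>
  Points with a nontrivial stabilizer. They form a countable set, because a Moebius transformation
  other than the identity has at most two fixed points.
\<close>

definition elliptic :: "complex set" where
  "elliptic = {z \<in> upper_half. \<exists>A\<in>\<Gamma>. A \<noteq> mat 1 \<and> A \<noteq> - mat 1 \<and> moebius A z = z}"

lemma moebius_act: "w \<in> generic \<Gamma> \<Longrightarrow> A \<in> \<Gamma> \<Longrightarrow> moebius A (pt w) = pt (act A w)"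
  by (rule moebius_pt(1)) (auto simp: generic_def in_SL2R)

lemma moebius_in: "A \<in> \<Gamma> \<Longrightarrow> z \<in> upper_half \<Longrightarrow> moebius A z \<in> upper_half"
  by (rule moebius_upper[OF in_SL2R])

lemma moebius_comp: "A \<in> \<Gamma> \<Longrightarrow> B \<in> \<Gamma> \<Longrightarrow> z \<in> upper_half \<Longrightarrow> moebius A (moebius B z) = moebius (A ** B) z"
  using moebius_mult[OF in_SL2R in_SL2R] by simp

lemma moebius_adj: "A \<in> \<Gamma> \<Longrightarrow> z \<in> upper_half \<Longrightarrow> moebius (adj2 A) (moebius A z) = z"
  "A \<in> \<Gamma> \<Longrightarrow> z \<in> upper_half \<Longrightarrow> moebius A (moebius (adj2 A) z) = z"
  by (simp_all add: moebius_comp adj2_mult[OF in_SL2R])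

lemma orbit_self: "z \<in> orbit \<Gamma> z"
  unfolding orbit_def by (rule image_eqI[of _ _ "mat 1"]) auto

lemma countable_elliptic: "countable elliptic"
proof -
  have "elliptic \<subseteq> (\<Union>A\<in>\<Gamma> - {mat 1, - mat 1}. {z \<in> upper_half. moebius A z = z})"
    by (auto simp: elliptic_def)
  moreover have "countable (\<Union>A\<in>\<Gamma> - {mat 1, - mat 1}. {z \<in> upper_half. moebius A z = z})"
  proof (rule countable_UN)
    show "countable (\<Gamma> - {mat 1, - mat 1})" using countable_group by (rule countable_Diff)
    fix A assume A: "A \<in> \<Gamma> - {mat 1, - mat 1}"
    define p where "p = [:- complex_of_real (A$1$2), complex_of_real (A$2$2 - A$1$1), complex_of_real (A$2$1):]"
    have "p \<noteq> 0"
    proof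
      assume "p = 0"
      then have z: "A$1$2 = 0" "A$2$2 = A$1$1" "A$2$1 = 0" by (auto simp: p_def)
      then have "(A$1$1)\<^sup>2 = 1" using det1[of A] A by (simp add: power2_eq_square)
      then have "A$1$1 = 1 \<or> A$1$1 = -1" by (simp add: power2_eq_1_iff)
      then have "A = mat 1 \<or> A = - mat 1" using z by (auto simp: mat2_eq_iff mat_def)
      then show False using A by auto
    qed
    then have "finite {z. poly p z = 0}" by (rule poly_roots_finite)
    moreover have "{z \<in> upper_half. moebius A z = z} \<subseteq> {z. poly p z = 0}"
    proof
      fix z assume z: "z \<in> {z \<in> upper_half. moebius A z = z}"
      then have "of_real (A$1$1) * z + of_real (A$1$2) = z * (of_real (A$2$1) * z + of_real (A$2$2))"
        using moebius_denom_nz[of A z] A in_SL2R by (auto simp: moebius_def divide_eq_eq)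
      then show "z \<in> {z. poly p z = 0}" by (simp add: p_def algebra_simps)
    qed
    ultimately show "countable {z \<in> upper_half. moebius A z = z}" by (meson countable_finite countable_subset)
  qed
  ultimately show ?thesis by (rule countable_subset)
qed

lemma elliptic_moebius: assumes A: "A \<in> \<Gamma>" and z: "z \<in> upper_half"
  shows "moebius A z \<in> elliptic \<longleftrightarrow> z \<in> elliptic"
proof -
  have *: "moebius A z \<in> elliptic" if A: "A \<in> \<Gamma>" and z: "z \<in> elliptic" for A z
  proof -
    from z obtain B where zu: "z \<in> upper_half" and B: "B \<in> \<Gamma>" "B \<noteq> mat 1" "B \<noteq> - mat 1" "moebius B z = z"
      by (auto simp: elliptic_def)
    define C where "C = A ** B ** adj2 A"
    have C: "C \<in> \<Gamma>" using A B by (simp add: C_def)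
    have B': "B = adj2 A ** C ** A"
      using adj2_mult[OF in_SL2R[OF A]] unfolding C_def
      by (metis matrix_mul_assoc matrix_mul_lid matrix_mul_rid)
    have "C \<noteq> mat 1" using B(2) B' adj2_mult[OF in_SL2R[OF A]] by (auto simp: matrix_mul_rid)
    moreover have "C \<noteq> - mat 1"
    proof
      assume "C = - mat 1"
      then have "B = - (adj2 A ** A)" using B' by (simp add: mat2_mult_neg)
      then show False using B(3) adj2_mult[OF in_SL2R[OF A]] by simp
    qed
    moreover have "moebius C (moebius A z) = moebius A z"
      using A B zu adj2_mult[OF in_SL2R[OF A]] unfolding C_def
      by (simp add: moebius_comp[symmetric] moebius_in moebius_adj)
    ultimately show ?thesis using C zu A by (auto simp: elliptic_def moebius_in)
  qed
  show ?thesis using *[OF A, of z] *[OF adj_in[OF A], of "moebius A z"] moebius_adj(1)[OF A z] by auto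
qed

lemma moebius_eq_imp:
  assumes z: "z \<in> upper_half" "z \<notin> elliptic" and A: "A \<in> \<Gamma>" and B: "B \<in> \<Gamma>" and e: "moebius A z = moebius B z"
  shows "A = B \<or> A = - B"
proof -
  have "moebius (adj2 B ** A) z = z"
    using e A B z by (simp add: moebius_comp[symmetric] moebius_adj)
  then have "adj2 B ** A = mat 1 \<or> adj2 B ** A = - mat 1"
    using z A B by (auto simp: elliptic_def)
  moreover have "A = B ** (adj2 B ** A)"
    using adj2_mult[OF in_SL2R[OF B]] by (simp add: matrix_mul_assoc matrix_mul_lid)
  ultimately show ?thesis by (auto simp: matrix_mul_rid mat2_mult_neg)
qed

text \<open>
  Proper discontinuity. If \<open>z\<close> and its image lie in \<open>K\<close>, the formula for the height of the image bounds
  the denominator \<open>c z + d\<close>, and then the numerator; as \<open>z\<close> stays away from the real line, the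
  entries are bounded, and a bounded part of a discrete group is finite.
\<close>

lemma finite_return:
  assumes m: "0 < m" and K: "\<And>z. z \<in> K \<Longrightarrow> m \<le> Im z \<and> cmod z \<le> M"
  shows "finite {A \<in> \<Gamma>. \<exists>z\<in>K. moebius A z \<in> K}"
proof (rule finite_of_bounded)
  \<comment> \<open>\<open>D\<close> bounds the denominator, \<open>M * D\<close> the numerator, and \<open>E\<close> adds up the bounds \<open>row\<close> for both rows.\<close>
  define D where "D = sqrt (M / m)"
  define E where "E = D / m + (D + D / m * M) + (M * D / m + (M * D + M * D / m * M))"
  show "bounded {A \<in> \<Gamma>. \<exists>z\<in>K. moebius A z \<in> K}"
    unfolding bounded_iff
  proof (intro exI[of _ E] ballI)
    fix A assume "A \<in> {A \<in> \<Gamma>. \<exists>z\<in>K. moebius A z \<in> K}"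
    then obtain z where A: "A \<in> \<Gamma>" and z: "z \<in> K" "moebius A z \<in> K" by blast
    have zu: "z \<in> upper_half" using K[OF z(1)] m by (auto simp: upper_half_def)
    define q where "q = of_real (A$2$1) * z + complex_of_real (A$2$2)"
    define p where "p = of_real (A$1$1) * z + complex_of_real (A$1$2)"
    have q0: "q \<noteq> 0" using moebius_denom_nz[OF in_SL2R[OF A] zu] by (simp add: q_def)
    have M0: "0 \<le> M" using K[OF z(1)] norm_ge_zero[of z] by linarith
    have "Im (moebius A z) = Im z / (cmod q)\<^sup>2" using Im_moebius[OF in_SL2R[OF A] zu] by (simp add: q_def)
    then have "m * (cmod q)\<^sup>2 \<le> Im z" using K[OF z(2)] q0 by (simp add: le_divide_eq)
    also have "Im z \<le> M" using K[OF z(1)] abs_Im_le_cmod[of z] by linarith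
    finally have "(cmod q)\<^sup>2 \<le> M / m" using m by (simp add: field_simps)
    then have qD: "cmod q \<le> D" unfolding D_def by (rule real_le_rsqrt)
    have D0: "0 \<le> D" using qD norm_ge_zero[of q] by linarith
    have row: "\<bar>u\<bar> \<le> R / m \<and> \<bar>v\<bar> \<le> R + R / m * M" if r: "cmod (of_real u * z + of_real v) \<le> R" for u v R
    proof -
      have "\<bar>u\<bar> * Im z = \<bar>Im (of_real u * z + of_real v)\<bar>" using K[OF z(1)] m by (simp add: abs_mult)
      also have "\<dots> \<le> R" using abs_Im_le_cmod r order_trans by blast
      finally have "\<bar>u\<bar> * m \<le> R" using K[OF z(1)] mult_left_mono[of m "Im z" "\<bar>u\<bar>"] by auto
      then have u: "\<bar>u\<bar> \<le> R / m" using m by (simp add: le_divide_eq)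
      have "\<bar>v\<bar> = cmod ((of_real u * z + of_real v) - of_real u * z)" by simp
      also have "\<dots> \<le> R + \<bar>u\<bar> * cmod z" using norm_triangle_ineq4[of "of_real u * z + of_real v" "of_real u * z"] r by (simp add: norm_mult)
      also have "\<bar>u\<bar> * cmod z \<le> R / m * M" using u K[OF z(1)] by (intro mult_mono) auto
      finally show ?thesis using u by simp
    qed
    have "cmod p = cmod (moebius A z) * cmod q" using q0 by (simp add: moebius_def p_def q_def norm_divide)
    also have "\<dots> \<le> M * D" using K[OF z(2)] qD M0 by (intro mult_mono) auto
    finally have pM: "cmod p \<le> M * D" .
    have "norm A \<le> (\<Sum>i\<in>UNIV. norm (A$i))" unfolding norm_vec_def[of A] by (rule L2_set_le_sum) simp
    also have "\<dots> \<le> (\<Sum>i\<in>UNIV. \<Sum>j\<in>UNIV. \<bar>A$i$j\<bar>)" by (intro sum_mono norm_le_l1_cart)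
    also have "\<dots> = (\<bar>A$1$1\<bar> + \<bar>A$1$2\<bar>) + (\<bar>A$2$1\<bar> + \<bar>A$2$2\<bar>)" by (simp add: sum_2)
    also have "\<dots> \<le> E"
      using row[OF qD[unfolded q_def]] row[OF pM[unfolded p_def]] unfolding E_def by linarith
    finally show "norm A \<le> E" .
  qed
qed auto

text \<open>
  Only finitely many elements move a ball around \<open>z0\<close> to meet itself; each of them moves \<open>z0\<close>, hence also
  a smaller ball off itself.
\<close>

lemma wandering_nbhd:
  assumes z0: "z0 \<in> upper_half" "z0 \<notin> elliptic"
  shows "\<exists>U. open U \<and> z0 \<in> U \<and> U \<subseteq> upper_half \<and> (\<forall>A\<in>\<Gamma>. A \<noteq> mat 1 \<longrightarrow> A \<noteq> - mat 1 \<longrightarrow> (\<forall>z\<in>U. moebius A z \<notin> U))"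
proof -
  define m where "m = Im z0 / 2"
  have m: "0 < m" using z0 by (simp add: m_def upper_half_def)
  define S where "S = {A \<in> \<Gamma>. \<exists>z\<in>ball z0 m. moebius A z \<in> ball z0 m} - {mat 1, - mat 1}"
  have Kb: "m \<le> Im z \<and> cmod z \<le> cmod z0 + m" if "z \<in> ball z0 m" for z
  proof
    have "cmod (z0 - z) < m" using that by (simp add: dist_norm)
    moreover have "\<bar>Im (z0 - z)\<bar> \<le> cmod (z0 - z)" by (rule abs_Im_le_cmod)
    ultimately show "m \<le> Im z" by (simp add: m_def)
    show "cmod z \<le> cmod z0 + m" using \<open>cmod (z0 - z) < m\<close> norm_triangle_ineq2[of z z0] by (simp add: norm_minus_commute)
  qed
  have fS: "finite S" unfolding S_def by (rule finite_Diff, rule finite_return[OF m Kb])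
  have "\<forall>A\<in>S. \<forall>\<^sub>F r in at_right 0. \<forall>z\<in>ball z0 r. moebius A z \<notin> ball z0 r"
  proof
    fix A assume A: "A \<in> S"
    then have AG: "A \<in> \<Gamma>" "A \<noteq> mat 1" "A \<noteq> - mat 1" by (auto simp: S_def)
    have ne: "moebius A z0 \<noteq> z0" using z0 AG by (auto simp: elliptic_def)
    define e where "e = dist (moebius A z0) z0 / 2"
    have e: "0 < e" using ne by (simp add: e_def)
    have "isCont (moebius A) z0"
      unfolding moebius_def[abs_def] using moebius_denom_nz[OF in_SL2R[OF AG(1)] z0(1)] by (intro continuous_intros) auto
    then obtain d where d: "0 < d" "\<And>z. dist z z0 < d \<Longrightarrow> dist (moebius A z) (moebius A z0) < e"
      using e unfolding continuous_at_eps_delta by blast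
    show "\<forall>\<^sub>F r in at_right 0. \<forall>z\<in>ball z0 r. moebius A z \<notin> ball z0 r"
      unfolding eventually_at_right_field
    proof (intro exI[of _ "min d e"] conjI allI impI ballI)
      show "0 < min d e" using d e by simp
      fix r z assume r: "0 < r" "r < min d e" and z: "z \<in> ball z0 r"
      have "dist (moebius A z) (moebius A z0) < e" using d(2)[of z] z r by (simp add: dist_commute)
      moreover have "dist (moebius A z0) z0 \<le> dist (moebius A z) (moebius A z0) + dist (moebius A z) z0"
        by (rule dist_triangle3)
      ultimately have "e < dist (moebius A z) z0" by (simp add: e_def)
      then show "moebius A z \<notin> ball z0 r" using r by (simp add: dist_commute)
    qed
  qed
  then have "\<forall>\<^sub>F r in at_right 0. \<forall>A\<in>S. \<forall>z\<in>ball z0 r. moebius A z \<notin> ball z0 r"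
    by (rule eventually_ball_finite[OF fS])
  moreover have "\<forall>\<^sub>F r in at_right 0. 0 < r \<and> r < m"
    unfolding eventually_at_right_field using m by blast
  ultimately have "\<forall>\<^sub>F r in at_right 0. (\<forall>A\<in>S. \<forall>z\<in>ball z0 r. moebius A z \<notin> ball z0 r) \<and> 0 < r \<and> r < m"
    by eventually_elim simp
  then obtain r where r: "\<forall>A\<in>S. \<forall>z\<in>ball z0 r. moebius A z \<notin> ball z0 r" "0 < r" "r < m"
    using eventually_happens'[OF trivial_limit_at_right_real] by blast
  show ?thesis
  proof (intro exI[of _ "ball z0 r"] conjI ballI impI)
    show "ball z0 r \<subseteq> upper_half"
    proof
      fix z assume "z \<in> ball z0 r"
      then have "z \<in> ball z0 m" using r(3) by auto
      then show "z \<in> upper_half" using Kb[of z] m by (auto simp: upper_half_def)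
    qed
    fix A z assume A: "A \<in> \<Gamma>" "A \<noteq> mat 1" "A \<noteq> - mat 1" and z: "z \<in> ball z0 r"
    show "moebius A z \<notin> ball z0 r"
    proof (cases "A \<in> S")
      case True then show ?thesis using r(1) z by blast
    next
      case False
      then have "moebius A z \<notin> ball z0 m" using A z r(3) by (auto simp: S_def)
      then show ?thesis using r(3) by auto
    qed
  qed (use r in auto)
qed

text \<open>
  Cover the non-elliptic points by countably many open sets \<open>U n\<close> that no element other than the
  identity maps to meet themselves. Keep from each \<open>U n\<close> the points whose orbit avoids the earlier sets.
\<close>

lemma exists_domain_plane:
  obtains F0 where "F0 \<in> sets borel" "F0 \<subseteq> upper_half - elliptic"
    "\<And>z. z \<in> upper_half - elliptic \<Longrightarrow> \<exists>B\<in>\<Gamma>. {A \<in> \<Gamma>. moebius A z \<in> F0} = {B, - B}"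
proof -
  obtain \<B> :: "complex set set" where \<B>: "countable \<B>" "topological_basis \<B>"
    using ex_countable_basis by blast
  define good where "good U \<longleftrightarrow> open U \<and> U \<subseteq> upper_half \<and> (\<forall>A\<in>\<Gamma>. A \<noteq> mat 1 \<longrightarrow> A \<noteq> - mat 1 \<longrightarrow> (\<forall>z\<in>U. moebius A z \<notin> U))" for U
  define \<U> where "\<U> = insert {} {U \<in> \<B>. good U}"
  have c\<U>: "countable \<U>" unfolding \<U>_def using \<B>(1) by (auto intro: countable_subset[of _ \<B>])
  have good: "good U" if "U \<in> \<U>" for U using that by (auto simp: \<U>_def good_def)
  define U where "U = from_nat_into \<U>"
  have rU: "range U = \<U>" unfolding U_def by (rule range_from_nat_into[OF _ c\<U>]) (simp add: \<U>_def)
  have gU: "good (U n)" for n using rU good by auto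
  have cover: "\<exists>n. z \<in> U n" if z: "z \<in> upper_half - elliptic" for z
  proof -
    obtain V where V: "open V" "z \<in> V" "good V" using wandering_nbhd[of z] z unfolding good_def by blast
    obtain b where b: "b \<in> \<B>" "z \<in> b" "b \<subseteq> V" using topological_basisE[OF \<B>(2) V(1,2)] by blast
    have "good b" using V b topological_basis_open[OF \<B>(2) b(1)] unfolding good_def by blast
    then have "b \<in> \<U>" using b by (simp add: \<U>_def)
    then show ?thesis using b rU by (metis rangeE)
  qed
  define sat where "sat V = {z \<in> upper_half. \<exists>A\<in>\<Gamma>. moebius A z \<in> V}" for V
  have sat_inv: "moebius A z \<in> sat V \<longleftrightarrow> z \<in> sat V" if A: "A \<in> \<Gamma>" and z: "z \<in> upper_half" for A z V
  proof -
    have *: "z \<in> sat V \<Longrightarrow> A \<in> \<Gamma> \<Longrightarrow> moebius A z \<in> sat V" for A z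
    proof -
      assume zs: "z \<in> sat V" and A: "A \<in> \<Gamma>"
      then obtain B where B: "B \<in> \<Gamma>" "moebius B z \<in> V" and zu: "z \<in> upper_half" by (auto simp: sat_def)
      have "moebius (B ** adj2 A) (moebius A z) = moebius B z"
        using A B zu by (simp add: moebius_comp[symmetric] moebius_in moebius_adj)
      then show "moebius A z \<in> sat V" using A B zu by (auto simp: sat_def moebius_in intro!: bexI[of _ "B ** adj2 A"])
    qed
    show ?thesis using *[of z A] *[of "moebius A z" "adj2 A"] A z by (auto simp: moebius_adj)
  qed
  have sat_borel: "sat V \<in> sets borel" if "V \<in> sets borel" for V
  proof -
    have "sat V = (\<Union>A\<in>\<Gamma>. upper_half \<inter> moebius A -` V)" by (auto simp: sat_def)
    also have "\<dots> \<in> sets borel"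
      using measurable_sets[OF moebius_measurable that]
      by (intro sets.countable_UN'[OF countable_group] sets.Int) auto
    finally show ?thesis .
  qed
  have Ub: "U n \<in> sets borel" for n using gU[of n] by (simp add: good_def)
  have ell_b: "elliptic \<in> sets borel"
    by (rule sets.countable[OF _ countable_elliptic]) simp
  define F0 where "F0 = (\<Union>n. U n - (\<Union>m<n. sat (U m))) - elliptic"
  show ?thesis
  proof (rule that)
    show "F0 \<in> sets borel" unfolding F0_def using Ub sat_borel ell_b by auto
    show "F0 \<subseteq> upper_half - elliptic" using gU by (auto simp: F0_def good_def)
    fix z assume z: "z \<in> upper_half - elliptic"
    define n where "n = (LEAST n. z \<in> sat (U n))"
    have "\<exists>n. z \<in> sat (U n)"
    proof -
      obtain n where "z \<in> U n" using cover[OF z] by blast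
      then have "z \<in> sat (U n)" using z by (auto simp: sat_def intro!: bexI[of _ "mat 1"])
      then show ?thesis ..
    qed
    then have n: "z \<in> sat (U n)" "\<And>m. m < n \<Longrightarrow> z \<notin> sat (U m)"
      unfolding n_def by (auto intro: LeastI_ex dest: not_less_Least)
    then obtain B where B: "B \<in> \<Gamma>" "moebius B z \<in> U n" by (auto simp: sat_def)
    have BF: "moebius B z \<in> F0"
      unfolding F0_def using B n(2) z by (auto simp: sat_inv elliptic_moebius)
    have uniq: "A = B \<or> A = - B" if A: "A \<in> \<Gamma>" and AF: "moebius A z \<in> F0" for A
    proof -
      from AF obtain k where k: "moebius A z \<in> U k" "\<And>m. m < k \<Longrightarrow> moebius A z \<notin> sat (U m)"
        by (auto simp: F0_def)
      have zk: "z \<in> sat (U k)" using k(1) A z by (auto simp: sat_def)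
      have "\<not> n < k" using k(2) n(1) A z by (auto simp: sat_inv)
      moreover have "\<not> k < n" using zk n(2) by auto
      ultimately have kn: "k = n" by simp
      define C where "C = A ** adj2 B"
      have C: "C \<in> \<Gamma>" using A B by (simp add: C_def)
      have "moebius C (moebius B z) = moebius A z"
        using A B z unfolding C_def by (simp add: moebius_comp[symmetric] moebius_in moebius_adj)
      then have "C = mat 1 \<or> C = - mat 1"
        using gU[of n] C B(2) k(1) kn unfolding good_def by metis
      moreover have "A = C ** B"
        using adj2_mult[OF in_SL2R[OF B(1)]] unfolding C_def by (simp add: matrix_mul_assoc[symmetric] matrix_mul_rid)
      ultimately show ?thesis by (auto simp: matrix_mul_lid mat2_mult_neg)
    qed
    show "\<exists>B\<in>\<Gamma>. {A \<in> \<Gamma>. moebius A z \<in> F0} = {B, - B}"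
      using B BF uniq by (intro bexI[of _ B]) auto
  qed
qed

text \<open>
  Lift the plane domain \<open>F0\<close> to all directions. The area of the orbifold is defined as a supremum over
  sets \<open>E\<close> that embed into the quotient; it is attained by \<open>F0\<close>, because unfolding the indicator of
  \<open>E\<close> over \<open>F\<close> shows that \<open>E\<close> has at most the area of \<open>F0\<close>.
\<close>

theorem exists_domain:
  assumes fin: "emeasure (orbifold_area \<Gamma>) (space (orbifold_area \<Gamma>)) < \<infinity>"
  obtains F where "sl2_domain \<Gamma> F" "measure lborel F = pi * total_area \<Gamma>"
proof -
  obtain F0 where F0: "F0 \<in> sets borel" "F0 \<subseteq> upper_half - elliptic"
    "\<And>z. z \<in> upper_half - elliptic \<Longrightarrow> \<exists>B\<in>\<Gamma>. {A \<in> \<Gamma>. moebius A z \<in> F0} = {B, - B}"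
    by (rule exists_domain_plane) blast
  define F where "F = generic \<Gamma> \<inter> pt -` F0"
  have Fb[measurable]: "F \<in> sets borel"
    unfolding F_def using measurable_sets[OF pt_measurable F0(1)] by simp
  have ell_b: "elliptic \<in> sets borel"
    by (rule sets.countable[OF _ countable_elliptic]) simp
  have AE_ell: "AE w in lborel. pt w \<notin> elliptic"
  proof -
    have "elliptic \<in> null_sets lborel" by (rule countable_imp_null_set_lborel[OF countable_elliptic])
    then have "AE z in lborel. z \<notin> elliptic" by (rule AE_not_in)
    then have "AE z in lborel. ennreal (1 / (Im z)\<^sup>2) * indicator elliptic z * indicator upper_half z = 0"
      by eventually_elim simp
    then have "(\<integral>\<^sup>+z. ennreal (1 / (Im z)\<^sup>2) * indicator elliptic z * indicator upper_half z \<partial>lborel) =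
        (\<integral>\<^sup>+z. 0 \<partial>(lborel :: complex measure))"
      by (rule nn_integral_cong_AE)
    then have "(\<integral>\<^sup>+z. indicator elliptic z \<partial>hyp_area) = (\<integral>\<^sup>+z. 0 \<partial>(lborel :: complex measure))"
      using ell_b by (subst nn_integral_hyp_area_lborel) simp_all
    then have "(\<integral>\<^sup>+w. indicator elliptic (pt w) \<partial>lborel) = 0"
      using nn_integral_hyp_area_pt[of "indicator elliptic"] ell_b by simp
    then have "AE w in lborel. indicator elliptic (pt w) = (0::ennreal)"
      using ell_b by (subst (asm) nn_integral_0_iff_AE) auto
    then show ?thesis by eventually_elim (auto split: split_indicator_asm)
  qed
  have once: "AE w in lborel. orbit_sum (indicator F) w = 2"
    using AE_ell AE_generic
  proof eventually_elim
    case (elim w)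
    then obtain B where B: "B \<in> \<Gamma>" "{A \<in> \<Gamma>. moebius A (pt w) \<in> F0} = {B, - B}"
      using F0(3)[of "pt w"] by auto
    have "orbit_sum (indicator F) w = (\<integral>\<^sup>+A. indicator {B, - B} A \<partial>count_space \<Gamma>)"
      unfolding orbit_sum_def
    proof (intro nn_integral_cong)
      fix A assume "A \<in> space (count_space \<Gamma>)"
      then have A: "A \<in> \<Gamma>" by simp
      have "act A w \<in> F \<longleftrightarrow> moebius A (pt w) \<in> F0"
        using elim A by (simp add: F_def generic_act moebius_act)
      also have "\<dots> \<longleftrightarrow> A \<in> {B, - B}" using A B(2) by blast
      finally show "indicator F (act A w) = (indicator {B, - B} A :: ennreal)" by (simp add: indicator_def)
    qed
    also have "\<dots> = emeasure (count_space \<Gamma>) {B, - B}" using B(1) by (intro nn_integral_indicator) auto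
    also have "\<dots> = 2" using B(1) neg_neq[OF B(1)] by (subst emeasure_count_space) auto
    finally show ?case .
  qed
  have hypF0: "F0 \<in> sets hyp_area"
    using F0(1,2) unfolding sets_hyp_area sets_restrict_space by auto
  have areaF: "ennreal pi * emeasure hyp_area F0 = emeasure lborel F"
  proof -
    have "ennreal pi * emeasure hyp_area F0 = ennreal pi * (\<integral>\<^sup>+z. indicator F0 z \<partial>hyp_area)" using hypF0 by simp
    also have "\<dots> = (\<integral>\<^sup>+w. indicator F0 (pt w) \<partial>lborel)"
      by (rule nn_integral_hyp_area_pt) (use F0(1) in simp)
    also have "\<dots> = (\<integral>\<^sup>+w. indicator F w \<partial>lborel)"
      by (intro nn_integral_cong_AE, use AE_generic in eventually_elim) (auto simp: F_def split: split_indicator)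
    finally show ?thesis by simp
  qed
  have inj: "inj_on (orbit \<Gamma>) F0"
  proof (rule inj_onI)
    fix z z' assume z: "z \<in> F0" "z' \<in> F0" and e: "orbit \<Gamma> z = orbit \<Gamma> z'"
    have "z' \<in> orbit \<Gamma> z" unfolding e by (rule orbit_self)
    then obtain A where A: "A \<in> \<Gamma>" "z' = moebius A z" by (auto simp: orbit_def)
    obtain B where B: "B \<in> \<Gamma>" "{A \<in> \<Gamma>. moebius A z \<in> F0} = {B, - B}" using F0(2,3) z(1) by blast
    have "A \<in> {B, - B}" using A z B(2) by blast
    moreover have "mat 1 \<in> {B, - B}" using z one_in B(2) by (metis (mono_tags, lifting) mem_Collect_eq moebius_one)
    ultimately have "A = mat 1 \<or> A = - mat 1" by auto
    then have "moebius A z = z" by (elim disjE) simp_all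
    then show "z = z'" using A(2) by simp
  qed
  have space: "space (orbifold_area \<Gamma>) = orbit \<Gamma> ` upper_half"
    by (simp add: orbifold_area_def induced_measure_def space_measure_of_conv)
  have em: "emeasure (orbifold_area \<Gamma>) (space (orbifold_area \<Gamma>)) = induced_emeasure hyp_area (orbit \<Gamma>) (orbit \<Gamma> ` upper_half)"
    unfolding space unfolding orbifold_area_def
  proof (rule emeasure_induced_measure)
    have "orbit \<Gamma> -` (orbit \<Gamma> ` upper_half) \<inter> space hyp_area = space hyp_area" by auto
    then show "orbit \<Gamma> -` (orbit \<Gamma> ` upper_half) \<inter> space hyp_area \<in> sets hyp_area" by (metis sets.top)
  qed simp
  have ge: "emeasure hyp_area F0 \<le> induced_emeasure hyp_area (orbit \<Gamma>) (orbit \<Gamma> ` upper_half)"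
    unfolding induced_emeasure_def using hypF0 inj F0(2) by (intro SUP_upper) auto
  have fin0: "emeasure hyp_area F0 < \<infinity>" using ge fin em by (metis order_le_less_trans)
  have finF: "emeasure lborel F < \<infinity>"
    unfolding areaF[symmetric] using fin0 by (auto simp: ennreal_mult_less_top)
  have posF: "0 < emeasure lborel F"
  proof (rule ccontr)
    assume "\<not> ?thesis"
    then have "AE w in lborel. w \<notin> F" by (intro AE_not_in) (auto simp: null_sets_def)
    then have "(\<integral>\<^sup>+w. indicator F w * orbit_sum (\<lambda>_. 1) w \<partial>lborel) = (\<integral>\<^sup>+w. 0 \<partial>(lborel :: horo_coords measure))"
      by (intro nn_integral_cong_AE) (auto split: split_indicator)
    then have "(\<integral>\<^sup>+w. 1 * orbit_sum (indicator F) w \<partial>lborel) = 0"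
      using unfold_swap[of "indicator F" "\<lambda>_. 1"] by simp
    moreover have "(\<integral>\<^sup>+w. 1 * orbit_sum (indicator F) w \<partial>lborel) = (\<integral>\<^sup>+w. 2 \<partial>(lborel :: horo_coords measure))"
      by (intro nn_integral_cong_AE, use once in eventually_elim) simp
    ultimately show False by (simp add: emeasure_lborel_UNIV)
  qed
  interpret D: sl2_domain \<Gamma> F
    by unfold_locales (use Fb once finF posF in auto)
  have le: "emeasure hyp_area E \<le> emeasure hyp_area F0"
    if E: "E \<in> sets hyp_area" "inj_on (orbit \<Gamma>) E" for E
  proof -
    have Eb: "E \<in> sets borel" "E \<subseteq> upper_half"
      using E(1) upper_half_borel unfolding sets_hyp_area sets_restrict_space by auto
    define E' where "E' = pt -` E"
    have E'b[measurable]: "E' \<in> sets borel" unfolding E'_def using measurable_sets[OF pt_measurable Eb(1)] by simp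
    have le2: "orbit_sum (indicator E') w \<le> 2" if w: "w \<in> F" for w
    proof (cases "\<exists>B\<in>\<Gamma>. act B w \<in> E'")
      case False
      then have "orbit_sum (indicator E') w = (\<integral>\<^sup>+A. 0 \<partial>count_space \<Gamma>)"
        unfolding orbit_sum_def by (intro nn_integral_cong) auto
      then show ?thesis by simp
    next
      case True
      then obtain B where B: "B \<in> \<Gamma>" "act B w \<in> E'" by blast
      have wg: "w \<in> generic \<Gamma>" "pt w \<in> F0" using w by (auto simp: F_def)
      have sub: "A \<in> {B, - B}" if A: "A \<in> \<Gamma>" "act A w \<in> E'" for A
      proof -
        have m: "moebius A (pt w) \<in> E" "moebius B (pt w) \<in> E"
          using A B wg by (auto simp: E'_def moebius_act)
        have orb: "orbit \<Gamma> (moebius C (pt w)) = orbit \<Gamma> (pt w)" if C: "C \<in> \<Gamma>" for C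
        proof
          show "orbit \<Gamma> (moebius C (pt w)) \<subseteq> orbit \<Gamma> (pt w)"
            using C by (auto simp: orbit_def moebius_comp)
          show "orbit \<Gamma> (pt w) \<subseteq> orbit \<Gamma> (moebius C (pt w))"
          proof
            fix z assume "z \<in> orbit \<Gamma> (pt w)"
            then obtain D where D: "D \<in> \<Gamma>" "z = moebius D (pt w)" by (auto simp: orbit_def)
            then have "z = moebius (D ** adj2 C) (moebius C (pt w))"
              using C by (simp add: moebius_comp[symmetric] moebius_in moebius_adj)
            then show "z \<in> orbit \<Gamma> (moebius C (pt w))" using C D by (auto simp: orbit_def)
          qed
        qed
        have "moebius A (pt w) = moebius B (pt w)"
          using E(2) m orb[OF A(1)] orb[OF B(1)] by (auto dest: inj_onD)
        then show ?thesis using moebius_eq_imp[of "pt w" A B] A(1) B(1) wg F0(2) by auto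
      qed
      have "orbit_sum (indicator E') w \<le> (\<integral>\<^sup>+A. indicator {B, - B} A \<partial>count_space \<Gamma>)"
        unfolding orbit_sum_def
      proof (rule nn_integral_mono)
        fix A assume "A \<in> space (count_space \<Gamma>)"
        then show "indicator E' (act A w) \<le> (indicator {B, - B} A :: ennreal)"
          using sub[of A] by (auto split: split_indicator)
      qed
      also have "\<dots> = emeasure (count_space \<Gamma>) {B, - B}" using B(1) by (intro nn_integral_indicator) auto
      also have "\<dots> = 2" using B(1) neg_neq[OF B(1)] by (subst emeasure_count_space) auto
      finally show ?thesis .
    qed
    have "2 * (ennreal pi * emeasure hyp_area E) = 2 * (\<integral>\<^sup>+w. indicator E (pt w) \<partial>lborel)"
      using nn_integral_hyp_area_pt[of "indicator E"] Eb E(1) by simp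
    also have "(\<integral>\<^sup>+w. indicator E (pt w) \<partial>lborel) = (\<integral>\<^sup>+w. indicator E' w \<partial>lborel)"
      by (intro nn_integral_cong) (auto simp: E'_def split: split_indicator)
    also have "2 * \<dots> = (\<integral>\<^sup>+w. indicator F w * orbit_sum (indicator E') w \<partial>lborel)"
      by (rule D.unfolding_formula[symmetric]) simp
    also have "\<dots> \<le> (\<integral>\<^sup>+w. 2 * indicator F w \<partial>lborel)"
      by (rule nn_integral_mono) (use le2 in \<open>auto split: split_indicator\<close>)
    also have "\<dots> = 2 * (ennreal pi * emeasure hyp_area F0)" by (simp add: nn_integral_cmult areaF)
    finally have "ennreal pi * emeasure hyp_area E \<le> ennreal pi * emeasure hyp_area F0"
      by (subst (asm) ennreal_mult_le_mult_iff) auto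
    then show ?thesis by (subst (asm) ennreal_mult_le_mult_iff) auto
  qed
  have "induced_emeasure hyp_area (orbit \<Gamma>) (orbit \<Gamma> ` upper_half) \<le> emeasure hyp_area F0"
    unfolding induced_emeasure_def by (rule SUP_least) (use le in blast)
  then have "emeasure (orbifold_area \<Gamma>) (space (orbifold_area \<Gamma>)) = emeasure hyp_area F0"
    using ge em by (metis antisym)
  then have ta: "total_area \<Gamma> = measure hyp_area F0" by (simp add: total_area_def measure_def)
  have "measure lborel F = pi * total_area \<Gamma>"
    unfolding ta measure_def areaF[symmetric] by (simp add: enn2real_mult)
  then show ?thesis using that D.sl2_domain_axioms by blast
qed

end

section \<open>Geodesics in horospherical coordinates\<close>

definition geo :: "horo_coords \<Rightarrow> real \<Rightarrow> complex" where
  "geo w t = pt (flow t w)"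

lemma geo_eq: "geo (x, a, s) t = of_real x - 1 / Complex a (exp (s + t))"
  by (simp add: geo_def pt_def flow_def)

lemma Complex_exp_deriv:
  "((\<lambda>t. Complex a (exp (s + t))) has_vector_derivative \<i> * of_real (exp (s + t))) (at t)"
proof -
  have "((\<lambda>t. of_real a + \<i> * of_real (exp (s + t))) has_vector_derivative \<i> * of_real (exp (s + t))) (at t)"
    by (auto intro!: derivative_eq_intros has_vector_derivative_of_real simp: has_real_derivative_iff_has_vector_derivative[symmetric])
  then show ?thesis by (simp add: Complex_eq)
qed

lemma geo_deriv:
  "(geo (x, a, s) has_vector_derivative \<i> * of_real (exp (s + t)) / (Complex a (exp (s + t)))\<^sup>2) (at t)"
proof -
  define W where "W = (\<lambda>t. Complex a (exp (s + t)))"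
  have W: "(W has_vector_derivative \<i> * of_real (exp (s + t))) (at t)" unfolding W_def by (rule Complex_exp_deriv)
  have nz: "W t \<noteq> 0" by (simp add: W_def)
  have "((\<lambda>z. of_real x - 1 / z) has_field_derivative 1 / (W t)\<^sup>2) (at (W t))"
    using nz by (auto intro!: derivative_eq_intros simp: power2_eq_square divide_inverse)
  from field_vector_diff_chain_at[OF W this]
  have "((\<lambda>z. of_real x - 1 / z) \<circ> W has_vector_derivative \<i> * of_real (exp (s + t)) * (1 / (W t)\<^sup>2)) (at t)" .
  moreover have "(\<lambda>z. of_real x - 1 / z) \<circ> W = geo (x, a, s)" by (auto simp: W_def geo_eq)
  ultimately show ?thesis by (simp add: W_def)
qed

lemma velocity_geo: "velocity (geo (x, a, s)) t = \<i> * of_real (exp (s + t)) / (Complex a (exp (s + t)))\<^sup>2"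
  unfolding velocity_def by (rule vector_derivative_at[OF geo_deriv])

lemma sgn_sq: "sgn (z ^ 2) = (sgn z)\<^sup>2" for z :: complex
  by (simp add: power2_eq_square sgn_mult)

lemma sgn_velocity_geo: "sgn (velocity (geo w) t) = dir (flow t w)"
proof -
  obtain x a s where w: "w = (x, a, s)" by (metis surj_pair)
  show ?thesis unfolding w velocity_geo
    by (simp add: dir_def flow_def sgn_divide sgn_mult sgn_sq sgn_of_real) (simp add: sgn_div_norm)
qed

lemma hyp_dist_cosh:
  assumes "z \<in> upper_half" "w \<in> upper_half" and e: "hyp_dist z w = d"
  shows "(cmod (z - w))\<^sup>2 = 2 * Im z * Im w * (cosh d - 1)"
proof -
  define X where "X = 1 + (cmod (z - w))\<^sup>2 / (2 * Im z * Im w)"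
  have p: "0 < 2 * Im z * Im w" using assms by (simp add: upper_half_def)
  then have "1 \<le> X" by (simp add: X_def)
  then have "cosh (arcosh X) = X" by (rule cosh_arcosh_real)
  then have "cosh d = X" using e by (simp add: hyp_dist_def X_def)
  then show ?thesis using p assms(1,2) by (simp add: X_def field_simps upper_half_def)
qed

lemma hyp_dist_eqI:
  assumes "z \<in> upper_half" "w \<in> upper_half" and e: "(cmod (z - w))\<^sup>2 = 2 * Im z * Im w * (cosh d - 1)"
  shows "hyp_dist z w = \<bar>d\<bar>"
proof -
  have p: "2 * Im z * Im w \<noteq> 0" using assms by (simp add: upper_half_def)
  have "hyp_dist z w = arcosh (cosh d)" unfolding hyp_dist_def e using p by simp
  also have "cosh d = cosh \<bar>d\<bar>" by (simp add: abs_if)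
  also have "arcosh \<dots> = \<bar>d\<bar>" by (rule arcosh_cosh_real) simp
  finally show ?thesis .
qed

lemma two_cosh: "2 * cosh (u::real) = exp u + exp (- u)" by (simp add: cosh_field_def)

text \<open>
  The squared Euclidean distance of two points on a vertical line in terms of their hyperbolic distance.
\<close>

lemma vertical_dist: "(exp u - exp v)\<^sup>2 = 2 * exp u * exp v * (cosh (u - v) - 1)" for u v :: real
proof -
  have "2 * exp u * exp v * (cosh (u - v) - 1) = exp u * exp v * (2 * cosh (u - v)) - 2 * exp u * exp v" by (simp add: algebra_simps)
  also have "\<dots> = exp (u + v) * exp (u - v) + exp (u + v) * exp (v - u) - 2 * exp u * exp v"
    unfolding two_cosh by (simp add: exp_add algebra_simps)
  also have "\<dots> = exp u * exp u + exp v * exp v - 2 * exp u * exp v"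
    by (simp flip: exp_add)
  finally show ?thesis by (simp add: power2_eq_square algebra_simps)
qed

lemma Im_recip: "Im (- 1 / z) = Im z / (cmod z)\<^sup>2"
  by (simp add: Im_divide cmod_power2)

lemma Re_recip: "Re (- 1 / z) = - Re z / (cmod z)\<^sup>2"
  by (simp add: Re_divide cmod_power2)

lemma recip_dist:
  assumes "z \<noteq> 0" "w \<noteq> 0"
  shows "(cmod (- 1 / z - - 1 / w))\<^sup>2 = (cmod (z - w))\<^sup>2 / ((cmod z)\<^sup>2 * (cmod w)\<^sup>2)"
proof -
  have "- 1 / z - - 1 / w = (z - w) / (z * w)" using assms by (simp add: field_simps)
  then show ?thesis by (simp add: norm_divide norm_mult power_divide power_mult_distrib)
qed

text \<open>
  The inversion \<open>z \<mapsto> -1/z\<close> is an isometry; together with horizontal translations it reduces every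
  geodesic to a vertical one.
\<close>

lemma hyp_dist_recip:
  assumes "z \<in> upper_half" "w \<in> upper_half"
  shows "hyp_dist (- 1 / z) (- 1 / w) = hyp_dist z w"
proof -
  have nz: "z \<noteq> 0" "w \<noteq> 0" using assms by (auto simp: upper_half_def)
  then show ?thesis unfolding hyp_dist_def recip_dist[OF nz] Im_recip by (simp add: field_simps)
qed

lemma hyp_dist_shift: "hyp_dist (z + of_real x) (w + of_real x) = hyp_dist z w"
  by (simp add: hyp_dist_def)

lemma geodesic_geo: "hyp_geodesic (geo w)"
  unfolding hyp_geodesic_def
proof (intro conjI allI)
  fix t u
  show "geo w t \<in> upper_half" by (simp add: geo_def)
  obtain x a s where w: "w = (x, a, s)" by (metis surj_pair)
  define z1 z2 where "z1 = Complex a (exp (s + t))" and "z2 = Complex a (exp (s + u))"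
  have up: "z1 \<in> upper_half" "z2 \<in> upper_half" by (simp_all add: z1_def z2_def upper_half_def)
  have "hyp_dist (geo w t) (geo w u) = hyp_dist (- 1 / z1 + of_real x) (- 1 / z2 + of_real x)"
    by (simp add: w geo_eq z1_def z2_def)
  also have "\<dots> = hyp_dist z1 z2" by (simp only: hyp_dist_shift hyp_dist_recip[OF up])
  also have "\<dots> = \<bar>t - u\<bar>"
  proof (rule hyp_dist_eqI[OF up])
    have "(cmod (z1 - z2))\<^sup>2 = (exp (s + t) - exp (s + u))\<^sup>2" by (simp add: cmod_power2 z1_def z2_def)
    then show "(cmod (z1 - z2))\<^sup>2 = 2 * Im z1 * Im z2 * (cosh (t - u) - 1)"
      using vertical_dist[of "s + t" "s + u"] by (simp add: z1_def z2_def)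
  qed
  finally show "hyp_dist (geo w t) (geo w u) = \<bar>t - u\<bar>" .
qed

text \<open>
  The distances of \<open>c t\<close> from \<open>c 0\<close> and \<open>c 1\<close> are those of the expected point of the vertical line, and
  the two equations have no other solution.
\<close>

lemma vertical_geodesic:
  assumes c: "hyp_geodesic c" and re: "Re (c 1) = Re (c 0)" and im: "Im (c 0) < Im (c 1)"
  shows "c t = Complex (Re (c 0)) (exp (ln (Im (c 0)) + t))"
proof -
  define y0 y1 a where "y0 = Im (c 0)" and "y1 = Im (c 1)" and "a = Re (c 0)"
  have up: "c t \<in> upper_half" for t using c by (simp add: hyp_geodesic_def)
  have y: "0 < y0" "0 < y1" using up by (auto simp: y0_def y1_def upper_half_def)
  have D: "(cmod (c s - c t))\<^sup>2 = 2 * Im (c s) * Im (c t) * (cosh (s - t) - 1)" for s t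
    by (subst hyp_dist_cosh[OF up up, of s t "\<bar>s - t\<bar>"]) (use c in \<open>auto simp: hyp_geodesic_def abs_if\<close>)
  have y1: "y1 = exp 1 * y0"
  proof -
    define r where "r = ln (y1 / y0)"
    have er: "y1 = y0 * exp r" using y by (simp add: r_def)
    have r0: "0 < r" unfolding r_def using im y by (simp add: y0_def y1_def)
    have "c 1 = Complex a y1" "c 0 = Complex a y0" by (simp_all add: complex_eq_iff a_def y0_def y1_def re)
    then have "hyp_dist (c 1) (c 0) = \<bar>r\<bar>"
    proof (intro hyp_dist_eqI up)
      assume e: "c 1 = Complex a y1" "c 0 = Complex a y0"
      have "(cmod (c 1 - c 0))\<^sup>2 = (y1 - y0)\<^sup>2" unfolding e by (simp add: cmod_power2)
      also have "\<dots> = 2 * exp (r + ln y0) * exp (ln y0) * (cosh r - 1)"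
        using vertical_dist[of "r + ln y0" "ln y0"] y er by (simp add: exp_add mult.commute)
      finally show "(cmod (c 1 - c 0))\<^sup>2 = 2 * Im (c 1) * Im (c 0) * (cosh r - 1)"
        unfolding e using y er by (simp add: exp_add mult.commute)
    qed
    moreover have "hyp_dist (c 1) (c 0) = 1" using c by (simp add: hyp_geodesic_def)
    ultimately have "r = 1" using r0 by simp
    then show ?thesis using er by (simp add: mult.commute)
  qed
  define p q where "p = Re (c t)" and "q = Im (c t)"
  have q0: "0 < q" using up[of t] by (simp add: q_def upper_half_def)
  have e0: "(p - a)\<^sup>2 + (q - y0)\<^sup>2 = 2 * q * y0 * (cosh t - 1)"
    using D[of t 0] by (simp add: cmod_power2 p_def q_def a_def y0_def)
  have e1: "(p - a)\<^sup>2 + (q - y1)\<^sup>2 = 2 * q * y1 * (cosh (t - 1) - 1)"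
    using D[of t 1] re by (simp add: cmod_power2 p_def q_def a_def y1_def)
  have ee: "exp (1::real) * exp (- 1) = 1" by (simp flip: exp_add)
  have et: "exp t * exp (- t) = 1" by (simp flip: exp_add)
  have c0: "2 * cosh t = exp t + exp (- t)" by (rule two_cosh)
  have c1: "2 * cosh (t - 1) = exp t * exp (- 1) + exp (- t) * exp 1"
    unfolding two_cosh by (simp flip: exp_add add: algebra_simps)
  have f0: "(p - a)\<^sup>2 + q\<^sup>2 + y0\<^sup>2 = q * y0 * (exp t + exp (- t))"
    unfolding c0[symmetric] using e0 by (simp add: power2_eq_square algebra_simps)
  have f1: "(p - a)\<^sup>2 + q\<^sup>2 + y1\<^sup>2 = q * y1 * (exp t * exp (- 1) + exp (- t) * exp 1)"
    unfolding c1[symmetric] using e1 by (simp add: power2_eq_square algebra_simps)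
  define E where "E = exp (1::real)"
  define Ei where "Ei = exp (- 1::real)"
  have EEi: "E * Ei = 1" using ee by (simp add: E_def Ei_def)
  have E1: "1 < E" by (simp add: E_def)
  define X Y where "X = exp t" and "Y = exp (- t)"
  have XY: "X * Y = 1" using et by (simp add: X_def Y_def)
  have g0: "(p - a)\<^sup>2 + q\<^sup>2 + y0\<^sup>2 = q * y0 * (X + Y)" using f0 by (simp add: X_def Y_def)
  have g1: "(p - a)\<^sup>2 + q\<^sup>2 + (E * y0)\<^sup>2 = q * (E * y0) * (X * Ei + Y * E)" using f1 y1 by (simp add: X_def Y_def E_def Ei_def)
  have "y0 * (E * E - 1) * y0 = y0 * (E * E - 1) * (q * Y)"
    using g0 g1 EEi by algebra
  then have "y0 = q * Y" using y E1 by (auto simp: mult_eq_0_iff) (smt (verit) mult_less_cancel_right2 mult_less_cancel_left2)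
  then have qX: "q = y0 * X" using XY by (metis mult.assoc mult.commute mult_1)
  have "(p - a)\<^sup>2 = 0" using g0 XY unfolding qX by algebra
  then have "p = a" by simp
  then show ?thesis using qX y by (simp add: complex_eq_iff p_def q_def a_def y0_def X_def exp_add)
qed

text \<open>
  Unless the way from \<open>z0\<close> to \<open>z1\<close> leads straight up, some inversion makes it do so. If the points lie on a
  common vertical line, invert about its foot. Otherwise they lie on a semicircle with centre \<open>m\<close> and
  radius \<open>r\<close>, and \<open>\<xi>\<close> is its end on the side of \<open>z1\<close>; the inversion takes the semicircle to the
  vertical line at \<open>\<epsilon> / (2 r)\<close>.
\<close>

lemma endpoint_exists:
  assumes z: "z0 \<in> upper_half" "z1 \<in> upper_half" "z0 \<noteq> z1" and nv: "Re z0 = Re z1 \<Longrightarrow> Im z1 < Im z0"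
  obtains \<xi> :: real where "Re (- 1 / (z0 - of_real \<xi>)) = Re (- 1 / (z1 - of_real \<xi>))"
    "Im (- 1 / (z0 - of_real \<xi>)) < Im (- 1 / (z1 - of_real \<xi>))"
proof (cases "Re z0 = Re z1")
  case True
  have i: "0 < Im z0" "0 < Im z1" using z by (auto simp: upper_half_def)
  have e: "z0 - of_real (Re z0) = \<i> * of_real (Im z0)" "z1 - of_real (Re z0) = \<i> * of_real (Im z1)"
    using True by (auto simp: complex_eq_iff)
  show ?thesis
  proof (rule that[of "Re z0"])
    show "Re (- 1 / (z0 - of_real (Re z0))) = Re (- 1 / (z1 - of_real (Re z0)))"
      unfolding e by (simp add: Re_divide)
    show "Im (- 1 / (z0 - of_real (Re z0))) < Im (- 1 / (z1 - of_real (Re z0)))"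
      unfolding e Im_recip using i nv[OF True] by (simp add: norm_mult power2_eq_square frac_less2)
  qed
next
  case False
  define x0 x1 y0 y1 where "x0 = Re z0" and "x1 = Re z1" and "y0 = Im z0" and "y1 = Im z1"
  have y: "0 < y0" "0 < y1" using z by (auto simp: upper_half_def y0_def y1_def)
  have x: "x0 \<noteq> x1" using False by (simp add: x0_def x1_def)
  \<comment> \<open>The centre is the real point at equal distance from \<open>z0\<close> and \<open>z1\<close>.\<close>
  define m where "m = (x1\<^sup>2 + y1\<^sup>2 - x0\<^sup>2 - y0\<^sup>2) / (2 * (x1 - x0))"
  define r where "r = sqrt ((x0 - m)\<^sup>2 + y0\<^sup>2)"
  define \<epsilon> where "\<epsilon> = (if x0 < x1 then 1 else - 1 :: real)"
  have eps: "\<epsilon> * \<epsilon> = 1" "0 < \<epsilon> * (x1 - x0)" using x by (auto simp: \<epsilon>_def)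
  have r2: "r\<^sup>2 = (x0 - m)\<^sup>2 + y0\<^sup>2" unfolding r_def by simp
  have "2 * (x1 - x0) * m = x1\<^sup>2 + y1\<^sup>2 - x0\<^sup>2 - y0\<^sup>2" using x by (simp add: m_def)
  then have r2': "r\<^sup>2 = (x1 - m)\<^sup>2 + y1\<^sup>2" unfolding r2 by (simp add: power2_eq_square algebra_simps)
  have r0: "0 < r" unfolding r_def using y by (simp add: add_nonneg_pos)
  define \<xi> where "\<xi> = m + \<epsilon> * r"
  have gen: "Re (- 1 / (z - of_real \<xi>)) = \<epsilon> / (2 * r)" "Im (- 1 / (z - of_real \<xi>)) = Im z / (2 * r * (r - \<epsilon> * (Re z - m)))"
    "\<epsilon> * (Re z - m) < r" "- r < \<epsilon> * (Re z - m)"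
    if zz: "r\<^sup>2 = (Re z - m)\<^sup>2 + (Im z)\<^sup>2" "0 < Im z" for z
  proof -
    define v where "v = \<epsilon> * (Re z - m)"
    have v2: "v\<^sup>2 = (Re z - m)\<^sup>2" using eps(1) by (simp add: v_def power_mult_distrib power2_eq_square)
    have "v\<^sup>2 < r\<^sup>2" unfolding v2 zz(1) using zz(2) by simp
    then have vr: "\<bar>v\<bar> < r" using r0 by (metis abs_of_pos power2_abs power2_less_imp_less less_imp_le)
    then show "\<epsilon> * (Re z - m) < r" "- r < \<epsilon> * (Re z - m)" by (auto simp: v_def)
    have n: "(cmod (z - of_real \<xi>))\<^sup>2 = 2 * r * (r - v)"
    proof -
      have "(cmod (z - of_real \<xi>))\<^sup>2 = (Re z - m - \<epsilon> * r)\<^sup>2 + (Im z)\<^sup>2"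
        by (simp add: cmod_power2 \<xi>_def algebra_simps)
      also have "\<dots> = (Re z - m)\<^sup>2 + (Im z)\<^sup>2 - 2 * v * r + \<epsilon> * \<epsilon> * r\<^sup>2"
        by (simp add: v_def power2_eq_square algebra_simps)
      also have "\<dots> = 2 * r * (r - v)" using zz(1) eps(1) by (simp add: power2_eq_square algebra_simps)
      finally show ?thesis .
    qed
    show "Im (- 1 / (z - of_real \<xi>)) = Im z / (2 * r * (r - \<epsilon> * (Re z - m)))"
      unfolding Im_recip n by (simp add: v_def)
    have "Re (- 1 / (z - of_real \<xi>)) = - (Re z - \<xi>) / (cmod (z - of_real \<xi>))\<^sup>2"
      by (simp only: Re_recip minus_complex.sel Re_complex_of_real)
    also have "- (Re z - \<xi>) = \<epsilon> * (r - v)"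
    proof -
      have "\<epsilon> * v = Re z - m" unfolding v_def using eps(1) by (simp flip: mult.assoc)
      then show ?thesis by (simp add: \<xi>_def algebra_simps)
    qed
    finally show "Re (- 1 / (z - of_real \<xi>)) = \<epsilon> / (2 * r)" unfolding n using vr by simp
  qed
  note g0 = gen[OF r2[unfolded x0_def y0_def] y(1)[unfolded y0_def]]
  note g1 = gen[OF r2'[unfolded x1_def y1_def] y(2)[unfolded y1_def]]
  define v0 v1 where "v0 = \<epsilon> * (Re z0 - m)" and "v1 = \<epsilon> * (Re z1 - m)"
  have v: "v0 < v1" using eps(2) by (simp add: v0_def v1_def x0_def x1_def algebra_simps)
  have vr: "v0 < r" "- r < v0" "v1 < r" "- r < v1" using g0(3,4) g1(3,4) by (auto simp: v0_def v1_def)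
  have v02: "v0\<^sup>2 = (x0 - m)\<^sup>2" and v12: "v1\<^sup>2 = (x1 - m)\<^sup>2"
    using eps(1) by (simp_all add: v0_def v1_def x0_def x1_def power_mult_distrib power2_eq_square)
  have y02: "y0\<^sup>2 = (r - v0) * (r + v0)" using r2 v02 by (simp add: power2_eq_square algebra_simps)
  have y12: "y1\<^sup>2 = (r - v1) * (r + v1)" using r2' v12 by (simp add: power2_eq_square algebra_simps)
  have "(y0 * (r - v1))\<^sup>2 < (y1 * (r - v0))\<^sup>2"
  proof -
    have "(y1 * (r - v0))\<^sup>2 - (y0 * (r - v1))\<^sup>2 = (r - v0) * (r - v1) * (2 * r * (v1 - v0))"
      unfolding power_mult_distrib y02 y12 by (simp add: power2_eq_square algebra_simps)
    also have "\<dots> > 0" using vr v r0 by simp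
    finally show ?thesis by simp
  qed
  then have "y0 * (r - v1) < y1 * (r - v0)"
    by (rule power2_less_imp_less) (use vr y in simp)
  then have "y0 / (2 * r * (r - v0)) < y1 / (2 * r * (r - v1))"
  proof -
    have "y0 / (r - v0) < y1 / (r - v1)"
      using vr \<open>y0 * (r - v1) < y1 * (r - v0)\<close> by (simp add: divide_simps)
    then have "y0 / (r - v0) / (2 * r) < y1 / (r - v1) / (2 * r)" using r0 by (intro divide_strict_right_mono) auto
    then show ?thesis by (simp add: mult.commute)
  qed
  then show ?thesis using that[of \<xi>] g0 g1 by (simp add: v0_def v1_def y0_def y1_def)
qed

text \<open>
  The geodesics of the half-plane are the curves \<open>geo w\<close> and the vertical lines traversed upwards.
\<close>

lemma geodesic_cases:
  assumes c: "hyp_geodesic c"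
  obtains w where "c = geo w" | x s where "c = (\<lambda>t. Complex x (exp (s + t)))"
proof -
  have up: "c t \<in> upper_half" for t using c by (simp add: hyp_geodesic_def)
  have ne: "c 0 \<noteq> c 1"
  proof
    assume "c 0 = c 1"
    then have "hyp_dist (c 0) (c 1) = hyp_dist (c 0) (c 0)" by simp
    then show False using c by (simp add: hyp_geodesic_def)
  qed
  show ?thesis
  proof (cases "Re (c 0) = Re (c 1) \<and> Im (c 0) < Im (c 1)")
    case True
    then have "c = (\<lambda>t. Complex (Re (c 0)) (exp (ln (Im (c 0)) + t)))"
      by (intro ext vertical_geodesic[OF c]) auto
    then show ?thesis by (rule that(2))
  next
    case False
    have "Im (c 1) < Im (c 0)" if "Re (c 0) = Re (c 1)"
      using False that ne by (auto simp: complex_eq_iff)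
    then obtain \<xi> where \<xi>: "Re (- 1 / (c 0 - of_real \<xi>)) = Re (- 1 / (c 1 - of_real \<xi>))"
        "Im (- 1 / (c 0 - of_real \<xi>)) < Im (- 1 / (c 1 - of_real \<xi>))"
      using endpoint_exists[OF up up ne] by blast
    define c' where "c' t = - 1 / (c t - of_real \<xi>)" for t
    have up': "c t - of_real \<xi> \<in> upper_half" for t using up[of t] by (simp add: upper_half_def)
    have nz: "c t - of_real \<xi> \<noteq> 0" for t using up'[of t] by (auto simp: upper_half_def)
    have "hyp_geodesic c'"
      unfolding hyp_geodesic_def
    proof (intro conjI allI)
      fix s t
      show "c' s \<in> upper_half" using up'[of s] nz[of s] unfolding upper_half_def mem_Collect_eq c'_def Im_recip by simp
      have "hyp_dist (c' s) (c' t) = hyp_dist (c s - of_real \<xi>) (c t - of_real \<xi>)"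
        unfolding c'_def by (rule hyp_dist_recip[OF up' up'])
      also have "\<dots> = hyp_dist (c s) (c t)" using hyp_dist_shift[of "c s" "- \<xi>" "c t"] by simp
      finally show "hyp_dist (c' s) (c' t) = \<bar>s - t\<bar>" using c by (simp add: hyp_geodesic_def)
    qed
    from vertical_geodesic[OF this] \<xi>
    have v: "c' t = Complex (Re (c' 0)) (exp (ln (Im (c' 0)) + t))" for t by (simp add: c'_def)
    have "c t = geo (\<xi>, Re (c' 0), ln (Im (c' 0))) t" for t
    proof -
      have "c t = of_real \<xi> - 1 / c' t" using nz[of t] by (simp add: c'_def)
      then show ?thesis unfolding geo_eq by (subst (asm) v)
    qed
    then show ?thesis by (intro that(1)) auto
  qed
qed

text \<open>
  A geodesic is determined by its initial vector, and vertical lines traversed upwards do not start in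
  the range of \<open>Psi\<close>.
\<close>

lemma geodesic_with_tangent:
  "hyp_geodesic c \<and> (c 0, sgn (velocity c 0)) = Psi w \<longleftrightarrow> c = geo w"
proof
  assume "c = geo w"
  then show "hyp_geodesic c \<and> (c 0, sgn (velocity c 0)) = Psi w"
    using geodesic_geo[of w] by (simp add: sgn_velocity_geo Psi_def geo_def)
next
  assume c: "hyp_geodesic c \<and> (c 0, sgn (velocity c 0)) = Psi w"
  then have cg: "hyp_geodesic c" by simp
  from geodesic_cases[OF cg] show "c = geo w"
  proof cases
    case (1 w')
    then have "Psi w' = Psi w" using c by (simp add: sgn_velocity_geo Psi_def geo_def)
    then show ?thesis using 1 inj_Psi by (simp add: inj_eq)
  next
    case (2 x s)
    have "velocity c 0 = \<i> * of_real (exp (s + 0))"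
      unfolding velocity_def 2 by (rule vector_derivative_at[OF Complex_exp_deriv])
    then have "sgn (velocity c 0) = \<i>" by (simp add: sgn_mult sgn_of_real) (simp add: sgn_div_norm)
    then have "dir w = \<i>" using c by (simp add: Psi_def)
    then show ?thesis using dir_neq by simp
  qed
qed

lemma moebius_T1_Psi:
  assumes A: "A \<in> SL2R" and k: "cocycle A (fst w) \<noteq> 0"
  shows "moebius_T1 A (Psi w) = Psi (act A w)"
proof -
  define W W' where "W = Complex (fst (snd w)) (exp (snd (snd w)))"
    and "W' = Complex (fst (snd (act A w))) (exp (snd (snd (act A w))))"
  define D where "D = of_real (A$2$1) * pt w + complex_of_real (A$2$2)"
  have nz: "W \<noteq> 0" "W' \<noteq> 0" by (simp_all add: W_def W'_def)
  have D: "D = W' / (of_real (cocycle A (fst w)) * W)"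
    unfolding D_def W_def W'_def by (rule moebius_pt(2)[OF A k])
  have d: "deriv (moebius A) (pt w) = 1 / D\<^sup>2" unfolding D_def by (rule deriv_moebius[OF A]) simp
  have dw: "dir w = \<i> / (sgn W)\<^sup>2" "dir (act A w) = \<i> / (sgn W')\<^sup>2"
    by (simp_all add: dir_def W_def W'_def case_prod_beta')
  have kk: "(sgn (complex_of_real (cocycle A (fst w))))\<^sup>2 = 1"
    using k by (auto simp: sgn_of_real sgn_if)
  have "sgn (1 / D\<^sup>2) * dir w = dir (act A w)"
    unfolding dw D using nz kk
    by (simp add: sgn_divide sgn_mult sgn_sq power_divide power_mult_distrib sgn_zero_iff)
  then show ?thesis
    unfolding moebius_T1_def Psi_def prod.case d using moebius_pt(1)[OF A k] by simp
qed

context sl2_group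
begin

lemma orbit_T1_Psi: "w \<in> generic \<Gamma> \<Longrightarrow> orbit_T1 \<Gamma> (Psi w) = (\<lambda>A. Psi (act A w)) ` \<Gamma>"
  unfolding orbit_T1_def using moebius_T1_Psi in_SL2R by (intro image_cong) (auto simp: generic_def)

lemma lifts_eq:
  assumes w: "w \<in> generic \<Gamma>"
  shows "lifts (orbit_T1 \<Gamma> (Psi w)) = (\<lambda>A. geo (act A w)) ` \<Gamma>"
proof -
  have "lifts (orbit_T1 \<Gamma> (Psi w)) =
      {c. \<exists>A\<in>\<Gamma>. hyp_geodesic c \<and> (c 0, sgn (velocity c 0)) = Psi (act A w)}"
    unfolding lifts_def orbit_T1_Psi[OF w] by blast
  then show ?thesis unfolding geodesic_with_tangent by blast
qed

lemma geod_eq: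
  assumes w: "w \<in> generic \<Gamma>"
  shows "geod (orbit_T1 \<Gamma> (Psi w)) t = orbit \<Gamma> (geo w t)"
proof -
  have "geo (act A w) t = moebius A (geo w t)" if "A \<in> \<Gamma>" for A
    using moebius_act[of "flow t w" A] w that by (simp add: geo_def act_flow)
  then have "(\<lambda>A. geo (act A w) t) ` \<Gamma> = orbit \<Gamma> (geo w t)" unfolding orbit_def by simp
  moreover have "geod (orbit_T1 \<Gamma> (Psi w)) t = (\<lambda>A. geo (act A w) t) ` \<Gamma>"
    unfolding geod_def lifts_eq[OF w] by blast
  ultimately show ?thesis by simp
qed

end

lemma Im_geo: "Im (geo (x, a, s) t) = exp (s + t) / (a\<^sup>2 + (exp (s + t))\<^sup>2)"
  by (simp add: geo_def flow_def Im_pt)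

text \<open>
  The height at time \<open>t\<close> before or after the apex.
\<close>

lemma Im_geo_apex:
  assumes "a \<noteq> 0"
  shows "Im (geo (x, a, s) (apex_time (x, a, s) + t)) = 1 / (2 * \<bar>a\<bar> * cosh t)"
proof -
  have e: "exp (s + (apex_time (x, a, s) + t)) = \<bar>a\<bar> * exp t"
    using assms by (simp add: apex_time_def exp_add)
  have "a\<^sup>2 + (\<bar>a\<bar> * exp t)\<^sup>2 = \<bar>a\<bar> * exp t * (\<bar>a\<bar> * (exp (- t) + exp t))"
    by (simp add: power_mult_distrib power2_eq_square algebra_simps flip: exp_add)
  also have "\<dots> = \<bar>a\<bar> * exp t * (2 * \<bar>a\<bar> * cosh t)" using two_cosh[of t] by (simp add: algebra_simps)
  finally show ?thesis unfolding Im_geo e using assms by simp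
qed

text \<open>
  A horizontal velocity means \<open>\<bar>a\<bar> = exp (s + t)\<close>, that is, \<open>t\<close> is the apex time.
\<close>

lemma tangent_at_geo:
  assumes d: "0 < d"
  shows "tangent_at (geo (x, a, s)) d t \<longleftrightarrow> a \<noteq> 0 \<and> t = apex_time (x, a, s) \<and> d = 2 * \<bar>a\<bar>"
proof -
  define b where "b = exp (s + t)"
  have b: "0 < b" by (simp add: b_def)
  have n: "(cmod (Complex a b))\<^sup>2 = a\<^sup>2 + b\<^sup>2" by (simp add: cmod_power2)
  have p: "0 < a\<^sup>2 + b\<^sup>2" using b by (simp add: add_nonneg_pos)
  have "\<i> * of_real b / (Complex a b)\<^sup>2 = \<i> * of_real b * (cnj (Complex a b))\<^sup>2 / of_real ((a\<^sup>2 + b\<^sup>2)\<^sup>2)"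
  proof -
    have "(Complex a b)\<^sup>2 * (cnj (Complex a b))\<^sup>2 = of_real ((a\<^sup>2 + b\<^sup>2)\<^sup>2)"
      unfolding power_mult_distrib[symmetric] complex_norm_square[symmetric] n by simp
    moreover have "Complex a b \<noteq> 0" "cnj (Complex a b) \<noteq> 0" using b by (auto simp: complex_eq_iff)
    ultimately show ?thesis by (metis (no_types, lifting) mult_divide_mult_cancel_right power_not_zero)
  qed
  then have "Im (velocity (geo (x, a, s)) t) = b * (a\<^sup>2 - b\<^sup>2) / (a\<^sup>2 + b\<^sup>2)\<^sup>2"
    unfolding velocity_geo b_def[symmetric] by (simp add: power2_eq_square Im_divide_of_real del: of_real_mult of_real_add of_real_power)
  then have V: "Im (velocity (geo (x, a, s)) t) = 0 \<longleftrightarrow> a\<^sup>2 = b\<^sup>2" using b p by auto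
  have V': "a\<^sup>2 = b\<^sup>2 \<longleftrightarrow> a \<noteq> 0 \<and> t = apex_time (x, a, s)"
  proof -
    have "a\<^sup>2 = b\<^sup>2 \<longleftrightarrow> \<bar>a\<bar> = b" using b by (metis abs_of_pos power2_abs power2_eq_iff abs_ge_zero power2_eq_imp_eq less_imp_le)
    also have "\<dots> \<longleftrightarrow> a \<noteq> 0 \<and> t = apex_time (x, a, s)"
    proof
      assume e: "\<bar>a\<bar> = b"
      then have "ln \<bar>a\<bar> = s + t" by (simp add: b_def)
      then show "a \<noteq> 0 \<and> t = apex_time (x, a, s)" using e b by (auto simp: apex_time_def)
    qed (auto simp: b_def apex_time_def)
    finally show ?thesis .
  qed
  have "Im (geo (x, a, s) t) = 1 / d \<longleftrightarrow> d = 2 * \<bar>a\<bar>" if "a \<noteq> 0" "t = apex_time (x, a, s)"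
  proof -
    have "Im (geo (x, a, s) t) = 1 / (2 * \<bar>a\<bar>)" using Im_geo_apex[OF that(1), of x s 0] that(2) by simp
    moreover have "1 / (2 * \<bar>a\<bar>) = 1 / d \<longleftrightarrow> d = 2 * \<bar>a\<bar>"
      using d that(1) by (subst frac_eq_eq) auto
    ultimately show ?thesis by simp
  qed
  then show ?thesis unfolding tangent_at_def V V' by blast
qed

lemma endpoints_in_geo:
  assumes a: "a \<noteq> 0"
  shows "endpoints_in (geo (x, a, s)) X \<longleftrightarrow> (x, x - 1 / a) \<in> X"
proof -
  have g: "geo (x, a, s) = (\<lambda>t. of_real x - 1 / Complex a (exp (s + t)))" by (auto simp: geo_eq)
  have top: "(geo (x, a, s) \<longlongrightarrow> of_real x) at_top"
  proof -
    have "((\<lambda>t. 1 / Complex a (exp (s + t))) \<longlongrightarrow> 0) at_top"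
    proof (rule Lim_null_comparison)
      show "\<forall>\<^sub>F t in at_top. norm (1 / Complex a (exp (s + t))) \<le> exp (- s) * exp (- t)"
      proof (intro always_eventually allI)
        fix t
        have "exp (s + t) \<le> cmod (Complex a (exp (s + t)))" using abs_Im_le_cmod[of "Complex a (exp (s + t))"] by simp
        then have "1 / cmod (Complex a (exp (s + t))) \<le> 1 / exp (s + t)" by (intro divide_left_mono) auto
        then show "norm (1 / Complex a (exp (s + t))) \<le> exp (- s) * exp (- t)"
          by (simp add: norm_divide exp_minus exp_add inverse_eq_divide)
      qed
      have "((\<lambda>t::real. exp (- t)) \<longlongrightarrow> 0) at_top"
        by (rule filterlim_compose[OF exp_at_bot filterlim_uminus_at_bot_at_top])
      from tendsto_mult_left[OF this, of "exp (- s)"] show "((\<lambda>t. exp (- s) * exp (- t)) \<longlongrightarrow> 0) at_top" by simp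
    qed
    from tendsto_diff[OF tendsto_const this, of "of_real x"] show ?thesis unfolding g by simp
  qed
  have bot: "(geo (x, a, s) \<longlongrightarrow> of_real (x - 1 / a)) at_bot"
  proof -
    have "((\<lambda>t. exp (s + t)) \<longlongrightarrow> 0) at_bot"
      using tendsto_mult_left[OF exp_at_bot, of "exp s"] by (simp add: exp_add)
    then have "((\<lambda>t. of_real x - 1 / Complex a (exp (s + t))) \<longlongrightarrow> of_real x - 1 / Complex a 0) at_bot"
      by (intro tendsto_intros) (use a in \<open>auto simp: complex_eq_iff\<close>)
    moreover have "Complex a 0 = of_real a" by (simp add: complex_eq_iff)
    ultimately show ?thesis unfolding g by simp
  qed
  show ?thesis
  proof
    assume "endpoints_in (geo (x, a, s)) X"
    then obtain x' y' where e: "(geo (x, a, s) \<longlongrightarrow> of_real x') at_top" "(geo (x, a, s) \<longlongrightarrow> of_real y') at_bot" "(x', y') \<in> X"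
      unfolding endpoints_in_def by blast
    have "complex_of_real x' = of_real x" by (rule tendsto_unique[OF _ e(1) top]) simp
    moreover have "complex_of_real y' = of_real (x - 1 / a)" by (rule tendsto_unique[OF _ e(2) bot]) simp
    ultimately show "(x, x - 1 / a) \<in> X" using e(3) by (simp only: of_real_eq_iff)
  next
    assume "(x, x - 1 / a) \<in> X"
    then show "endpoints_in (geo (x, a, s)) X" unfolding endpoints_in_def using top bot by blast
  qed
qed

section \<open>Excursions as orbit points\<close>

text \<open>
  The first two coordinates of the lifts that are tangent to a horocycle at height \<open>1/d\<close> with \<open>d < k\<close>
  and have endpoints in \<open>J_region\<close>. For \<open>k \<le> 2\<close> the backward endpoint \<open>x - 1/a\<close> differs from \<open>x\<close> by more
  than 1, so that its sign is opposite to that of \<open>a\<close>.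
\<close>

definition excursion_region :: "real \<Rightarrow> (real \<times> real) set" where
  "excursion_region k = {(x, a). (0 < x \<and> x < 1 \<and> 0 < a \<and> 2 * a < k) \<or> (- 1 < x \<and> x < 0 \<and> a < 0 \<and> - (2 * a) < k)}"

lemma excursion_region_iff:
  "(x, a) \<in> excursion_region k \<longleftrightarrow> (x, a) \<in> excursion_region 2 \<and> 2 * \<bar>a\<bar> < k" if "k \<le> 2"
  using that by (auto simp: excursion_region_def)

lemma excursion_region_borel [measurable]: "excursion_region k \<in> sets borel"
proof -
  have "excursion_region k = {p. (0 < fst p \<and> fst p < 1 \<and> 0 < snd p \<and> 2 * snd p < k) \<or> (- 1 < fst p \<and> fst p < 0 \<and> snd p < 0 \<and> - (2 * snd p) < k)}"
    by (auto simp: excursion_region_def)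
  also have "open \<dots>" by (intro open_Collect_disj open_Collect_conj open_Collect_less continuous_intros)
  finally show ?thesis by (rule borel_open)
qed

abbreviation pr :: "horo_coords \<Rightarrow> real \<times> real" where "pr p \<equiv> (fst p, fst (snd p))"

lemma AE_fst_not_Ints: "AE w in (lborel :: horo_coords measure). fst w \<notin> \<int>"
proof -
  have c: "closed {w::horo_coords. fst w \<in> \<int>}"
    using continuous_closed_preimage[OF continuous_on_fst[OF continuous_on_id] closed_UNIV closed_Ints]
    by (simp add: vimage_def)
  have "AE x in lborel. (x::real) \<notin> \<int>"
    using countable_imp_null_set_lborel[OF countable_int[where 'a = real]] by (rule AE_not_in)
  then have "AE w in lborel. w \<notin> {w::horo_coords. fst w \<in> \<int>}"
    by (subst AE_lborel3[OF borel_closed[OF c]]) (auto elim!: eventually_mono)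
  then show ?thesis by simp
qed

text \<open>
  With \<open>j\<close> the cocycle, equal apex times mean \<open>\<bar>j b - c\<bar> = \<bar>j b\<bar>\<close>, where \<open>c\<close> is the lower left entry
  of \<open>C\<close> and \<open>b\<close> the second coordinate of \<open>w\<close>.
\<close>

lemma apex_coincide:
  assumes k: "cocycle C (fst w) \<noteq> 0" and a: "fst (snd w) \<noteq> 0" "fst (snd (act C w)) \<noteq> 0"
    and e: "apex_time (act C w) = apex_time w"
  shows "C$2$1 = 0 \<or> C$2$1 = 2 * fst (snd w) * cocycle C (fst w)"
proof -
  obtain x b s where w: "w = (x, b, s)" by (metis surj_pair)
  define kk where "kk = cocycle C x"
  define b' where "b' = kk\<^sup>2 * b - C$2$1 * kk"
  have kk: "kk \<noteq> 0" and b: "b \<noteq> 0" "b' \<noteq> 0" using k a by (auto simp: w kk_def b'_def act_def)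
  have "ln \<bar>b'\<bar> = ln (\<bar>b\<bar> * (\<bar>kk\<bar> * \<bar>kk\<bar>))"
    using e kk b by (simp add: w apex_time_def act_def kk_def[symmetric] b'_def[symmetric] ln_mult del: abs_mult_self_eq)
  moreover have "0 < \<bar>b\<bar> * (\<bar>kk\<bar> * \<bar>kk\<bar>)" by (intro mult_pos_pos) (use kk b in auto)
  moreover have "0 < \<bar>b'\<bar>" using b by simp
  ultimately have "\<bar>b'\<bar> = \<bar>b\<bar> * (\<bar>kk\<bar> * \<bar>kk\<bar>)" by (metis ln_inj_iff)
  moreover have "b' = kk * (kk * b - C$2$1)" by (simp add: b'_def power2_eq_square algebra_simps)
  ultimately have "\<bar>kk\<bar> * \<bar>kk * b - C$2$1\<bar> = \<bar>kk\<bar> * (\<bar>b\<bar> * \<bar>kk\<bar>)" by (simp add: abs_mult)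
  then have "\<bar>kk * b - C$2$1\<bar> = \<bar>kk * b\<bar>" using kk by (simp add: abs_mult mult.commute)
  then have "C$2$1 = 0 \<or> C$2$1 = 2 * b * kk" by (auto simp: abs_eq_iff)
  then show ?thesis by (simp add: w kk_def)
qed

locale sl2_zonal = sl2_domain +
  assumes stab: "stab_inf \<Gamma> = (\<Union>n::int. {mat2 1 (of_int n) 0 1, - mat2 1 (of_int n) 0 1})"
begin

definition shift :: "int \<Rightarrow> real^2^2" where "shift n = mat2 1 (of_int n) 0 1"

lemma shift_in: "shift n \<in> \<Gamma>"
proof -
  have "shift n \<in> stab_inf \<Gamma>" unfolding stab shift_def by blast
  then show ?thesis by (simp add: stab_inf_def)
qed

lemma in_stab_infD: "A \<in> \<Gamma> \<Longrightarrow> A$2$1 = 0 \<Longrightarrow> \<exists>n. A = shift n \<or> A = - shift n"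
proof -
  assume "A \<in> \<Gamma>" "A$2$1 = 0"
  then have "A \<in> stab_inf \<Gamma>" by (simp add: stab_inf_def)
  then show ?thesis unfolding stab shift_def by blast
qed

lemma act_shift: "act (shift n) (x, a, s) = (x + of_int n, a, s)"
  by (simp add: act_def shift_def cocycle_def)

lemma one_shift: "shift 0 = mat 1" by (simp add: shift_def mat2_eq_iff mat_def)

lemma lower_left_ge_1: "A \<in> \<Gamma> \<Longrightarrow> A$2$1 \<noteq> 0 \<Longrightarrow> 1 \<le> \<bar>A$2$1\<bar>"
  using shimizu[of A] shift_in[of 1] by (simp add: shift_def)

text \<open>
  The first condition keeps the forward endpoint of every lift off the boundary of \<open>excursion_region\<close>
  up to translation; by \<open>apex_coincide\<close> the second one ensures that different excursions have different
  depth parameters.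
\<close>

definition typical :: "horo_coords \<Rightarrow> bool" where
  "typical w \<longleftrightarrow> w \<in> generic \<Gamma> \<and> (\<forall>A\<in>\<Gamma>. fst (act A w) \<notin> \<int> \<and>
     (\<forall>C\<in>\<Gamma>. C$2$1 \<noteq> 0 \<longrightarrow> C$2$1 \<noteq> 2 * fst (snd (act A w)) * cocycle C (fst (act A w))))"

lemma AE_typical: "AE w in lborel. typical w"
proof -
  have 1: "AE w in lborel. fst (act A w) \<notin> \<int>" if "A \<in> \<Gamma>" for A
    by (rule AE_act[OF _ AE_fst_not_Ints]) (use that in_SL2R in auto)
  have 2: "AE w in (lborel :: horo_coords measure). C$2$1 \<noteq> 2 * fst (snd w) * cocycle C (fst w)" if C: "C \<in> \<Gamma>" "C$2$1 \<noteq> 0" for C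
  proof -
    have "closed {w::horo_coords. C$2$1 = 2 * fst (snd w) * cocycle C (fst w)}"
      unfolding cocycle_def by (intro closed_Collect_eq continuous_intros)
    then have b: "{w::horo_coords. C$2$1 = 2 * fst (snd w) * cocycle C (fst w)} \<in> sets borel" by (rule borel_closed)
    have "AE a in lborel. C$2$1 \<noteq> 2 * a * cocycle C x" for x
      using AE_lborel_singleton[of "C$2$1 / (2 * cocycle C x)"]
    proof eventually_elim
      case (elim a)
      show ?case
      proof
        assume e: "C$2$1 = 2 * a * cocycle C x"
        then have "cocycle C x \<noteq> 0" using C(2) by auto
        then have "a = C$2$1 / (2 * cocycle C x)" using e by (simp add: field_simps)
        then show False using elim by simp
      qed
    qed
    then have "AE w in lborel. w \<notin> {w::horo_coords. C$2$1 = 2 * fst (snd w) * cocycle C (fst w)}"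
      by (subst AE_lborel3[OF b]) (auto elim!: eventually_mono)
    then show ?thesis by simp
  qed
  have 3: "AE w in lborel. C$2$1 \<noteq> 0 \<longrightarrow> C$2$1 \<noteq> 2 * fst (snd (act A w)) * cocycle C (fst (act A w))"
    if "A \<in> \<Gamma>" "C \<in> \<Gamma>" for A C
    by (cases "C$2$1 = 0") (simp, use AE_act[OF in_SL2R[OF that(1)] 2[OF that(2)]] in auto)
  have "AE w in lborel. \<forall>A\<in>\<Gamma>. fst (act A w) \<notin> \<int> \<and>
     (\<forall>C\<in>\<Gamma>. C$2$1 \<noteq> 0 \<longrightarrow> C$2$1 \<noteq> 2 * fst (snd (act A w)) * cocycle C (fst (act A w)))"
    using 1 3 by (simp add: AE_ball_countable[OF countable_group] AE_conj_iff)
  then show ?thesis using AE_generic unfolding typical_def by eventually_elim blast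
qed

lemma typical_generic: "typical w \<Longrightarrow> w \<in> generic \<Gamma>" by (simp add: typical_def)

text \<open>
  The chosen lifts of the \<open>2\<close>-excursions of \<open>w\<close>, by their coordinates.
\<close>

definition excursions :: "horo_coords \<Rightarrow> horo_coords set" where
  "excursions w = {act A w | A. A \<in> \<Gamma> \<and> pr (act A w) \<in> excursion_region 2}"

text \<open>
  Lifts that are tangent to a horocycle at the same time differ by an integer translation.
\<close>

lemma excursion_same_time:
  assumes w: "typical w" and A: "A \<in> \<Gamma>" and B: "B \<in> \<Gamma>"
    and a: "fst (snd (act A w)) \<noteq> 0" "fst (snd (act B w)) \<noteq> 0"
    and e: "apex_time (act A w) = apex_time (act B w)"
  obtains n where "A = shift n ** B \<or> A = - (shift n ** B)" "act A w = act (shift n) (act B w)"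
proof -
  define C where "C = A ** adj2 B"
  have C: "C \<in> \<Gamma>" using A B by (simp add: C_def)
  have g: "w \<in> generic \<Gamma>" using w by (rule typical_generic)
  have gB: "act B w \<in> generic \<Gamma>" by (rule generic_act[OF g B])
  have AB: "A = C ** B"
    using adj2_mult[OF in_SL2R[OF B]] unfolding C_def by (simp add: matrix_mul_assoc[symmetric] matrix_mul_rid)
  have actC: "act C (act B w) = act A w" using act_act[OF g C B] AB by simp
  have "C$2$1 = 0 \<or> C$2$1 = 2 * fst (snd (act B w)) * cocycle C (fst (act B w))"
    by (rule apex_coincide) (use gB C a e actC in \<open>auto simp: generic_def\<close>)
  then have "C$2$1 = 0" using w B C unfolding typical_def by blast
  then obtain n where n: "C = shift n \<or> C = - shift n" using in_stab_infD[OF C] by blast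
  show ?thesis
  proof (rule that)
    show "A = shift n ** B \<or> A = - (shift n ** B)" using n AB by (auto simp: mat2_mult_neg)
    show "act A w = act (shift n) (act B w)" using n actC by auto
  qed
qed

lemma excursion_region_nz: "(x, a) \<in> excursion_region k \<Longrightarrow> a \<noteq> 0"
  by (auto simp: excursion_region_def)

text \<open>
  A translation that keeps both points in the excursion region is trivial.
\<close>

lemma excursion_fiber:
  assumes w: "typical w" and A: "A \<in> \<Gamma>" "pr (act A w) \<in> excursion_region 2"
    and B: "B \<in> \<Gamma>" "pr (act B w) \<in> excursion_region 2" and e: "apex_time (act A w) = apex_time (act B w)"
  shows "act A w = act B w" "A = B \<or> A = - B"
proof -
  obtain n where n: "A = shift n ** B \<or> A = - (shift n ** B)" "act A w = act (shift n) (act B w)"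
    using excursion_same_time[OF w A(1) B(1) _ _ e] A(2) B(2) excursion_region_nz by blast
  obtain x a s where p: "act B w = (x, a, s)" by (metis surj_pair)
  have "act A w = (x + of_int n, a, s)" using n(2) p by (simp add: act_shift)
  then have "(x, a) \<in> excursion_region 2" "(x + of_int n, a) \<in> excursion_region 2" using A(2) B(2) p by auto
  then have "\<bar>real_of_int n\<bar> < 1" by (auto simp: excursion_region_def)
  then have n0: "n = 0" by linarith
  show "act A w = act B w" using n(2) by (simp add: n0 one_shift)
  show "A = B \<or> A = - B" using n(1) by (simp add: n0 one_shift matrix_mul_lid)
qed

lemma apex_inj: "typical w \<Longrightarrow> inj_on apex_time (excursions w)"
  using excursion_fiber(1) unfolding inj_on_def excursions_def by blast

definition exc_between :: "horo_coords \<Rightarrow> real set \<Rightarrow> horo_coords set" where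
  "exc_between w I = {p \<in> excursions w. apex_time p \<in> I}"

text \<open>
  Every excursion is counted by exactly two group elements of opposite sign.
\<close>

lemma orbit_count_excursions:
  fixes h :: "real \<times> real \<Rightarrow> real"
  assumes w: "typical w" and fin: "orbit_count (indicator (excursion_region 2)) w I < \<infinity>"
    and h0: "\<And>q. 0 \<le> h q" and hs: "\<And>q. q \<notin> excursion_region 2 \<Longrightarrow> h q = 0"
  shows "finite (exc_between w I)"
    "orbit_count (\<lambda>q. ennreal (h q)) w I = ennreal (2 * (\<Sum>p\<in>exc_between w I. h (pr p)))"
proof -
  define E where "E = {A \<in> \<Gamma>. pr (act A w) \<in> excursion_region 2 \<and> apex_time (act A w) \<in> I}"
  have "orbit_count (indicator (excursion_region 2)) w I = (\<integral>\<^sup>+A. indicator E A \<partial>count_space \<Gamma>)"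
    unfolding orbit_count_def orbit_sum_def
    by (intro nn_integral_cong) (auto simp: height_fun_def E_def split: split_indicator)
  also have "\<dots> = emeasure (count_space \<Gamma>) E" by (rule nn_integral_indicator) (auto simp: E_def)
  finally have "emeasure (count_space \<Gamma>) E < \<infinity>" using fin by simp
  then have fE: "finite E" by (subst (asm) emeasure_count_space) (auto simp: E_def split: if_splits)
  have Q: "exc_between w I = (\<lambda>A. act A w) ` E"
    by (auto simp: exc_between_def excursions_def E_def)
  show "finite (exc_between w I)" unfolding Q using fE by simp
  have fib: "card {A \<in> E. act A w = p} = 2" if p: "p \<in> exc_between w I" for p
  proof -
    obtain B where B: "B \<in> E" "p = act B w" using p unfolding Q by blast
    then have BG: "B \<in> \<Gamma>" by (simp add: E_def)
    have "{A \<in> E. act A w = p} = {B, - B}"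
    proof
      show "{A \<in> E. act A w = p} \<subseteq> {B, - B}"
      proof
        fix A assume "A \<in> {A \<in> E. act A w = p}"
        then have A: "A \<in> \<Gamma>" "act A w = act B w" using B(2) by (auto simp: E_def)
        have "pr (act B w) \<in> excursion_region 2" using B(1) by (simp add: E_def)
        then show "A \<in> {B, - B}" using excursion_fiber(2)[OF w A(1) _ BG] A(2) by auto
      qed
      show "{B, - B} \<subseteq> {A \<in> E. act A w = p}" using B BG by (auto simp: E_def)
    qed
    then show ?thesis using neg_neq[OF BG] by simp
  qed
  have "orbit_count (\<lambda>q. ennreal (h q)) w I = (\<Sum>A\<in>E. ennreal (h (pr (act A w))))"
    unfolding orbit_count_def orbit_sum_def
  proof (subst nn_integral_count_space'[OF fE])
    show "height_fun (\<lambda>q. ennreal (h q)) I (act A w) = 0" if "A \<in> \<Gamma>" "A \<notin> E" for A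
      using that hs[of "pr (act A w)"] by (auto simp: height_fun_def E_def split: split_indicator)
    show "E \<subseteq> \<Gamma>" by (auto simp: E_def)
    show "(\<Sum>A\<in>E. height_fun (\<lambda>q. ennreal (h q)) I (act A w)) = (\<Sum>A\<in>E. ennreal (h (pr (act A w))))"
      by (intro sum.cong) (auto simp: height_fun_def E_def)
  qed
  also have "\<dots> = ennreal (\<Sum>A\<in>E. h (pr (act A w)))" using h0 by (simp add: sum_ennreal)
  also have "(\<Sum>A\<in>E. h (pr (act A w))) = (\<Sum>p\<in>exc_between w I. \<Sum>A\<in>{A \<in> E. act A w = p}. h (pr (act A w)))"
    unfolding Q by (rule sum.image_gen[OF fE])
  also have "\<dots> = (\<Sum>p\<in>exc_between w I. 2 * h (pr p))"
    by (intro sum.cong refl) (simp add: fib)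
  finally show "orbit_count (\<lambda>q. ennreal (h q)) w I = ennreal (2 * (\<Sum>p\<in>exc_between w I. h (pr p)))"
    by (simp add: sum_distrib_left)
qed

theorem excursion_average:
  fixes h :: "real \<times> real \<Rightarrow> real"
  assumes fin: "AE w in lborel. \<forall>n::nat. orbit_count (indicator (excursion_region 2)) w {- real n..<real n} < \<infinity>"
    and h: "h \<in> borel_measurable borel" and h0: "\<And>q. 0 \<le> h q" and hs: "\<And>q. q \<notin> excursion_region 2 \<Longrightarrow> h q = 0"
    and \<mu>: "(\<integral>\<^sup>+q. ennreal (h q) \<partial>lborel) = ennreal \<mu>" "0 \<le> \<mu>"
  shows "AE w in lborel. (\<lambda>n. (\<Sum>p\<in>exc_between w {0..<real n}. h (pr p)) / real n) \<longlonglongrightarrow> \<mu> / measure lborel F"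
proof -
  have "(\<lambda>q. ennreal (h q)) \<in> borel_measurable borel" using h by measurable
  from count_average[OF this \<mu>] fin AE_typical
  show ?thesis
  proof eventually_elim
    case (elim w)
    have fw: "orbit_count (indicator (excursion_region 2)) w {0..<real n} < \<infinity>" for n
    proof -
      have "orbit_count (indicator (excursion_region 2)) w {0..<real n} \<le> orbit_count (indicator (excursion_region 2)) w {- real n..<real n}"
        by (rule orbit_count_mono) auto
      also have "\<dots> < \<infinity>" using elim(2) by blast
      finally show ?thesis .
    qed
    have "enn2real (orbit_count (\<lambda>q. ennreal (h q)) w {0..<real n}) = 2 * (\<Sum>p\<in>exc_between w {0..<real n}. h (pr p))" for n
    proof -
      have "orbit_count (\<lambda>q. ennreal (h q)) w {0..<real n} = ennreal (2 * (\<Sum>p\<in>exc_between w {0..<real n}. h (pr p)))"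
        by (rule orbit_count_excursions(2)[OF elim(3) fw]) (use h0 hs in auto)
      moreover have "0 \<le> 2 * (\<Sum>p\<in>exc_between w {0..<real n}. h (pr p))" using h0 by (simp add: sum_nonneg)
      ultimately show ?thesis by simp
    qed
    then have "(\<lambda>n. 2 * ((\<Sum>p\<in>exc_between w {0..<real n}. h (pr p)) / real n)) \<longlonglongrightarrow> 2 * (\<mu> / measure lborel F)"
      using elim(1) by simp
    then show ?case by (subst (asm) tendsto_mult_left_iff) auto
  qed
qed

text \<open>
  A lift that is tangent to a horocycle can be translated by an integer so that its forward endpoint lies
  in \<open>(0, 1)\<close> if \<open>a > 0\<close>, and in \<open>(-1, 0)\<close> if \<open>a < 0\<close>.
\<close>

lemma depth_params_eq:
  assumes w: "typical w" and k: "k \<le> 2"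
  shows "depth_params k (orbit_T1 \<Gamma> (Psi w)) = apex_time ` {p \<in> excursions w. 2 * \<bar>fst (snd p)\<bar> < k}"
proof
  have g: "w \<in> generic \<Gamma>" using w by (rule typical_generic)
  show "apex_time ` {p \<in> excursions w. 2 * \<bar>fst (snd p)\<bar> < k} \<subseteq> depth_params k (orbit_T1 \<Gamma> (Psi w))"
  proof
    fix t assume "t \<in> apex_time ` {p \<in> excursions w. 2 * \<bar>fst (snd p)\<bar> < k}"
    then obtain A where A: "A \<in> \<Gamma>" "pr (act A w) \<in> excursion_region 2" "2 * \<bar>fst (snd (act A w))\<bar> < k" "t = apex_time (act A w)"
      by (auto simp: excursions_def)
    obtain x a s where p: "act A w = (x, a, s)" by (metis surj_pair)
    have a: "a \<noteq> 0" using A(2) p excursion_region_nz by auto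
    have "tangent_at (geo (act A w)) (2 * \<bar>a\<bar>) t" unfolding p using a A(4) p by (subst tangent_at_geo) auto
    then show "t \<in> depth_params k (orbit_T1 \<Gamma> (Psi w))"
      unfolding depth_params_def lifts_eq[OF g] using A a p by (auto intro!: bexI[of _ A] exI[of _ "2 * \<bar>a\<bar>"])
  qed
  show "depth_params k (orbit_T1 \<Gamma> (Psi w)) \<subseteq> apex_time ` {p \<in> excursions w. 2 * \<bar>fst (snd p)\<bar> < k}"
  proof
    fix t assume "t \<in> depth_params k (orbit_T1 \<Gamma> (Psi w))"
    then obtain A d where A: "A \<in> \<Gamma>" and d: "0 < d" "d < k" "tangent_at (geo (act A w)) d t"
      unfolding depth_params_def lifts_eq[OF g] by auto
    obtain x a s where p: "act A w = (x, a, s)" by (metis surj_pair)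
    have a: "a \<noteq> 0" "t = apex_time (x, a, s)" "d = 2 * \<bar>a\<bar>" using d(3) unfolding p tangent_at_geo[OF d(1)] by auto
    have x: "x \<notin> \<int>" using w A p unfolding typical_def by (metis fst_conv)
    define m where "m = (if 0 < a then - \<lfloor>x\<rfloor> else - \<lfloor>x\<rfloor> - 1)"
    have "real_of_int \<lfloor>x\<rfloor> \<noteq> x" using x by (metis Ints_of_int)
    define f where "f = real_of_int \<lfloor>x\<rfloor>"
    have fx: "f < x" "x < f + 1"
      using \<open>real_of_int \<lfloor>x\<rfloor> \<noteq> x\<close> unfolding f_def by linarith+
    have mf: "real_of_int m = (if 0 < a then - f else - f - 1)" by (simp add: m_def f_def)
    have p': "act (shift m ** A) w = (x + of_int m, a, s)"
      using act_act[OF g shift_in A, of m] p by (simp add: act_shift)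
    have "(x + of_int m, a) \<in> excursion_region 2"
      using fx a d k unfolding mf by (auto simp: excursion_region_def)
    then have "(x + of_int m, a, s) \<in> excursions w"
      unfolding excursions_def using A shift_in p' by (intro CollectI exI[of _ "shift m ** A"]) auto
    moreover have "t = apex_time (x + of_int m, a, s)" using a by (simp add: apex_time_def)
    ultimately show "t \<in> apex_time ` {p \<in> excursions w. 2 * \<bar>fst (snd p)\<bar> < k}"
      using a d by (intro image_eqI[of _ _ "(x + of_int m, a, s)"]) auto
  qed
qed

lemma approx_depth_params_eq:
  assumes w: "typical w" and k: "k \<le> 2"
  shows "approx_depth_params k (orbit_T1 \<Gamma> (Psi w)) = apex_time ` {p \<in> excursions w.
    2 * \<bar>fst (snd p)\<bar> < k \<and> (fst p, fst p - 1 / fst (snd p)) \<in> I_region}"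
proof
  have g: "w \<in> generic \<Gamma>" using w by (rule typical_generic)
  show "apex_time ` {p \<in> excursions w. 2 * \<bar>fst (snd p)\<bar> < k \<and> (fst p, fst p - 1 / fst (snd p)) \<in> I_region}
      \<subseteq> approx_depth_params k (orbit_T1 \<Gamma> (Psi w))"
  proof
    fix t assume "t \<in> apex_time ` {p \<in> excursions w. 2 * \<bar>fst (snd p)\<bar> < k \<and> (fst p, fst p - 1 / fst (snd p)) \<in> I_region}"
    then obtain A where A: "A \<in> \<Gamma>" "pr (act A w) \<in> excursion_region 2" "2 * \<bar>fst (snd (act A w))\<bar> < k" "t = apex_time (act A w)"
        "(fst (act A w), fst (act A w) - 1 / fst (snd (act A w))) \<in> I_region"
      by (auto simp: excursions_def)
    obtain x a s where p: "act A w = (x, a, s)" by (metis surj_pair)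
    have a: "a \<noteq> 0" using A(2) p excursion_region_nz by auto
    have I: "(x, x - 1 / a) \<in> I_region" using A(5) p by simp
    have J: "(x, x - 1 / a) \<in> J_region" using I by (auto simp: I_region_def J_region_def)
    have "tangent_at (geo (act A w)) (2 * \<bar>a\<bar>) t" unfolding p using a A(4) p by (subst tangent_at_geo) auto
    moreover have "endpoints_in (geo (act A w)) J_region" "endpoints_in (geo (act A w)) I_region"
      unfolding p using I J by (simp_all add: endpoints_in_geo[OF a])
    ultimately show "t \<in> approx_depth_params k (orbit_T1 \<Gamma> (Psi w))"
      unfolding approx_depth_params_def lifts_eq[OF g] using A a p by (auto intro!: bexI[of _ A] exI[of _ "2 * \<bar>a\<bar>"])
  qed
  show "approx_depth_params k (orbit_T1 \<Gamma> (Psi w)) \<subseteq> apex_time ` {p \<in> excursions w.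
      2 * \<bar>fst (snd p)\<bar> < k \<and> (fst p, fst p - 1 / fst (snd p)) \<in> I_region}"
  proof
    fix t assume "t \<in> approx_depth_params k (orbit_T1 \<Gamma> (Psi w))"
    then obtain A d where A: "A \<in> \<Gamma>" and d: "0 < d" "d < k" "tangent_at (geo (act A w)) d t"
      and ep: "endpoints_in (geo (act A w)) J_region" "endpoints_in (geo (act A w)) I_region"
      unfolding approx_depth_params_def lifts_eq[OF g] by auto
    obtain x a s where p: "act A w = (x, a, s)" by (metis surj_pair)
    have a: "a \<noteq> 0" "t = apex_time (x, a, s)" "d = 2 * \<bar>a\<bar>" using d(3) unfolding p tangent_at_geo[OF d(1)] by auto
    have J: "(x, x - 1 / a) \<in> J_region" "(x, x - 1 / a) \<in> I_region" using ep unfolding p endpoints_in_geo[OF a(1)] by auto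
    have "(x, a) \<in> excursion_region 2"
    proof -
      consider "- 1 < x" "x < 0" "0 < x - 1 / a" | "0 < x" "x < 1" "x - 1 / a < 0"
        using J(1) by (auto simp: J_region_def)
      then show ?thesis
      proof cases
        case 1
        then have "1 / a < 0" by linarith
        then have "a < 0" by simp
        then show ?thesis using 1 a d k by (auto simp: excursion_region_def)
      next
        case 2
        then have "0 < 1 / a" by linarith
        then have "0 < a" by simp
        then show ?thesis using 2 a d k by (auto simp: excursion_region_def)
      qed
    qed
    then have "(x, a, s) \<in> excursions w"
      unfolding excursions_def using A p by (intro CollectI exI[of _ A]) auto
    then show "t \<in> apex_time ` {p \<in> excursions w. 2 * \<bar>fst (snd p)\<bar> < k \<and> (fst p, fst p - 1 / fst (snd p)) \<in> I_region}"
      using a d J by (intro image_eqI[of _ _ "(x, a, s)"]) auto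
  qed
qed

end

section \<open>Averages along an increasing enumeration\<close>

text \<open>
  If \<open>D\<close> has density \<open>lam\<close>, its \<open>i\<close>-th element is about \<open>i / lam\<close>, and averages per unit time become
  averages per element after division by \<open>lam\<close>. The \<open>i\<close>-th element is the one with \<open>i - 1\<close> predecessors, and
  \<open>m i\<close>, its integer part, translates between sums up to \<open>i\<close> and sums over an integer interval.
\<close>

lemma increasing_enumeration_limit:
  fixes D :: "real set" and lam :: real
  assumes D0: "D \<subseteq> {0..}" and fin: "\<And>n::nat. finite (D \<inter> {0..<real n})"
    and lim: "(\<lambda>n. real (card (D \<inter> {0..<real n})) / real n) \<longlonglongrightarrow> lam" and pos: "0 < lam"
  obtains t where "increasing_enumeration t D"
    "(\<lambda>n. (\<Sum>i=1..n. t (i + 1) - t i) / real n) \<longlonglongrightarrow> 1 / lam"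
    "\<And>g \<sigma>. (\<And>x. x \<in> D \<Longrightarrow> 0 \<le> g x) \<Longrightarrow>
       (\<lambda>n. (\<Sum>x\<in>D \<inter> {0..<real n}. g x) / real n) \<longlonglongrightarrow> \<sigma> \<Longrightarrow>
       (\<lambda>n. (\<Sum>i=1..n. g (t i)) / real n) \<longlonglongrightarrow> \<sigma> / lam"
proof -
  define N where "N n = card (D \<inter> {0..<real n})" for n :: nat
  define rank where "rank x = card (D \<inter> {0..<x})" for x :: real
  have finx: "finite (D \<inter> {0..<x})" for x
  proof -
    obtain n where "x \<le> real n" using real_arch_simple by blast
    then have "D \<inter> {0..<x} \<subseteq> D \<inter> {0..<real n}" by auto
    then show ?thesis using fin finite_subset by blast
  qed
  have rank_less: "rank x < rank y" if "x \<in> D" "x < y" for x y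
  proof -
    have "x \<in> D \<inter> {0..<y}" "x \<notin> D \<inter> {0..<x}" using that D0 by auto
    moreover have "D \<inter> {0..<x} \<subseteq> D \<inter> {0..<y}" using that by auto
    ultimately have "D \<inter> {0..<x} \<subset> D \<inter> {0..<y}" by blast
    then show ?thesis unfolding rank_def by (rule psubset_card_mono[OF finx])
  qed
  have inj: "inj_on rank D" by (rule inj_onI) (metis rank_less less_irrefl linorder_neqE_linordered_idom)
  have infD: "infinite D"
  proof
    assume "finite D"
    then have "real (N n) \<le> real (card D)" for n unfolding N_def by (simp add: card_mono)
    then have le: "real (N n) / real n \<le> real (card D) / real n" for n by (simp add: divide_right_mono)
    have "(\<lambda>n. real (card D) / real n) \<longlonglongrightarrow> 0" by (rule lim_const_over_n)
    with lim[folded N_def] have "lam \<le> 0" by (rule LIMSEQ_le) (use le in auto)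
    then show False using pos by simp
  qed
  have down: "m \<in> rank ` D" if "Suc m \<in> rank ` D" for m
  proof -
    from that obtain x where x: "x \<in> D" "rank x = Suc m" by auto
    define S where "S = D \<inter> {0..<x}"
    have S: "finite S" "S \<noteq> {}" "card S = Suc m" using x finx[of x] by (auto simp: S_def rank_def)
    define y where "y = Max S"
    have yS: "y \<in> S" using S by (simp add: y_def)
    have "S = insert y (D \<inter> {0..<y})"
      using yS S(1) unfolding y_def S_def using Max_ge[of "D \<inter> {0..<x}"] by (force simp: le_less)
    then have "card S = Suc (rank y)" unfolding rank_def using finx by simp
    then have "rank y = m" using S by simp
    then show ?thesis using yS by (auto simp: S_def)
  qed
  have surj: "rank ` D = UNIV"
  proof -
    have inf: "infinite (rank ` D)" using infD inj by (simp add: finite_image_iff)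
    have "m \<in> rank ` D" for m
    proof -
      obtain k where k: "m < k" "k \<in> rank ` D" using inf unfolding infinite_nat_iff_unbounded by blast
      have "k - j \<in> rank ` D" if "j \<le> k" for j
        using that
      proof (induction j)
        case (Suc j)
        then have "Suc (k - Suc j) \<in> rank ` D" by (simp add: Suc_diff_Suc)
        then show ?case by (rule down)
      qed (use k in simp)
      from this[of "k - m"] show ?thesis using k by simp
    qed
    then show ?thesis by auto
  qed
  \<comment> \<open>Enumerations start at 1, ranks at 0.\<close>
  define t where "t i = inv_into D rank (i - 1)" for i
  have tD: "t i \<in> D" for i unfolding t_def by (rule inv_into_into) (simp add: surj)
  have tr: "rank (t i) = i - 1" for i unfolding t_def by (rule f_inv_into_f) (simp add: surj)
  have t_mono: "t i < t j" if "1 \<le> i" "i < j" for i j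
  proof (rule ccontr)
    assume "\<not> t i < t j"
    then have "rank (t j) \<le> rank (t i)" using rank_less[OF tD, of j "t i"] by (cases "t i = t j") auto
    then show False using that by (simp add: tr)
  qed
  have t_img: "t ` {1..} = D"
  proof
    show "D \<subseteq> t ` {1..}"
    proof
      fix x assume x: "x \<in> D"
      have "t (Suc (rank x)) = x" unfolding t_def using inv_into_f_f[OF inj x] by simp
      then show "x \<in> t ` {1..}" by (intro image_eqI[of _ _ "Suc (rank x)"]) auto
    qed
  qed (use tD in auto)
  have enum: "increasing_enumeration t D"
    unfolding increasing_enumeration_def using t_mono t_img by (auto intro!: strict_mono_onI)
  have t0: "0 \<le> t i" for i using tD[of i] D0 by auto
  define m where "m i = nat \<lfloor>t i\<rfloor>" for i
  have m: "real (m i) \<le> t i" "t i < real (m i + 1)" for i using t0[of i] by (auto simp: m_def) linarith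
  have N_up: "i \<le> N (m i + 1)" if "1 \<le> i" for i
  proof -
    have "Suc (rank (t i)) = card (insert (t i) (D \<inter> {0..<t i}))" unfolding rank_def using finx by simp
    also have "\<dots> \<le> N (m i + 1)" unfolding N_def
      by (rule card_mono[OF fin]) (use tD[of i] t0[of i] m[of i] in auto)
    finally show ?thesis using that by (simp add: tr)
  qed
  have N_lo: "N (m i) \<le> i - 1" for i
  proof -
    have "N (m i) \<le> rank (t i)" unfolding N_def rank_def
      by (rule card_mono[OF finx]) (use m[of i] in auto)
    then show ?thesis by (simp add: tr)
  qed
  have N_mono: "N a \<le> N b" if "a \<le> b" for a b
    unfolding N_def by (rule card_mono[OF fin]) (use that in auto)
  have m_inf: "filterlim m at_top sequentially"
    unfolding filterlim_at_top
  proof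
    fix Z :: nat
    show "\<forall>\<^sub>F i in sequentially. Z \<le> m i"
      using eventually_ge_at_top[of "N Z + 1"]
    proof eventually_elim
      case (elim i)
      show ?case
      proof (rule ccontr)
        assume "\<not> Z \<le> m i"
        then have "N (m i + 1) \<le> N Z" by (intro N_mono) auto
        then show False using N_up[of i] elim by simp
      qed
    qed
  qed
  have m_pos: "\<forall>\<^sub>F i in sequentially. 1 \<le> m i" using m_inf unfolding filterlim_at_top by blast
  have sandwich: "(\<lambda>i. h i / real (m i)) \<longlonglongrightarrow> \<tau>"
    if H: "(\<lambda>n. H n / real n) \<longlonglongrightarrow> \<tau>" and lo: "\<forall>\<^sub>F i in sequentially. H (m i) \<le> h i"
      and up: "\<forall>\<^sub>F i in sequentially. h i \<le> H (m i + 1)" for h :: "nat \<Rightarrow> real" and H \<tau>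
  proof (rule tendsto_sandwich)
    show "(\<lambda>i. H (m i) / real (m i)) \<longlonglongrightarrow> \<tau>" by (rule filterlim_compose[OF H m_inf])
    show "(\<lambda>i. H (m i + 1) / real (m i)) \<longlonglongrightarrow> \<tau>"
    proof -
      have "(\<lambda>n. H (n + 1) / real (n + 1)) \<longlonglongrightarrow> \<tau>" using LIMSEQ_ignore_initial_segment[OF H, of 1] .
      moreover have "(\<lambda>n. real (n + 1) / real n) \<longlonglongrightarrow> 1"
        using LIMSEQ_Suc_n_over_n by (simp add: add.commute)
      ultimately have "(\<lambda>n. H (n + 1) / real (n + 1) * (real (n + 1) / real n)) \<longlonglongrightarrow> \<tau> * 1" by (rule tendsto_mult)
      moreover have "H (n + 1) / real (n + 1) * (real (n + 1) / real n) = H (n + 1) / real n" for n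
        by simp
      ultimately have "(\<lambda>n. H (n + 1) / real n) \<longlonglongrightarrow> \<tau>" by (simp only: mult_1_right)
      from filterlim_compose[OF this m_inf] show ?thesis .
    qed
    show "\<forall>\<^sub>F i in sequentially. H (m i) / real (m i) \<le> h i / real (m i)"
      using lo by eventually_elim (simp add: divide_right_mono)
    show "\<forall>\<^sub>F i in sequentially. h i / real (m i) \<le> H (m i + 1) / real (m i)"
      using up by eventually_elim (simp add: divide_right_mono)
  qed
  have i_m: "(\<lambda>i. real i / real (m i)) \<longlonglongrightarrow> lam"
  proof (rule sandwich[where H = "\<lambda>n. real (N n)"])
    show "(\<lambda>n. real (N n) / real n) \<longlonglongrightarrow> lam" using lim by (simp add: N_def)
    show "\<forall>\<^sub>F i in sequentially. real (N (m i)) \<le> real i"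
    proof (intro always_eventually allI)
      fix i show "real (N (m i)) \<le> real i" using N_lo[of i] by linarith
    qed
    show "\<forall>\<^sub>F i in sequentially. real i \<le> real (N (m i + 1))"
      using eventually_ge_at_top[of 1] by eventually_elim (use N_up in force)
  qed
  have t_m: "(\<lambda>i. t i / real (m i)) \<longlonglongrightarrow> 1"
  proof (rule sandwich[where H = real])
    show "(\<lambda>n. real n / real n) \<longlonglongrightarrow> 1"
      by (rule Lim_transform_eventually[OF tendsto_const]) (use eventually_gt_at_top[of 0] in \<open>eventually_elim, simp\<close>)
    show "\<forall>\<^sub>F i in sequentially. real (m i) \<le> t i" using m by simp
    show "\<forall>\<^sub>F i in sequentially. t i \<le> real (m i + 1)" using m by (simp add: less_imp_le)
  qed
  have ratio: "(\<lambda>i. h i / real i) \<longlonglongrightarrow> \<tau> / lam" if "(\<lambda>i. h i / real (m i)) \<longlonglongrightarrow> \<tau>" for h :: "nat \<Rightarrow> real" and \<tau>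
  proof -
    have "(\<lambda>i. (h i / real (m i)) / (real i / real (m i))) \<longlonglongrightarrow> \<tau> / lam"
      using that i_m pos by (intro tendsto_divide) auto
    then show ?thesis
      by (rule Lim_transform_eventually) (use m_pos in \<open>eventually_elim, simp\<close>)
  qed
  have t_i: "(\<lambda>i. t i / real i) \<longlonglongrightarrow> 1 / lam" by (rule ratio[OF t_m])
  have tel: "(\<Sum>i=1..n. t (i + 1) - t i) = t (n + 1) - t 1" for n
    by (induction n) auto
  have avg: "(\<lambda>n. (\<Sum>i=1..n. t (i + 1) - t i) / real n) \<longlonglongrightarrow> 1 / lam"
  proof -
    have "(\<lambda>n. t (n + 1) / real (n + 1)) \<longlonglongrightarrow> 1 / lam" using LIMSEQ_ignore_initial_segment[OF t_i, of 1] .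
    moreover have "(\<lambda>n. real (n + 1) / real n) \<longlonglongrightarrow> 1"
      using LIMSEQ_Suc_n_over_n by (simp add: add.commute)
    ultimately have "(\<lambda>n. t (n + 1) / real (n + 1) * (real (n + 1) / real n) - t 1 / real n) \<longlonglongrightarrow> 1 / lam * 1 - 0"
      by (intro tendsto_diff tendsto_mult lim_const_over_n)
    moreover have "t (n + 1) / real (n + 1) * (real (n + 1) / real n) - t 1 / real n = (\<Sum>i=1..n. t (i + 1) - t i) / real n" for n
      unfolding tel by (simp add: diff_divide_distrib)
    ultimately show ?thesis by simp
  qed
  have sums: "(\<lambda>n. (\<Sum>i=1..n. g (t i)) / real n) \<longlonglongrightarrow> \<sigma> / lam"
    if g: "\<And>x. x \<in> D \<Longrightarrow> 0 \<le> g x" and G: "(\<lambda>n. (\<Sum>x\<in>D \<inter> {0..<real n}. g x) / real n) \<longlonglongrightarrow> \<sigma>" for g \<sigma>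
  proof (rule ratio, rule sandwich[OF G])
    have t_inj: "inj_on t {1..n}" for n
      by (rule inj_onI) (metis atLeastAtMost_iff less_irrefl linorder_neqE_nat t_mono)
    have S: "(\<Sum>i=1..n. g (t i)) = (\<Sum>x\<in>t ` {1..n}. g x)" for n
      unfolding sum.reindex[OF t_inj] o_def ..
    show "\<forall>\<^sub>F i in sequentially. (\<Sum>x\<in>D \<inter> {0..<real (m i)}. g x) \<le> (\<Sum>j=1..i. g (t j))"
    proof (intro always_eventually allI)
      fix i
      show "(\<Sum>x\<in>D \<inter> {0..<real (m i)}. g x) \<le> (\<Sum>j=1..i. g (t j))"
        unfolding S
      proof (rule sum_mono2)
        show "D \<inter> {0..<real (m i)} \<subseteq> t ` {1..i}"
        proof
          fix x assume x: "x \<in> D \<inter> {0..<real (m i)}"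
          then obtain j where j: "1 \<le> j" "x = t j" using t_img by auto
          have "j < i"
          proof (rule ccontr)
            assume "\<not> j < i"
            then have "t i \<le> t j \<or> i = 0" using t_mono[of i j] by (cases "i = j") auto
            moreover have "x < t i" using x m(1)[of i] by simp
            moreover have "i \<noteq> 0"
            proof
              assume "i = 0"
              then have "rank (t i) = 0" by (simp add: tr)
              moreover have "rank x < rank (t i)" using rank_less[of x "t i"] x \<open>x < t i\<close> by blast
              ultimately show False by simp
            qed
            ultimately show False using j by simp
          qed
          then show "x \<in> t ` {1..i}" using j by auto
        qed
        show "0 \<le> g b" if "b \<in> t ` {1..i} - D \<inter> {0..<real (m i)}" for b using that g tD by auto
      qed simp
    qed
    show "\<forall>\<^sub>F i in sequentially. (\<Sum>j=1..i. g (t j)) \<le> (\<Sum>x\<in>D \<inter> {0..<real (m i + 1)}. g x)"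
    proof (intro always_eventually allI)
      fix i
      show "(\<Sum>j=1..i. g (t j)) \<le> (\<Sum>x\<in>D \<inter> {0..<real (m i + 1)}. g x)"
        unfolding S
      proof (rule sum_mono2[OF fin])
        show "t ` {1..i} \<subseteq> D \<inter> {0..<real (m i + 1)}"
        proof
          fix x assume "x \<in> t ` {1..i}"
          then obtain j where j: "1 \<le> j" "j \<le> i" "x = t j" by auto
          then have "t j \<le> t i" using t_mono[of j i] by (cases "j = i") auto
          then show "x \<in> D \<inter> {0..<real (m i + 1)}" using j tD t0[of j] m(2)[of i] by auto
        qed
        show "0 \<le> g b" if "b \<in> D \<inter> {0..<real (m i + 1)} - t ` {1..i}" for b using that g by auto
      qed
    qed
  qed
  show ?thesis by (rule that[OF enum avg sums])
qed

text \<open>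
  A real parameter is enclosed between two rational ones for which \<open>\<phi>\<close> has nearly the same value.
\<close>

lemma monotone_family_limit:
  fixes f :: "real \<Rightarrow> nat \<Rightarrow> real" and \<phi> :: "real \<Rightarrow> real"
  assumes mono: "\<And>k k' n. 0 < k \<Longrightarrow> k \<le> k' \<Longrightarrow> k' \<le> 2 \<Longrightarrow> f k n \<le> f k' n"
    and cont: "continuous_on {0<..2} \<phi>"
    and rat: "\<And>q. q \<in> \<rat> \<Longrightarrow> 0 < q \<Longrightarrow> q \<le> 2 \<Longrightarrow> (\<lambda>n. f q n / real n) \<longlonglongrightarrow> \<phi> q"
    and k: "0 < k" "k \<le> 2"
  shows "(\<lambda>n. f k n / real n) \<longlonglongrightarrow> \<phi> k"
proof (cases "k = 2")
  case True then show ?thesis using rat[of 2] by simp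
next
  case False
  with k have k2: "k < 2" by simp
  have "open {0<..<2::real}" by simp
  have c: "isCont \<phi> k"
  proof -
    have "continuous_on {0<..<2} \<phi>" by (rule continuous_on_subset[OF cont]) auto
    then show ?thesis using continuous_on_eq_continuous_at[of "{0<..<2}" \<phi>] k k2 by auto
  qed
  show ?thesis
  proof (rule LIMSEQ_I)
    fix e :: real assume e: "0 < e"
    then obtain d where d: "0 < d" "\<And>x. dist x k < d \<Longrightarrow> dist (\<phi> x) (\<phi> k) < e / 2"
      using c unfolding continuous_at_eps_delta by (metis half_gt_zero)
    obtain q where q: "q \<in> \<rat>" "max 0 (k - d) < q" "q < k" using Rats_dense_in_real[of "max 0 (k - d)" k] k d by auto
    obtain q' where q': "q' \<in> \<rat>" "k < q'" "q' < min 2 (k + d)" using Rats_dense_in_real[of k "min 2 (k + d)"] k2 d by auto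
    have dq: "dist (\<phi> q) (\<phi> k) < e / 2" "dist (\<phi> q') (\<phi> k) < e / 2"
      by (rule d(2), use q q' in \<open>simp add: dist_real_def\<close>)+
    obtain N1 where N1: "\<And>n. n \<ge> N1 \<Longrightarrow> norm (f q n / real n - \<phi> q) < e / 2"
      using LIMSEQ_D[OF rat[of q], of "e/2"] q k e by auto
    obtain N2 where N2: "\<And>n. n \<ge> N2 \<Longrightarrow> norm (f q' n / real n - \<phi> q') < e / 2"
      using LIMSEQ_D[OF rat[of q'], of "e/2"] q' k e by auto
    show "\<exists>no. \<forall>n\<ge>no. norm (f k n / real n - \<phi> k) < e"
    proof (intro exI allI impI)
      fix n assume n: "n \<ge> max N1 N2"
      have "f q n / real n \<le> f k n / real n" by (intro divide_right_mono mono) (use q k in auto)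
      moreover have "f k n / real n \<le> f q' n / real n" by (intro divide_right_mono mono) (use q' k in auto)
      ultimately show "norm (f k n / real n - \<phi> k) < e"
        using N1[of n] N2[of n] n dq unfolding real_norm_def dist_real_def by linarith
    qed
  qed
qed

section \<open>Areas of the excursion regions\<close>

text \<open>
  The excursion region is symmetric about the origin, so one integrates over the half with \<open>a > 0\<close>.
\<close>

lemma nn_integral_symmetric:
  fixes g :: "real \<Rightarrow> real \<Rightarrow> ennreal"
  assumes g: "(\<lambda>p. g (fst p) (snd p)) \<in> borel_measurable (borel \<Otimes>\<^sub>M borel)"
    and g0: "\<And>x a. \<not> (0 < x \<and> x < 1 \<and> 0 < a) \<Longrightarrow> g x a = 0"
  shows "(\<integral>\<^sup>+p. g (fst p) (snd p) + g (- fst p) (- snd p) \<partial>lborel) =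
    2 * (\<integral>\<^sup>+x. (\<integral>\<^sup>+a. g x a \<partial>lborel) * indicator {0<..<1} x \<partial>lborel)"
proof -
  have gm[measurable (raw)]: "(\<lambda>z. g (f z) (h z)) \<in> borel_measurable M"
    if "f \<in> borel_measurable M" "h \<in> borel_measurable M" for f h and M :: "'c measure"
    using measurable_compose[OF measurable_Pair[OF that] g] by simp
  have m: "(\<lambda>p. g (- fst p) (- snd p)) \<in> borel_measurable (borel \<Otimes>\<^sub>M borel)" by measurable
  have P: "(\<integral>\<^sup>+p. f (fst p) (snd p) \<partial>lborel) = (\<integral>\<^sup>+x. \<integral>\<^sup>+a. f x a \<partial>lborel \<partial>lborel)"
    if "(\<lambda>p. f (fst p) (snd p)) \<in> borel_measurable (borel \<Otimes>\<^sub>M borel)" for f :: "real \<Rightarrow> real \<Rightarrow> ennreal"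
  proof -
    have "(\<lambda>p. f (fst p) (snd p)) \<in> borel_measurable (lborel \<Otimes>\<^sub>M lborel)" using that by (simp add: lborel_prod borel_prod)
    from lborel.nn_integral_fst[OF this] show ?thesis by (simp add: lborel_prod)
  qed
  have neg: "(\<integral>\<^sup>+x. f (- x) \<partial>lborel) = (\<integral>\<^sup>+x. f x \<partial>lborel)" if "f \<in> borel_measurable borel" for f :: "real \<Rightarrow> ennreal"
    using nn_integral_scale[OF that, of "-1" 0] by simp
  have "(\<integral>\<^sup>+p. g (fst p) (snd p) + g (- fst p) (- snd p) \<partial>lborel) =
    (\<integral>\<^sup>+p. g (fst p) (snd p) \<partial>lborel) + (\<integral>\<^sup>+p. g (- fst p) (- snd p) \<partial>lborel)"
    using g m by (intro nn_integral_add) (simp_all add: borel_prod)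
  also have "(\<integral>\<^sup>+p. g (- fst p) (- snd p) \<partial>lborel) = (\<integral>\<^sup>+x. \<integral>\<^sup>+a. g (- x) (- a) \<partial>lborel \<partial>lborel)"
    by (rule P[OF m])
  also have "\<dots> = (\<integral>\<^sup>+x. \<integral>\<^sup>+a. g (- x) a \<partial>lborel \<partial>lborel)"
    by (rule nn_integral_cong, rule neg) measurable
  also have "\<dots> = (\<integral>\<^sup>+x. \<integral>\<^sup>+a. g x a \<partial>lborel \<partial>lborel)" by (rule neg) measurable
  also have "(\<integral>\<^sup>+p. g (fst p) (snd p) \<partial>lborel) = (\<integral>\<^sup>+x. \<integral>\<^sup>+a. g x a \<partial>lborel \<partial>lborel)" by (rule P[OF g])
  also have "(\<integral>\<^sup>+x. \<integral>\<^sup>+a. g x a \<partial>lborel \<partial>lborel) = (\<integral>\<^sup>+x. (\<integral>\<^sup>+a. g x a \<partial>lborel) * indicator {0<..<1} x \<partial>lborel)"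
  proof (intro nn_integral_cong)
    fix x :: real
    have "(\<integral>\<^sup>+a. g x a \<partial>lborel) = 0" if "\<not> (0 < x \<and> x < 1)"
    proof -
      have "(\<integral>\<^sup>+a. g x a \<partial>lborel) = (\<integral>\<^sup>+a. 0 \<partial>(lborel :: real measure))"
        by (intro nn_integral_cong) (use g0 that in auto)
      then show ?thesis by simp
    qed
    then show "(\<integral>\<^sup>+a. g x a \<partial>lborel) = (\<integral>\<^sup>+a. g x a \<partial>lborel) * indicator {0<..<1} x"
      by (auto split: split_indicator)
  qed
  finally show ?thesis by (simp add: mult_2)
qed

lemma area_excursion_region:
  assumes k: "0 < k"
  shows "(\<integral>\<^sup>+p. ennreal (indicator (excursion_region k) p) \<partial>lborel) = ennreal k"
proof -
  define g :: "real \<Rightarrow> real \<Rightarrow> ennreal" where "g x a = indicator {0<..<1} x * indicator {0<..<k/2} a" for x a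
  have "(\<integral>\<^sup>+p. ennreal (indicator (excursion_region k) p) \<partial>lborel) =
      (\<integral>\<^sup>+p. g (fst p) (snd p) + g (- fst p) (- snd p) \<partial>lborel)"
    by (intro nn_integral_cong) (auto simp: g_def excursion_region_def split: split_indicator)
  also have "\<dots> = 2 * (\<integral>\<^sup>+x. (\<integral>\<^sup>+a. g x a \<partial>lborel) * indicator {0<..<1} x \<partial>lborel)"
  proof (rule nn_integral_symmetric)
    show "(\<lambda>p. g (fst p) (snd p)) \<in> borel_measurable (borel \<Otimes>\<^sub>M borel)" unfolding g_def by measurable
  qed (auto simp: g_def split: split_indicator)
  also have "(\<integral>\<^sup>+x. (\<integral>\<^sup>+a. g x a \<partial>lborel) * indicator {0<..<1} x \<partial>lborel) = (\<integral>\<^sup>+x. ennreal (k / 2) * indicator {0<..<1::real} x \<partial>lborel)"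
    using k by (intro nn_integral_cong) (auto simp: g_def nn_integral_cmult split: split_indicator)
  also have "2 * \<dots> = ennreal k" using k by (simp add: nn_integral_cmult_indicator flip: ennreal_mult' ennreal_numeral)
  finally show ?thesis .
qed

lemma nn_integral_recip:
  assumes "0 \<le> c" "c \<le> 1"
  shows "(\<integral>\<^sup>+x. ennreal (1 / (1 + x)) * indicator {c..1} x \<partial>lborel) = ennreal (ln 2 - ln (1 + c))"
proof -
  have "(\<integral>\<^sup>+x. ennreal (1 / (1 + x)) * indicator {c..1} x \<partial>lborel) = ennreal (ln (1 + 1) - ln (1 + c))"
  proof (rule nn_integral_FTC_Icc)
    show "((\<lambda>x. ln (1 + x)) has_real_derivative 1 / (1 + x)) (at x)" if "x \<in> {c..1}" for x
      using that assms by (auto intro!: derivative_eq_intros)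
  qed (use assms in auto)
  then show ?thesis by simp
qed

text \<open>
  For \<open>0 < x < 1\<close> the excursion is approximating if \<open>x - 1/a < -1\<close>, that is \<open>a < 1/(1 + x)\<close>. So the slice at
  \<open>x\<close> has length \<open>M x = min (k/2) (1/(1 + x))\<close>. For \<open>k \<le> 1\<close> this is \<open>k/2\<close> throughout, otherwise the two
  bounds cross at \<open>c = 2/k - 1\<close>.
\<close>

lemma area_approx_region:
  assumes k: "0 < k" "k \<le> 2"
  shows "(\<integral>\<^sup>+p. ennreal (indicator {p \<in> excursion_region k. (fst p, fst p - 1 / snd p) \<in> I_region} p) \<partial>lborel) = ennreal (calA k)"
proof -
  define M where "M x = min (k / 2) (1 / (1 + x))" for x :: real
  define g :: "real \<Rightarrow> real \<Rightarrow> ennreal" where "g x a = indicator {0<..<1} x * indicator {0<..<M x} a" for x a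
  have I1: "(x, x - 1 / a) \<in> I_region \<longleftrightarrow> a < 1 / (1 + x)" if "0 < x" "x < 1" "0 < a" for x a
    using that by (auto simp: I_region_def field_simps)
  have I2: "(x, x - 1 / a) \<in> I_region \<longleftrightarrow> - a < 1 / (1 + - x)" if "x < 0" "- 1 < x" "a < 0" for x a
    using that by (auto simp: I_region_def field_simps)
  have "(\<integral>\<^sup>+p. ennreal (indicator {p \<in> excursion_region k. (fst p, fst p - 1 / snd p) \<in> I_region} p) \<partial>lborel) =
      (\<integral>\<^sup>+p. g (fst p) (snd p) + g (- fst p) (- snd p) \<partial>lborel)"
  proof (intro nn_integral_cong)
    fix p :: "real \<times> real"
    obtain x a where p: "p = (x, a)" by fastforce
    show "ennreal (indicator {p \<in> excursion_region k. (fst p, fst p - 1 / snd p) \<in> I_region} p) = g (fst p) (snd p) + g (- fst p) (- snd p)"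
      unfolding p using I1[of x a] I2[of x a]
      by (auto simp: g_def excursion_region_def M_def indicator_def)
  qed
  also have "\<dots> = 2 * (\<integral>\<^sup>+x. (\<integral>\<^sup>+a. g x a \<partial>lborel) * indicator {0<..<1} x \<partial>lborel)"
  proof (rule nn_integral_symmetric)
    have e: "g (fst p) (snd p) = indicator {0<..<1} (fst p) * (if 0 < snd p \<and> snd p < M (fst p) then 1 else 0)" for p
      by (auto simp: g_def indicator_def)
    have [measurable]: "M \<in> borel_measurable borel" unfolding M_def[abs_def] by measurable
    show "(\<lambda>p. g (fst p) (snd p)) \<in> borel_measurable (borel \<Otimes>\<^sub>M borel)" unfolding e by measurable
  qed (auto simp: g_def split: split_indicator)
  also have "(\<integral>\<^sup>+x. (\<integral>\<^sup>+a. g x a \<partial>lborel) * indicator {0<..<1} x \<partial>lborel) = (\<integral>\<^sup>+x. ennreal (M x) * indicator {0<..<1} x \<partial>lborel)"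
  proof (intro nn_integral_cong)
    fix x :: real
    have "0 \<le> M x" if "0 < x" using that k by (simp add: M_def)
    then show "(\<integral>\<^sup>+a. g x a \<partial>lborel) * indicator {0<..<1} x = ennreal (M x) * indicator {0<..<1} x"
      by (auto simp: g_def split: split_indicator)
  qed
  also have "2 * \<dots> = ennreal (calA k)"
  proof (cases "k \<le> 1")
    case True
    have "(\<integral>\<^sup>+x. ennreal (M x) * indicator {0<..<1} x \<partial>lborel) = (\<integral>\<^sup>+x. ennreal (k / 2) * indicator {0<..<1::real} x \<partial>lborel)"
    proof (intro nn_integral_cong)
      fix x :: real
      have "k / 2 \<le> 1 / (1 + x)" if "0 < x" "x < 1"
      proof -
        have "k * (1 + x) \<le> 1 * 2" using that k True by (intro mult_mono) auto
        then show ?thesis using that by (simp add: le_divide_eq)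
      qed
      then show "ennreal (M x) * indicator {0<..<1} x = ennreal (k / 2) * indicator {0<..<1} x"
        by (auto simp: M_def min_def split: split_indicator)
    qed
    then show ?thesis using k True by (simp add: nn_integral_cmult_indicator calA_def flip: ennreal_mult' ennreal_numeral)
  next
    case False
    define c where "c = 2 / k - 1"
    have c: "0 \<le> c" "c < 1" using k False by (auto simp: c_def field_simps)
    have "(\<integral>\<^sup>+x. ennreal (M x) * indicator {0<..<1} x \<partial>lborel) =
      (\<integral>\<^sup>+x. ennreal (k / 2) * indicator {0<..<c} x + ennreal (1 / (1 + x)) * indicator {c..1} x \<partial>lborel)"
    proof (intro nn_integral_cong_AE)
      show "AE x in lborel. ennreal (M x) * indicator {0<..<1} x = ennreal (k / 2) * indicator {0<..<c} x + ennreal (1 / (1 + x)) * indicator {c..1} x"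
        using AE_lborel_singleton[of 0] AE_lborel_singleton[of 1]
      proof eventually_elim
        case (elim x)
        have 1: "k / 2 \<le> 1 / (1 + x)" if "0 < x" "x < c"
        proof -
          have "1 + x \<le> 2 / k" using that by (simp add: c_def)
          then have "k * (1 + x) \<le> 2" using k by (simp add: le_divide_eq mult.commute)
          then show ?thesis using that by (simp add: le_divide_eq)
        qed
        have 2: "1 / (1 + x) \<le> k / 2" if "c \<le> x"
        proof -
          have "2 / k \<le> 1 + x" using that by (simp add: c_def)
          then have "2 \<le> k * (1 + x)" using k by (simp add: divide_le_eq mult.commute)
          then show ?thesis using that c by (simp add: divide_le_eq)
        qed
        show ?case
        proof (cases "x < c")
          case True
          then have "0 < x \<Longrightarrow> M x = k / 2" unfolding M_def using 1 by (intro min.absorb1) auto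
          then show ?thesis using True elim c by (auto simp: indicator_def)
        next
          case False
          then have "M x = 1 / (1 + x)" unfolding M_def using 2 by (intro min.absorb2) auto
          then show ?thesis using False elim c by (auto simp: indicator_def)
        qed
      qed
    qed
    also have "\<dots> = (\<integral>\<^sup>+x. ennreal (k / 2) * indicator {0<..<c} x \<partial>lborel) + (\<integral>\<^sup>+x. ennreal (1 / (1 + x)) * indicator {c..1} x \<partial>lborel)"
      by (rule nn_integral_add) auto
    also have "(\<integral>\<^sup>+x. ennreal (k / 2) * indicator {0<..<c} x \<partial>lborel) = ennreal (k / 2 * c)"
    proof -
      have "(\<integral>\<^sup>+x. ennreal (k / 2) * indicator {0<..<c} x \<partial>lborel) = ennreal (k / 2) * ennreal c"
        using c by (simp add: nn_integral_cmult_indicator)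
      also have "\<dots> = ennreal (k / 2 * c)" by (rule ennreal_mult'[symmetric]) (use k in simp)
      finally show ?thesis .
    qed
    also have "(\<integral>\<^sup>+x. ennreal (1 / (1 + x)) * indicator {c..1} x \<partial>lborel) = ennreal (ln 2 - ln (1 + c))"
      by (rule nn_integral_recip) (use c in auto)
    also have "ln 2 - ln (1 + c) = ln k" using k by (simp add: c_def ln_div)
    also have "k / 2 * c = 1 - k / 2" using k by (simp add: c_def field_simps)
    also have "2 * (ennreal (1 - k / 2) + ennreal (ln k)) = ennreal (calA k)"
    proof -
      have "0 \<le> ln k" using False by simp
      then have "ennreal (1 - k / 2) + ennreal (ln k) = ennreal (1 - k / 2 + ln k)" using k by (subst ennreal_plus) auto
      then have "2 * (ennreal (1 - k / 2) + ennreal (ln k)) = ennreal (2 * (1 - k / 2 + ln k))"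
        using ennreal_mult'[of 2 "1 - k / 2 + ln k"] by simp
      moreover have "2 * (1 - k / 2 + ln k) = calA k" using False by (simp add: calA_def)
      ultimately show ?thesis by (simp only:)
    qed
    finally show ?thesis .
  qed
  finally show ?thesis .
qed

text \<open>
  The antiderivative \<open>v arcosh (1/v) + arcsin v\<close> tends to 0 and \<open>\<pi>/2\<close> at the ends. The integrand is half the
  length of an excursion whose depth is \<open>v k\<close>.
\<close>

lemma nn_integral_arcosh:
  "(\<integral>\<^sup>+v. ennreal (arcosh (1 / v)) * indicator {0<..<1} v \<partial>lborel) = ennreal (pi / 2)"
proof -
  define P where "P v = v * arcosh (1 / v) + arcsin v" for v :: real
  have nn: "0 \<le> arcosh (1 / v)" if "0 < v" "v < 1" for v :: real
    using that by (intro arcosh_nonneg_real) simp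
  have der: "(P has_real_derivative arcosh (1 / v)) (at v)" if v: "0 < v" "v < 1" for v
  proof -
    have gt: "1 < 1 / v" using v by simp
    have s: "sqrt ((1 / v)\<^sup>2 - 1) = sqrt (1 - v\<^sup>2) / v"
    proof -
      have "(1 / v)\<^sup>2 - 1 = (1 - v\<^sup>2) / v\<^sup>2" using v by (simp add: field_simps)
      then show ?thesis using v by (simp add: real_sqrt_divide)
    qed
    have p: "0 < sqrt (1 - v\<^sup>2)" using v by (simp add: power_less_one_iff)
    have dv: "((\<lambda>v. 1 / v) has_real_derivative - 1 / v\<^sup>2) (at v)"
      using v by (auto intro!: derivative_eq_intros simp: power2_eq_square)
    have "((\<lambda>v. arcosh (1 / v)) has_real_derivative 1 / sqrt ((1 / v)\<^sup>2 - 1) * (- 1 / v\<^sup>2)) (at v)"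
      by (rule DERIV_chain2[OF arcosh_real_has_field_derivative[OF gt] dv])
    then have d1: "((\<lambda>v. arcosh (1 / v)) has_real_derivative - (1 / (v * sqrt (1 - v\<^sup>2)))) (at v)"
      unfolding s using v by (simp add: power2_eq_square mult.commute)
    have d2: "(arcsin has_real_derivative 1 / sqrt (1 - v\<^sup>2)) (at v)"
      using DERIV_arcsin[of v] v by (simp add: inverse_eq_divide)
    have "(P has_real_derivative (1 * arcosh (1 / v) + - (1 / (v * sqrt (1 - v\<^sup>2))) * v) + 1 / sqrt (1 - v\<^sup>2)) (at v)"
      unfolding P_def[abs_def] by (intro DERIV_add DERIV_mult DERIV_ident d1 d2)
    moreover have "- (1 / (v * sqrt (1 - v\<^sup>2))) * v + 1 / sqrt (1 - v\<^sup>2) = 0" using v p by simp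
    ultimately show ?thesis by (metis (no_types, lifting) add.assoc add.right_neutral mult_1)
  qed
  have lim0: "((P \<circ> real_of_ereal) \<longlongrightarrow> 0) (at_right (ereal 0))"
  proof -
    \<comment> \<open>The logarithmic growth of \<open>arcosh (1/v)\<close> is dominated by \<open>1 / sqrt v\<close>.\<close>
    have b: "0 \<le> v * arcosh (1 / v) \<and> v * arcosh (1 / v) \<le> 2 * sqrt 2 * sqrt v" if v: "0 < v" "v < 1" for v
    proof
      show "0 \<le> v * arcosh (1 / v)" using nn[OF v] v by simp
      have "arcosh (1 / v) = ln (1 / v + sqrt ((1 / v)\<^sup>2 - 1))" using v by (subst arcosh_real_def) auto
      also have "\<dots> \<le> ln (2 / v)"
      proof (rule ln_mono)
        have "sqrt ((1 / v)\<^sup>2 - 1) \<le> sqrt ((1 / v)\<^sup>2)" by (rule real_sqrt_le_mono) simp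
        also have "\<dots> = 1 / v" using v by (simp add: real_sqrt_divide)
        finally show "1 / v + sqrt ((1 / v)\<^sup>2 - 1) \<le> 2 / v" using v by simp
        have "0 < 1 / v" "0 \<le> sqrt ((1 / v)\<^sup>2 - 1)" using v by (auto simp: one_le_power)
        then show "0 < 1 / v + sqrt ((1 / v)\<^sup>2 - 1)" by linarith
      qed
      also have "ln (2 / v) = 2 * ln (sqrt (2 / v))" using v by (simp add: ln_sqrt)
      also have "\<dots> \<le> 2 * sqrt (2 / v)" using ln_bound[of "sqrt (2 / v)"] v by simp
      finally have "v * arcosh (1 / v) \<le> v * (2 * sqrt (2 / v))" using v by (intro mult_left_mono) auto
      also have "\<dots> = 2 * sqrt 2 * (v / sqrt v)" using v by (simp add: real_sqrt_divide)
      also have "v / sqrt v = sqrt v" using v by (simp add: real_div_sqrt)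
      finally show "v * arcosh (1 / v) \<le> 2 * sqrt 2 * sqrt v" .
    qed
    have "((\<lambda>v. v * arcosh (1 / v)) \<longlongrightarrow> 0) (at_right (0::real))"
    proof (rule tendsto_sandwich[where f = "\<lambda>_. 0" and h = "\<lambda>v. 2 * sqrt 2 * sqrt v"])
      have ev: "\<forall>\<^sub>F v in at_right (0::real). 0 < v \<and> v < 1"
        unfolding eventually_at_right_field by (intro exI[of _ 1]) auto
      show "\<forall>\<^sub>F v in at_right (0::real). 0 \<le> v * arcosh (1 / v)" using ev by eventually_elim (use b in auto)
      show "\<forall>\<^sub>F v in at_right (0::real). v * arcosh (1 / v) \<le> 2 * sqrt 2 * sqrt v" using ev by eventually_elim (use b in auto)
      have "((\<lambda>v::real. 2 * sqrt 2 * sqrt v) \<longlongrightarrow> 2 * sqrt 2 * sqrt 0) (at_right 0)" by (intro tendsto_intros)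
      then show "((\<lambda>v::real. 2 * sqrt 2 * sqrt v) \<longlongrightarrow> 0) (at_right 0)" by simp
    qed simp
    moreover have "(arcsin \<longlongrightarrow> arcsin 0) (at_right 0)"
      using isCont_arcsin[of 0] tendsto_within_subset[where S = UNIV] by (auto simp: isCont_def)
    ultimately have "(P \<longlongrightarrow> 0 + arcsin 0) (at_right 0)" unfolding P_def[abs_def] by (rule tendsto_add)
    then show ?thesis by (simp add: ereal_tendsto_simps1(2)[symmetric] comp_def)
  qed
  have lim1: "((P \<circ> real_of_ereal) \<longlongrightarrow> pi / 2) (at_left (ereal 1))"
  proof -
    have ev: "\<forall>\<^sub>F v in at_left (1::real). 1 \<le> 1 / v"
      unfolding eventually_at_left_field by (intro exI[of _ 0]) auto
    have "((\<lambda>v::real. 1 / v) \<longlongrightarrow> 1 / 1) (at_left 1)" by (intro tendsto_intros) auto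
    then have "((\<lambda>v. arcosh (1 / v)) \<longlongrightarrow> arcosh (1 / 1)) (at_left (1::real))"
      by (rule tendsto_arcosh_strong) (use ev in auto)
    moreover have "(arcsin \<longlongrightarrow> arcsin 1) (at_left 1)"
    proof -
      have "(arcsin \<longlongrightarrow> arcsin 1) (at 1 within {-1..1})"
        using bspec[OF continuous_on_arcsin'[unfolded continuous_on_def], of 1] by simp
      then show ?thesis by (simp add: at_within_Icc_at_left)
    qed
    ultimately have "(P \<longlongrightarrow> 1 * arcosh (1 / 1) + arcsin 1) (at_left 1)"
      unfolding P_def[abs_def] by (intro tendsto_add tendsto_mult) auto
    then have "(P \<longlongrightarrow> pi / 2) (at_left 1)" by simp
    then show ?thesis by (simp add: ereal_tendsto_simps1(1)[symmetric] comp_def)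
  qed
  have cont: "isCont (\<lambda>v. arcosh (1 / v)) v" if "0 < v" "v < 1" for v :: real
  proof -
    have "continuous_on {0<..<1} (\<lambda>v::real. arcosh (1 / v))" by (intro continuous_intros) auto
    then show ?thesis using that by (simp add: continuous_on_eq_continuous_at)
  qed
  have F: "set_integrable lborel (einterval (ereal 0) (ereal 1)) (\<lambda>v. arcosh (1 / v))"
    "(LBINT v=ereal 0..ereal 1. arcosh (1 / v)) = pi / 2 - 0"
    by (rule interval_integral_FTC_nonneg[where F = P, OF _ _ _ _ lim0 lim1]; use der cont nn in auto)+
  have e: "einterval (ereal 0) (ereal 1) = {0<..<1}" by (auto simp: einterval_def)
  have "(\<integral>\<^sup>+v. ennreal (arcosh (1 / v)) * indicator {0<..<1} v \<partial>lborel) = (\<integral>\<^sup>+v. ennreal (indicator {0<..<1} v * arcosh (1 / v)) \<partial>lborel)"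
    by (intro nn_integral_cong) (auto split: split_indicator)
  also have "\<dots> = ennreal (\<integral>v. indicator {0<..<1} v * arcosh (1 / v) \<partial>lborel)"
    by (rule nn_integral_eq_integral)
      (use F(1) nn in \<open>auto simp: e set_integrable_def split: split_indicator\<close>)
  also have "(\<integral>v. indicator {0<..<1} v * arcosh (1 / v) \<partial>lborel) = pi / 2"
    using F(2) by (simp add: interval_lebesgue_integral_def e set_lebesgue_integral_def)
  finally show ?thesis .
qed

text \<open>
  At time \<open>u\<close> from the apex the height is \<open>1/(2 \<bar>a\<bar> cosh u)\<close>, which equals \<open>1/k\<close> for \<open>cosh u = k/(2 \<bar>a\<bar>)\<close>.
\<close>

definition excursion_length :: "real \<Rightarrow> real \<times> real \<Rightarrow> real" where
  "excursion_length k p = 2 * arcosh (k / (2 * \<bar>snd p\<bar>)) * indicator (excursion_region k) p"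

lemma excursion_length_measurable [measurable]: "excursion_length k \<in> borel_measurable borel"
proof -
  have m: "(arcosh :: real \<Rightarrow> real) \<in> borel_measurable borel"
    unfolding arcosh_def[abs_def] by measurable
  have r: "excursion_region k \<in> sets (borel \<Otimes>\<^sub>M borel)"
  proof -
    have "excursion_region k = {p \<in> space (borel \<Otimes>\<^sub>M borel). (0 < fst p \<and> fst p < 1 \<and> 0 < snd p \<and> 2 * snd p < k) \<or> (- 1 < fst p \<and> fst p < 0 \<and> snd p < 0 \<and> - (2 * snd p) < k)}"
      by (auto simp: excursion_region_def space_pair_measure)
    also have "\<dots> \<in> sets (borel \<Otimes>\<^sub>M borel)" by measurable
    finally show ?thesis .
  qed
  show ?thesis
    unfolding excursion_length_def[abs_def] borel_prod[symmetric] using m r by measurable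
qed

lemma excursion_length_nonneg: "0 \<le> excursion_length k p"
proof (cases "p \<in> excursion_region k")
  case True
  then have "1 \<le> k / (2 * \<bar>snd p\<bar>)" by (auto simp: excursion_region_def le_divide_eq)
  then show ?thesis by (simp add: excursion_length_def)
qed (simp add: excursion_length_def)

lemma integral_excursion_length:
  assumes k: "0 < k"
  shows "(\<integral>\<^sup>+p. ennreal (excursion_length k p) \<partial>lborel) = ennreal (pi * k)"
proof -
  define g :: "real \<Rightarrow> real \<Rightarrow> ennreal" where
    "g x a = indicator {0<..<1} x * (ennreal (2 * arcosh (k / (2 * a))) * indicator {0<..<k/2} a)" for x a
  have am: "(arcosh :: real \<Rightarrow> real) \<in> borel_measurable borel"
    unfolding arcosh_def[abs_def] by measurable
  have "(\<integral>\<^sup>+p. ennreal (excursion_length k p) \<partial>lborel) = (\<integral>\<^sup>+p. g (fst p) (snd p) + g (- fst p) (- snd p) \<partial>lborel)"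
    by (intro nn_integral_cong) (auto simp: g_def excursion_length_def excursion_region_def split: split_indicator)
  also have "\<dots> = 2 * (\<integral>\<^sup>+x. (\<integral>\<^sup>+a. g x a \<partial>lborel) * indicator {0<..<1} x \<partial>lborel)"
  proof (rule nn_integral_symmetric)
    show "(\<lambda>p. g (fst p) (snd p)) \<in> borel_measurable (borel \<Otimes>\<^sub>M borel)" unfolding g_def using am by measurable
  qed (auto simp: g_def split: split_indicator)
  also have "(\<integral>\<^sup>+x. (\<integral>\<^sup>+a. g x a \<partial>lborel) * indicator {0<..<1} x \<partial>lborel) = (\<integral>\<^sup>+x. ennreal (pi * k / 2) * indicator {0<..<1::real} x \<partial>lborel)"
  proof (intro nn_integral_cong)
    fix x :: real
    define f :: "real \<Rightarrow> ennreal" where "f a = ennreal (2 * arcosh (k / (2 * a))) * indicator {0<..<k/2} a" for a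
    have fm[measurable]: "f \<in> borel_measurable borel" unfolding f_def[abs_def] using am by measurable
    have "(\<integral>\<^sup>+a. f a \<partial>lborel) = ennreal \<bar>k / 2\<bar> * (\<integral>\<^sup>+v. f (k / 2 * v + 0) \<partial>lborel)"
      by (rule nn_integral_scale[OF fm, symmetric]) (use k in auto)
    also have "(\<integral>\<^sup>+v. f (k / 2 * v + 0) \<partial>lborel) = (\<integral>\<^sup>+v. 2 * (ennreal (arcosh (1 / v)) * indicator {0<..<1} v) \<partial>lborel)"
      using k by (intro nn_integral_cong) (auto simp: f_def ennreal_mult' zero_less_mult_iff field_simps split: split_indicator)
    also have "\<dots> = 2 * ennreal (pi / 2)"
      using am by (subst nn_integral_cmult) (auto simp: nn_integral_arcosh)
    also have "ennreal \<bar>k / 2\<bar> * \<dots> = ennreal (pi * k / 2)"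
      using k by (simp flip: ennreal_mult' ennreal_numeral add: mult.commute)
    finally have e: "(\<integral>\<^sup>+a. f a \<partial>lborel) = ennreal (pi * k / 2)" .
    have "(\<integral>\<^sup>+a. g x a \<partial>lborel) = indicator {0<..<1} x * (\<integral>\<^sup>+a. f a \<partial>lborel)"
      unfolding g_def f_def[symmetric] by (rule nn_integral_cmult) simp
    then show "(\<integral>\<^sup>+a. g x a \<partial>lborel) * indicator {0<..<1} x = ennreal (pi * k / 2) * indicator {0<..<1} x"
      by (simp add: e split: split_indicator)
  qed
  also have "2 * \<dots> = ennreal (pi * k)" using k by (simp add: nn_integral_cmult_indicator flip: ennreal_mult' ennreal_numeral)
  finally show ?thesis .
qed

section \<open>Arcs in the cusp neighbourhood and passage to the quotient\<close>

lemma topspace_orbifold: "topspace (orbifold_topology \<Gamma>) = orbit \<Gamma> ` upper_half"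
proof
  have "openin (orbifold_topology \<Gamma>) (orbit \<Gamma> ` upper_half)"
  proof -
    have "{z \<in> upper_half. orbit \<Gamma> z \<in> orbit \<Gamma> ` upper_half} = upper_half" by auto
    moreover have "open upper_half" unfolding upper_half_def by (intro open_Collect_less continuous_intros)
    ultimately show ?thesis by (simp add: openin_orbifold_topology)
  qed
  then show "orbit \<Gamma> ` upper_half \<subseteq> topspace (orbifold_topology \<Gamma>)" by (rule openin_subset)
  show "topspace (orbifold_topology \<Gamma>) \<subseteq> orbit \<Gamma> ` upper_half"
    unfolding topspace_def openin_orbifold_topology by blast
qed

context sl2_zonal
begin

text \<open>
  Points directly above \<open>z\<close> belong to the horoball, so \<open>z\<close> is adherent to the cusp neighbourhood. It does
  not belong to it: the denominator of an element that moves \<open>\<infinity>\<close> has absolute value at least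
  \<open>\<bar>c\<bar> Im z \<ge> 1\<close> at \<open>z\<close>, so no image of \<open>z\<close> is higher than \<open>z\<close>.
\<close>

lemma horocycle_frontier:
  assumes k: "0 < k" "k \<le> 1" and z: "Im z = 1 / k"
  shows "orbit \<Gamma> z \<in> orbifold_topology \<Gamma> frontier_of cusp_nbhd \<Gamma> k"
proof -
  have zu: "z \<in> upper_half" using z k by (simp add: upper_half_def)
  have "orbit \<Gamma> z \<in> orbifold_topology \<Gamma> closure_of cusp_nbhd \<Gamma> k"
    unfolding in_closure_of
  proof (intro conjI allI impI)
    show "orbit \<Gamma> z \<in> topspace (orbifold_topology \<Gamma>)" unfolding topspace_orbifold using zu by blast
    fix V assume V: "orbit \<Gamma> z \<in> V \<and> openin (orbifold_topology \<Gamma>) V"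
    then have "open {y \<in> upper_half. orbit \<Gamma> y \<in> V}" "z \<in> {y \<in> upper_half. orbit \<Gamma> y \<in> V}"
      using zu by (auto simp: openin_orbifold_topology)
    then obtain e where e: "0 < e" "ball z e \<subseteq> {y \<in> upper_half. orbit \<Gamma> y \<in> V}"
      using open_contains_ball by blast
    define y where "y = z + \<i> * of_real (e / 2)"
    have "y \<in> ball z e" using e by (simp add: y_def dist_norm norm_mult)
    then have "orbit \<Gamma> y \<in> V" using e by blast
    moreover have "orbit \<Gamma> y \<in> cusp_nbhd \<Gamma> k"
      unfolding cusp_nbhd_def horoball_def using z e by (auto simp: y_def)
    ultimately show "\<exists>v. v \<in> cusp_nbhd \<Gamma> k \<and> v \<in> V" by blast
  qed
  moreover have "orbit \<Gamma> z \<notin> cusp_nbhd \<Gamma> k"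
  proof
    assume "orbit \<Gamma> z \<in> cusp_nbhd \<Gamma> k"
    then obtain y where y: "1 / k < Im y" "orbit \<Gamma> z = orbit \<Gamma> y" by (auto simp: cusp_nbhd_def horoball_def)
    then obtain A where A: "A \<in> \<Gamma>" "y = moebius A z" using orbit_self[of y] by (auto simp: orbit_def)
    define q where "q = of_real (A$2$1) * z + complex_of_real (A$2$2)"
    have Iy: "Im y = (1 / k) / (cmod q)\<^sup>2" using Im_moebius[OF in_SL2R[OF A(1)] zu] A(2) z by (simp add: q_def)
    have "1 \<le> (cmod q)\<^sup>2"
    proof (cases "A$2$1 = 0")
      case True
      then obtain n where "A = shift n \<or> A = - shift n" using in_stab_infD[OF A(1)] by blast
      then have "\<bar>A$2$2\<bar> = 1" by (auto simp: shift_def)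
      then show ?thesis using True by (simp add: q_def)
    next
      case False
      have "1 \<le> \<bar>A$2$1\<bar> * (1 / k)"
        using lower_left_ge_1[OF A(1) False] k mult_mono[of 1 "\<bar>A$2$1\<bar>" 1 "1 / k"] by simp
      also have "\<dots> = \<bar>Im q\<bar>" using z k by (simp add: q_def abs_mult)
      also have "\<dots> \<le> cmod q" by (rule abs_Im_le_cmod)
      finally show ?thesis by (simp add: one_le_power)
    qed
    then have "1 / k / (cmod q)\<^sup>2 \<le> 1 / k / 1" by (intro divide_left_mono) (use k in auto)
    then have "Im y \<le> 1 / k" unfolding Iy by simp
    then show False using y(1) by simp
  qed
  ultimately show ?thesis unfolding frontier_of_def using interior_of_subset by fastforce
qed

lemma excursion_boundary:
  assumes w: "w \<in> generic \<Gamma>" and k: "0 < k" "k \<le> 1" and A: "A \<in> \<Gamma>"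
    and a: "fst (snd (act A w)) \<noteq> 0" "2 * \<bar>fst (snd (act A w))\<bar> < k"
  defines "L \<equiv> arcosh (k / (2 * \<bar>fst (snd (act A w))\<bar>))"
  shows "boundary_params \<Gamma> k (orbit_T1 \<Gamma> (Psi w)) (apex_time (act A w)) (apex_time (act A w) - L) (apex_time (act A w) + L)"
proof -
  obtain x b s where p: "act A w = (x, b, s)" by (metis surj_pair)
  have b: "b \<noteq> 0" "2 * \<bar>b\<bar> < k" using a p by auto
  define t where "t = apex_time (x, b, s)"
  have gt: "1 < k / (2 * \<bar>b\<bar>)" using b by (simp add: less_divide_eq)
  have L: "L = arcosh (k / (2 * \<bar>b\<bar>))" by (simp add: L_def p)
  have L0: "0 < L" unfolding L by (metis arcosh_real_gt_1_iff gt less_imp_le less_irrefl)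
  have cL: "cosh L = k / (2 * \<bar>b\<bar>)" unfolding L using gt by simp
  have geod: "geod (orbit_T1 \<Gamma> (Psi w)) u = orbit \<Gamma> (geo (x, b, s) u)" for u
  proof -
    have "orbit_T1 \<Gamma> (Psi (act A w)) = orbit_T1 \<Gamma> (Psi w)"
    proof -
      have g': "act A w \<in> generic \<Gamma>" by (rule generic_act[OF w A])
      have "(\<lambda>B. Psi (act B (act A w))) ` \<Gamma> = (\<lambda>B. Psi (act (B ** A) w)) ` \<Gamma>"
        by (intro image_cong) (simp_all add: act_act[OF w _ A])
      also have "\<dots> = (\<lambda>B. Psi (act B w)) ` ((\<lambda>B. B ** A) ` \<Gamma>)" by (simp add: image_image)
      also have "(\<lambda>B. B ** A) ` \<Gamma> = \<Gamma>" using bij_mult_right[OF A] by (rule bij_betw_imp_surj_on)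
      finally show ?thesis by (simp add: orbit_T1_Psi w g')
    qed
    then show ?thesis using geod_eq[OF generic_act[OF w A], of u] p by simp
  qed
  have Im: "Im (geo (x, b, s) (t + u)) = 1 / (2 * \<bar>b\<bar> * cosh u)" for u
    unfolding t_def by (rule Im_geo_apex[OF b(1)])
  have ends: "Im (geo (x, b, s) (t - L)) = 1 / k" "Im (geo (x, b, s) (t + L)) = 1 / k"
    using Im[of "- L"] Im[of L] b cL by simp_all
  have mid: "geod (orbit_T1 \<Gamma> (Psi w)) u \<in> cusp_nbhd \<Gamma> k" if u: "u \<in> {t - L<..<t + L}" for u
  proof -
    have "cosh (u - t) < cosh L"
    proof -
      have "\<bar>u - t\<bar> < L" using u by auto
      then have "cosh \<bar>u - t\<bar> < cosh L" by (subst cosh_real_nonneg_less_iff) auto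
      moreover have "cosh \<bar>x\<bar> = cosh x" for x :: real by (simp add: abs_if)
      ultimately show ?thesis by (simp only:)
    qed
    then have "2 * \<bar>b\<bar> * cosh (u - t) < k" unfolding cL using b by (simp add: less_divide_eq mult.commute)
    moreover have "0 < 2 * \<bar>b\<bar> * cosh (u - t)" using b by simp
    ultimately have "1 / k < 1 / (2 * \<bar>b\<bar> * cosh (u - t))" by (intro divide_strict_left_mono) (use k in auto)
    then have "1 / k < Im (geo (x, b, s) u)" using Im[of "u - t"] by simp
    then show ?thesis unfolding geod cusp_nbhd_def horoball_def by blast
  qed
  have "geod (orbit_T1 \<Gamma> (Psi w)) (t - L) \<in> orbifold_topology \<Gamma> frontier_of cusp_nbhd \<Gamma> k"
    "geod (orbit_T1 \<Gamma> (Psi w)) (t + L) \<in> orbifold_topology \<Gamma> frontier_of cusp_nbhd \<Gamma> k"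
    unfolding geod by (rule horocycle_frontier[OF k ends(1)], rule horocycle_frontier[OF k ends(2)])
  then show ?thesis
    unfolding boundary_params_def p t_def[symmetric] using L0 mid by auto
qed

text \<open>
  Let \<open>N\<close> be the exceptional null set of vectors and \<open>N'\<close> the union of its translates, which is null as
  the group is countable. The image of \<open>N'\<close> in the quotient has measure 0, since every set that
  embeds into it is contained in \<open>N'\<close>.
\<close>

lemma AE_T1S:
  assumes "AE w in lborel. P (orbit_T1 \<Gamma> (Psi w))"
  shows "AE v in T1S_measure \<Gamma>. P v"
proof -
  have "AE p in T1H_measure. P (orbit_T1 \<Gamma> p)" by (rule AE_T1H) (rule assms)
  then obtain N where N: "{p \<in> space T1H_measure. \<not> P (orbit_T1 \<Gamma> p)} \<subseteq> N" "emeasure T1H_measure N = 0" "N \<in> sets T1H_measure"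
    by (rule AE_E)
  have Nb: "N \<in> sets borel" by (rule T1H_sets_borel[OF N(3)])
  \<comment> \<open>A Borel map that agrees with \<open>moebius_T1\<close> over the half-plane, with the derivative written out.\<close>
  define m :: "real^2^2 \<Rightarrow> complex \<times> complex \<Rightarrow> complex \<times> complex" where
    "m A p = (moebius A (fst p), sgn (1 / (of_real (A$2$1) * fst p + of_real (A$2$2))\<^sup>2) * snd p)" for A p
  have m_meas: "m A \<in> borel_measurable borel" for A
    unfolding m_def borel_prod[symmetric] by measurable
  have m_eq: "moebius_T1 A p = m A p" if "A \<in> \<Gamma>" "fst p \<in> upper_half" for A p
    using deriv_moebius[OF in_SL2R] that by (simp add: m_def moebius_T1_def case_prod_beta')
  define N' where "N' = {p \<in> space T1H_measure. \<exists>A\<in>\<Gamma>. moebius_T1 A p \<in> N}"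
  have N'_sets: "N' \<in> sets T1H_measure"
  proof -
    have "N' = (\<Union>A\<in>\<Gamma>. m A -` N) \<inter> (upper_half \<times> sphere 0 1)"
    proof (rule set_eqI)
      fix p
      show "p \<in> N' \<longleftrightarrow> p \<in> (\<Union>A\<in>\<Gamma>. m A -` N) \<inter> (upper_half \<times> sphere 0 1)"
      proof (cases "p \<in> upper_half \<times> sphere 0 1")
        case True
        then have "moebius_T1 A p = m A p" if "A \<in> \<Gamma>" for A using m_eq[OF that] by (simp add: mem_Times_iff)
        then show ?thesis using True unfolding N'_def space_T1H by (simp cong: bex_cong)
      qed (simp add: N'_def)
    qed
    moreover have "(\<Union>A\<in>\<Gamma>. m A -` N) \<in> sets borel"
      using measurable_sets[OF m_meas Nb] by (intro sets.countable_UN'[OF countable_group]) auto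
    ultimately show ?thesis using T1H_sets by simp
  qed
  have N'_null: "emeasure T1H_measure N' = 0"
  proof -
    have "(\<integral>\<^sup>+p. indicator N p \<partial>T1H_measure) = 0" using N by simp
    then have "(\<integral>\<^sup>+w. indicator N (Psi w) \<partial>lborel) = 0"
      using nn_integral_T1H[of "indicator N"] Nb by simp
    then have "AE w in lborel. indicator N (Psi w) = (0::ennreal)"
      using Nb by (subst (asm) nn_integral_0_iff_AE) auto
    then have null: "AE w in lborel. Psi w \<notin> N" by eventually_elim (auto split: split_indicator_asm)
    have "AE w in lborel. \<forall>A\<in>\<Gamma>. Psi (act A w) \<notin> N"
      by (subst AE_ball_countable[OF countable_group]) (use AE_act[OF in_SL2R null] in blast)
    then have "AE w in lborel. indicator N' (Psi w) = (0::ennreal)"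
      using AE_generic
    proof eventually_elim
      case (elim w)
      have "moebius_T1 A (Psi w) = Psi (act A w)" if "A \<in> \<Gamma>" for A
        using elim(2) that by (intro moebius_T1_Psi in_SL2R) (auto simp: generic_def)
      then have "Psi w \<notin> N'" using elim(1) by (auto simp: N'_def)
      then show ?case by simp
    qed
    then have "(\<integral>\<^sup>+w. indicator N' (Psi w) \<partial>lborel) = (\<integral>\<^sup>+w. 0 \<partial>(lborel :: horo_coords measure))"
      by (rule nn_integral_cong_AE)
    then have "(\<integral>\<^sup>+p. indicator N' p \<partial>T1H_measure) = 0"
      using nn_integral_T1H[of "indicator N'"] T1H_sets_borel[OF N'_sets] by simp
    then show ?thesis using N'_sets by simp
  qed
  define B where "B = orbit_T1 \<Gamma> ` N'"
  have pre: "orbit_T1 \<Gamma> -` B \<inter> space T1H_measure = N'"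
  proof
    show "N' \<subseteq> orbit_T1 \<Gamma> -` B \<inter> space T1H_measure" unfolding B_def N'_def by blast
    show "orbit_T1 \<Gamma> -` B \<inter> space T1H_measure \<subseteq> N'"
    proof
      fix p assume p: "p \<in> orbit_T1 \<Gamma> -` B \<inter> space T1H_measure"
      then obtain y where y: "y \<in> N'" "orbit_T1 \<Gamma> p = orbit_T1 \<Gamma> y" by (auto simp: B_def)
      then obtain A where A: "A \<in> \<Gamma>" "moebius_T1 A y \<in> N" by (auto simp: N'_def)
      have "moebius_T1 A y \<in> orbit_T1 \<Gamma> y" using A unfolding orbit_T1_def by blast
      then have "moebius_T1 A y \<in> orbit_T1 \<Gamma> p" by (simp only: y(2))
      then obtain A' where "A' \<in> \<Gamma>" "moebius_T1 A y = moebius_T1 A' p" unfolding orbit_T1_def by blast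
      then show "p \<in> N'" using A p unfolding N'_def by auto
    qed
  qed
  have sp: "space (T1S_measure \<Gamma>) = orbit_T1 \<Gamma> ` space T1H_measure"
    by (simp add: T1S_measure_def induced_measure_def space_measure_of_conv)
  have Bs: "B \<subseteq> orbit_T1 \<Gamma> ` space T1H_measure" unfolding B_def N'_def by blast
  have "emeasure (T1S_measure \<Gamma>) B = induced_emeasure T1H_measure (orbit_T1 \<Gamma>) B"
    unfolding T1S_measure_def by (rule emeasure_induced_measure) (use Bs pre N'_sets in auto)
  also have "\<dots> \<le> 0"
    unfolding induced_emeasure_def
  proof (rule SUP_least)
    fix E assume E: "E \<in> {E \<in> sets T1H_measure. inj_on (orbit_T1 \<Gamma>) E \<and> orbit_T1 \<Gamma> ` E \<subseteq> B}"
    then have "E \<subseteq> N'" using sets.sets_into_space[of E T1H_measure] pre by blast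
    then have "emeasure T1H_measure E \<le> emeasure T1H_measure N'" by (rule emeasure_mono[OF _ N'_sets])
    then show "emeasure T1H_measure E \<le> 0" using N'_null by simp
  qed
  finally have B0: "emeasure (T1S_measure \<Gamma>) B = 0" by simp
  have "B \<in> sets (T1S_measure \<Gamma>)"
    unfolding T1S_measure_def induced_measure_def
    by (subst sets_measure_of) (use Bs pre N'_sets in \<open>auto intro!: sigma_sets.Basic\<close>)
  then have "B \<in> null_sets (T1S_measure \<Gamma>)" using B0 by auto
  then show ?thesis
  proof (rule AE_I')
    show "{v \<in> space (T1S_measure \<Gamma>). \<not> P v} \<subseteq> B"
    proof
      fix v assume "v \<in> {v \<in> space (T1S_measure \<Gamma>). \<not> P v}"
      then obtain p where p: "p \<in> space T1H_measure" "v = orbit_T1 \<Gamma> p" "\<not> P v" unfolding sp by blast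
      then have "p \<in> N" using N(1) by blast
      moreover have "moebius_T1 (mat 1) p = p"
      proof -
        have "moebius_T1 (mat 1) p = m (mat 1) p" by (rule m_eq) (use p(1) in auto)
        also have "\<dots> = p" by (cases p) (simp add: m_def mat_def moebius_def)
        finally show ?thesis .
      qed
      ultimately have "p \<in> N'" using p(1) unfolding N'_def by (auto intro!: bexI[of _ "mat 1"])
      then show "v \<in> B" using p(2) by (simp add: B_def)
    qed
  qed
qed

end

section \<open>Limits for all depths\<close>

lemma calA_pos: "0 < k \<Longrightarrow> k \<le> 2 \<Longrightarrow> 0 < calA k"
proof -
  assume k: "0 < k" "k \<le> 2"
  show ?thesis
  proof (cases "k \<le> 1")
    case False
    then have "0 < ln k" by simp
    then have "0 < 2 - k + 2 * ln k" using k by linarith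
    then show ?thesis using False by (simp add: calA_def)
  qed (use k in \<open>simp add: calA_def\<close>)
qed

lemma continuous_calA: "continuous_on {0<..2} calA"
proof -
  have "continuous_on ({0..1} \<union> {1..2}) (\<lambda>z::real. if z \<le> 1 then z else 2 - z + 2 * ln z)"
    by (rule continuous_on_If) (auto intro!: continuous_intros)
  then show ?thesis unfolding calA_def[abs_def] by (rule continuous_on_subset) auto
qed

lemma excursion_length_mono:
  assumes k: "0 < k" "k \<le> k'"
  shows "excursion_length k q \<le> excursion_length k' q"
proof (cases "q \<in> excursion_region k")
  case True
  then have q': "q \<in> excursion_region k'" using k by (auto simp: excursion_region_def)
  have a: "0 < 2 * \<bar>snd q\<bar>" "2 * \<bar>snd q\<bar> < k" using True by (auto simp: excursion_region_def)
  have "1 \<le> k / (2 * \<bar>snd q\<bar>)" using a by (simp add: le_divide_eq)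
  moreover have "k / (2 * \<bar>snd q\<bar>) \<le> k' / (2 * \<bar>snd q\<bar>)" using k a by (intro divide_right_mono) auto
  ultimately have "arcosh (k / (2 * \<bar>snd q\<bar>)) \<le> arcosh (k' / (2 * \<bar>snd q\<bar>))"
    by (metis arcosh_real_strict_mono order_le_less)
  then show ?thesis using True q' by (simp add: excursion_length_def)
next
  case False
  then show ?thesis using excursion_length_nonneg[of k' q] by (simp add: excursion_length_def)
qed

definition approx_region :: "real \<Rightarrow> (real \<times> real) set" where
  "approx_region k = {p \<in> excursion_region k. (fst p, fst p - 1 / snd p) \<in> I_region}"

lemma approx_region_borel: "approx_region k \<in> sets borel"
proof -
  have "excursion_region k \<in> sets (borel \<Otimes>\<^sub>M borel)" unfolding borel_prod by (rule excursion_region_borel)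
  moreover have "approx_region k = excursion_region k \<inter> {p \<in> space (borel \<Otimes>\<^sub>M borel).
      (- 1 < fst p \<and> fst p < 0 \<and> 1 < fst p - 1 / snd p) \<or> (0 < fst p \<and> fst p < 1 \<and> fst p - 1 / snd p < - 1)}"
    by (auto simp: approx_region_def I_region_def space_pair_measure)
  moreover have "{p \<in> space (borel \<Otimes>\<^sub>M borel).
      (- 1 < fst p \<and> fst p < 0 \<and> 1 < fst p - 1 / snd p) \<or> (0 < fst p \<and> fst p < 1 \<and> fst p - 1 / snd p < (- 1::real))} \<in> sets (borel \<Otimes>\<^sub>M (borel :: real measure))"
    by measurable
  ultimately have "approx_region k \<in> sets (borel \<Otimes>\<^sub>M borel)" by simp
  then show ?thesis unfolding borel_prod .
qed

context sl2_zonal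
begin

text \<open>
  The vectors for which the theorem holds: the three sums over excursions grow at the expected rate for every \<open>k\<close>.
\<close>

definition regular :: "horo_coords \<Rightarrow> bool" where
  "regular w \<longleftrightarrow> typical w \<and> (\<forall>n::nat. finite (exc_between w {0..<real n})) \<and>
     (\<forall>k. 0 < k \<and> k \<le> 2 \<longrightarrow>
        (\<lambda>n. (\<Sum>p\<in>exc_between w {0..<real n}. indicator (excursion_region k) (pr p)) / real n) \<longlonglongrightarrow> k / measure lborel F \<and>
        (\<lambda>n. (\<Sum>p\<in>exc_between w {0..<real n}. indicator (approx_region k) (pr p)) / real n) \<longlonglongrightarrow> calA k / measure lborel F \<and>
        (\<lambda>n. (\<Sum>p\<in>exc_between w {0..<real n}. excursion_length k (pr p)) / real n) \<longlonglongrightarrow> pi * k / measure lborel F)"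

lemma measure_F_pos: "0 < measure lborel F"
  using F_pos F_finite by (simp add: measure_def enn2real_positive_iff less_top)

text \<open>
  Each limit holds almost everywhere for fixed \<open>k\<close>, hence for all rational \<open>k\<close> at once, and all three sums
  increase with \<open>k\<close>.
\<close>

lemma AE_regular: "AE w in lborel. regular w"
proof -
  have "(\<integral>\<^sup>+p. indicator (excursion_region 2) p \<partial>lborel) = ennreal 2"
    using area_excursion_region[of 2] by (simp add: ennreal_indicator)
  from count_average[OF _ this]
  have fin: "AE w in lborel. \<forall>n::nat. orbit_count (indicator (excursion_region 2)) w {- real n..<real n} < \<infinity>"
    by (auto elim!: eventually_mono)
  have sub: "q \<in> excursion_region k \<Longrightarrow> k \<le> 2 \<Longrightarrow> q \<in> excursion_region 2" for q k
    by (auto simp: excursion_region_def)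
  have 1: "AE w in lborel. (\<lambda>n. (\<Sum>p\<in>exc_between w {0..<real n}. indicator (excursion_region k) (pr p)) / real n) \<longlonglongrightarrow> k / measure lborel F"
    if k: "0 < k" "k \<le> 2" for k
    by (rule excursion_average[OF fin]) (use k sub area_excursion_region[OF k(1)] in \<open>auto split: split_indicator\<close>)
  have 2: "AE w in lborel. (\<lambda>n. (\<Sum>p\<in>exc_between w {0..<real n}. indicator (approx_region k) (pr p)) / real n) \<longlonglongrightarrow> calA k / measure lborel F"
    if k: "0 < k" "k \<le> 2" for k
  proof (rule excursion_average[OF fin])
    show "(indicator (approx_region k) :: _ \<Rightarrow> real) \<in> borel_measurable borel" using approx_region_borel by simp
    show "(\<integral>\<^sup>+q. ennreal (indicator (approx_region k) q) \<partial>lborel) = ennreal (calA k)"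
      unfolding approx_region_def by (rule area_approx_region[OF k])
    show "0 \<le> calA k" using calA_pos[OF k] by simp
    show "indicator (approx_region k) q = 0" if "q \<notin> excursion_region 2" for q
      using that sub[of q k] k by (auto simp: approx_region_def indicator_def)
  qed simp
  have 3: "AE w in lborel. (\<lambda>n. (\<Sum>p\<in>exc_between w {0..<real n}. excursion_length k (pr p)) / real n) \<longlonglongrightarrow> pi * k / measure lborel F"
    if k: "0 < k" "k \<le> 2" for k
  proof (rule excursion_average[OF fin])
    show "excursion_length k q = 0" if "q \<notin> excursion_region 2" for q
      using that sub[of q k] k by (auto simp: excursion_length_def indicator_def)
  qed (use k excursion_length_nonneg integral_excursion_length[OF k(1)] in auto)
  have cQ: "countable {q \<in> \<rat>. 0 < q \<and> q \<le> (2::real)}" by (rule countable_subset[OF _ countable_rat]) auto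
  have "AE w in lborel. \<forall>k\<in>{q \<in> \<rat>. 0 < q \<and> q \<le> 2}.
        (\<lambda>n. (\<Sum>p\<in>exc_between w {0..<real n}. indicator (excursion_region k) (pr p)) / real n) \<longlonglongrightarrow> k / measure lborel F \<and>
        (\<lambda>n. (\<Sum>p\<in>exc_between w {0..<real n}. indicator (approx_region k) (pr p)) / real n) \<longlonglongrightarrow> calA k / measure lborel F \<and>
        (\<lambda>n. (\<Sum>p\<in>exc_between w {0..<real n}. excursion_length k (pr p)) / real n) \<longlonglongrightarrow> pi * k / measure lborel F"
    unfolding AE_ball_countable[OF cQ] AE_conj_iff using 1 2 3 by simp
  then show ?thesis
    using AE_typical fin
  proof eventually_elim
    case (elim w)
    have f: "finite (exc_between w {0..<real n})" for n :: nat
    proof (rule orbit_count_excursions(1)[OF elim(2), where h = "indicator (excursion_region 2)"])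
      have "orbit_count (indicator (excursion_region 2)) w {0..<real n} \<le> orbit_count (indicator (excursion_region 2)) w {- real n..<real n}"
        by (rule orbit_count_mono) auto
      also have "\<dots> < \<infinity>" using elim(3) by blast
      finally show "orbit_count (indicator (excursion_region 2)) w {0..<real n} < \<infinity>" .
    qed auto
    have rat: "(\<lambda>n. (\<Sum>p\<in>exc_between w {0..<real n}. indicator (excursion_region q) (pr p)) / real n) \<longlonglongrightarrow> q / measure lborel F"
        "(\<lambda>n. (\<Sum>p\<in>exc_between w {0..<real n}. indicator (approx_region q) (pr p)) / real n) \<longlonglongrightarrow> calA q / measure lborel F"
        "(\<lambda>n. (\<Sum>p\<in>exc_between w {0..<real n}. excursion_length q (pr p)) / real n) \<longlonglongrightarrow> pi * q / measure lborel F"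
      if "q \<in> \<rat>" "0 < q" "q \<le> 2" for q
      using elim(1) that by auto
    have mono_reg: "excursion_region k \<subseteq> excursion_region k'" if "k \<le> k'" for k k'
      using that by (auto simp: excursion_region_def)
    have A: "(\<lambda>n. (\<Sum>p\<in>exc_between w {0..<real n}. indicator (excursion_region k) (pr p)) / real n) \<longlonglongrightarrow> k / measure lborel F"
      if k: "0 < k" "k \<le> 2" for k
    proof (rule monotone_family_limit[where f = "\<lambda>k n. \<Sum>p\<in>exc_between w {0..<real n}. indicator (excursion_region k) (pr p)"])
      show "(\<Sum>p\<in>exc_between w {0..<real n}. indicator (excursion_region k) (pr p)) \<le> (\<Sum>p\<in>exc_between w {0..<real n}. (indicator (excursion_region k') (pr p) :: real))"
        if "k \<le> k'" for k k' and n :: nat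
        using mono_reg[OF that] by (intro sum_mono) (auto split: split_indicator)
    qed (use k rat(1) measure_F_pos in \<open>auto intro!: continuous_intros\<close>)
    have B: "(\<lambda>n. (\<Sum>p\<in>exc_between w {0..<real n}. indicator (approx_region k) (pr p)) / real n) \<longlonglongrightarrow> calA k / measure lborel F"
      if k: "0 < k" "k \<le> 2" for k
    proof (rule monotone_family_limit[where f = "\<lambda>k n. \<Sum>p\<in>exc_between w {0..<real n}. indicator (approx_region k) (pr p)"])
      show "(\<Sum>p\<in>exc_between w {0..<real n}. indicator (approx_region k) (pr p)) \<le> (\<Sum>p\<in>exc_between w {0..<real n}. (indicator (approx_region k') (pr p) :: real))"
        if "k \<le> k'" for k k' and n :: nat
        using mono_reg[OF that] by (intro sum_mono) (auto simp: approx_region_def split: split_indicator)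
      show "continuous_on {0<..2} (\<lambda>k. calA k / measure lborel F)"
        using continuous_calA unfolding divide_inverse by (rule continuous_on_mult_right)
    qed (use k rat(2) in auto)
    have C: "(\<lambda>n. (\<Sum>p\<in>exc_between w {0..<real n}. excursion_length k (pr p)) / real n) \<longlonglongrightarrow> pi * k / measure lborel F"
      if k: "0 < k" "k \<le> 2" for k
    proof (rule monotone_family_limit[where f = "\<lambda>k n. \<Sum>p\<in>exc_between w {0..<real n}. excursion_length k (pr p)"])
      show "(\<Sum>p\<in>exc_between w {0..<real n}. excursion_length k (pr p)) \<le> (\<Sum>p\<in>exc_between w {0..<real n}. excursion_length k' (pr p))"
        if "0 < k" "k \<le> k'" for k k' and n :: nat
        using excursion_length_mono[OF that] by (intro sum_mono)
    qed (use k rat(3) measure_F_pos in \<open>auto intro!: continuous_intros\<close>)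
    show ?case unfolding regular_def using elim(2) f A B C by blast
  qed
qed

text \<open>
  Since different excursions have different times, sums over excursions are sums over times.
\<close>

lemma sum_over_times:
  assumes w: "typical w" and R: "\<And>q. q \<in> R \<Longrightarrow> q \<in> excursion_region 2"
  shows "(\<Sum>t\<in>(apex_time ` {p \<in> excursions w. pr p \<in> R} \<inter> {0..}) \<inter> {0..<real n}. g (inv_into (excursions w) apex_time t)) =
    (\<Sum>p\<in>{p \<in> exc_between w {0..<real n}. pr p \<in> R}. g p :: real)"
proof -
  define S where "S = {p \<in> exc_between w {0..<real n}. pr p \<in> R}"
  have S: "S \<subseteq> excursions w" by (auto simp: S_def exc_between_def)
  have inj: "inj_on apex_time S" by (rule inj_on_subset[OF apex_inj[OF w] S])
  have "(apex_time ` {p \<in> excursions w. pr p \<in> R} \<inter> {0..}) \<inter> {0..<real n} = apex_time ` S"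
    by (auto simp: S_def exc_between_def)
  moreover have "(\<Sum>t\<in>apex_time ` S. g (inv_into (excursions w) apex_time t)) = (\<Sum>p\<in>S. g p)"
    unfolding sum.reindex[OF inj] by (intro sum.cong refl) (use S inv_into_f_f[OF apex_inj[OF w]] in auto)
  ultimately show ?thesis by (simp add: S_def)
qed

text \<open>
  The passage from counting excursions with \<open>(x, a)\<close> in \<open>R\<close> to enumerating their depth parameters; the
  inverse of \<open>apex_time\<close> recovers the excursion from the time.
\<close>

lemma enumeration_of_region:
  assumes w: "regular w" and R: "\<And>q. q \<in> R \<Longrightarrow> q \<in> excursion_region 2" and c: "0 < c"
    and lim: "(\<lambda>n. (\<Sum>p\<in>exc_between w {0..<real n}. indicator R (pr p)) / real n) \<longlonglongrightarrow> c / measure lborel F"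
  obtains t where "increasing_enumeration t (apex_time ` {p \<in> excursions w. pr p \<in> R} \<inter> {0..})"
    "(\<lambda>n. (\<Sum>i=1..n. t (i + 1) - t i) / real n) \<longlonglongrightarrow> measure lborel F / c"
    "\<forall>g \<sigma>. (\<forall>q. 0 \<le> g q) \<longrightarrow> (\<forall>q. q \<notin> R \<longrightarrow> g q = 0) \<longrightarrow>
       (\<lambda>n. (\<Sum>p\<in>exc_between w {0..<real n}. g (pr p)) / real n) \<longlonglongrightarrow> \<sigma> \<longrightarrow>
       (\<lambda>n. (\<Sum>i=1..n. g (pr (inv_into (excursions w) apex_time (t i)))) / real n) \<longlonglongrightarrow> \<sigma> * measure lborel F / c"
proof -
  have tp: "typical w" and fin: "\<And>n::nat. finite (exc_between w {0..<real n})" using w by (auto simp: regular_def)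
  define D where "D = apex_time ` {p \<in> excursions w. pr p \<in> R} \<inter> {0..}"
  have Dfin: "finite (D \<inter> {0..<real n})" for n
  proof -
    have "D \<inter> {0..<real n} \<subseteq> apex_time ` exc_between w {0..<real n}" by (auto simp: D_def exc_between_def)
    then show ?thesis using fin finite_surj by blast
  qed
  have sumD: "(\<Sum>t\<in>D \<inter> {0..<real n}. g (inv_into (excursions w) apex_time t)) = (\<Sum>p\<in>{p \<in> exc_between w {0..<real n}. pr p \<in> R}. g p)"
    for g :: "horo_coords \<Rightarrow> real" and n unfolding D_def by (rule sum_over_times[OF tp R])
  have card: "real (card (D \<inter> {0..<real n})) = (\<Sum>p\<in>exc_between w {0..<real n}. indicator R (pr p))" for n
  proof -
    have "real (card (D \<inter> {0..<real n})) = (\<Sum>t\<in>D \<inter> {0..<real n}. 1)" by simp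
    also have "\<dots> = (\<Sum>p\<in>{p \<in> exc_between w {0..<real n}. pr p \<in> R}. 1)" by (rule sumD)
    also have "\<dots> = (\<Sum>p\<in>exc_between w {0..<real n}. indicator R (pr p))"
      by (rule sum.mono_neutral_cong_left) (use fin in auto)
    finally show ?thesis .
  qed
  obtain t where t: "increasing_enumeration t D"
    "(\<lambda>n. (\<Sum>i=1..n. t (i + 1) - t i) / real n) \<longlonglongrightarrow> 1 / (c / measure lborel F)"
    "\<And>g \<sigma>. (\<And>x. x \<in> D \<Longrightarrow> 0 \<le> g x) \<Longrightarrow> (\<lambda>n. (\<Sum>x\<in>D \<inter> {0..<real n}. g x) / real n) \<longlonglongrightarrow> \<sigma> \<Longrightarrow>
       (\<lambda>n. (\<Sum>i=1..n. g (t i)) / real n) \<longlonglongrightarrow> \<sigma> / (c / measure lborel F)"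
  proof (rule increasing_enumeration_limit)
    show "D \<subseteq> {0..}" by (auto simp: D_def)
    show "(\<lambda>n. real (card (D \<inter> {0..<real n})) / real n) \<longlonglongrightarrow> c / measure lborel F" unfolding card by (rule lim)
    show "0 < c / measure lborel F" using c measure_F_pos by simp
  qed (use Dfin in auto)
  show ?thesis
  proof (rule that[of t])
    show "increasing_enumeration t (apex_time ` {p \<in> excursions w. pr p \<in> R} \<inter> {0..})" using t(1) by (simp add: D_def)
    show "(\<lambda>n. (\<Sum>i=1..n. t (i + 1) - t i) / real n) \<longlonglongrightarrow> measure lborel F / c" using t(2) by simp
  next
    show "\<forall>g \<sigma>. (\<forall>q. 0 \<le> g q) \<longrightarrow> (\<forall>q. q \<notin> R \<longrightarrow> g q = 0) \<longrightarrow>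
       (\<lambda>n. (\<Sum>p\<in>exc_between w {0..<real n}. g (pr p)) / real n) \<longlonglongrightarrow> \<sigma> \<longrightarrow>
       (\<lambda>n. (\<Sum>i=1..n. g (pr (inv_into (excursions w) apex_time (t i)))) / real n) \<longlonglongrightarrow> \<sigma> * measure lborel F / c"
    proof (intro allI impI)
      fix g :: "real \<times> real \<Rightarrow> real" and \<sigma>
      assume g: "\<forall>q. 0 \<le> g q" "\<forall>q. q \<notin> R \<longrightarrow> g q = 0"
        and l: "(\<lambda>n. (\<Sum>p\<in>exc_between w {0..<real n}. g (pr p)) / real n) \<longlonglongrightarrow> \<sigma>"
      have "(\<Sum>t\<in>D \<inter> {0..<real n}. g (pr (inv_into (excursions w) apex_time t))) = (\<Sum>p\<in>exc_between w {0..<real n}. g (pr p))" for n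
        unfolding sumD[of "\<lambda>p. g (pr p)"] by (rule sum.mono_neutral_left) (use fin g(2) in auto)
      then have "(\<lambda>n. (\<Sum>t\<in>D \<inter> {0..<real n}. g (pr (inv_into (excursions w) apex_time t))) / real n) \<longlonglongrightarrow> \<sigma>"
        using l by simp
      from t(3)[OF _ this] g(1)
      show "(\<lambda>n. (\<Sum>i=1..n. g (pr (inv_into (excursions w) apex_time (t i)))) / real n) \<longlonglongrightarrow> \<sigma> * measure lborel F / c"
        by simp
    qed
  qed
qed

lemma depth_params_region:
  assumes "typical w" "k \<le> 2"
  shows "depth_params k (orbit_T1 \<Gamma> (Psi w)) = apex_time ` {p \<in> excursions w. pr p \<in> excursion_region k}"
proof -
  have "pr p \<in> excursion_region k \<longleftrightarrow> 2 * \<bar>fst (snd p)\<bar> < k" if "p \<in> excursions w" for p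
    using that excursion_region_iff[OF assms(2), of "fst p" "fst (snd p)"] by (auto simp: excursions_def)
  then show ?thesis unfolding depth_params_eq[OF assms] by (metis (mono_tags, lifting) Collect_cong)
qed

lemma approx_depth_params_region:
  assumes "typical w" "k \<le> 2"
  shows "approx_depth_params k (orbit_T1 \<Gamma> (Psi w)) = apex_time ` {p \<in> excursions w. pr p \<in> approx_region k}"
proof -
  have "pr p \<in> approx_region k \<longleftrightarrow> 2 * \<bar>fst (snd p)\<bar> < k \<and> (fst p, fst p - 1 / fst (snd p)) \<in> I_region" if "p \<in> excursions w" for p
    using that excursion_region_iff[OF assms(2), of "fst p" "fst (snd p)"] by (auto simp: excursions_def approx_region_def)
  then show ?thesis unfolding approx_depth_params_eq[OF assms] by (metis (mono_tags, lifting) Collect_cong)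
qed

lemma regular_gaps:
  assumes w: "regular w" and k: "0 < k" "k \<le> 2"
  shows "\<exists>t. increasing_enumeration t (depth_params k (orbit_T1 \<Gamma> (Psi w)) \<inter> {0..}) \<and>
    (\<lambda>n. (\<Sum>i=1..n. t (i + 1) - t i) / real n) \<longlonglongrightarrow> measure lborel F / k"
proof -
  have tp: "typical w" using w by (simp add: regular_def)
  have R: "q \<in> excursion_region k \<Longrightarrow> q \<in> excursion_region 2" for q using k by (auto simp: excursion_region_def)
  have "(\<lambda>n. (\<Sum>p\<in>exc_between w {0..<real n}. indicator (excursion_region k) (pr p)) / real n) \<longlonglongrightarrow> k / measure lborel F"
    using w k by (auto simp: regular_def)
  note l = this
  obtain t where "increasing_enumeration t (apex_time ` {p \<in> excursions w. pr p \<in> excursion_region k} \<inter> {0..})"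
    "(\<lambda>n. (\<Sum>i=1..n. t (i + 1) - t i) / real n) \<longlonglongrightarrow> measure lborel F / k"
    by (rule enumeration_of_region[OF w R k(1) l]) blast
  then show ?thesis unfolding depth_params_region[OF tp k(2)] by blast
qed

lemma regular_approx_gaps:
  assumes w: "regular w" and k: "0 < k" "k \<le> 2"
  shows "\<exists>t. increasing_enumeration t (approx_depth_params k (orbit_T1 \<Gamma> (Psi w)) \<inter> {0..}) \<and>
    (\<lambda>n. (\<Sum>i=1..n. t (i + 1) - t i) / real n) \<longlonglongrightarrow> measure lborel F / calA k"
proof -
  have tp: "typical w" using w by (simp add: regular_def)
  have R: "q \<in> approx_region k \<Longrightarrow> q \<in> excursion_region 2" for q
    using k by (auto simp: excursion_region_def approx_region_def)
  have "(\<lambda>n. (\<Sum>p\<in>exc_between w {0..<real n}. indicator (approx_region k) (pr p)) / real n) \<longlonglongrightarrow> calA k / measure lborel F"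
    using w k by (auto simp: regular_def)
  note l = this
  obtain t where "increasing_enumeration t (apex_time ` {p \<in> excursions w. pr p \<in> approx_region k} \<inter> {0..})"
    "(\<lambda>n. (\<Sum>i=1..n. t (i + 1) - t i) / real n) \<longlonglongrightarrow> measure lborel F / calA k"
    by (rule enumeration_of_region[OF w R calA_pos[OF k] l]) blast
  then show ?thesis unfolding approx_depth_params_region[OF tp k(2)] by blast
qed

lemma regular_lengths:
  assumes w: "regular w" and k: "0 < k" "k \<le> 1"
  shows "\<exists>t \<delta>. increasing_enumeration t (depth_params k (orbit_T1 \<Gamma> (Psi w)) \<inter> {0..}) \<and>
    (\<forall>i\<ge>1. boundary_params \<Gamma> k (orbit_T1 \<Gamma> (Psi w)) (t i) (\<delta> (2 * i - 1)) (\<delta> (2 * i))) \<and>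
    (\<lambda>n. (\<Sum>i=1..n. \<delta> (2 * i) - \<delta> (2 * i - 1)) / real n) \<longlonglongrightarrow> pi"
proof -
  have tp: "typical w" using w by (simp add: regular_def)
  have k2: "k \<le> 2" using k by simp
  have R: "q \<in> excursion_region k \<Longrightarrow> q \<in> excursion_region 2" for q using k by (auto simp: excursion_region_def)
  have l1: "(\<lambda>n. (\<Sum>p\<in>exc_between w {0..<real n}. indicator (excursion_region k) (pr p)) / real n) \<longlonglongrightarrow> k / measure lborel F"
    and l2: "(\<lambda>n. (\<Sum>p\<in>exc_between w {0..<real n}. excursion_length k (pr p)) / real n) \<longlonglongrightarrow> pi * k / measure lborel F"
    using w k by (auto simp: regular_def)
  define D where "D = apex_time ` {p \<in> excursions w. pr p \<in> excursion_region k} \<inter> {0..}"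
  define e where "e = inv_into (excursions w) apex_time"
  obtain t where t: "increasing_enumeration t D"
    "(\<lambda>n. (\<Sum>i=1..n. t (i + 1) - t i) / real n) \<longlonglongrightarrow> measure lborel F / k"
    "\<forall>g \<sigma>. (\<forall>q. 0 \<le> g q) \<longrightarrow> (\<forall>q. q \<notin> excursion_region k \<longrightarrow> g q = 0) \<longrightarrow>
       (\<lambda>n. (\<Sum>p\<in>exc_between w {0..<real n}. g (pr p)) / real n) \<longlonglongrightarrow> \<sigma> \<longrightarrow>
       (\<lambda>n. (\<Sum>i=1..n. g (pr (e (t i)))) / real n) \<longlonglongrightarrow> \<sigma> * measure lborel F / k"
    by (rule enumeration_of_region[OF w R k(1) l1, folded D_def e_def])
  define L where "L i = arcosh (k / (2 * \<bar>fst (snd (e (t i)))\<bar>))" for i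
  \<comment> \<open>\<open>\<delta> (2 i)\<close> ends and \<open>\<delta> (2 i - 1)\<close> begins the \<open>i\<close>-th excursion.\<close>
  define \<delta> where "\<delta> j = (if even j then t (j div 2) + L (j div 2) else t ((j + 1) div 2) - L ((j + 1) div 2))" for j
  have d_even: "\<delta> (2 * i) = t i + L i" for i by (simp add: \<delta>_def)
  have d_odd: "\<delta> (2 * i - 1) = t i - L i" if i: "1 \<le> i" for i
  proof -
    obtain j where "i = Suc j" using i by (cases i) auto
    then show ?thesis by (simp add: \<delta>_def)
  qed
  have et: "e (t i) \<in> excursions w \<and> apex_time (e (t i)) = t i \<and> pr (e (t i)) \<in> excursion_region k" if "1 \<le> i" for i
  proof -
    have "t i \<in> D" using t(1) that by (auto simp: increasing_enumeration_def)
    then obtain p where p: "p \<in> excursions w" "pr p \<in> excursion_region k" "t i = apex_time p" by (auto simp: D_def)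
    have "e (t i) = p" unfolding e_def p(3) by (rule inv_into_f_f[OF apex_inj[OF tp] p(1)])
    then show ?thesis using p by simp
  qed
  have bd: "boundary_params \<Gamma> k (orbit_T1 \<Gamma> (Psi w)) (t i) (\<delta> (2 * i - 1)) (\<delta> (2 * i))" if i: "1 \<le> i" for i
  proof -
    obtain A where A: "A \<in> \<Gamma>" "e (t i) = act A w" using et[OF i] by (auto simp: excursions_def)
    have a: "fst (snd (act A w)) \<noteq> 0" "2 * \<bar>fst (snd (act A w))\<bar> < k"
      using et[OF i] unfolding A(2) by (auto simp: excursion_region_def)
    from excursion_boundary[OF typical_generic[OF tp] k A(1) a]
    show ?thesis using et[OF i] unfolding d_even d_odd[OF i] L_def A(2) by simp
  qed
  have "(\<lambda>n. (\<Sum>i=1..n. excursion_length k (pr (e (t i)))) / real n) \<longlonglongrightarrow> pi * k / measure lborel F * measure lborel F / k"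
    by (rule t(3)[rule_format, OF _ _ l2]) (simp_all only: excursion_length_nonneg, simp add: excursion_length_def)
  moreover have "(\<Sum>i=1..n. excursion_length k (pr (e (t i)))) = (\<Sum>i=1..n. \<delta> (2 * i) - \<delta> (2 * i - 1))" for n
  proof (rule sum.cong[OF refl])
    fix i assume "i \<in> {1..n}"
    then have i: "1 \<le> i" by simp
    show "excursion_length k (pr (e (t i))) = \<delta> (2 * i) - \<delta> (2 * i - 1)"
      unfolding d_even d_odd[OF i] using et[OF i] by (simp add: excursion_length_def L_def)
  qed
  ultimately have "(\<lambda>n. (\<Sum>i=1..n. \<delta> (2 * i) - \<delta> (2 * i - 1)) / real n) \<longlonglongrightarrow> pi"
    using k measure_F_pos by simp
  then show ?thesis
    unfolding depth_params_region[OF tp k2] D_def[symmetric] using t(1) bd by blast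
qed

end

theorem corollary1:
  fixes \<Gamma> :: "(real^2^2) set"
  assumes "zonal_fuchsian \<Gamma>" and "normalized \<Gamma>"
  shows "AE v in T1S_measure \<Gamma>.
    (\<forall>k. 0 < k \<and> k \<le> 2 \<longrightarrow>
       (\<Gamma> = PSL2Z \<or> U_eta (eta \<Gamma>) \<notin> \<Gamma> \<longrightarrow>
         (\<exists>t. increasing_enumeration t (depth_params k v \<inter> {0..}) \<and>
           (\<lambda>n. (\<Sum>i=1..n. t (i + 1) - t i) / real n) \<longlonglongrightarrow> pi * total_area \<Gamma> / k)) \<and>
       (\<exists>t. increasing_enumeration t (approx_depth_params k v \<inter> {0..}) \<and>
         (\<lambda>n. (\<Sum>i=1..n. t (i + 1) - t i) / real n) \<longlonglongrightarrow> pi * total_area \<Gamma> / calA k)) \<and>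
    (\<forall>k. 0 < k \<and> k \<le> 1 \<longrightarrow>
       (\<exists>t \<delta>. increasing_enumeration t (depth_params k v \<inter> {0..}) \<and>
         (\<forall>i\<ge>1. boundary_params \<Gamma> k v (t i) (\<delta> (2 * i - 1)) (\<delta> (2 * i))) \<and>
         (\<lambda>n. (\<Sum>i=1..n. \<delta> (2 * i) - \<delta> (2 * i - 1)) / real n) \<longlonglongrightarrow> pi))"
proof -
  have "PSL2R_subgroup \<Gamma>" "discrete \<Gamma>" using assms(1) by (auto simp: zonal_fuchsian_def)
  then interpret G: sl2_group \<Gamma> by unfold_locales
  have "emeasure (orbifold_area \<Gamma>) (space (orbifold_area \<Gamma>)) < \<infinity>"
    using assms(1) by (simp add: zonal_fuchsian_def)
  then obtain F where F: "sl2_domain \<Gamma> F" "measure lborel F = pi * total_area \<Gamma>"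
    by (rule G.exists_domain)
  interpret D: sl2_domain \<Gamma> F by (rule F(1))
  interpret Z: sl2_zonal \<Gamma> F
    by unfold_locales (use assms(1) in \<open>simp add: zonal_fuchsian_def\<close>)
  show ?thesis
  proof (rule Z.AE_T1S, rule eventually_mono[OF Z.AE_regular])
    fix w assume w: "Z.regular w"
    show "(\<forall>k. 0 < k \<and> k \<le> 2 \<longrightarrow>
       (\<Gamma> = PSL2Z \<or> U_eta (eta \<Gamma>) \<notin> \<Gamma> \<longrightarrow>
         (\<exists>t. increasing_enumeration t (depth_params k (orbit_T1 \<Gamma> (Psi w)) \<inter> {0..}) \<and>
           (\<lambda>n. (\<Sum>i=1..n. t (i + 1) - t i) / real n) \<longlonglongrightarrow> pi * total_area \<Gamma> / k)) \<and>
       (\<exists>t. increasing_enumeration t (approx_depth_params k (orbit_T1 \<Gamma> (Psi w)) \<inter> {0..}) \<and>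
         (\<lambda>n. (\<Sum>i=1..n. t (i + 1) - t i) / real n) \<longlonglongrightarrow> pi * total_area \<Gamma> / calA k)) \<and>
    (\<forall>k. 0 < k \<and> k \<le> 1 \<longrightarrow>
       (\<exists>t \<delta>. increasing_enumeration t (depth_params k (orbit_T1 \<Gamma> (Psi w)) \<inter> {0..}) \<and>
         (\<forall>i\<ge>1. boundary_params \<Gamma> k (orbit_T1 \<Gamma> (Psi w)) (t i) (\<delta> (2 * i - 1)) (\<delta> (2 * i))) \<and>
         (\<lambda>n. (\<Sum>i=1..n. \<delta> (2 * i) - \<delta> (2 * i - 1)) / real n) \<longlonglongrightarrow> pi))"
      using Z.regular_gaps[OF w] Z.regular_approx_gaps[OF w] Z.regular_lengths[OF w]
      unfolding F(2) by blast
  qed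
qed

end
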